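(* Let $p=P_1^{\alpha_1}P_2^{\alpha_2}\cdots P_s^{\alpha_s}$ where $P_1=2$, $P_1,\dots,P_s$ are distinct primes and each $\alpha_i$ is a positive integer. For every even integer $q$ with $4\le q<p$ such that (i) the largest power of $2$ dividing $q$ is $2$, $4$ or $2^{\alpha_1-1}$, (ii) for every $i\ge 2$ either $\gcd(q,P_i)=1$ or $P_i^{\alpha_i}$ divides $q$, and (iii) $q$ divides $p$, there exists a tight orientably regular polyhedron of type $\{p,q\}$ with no multiple edges. This polyhedron is unique up to isomorphism unless $\alpha_1\ge 4$ and $2^{\alpha_1-1}$ divides $q$, in which case there are exactly two such polyhedra. Moreover, every tight orientably regular polyhedron with no multiple edges either has one of these types, or has type $\{2q,q\}$ for some odd $q$, or is the map of type $\{p,2\}$ on the sphere.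
   Context: An (abstract) polyhedron is a partially ordered set whose elements have rank 0 (vertices), 1 (edges) or 2 (faces) such that: every flag (maximal chain) consists of one vertex, one edge and one face; each edge is incident with exactly two vertices and exactly two faces; the vertex–edge graph is connected; and for every vertex $F_0$ the poset $\{G:G>F_0\}$ is isomorphic to the vertex–edge incidence poset of a connected 2-regular graph. $\Phi^i$ is the flag differing from flag $\Phi$ only in its rank-$i$ element. Type $\{p,q\}$: faces have $p$ edges, vertices lie on $q$ edges. Regular: automorphism group $\Gamma$ transitive on flags; with base flag $\Phi$, $\Gamma=\langle\rho_0,\rho_1,\rho_2\rangle$ with $\rho_i:\Phi\mapsto\Phi^i$; $\Gamma^+=\langle\rho_0\rho_1,\rho_1\rho_2\rangle$; orientably regular means $[\Gamma:\Gamma^+]=2$. A finite polyhedron of type $\{p,q\}$ has at least $2pq$ flags and is tight if it has exactly $2pq$. A polyhedron has multiple edges if some two distinct edges are incident with the same pair of vertices.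
   Formalization: Existence and uniqueness exclude α₁=2 with 4 | q, where no such polyhedron exists (e.g. type {12,4}); and every face of a polyhedron is also required to be a polygon (connected 2-regular graph), without which uniqueness fails for type {16,4}. *)

theory Defs
  imports
    "HOL-Algebra.Bij"
    "HOL-Algebra.Coset"
    "HOL-Algebra.Generated_Groups"
    "HOL-Computational_Algebra.Primes"
begin

section \<open>Order isomorphisms and multigraphs\<close>

text \<open>A poset is given by its reflexive order relation \<open>r\<close>, with \<open>Field r\<close> as its set of elements.
  (The library's \<open>iso\<close> is tailored to well-orders.)\<close>

definition order_iso :: "'a rel \<Rightarrow> 'b rel \<Rightarrow> ('a \<Rightarrow> 'b) \<Rightarrow> bool" where
  "order_iso r s f \<longleftrightarrow>
     bij_betw f (Field r) (Field s) \<and>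
     (\<forall>x\<in>Field r. \<forall>y\<in>Field r. (x, y) \<in> r \<longleftrightarrow> (f x, f y) \<in> s)"

text \<open>Parallel edges must be allowed: the vertex-figures of a polyhedron of type \<open>{p,2}\<close> are digons.
  Loops are excluded; a loop in a vertex-figure would be a face containing only one of the edges
  at that vertex.\<close>

record ('v, 'e) multigraph =
  verts :: "'v set"
  edges :: "'e set"
  ends :: "'e \<Rightarrow> 'v set"

definition multigraph :: "('v, 'e) multigraph \<Rightarrow> bool" where
  "multigraph G \<longleftrightarrow> (\<forall>e\<in>edges G. ends G e \<subseteq> verts G \<and> card (ends G e) = 2)"

definition connected_graph :: "('v, 'e) multigraph \<Rightarrow> bool" where
  "connected_graph G \<longleftrightarrow>
     (\<forall>u\<in>verts G. \<forall>v\<in>verts G. (u, v) \<in> {(x, y). \<exists>e\<in>edges G. {x, y} \<subseteq> ends G e}\<^sup>*)"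

definition two_regular :: "('v, 'e) multigraph \<Rightarrow> bool" where
  "two_regular G \<longleftrightarrow> (\<forall>v\<in>verts G. card {e\<in>edges G. v \<in> ends G e} = 2)"

definition incidence_order :: "('v, 'e) multigraph \<Rightarrow> ('v + 'e) rel" where
  "incidence_order G =
     Id_on (Inl ` verts G \<union> Inr ` edges G) \<union>
     {(Inl v, Inr e) | v e. v \<in> verts G \<and> e \<in> edges G \<and> v \<in> ends G e}"

text \<open>Vertices and edges of the graph may be taken to be elements of the type of the poset
  itself, since the poset is the disjoint union of (copies of) the two sets.\<close>

definition polygonal :: "'a rel \<Rightarrow> bool" where
  "polygonal r \<longleftrightarrow>
     (\<exists>(G :: ('a, 'a) multigraph) f.
        multigraph G \<and> connected_graph G \<and> two_regular G \<and> order_iso r (incidence_order G) f)"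


section \<open>Polyhedra\<close>

record 'a ranked_poset =
  leq :: "'a rel"
  rank :: "'a \<Rightarrow> nat"

definition elems :: "'a ranked_poset \<Rightarrow> nat \<Rightarrow> 'a set" where
  "elems P i = {x \<in> Field (leq P). rank P x = i}"

definition incident :: "'a ranked_poset \<Rightarrow> 'a \<Rightarrow> 'a \<Rightarrow> bool" where
  "incident P x y \<longleftrightarrow> (x, y) \<in> leq P \<or> (y, x) \<in> leq P"

definition flags :: "'a ranked_poset \<Rightarrow> 'a set set" where
  "flags P = {C \<in> Chains (leq P). \<forall>D\<in>Chains (leq P). C \<subseteq> D \<longrightarrow> D = C}"

definition vertex_edge_graph :: "'a ranked_poset \<Rightarrow> ('a, 'a) multigraph" where
  "vertex_edge_graph P =
     \<lparr>verts = elems P 0, edges = elems P 1, ends = (\<lambda>e. {v \<in> elems P 0. incident P v e})\<rparr>"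

text \<open>The last condition says that every face is a (possibly infinite) polygon. It is part of the
  standard notion of an abstract polyhedron and does not follow from the other conditions:
  colour the squares of the \<open>b \<times> b\<close> square grid on the torus (\<open>b \<ge> 4\<close> even) by the parities of their
  two coordinates, and identify squares of the same colour. This gives a poset with four
  ``faces'' satisfying all the other conditions.\<close>

definition polyhedron :: "'a ranked_poset \<Rightarrow> bool" where
  "polyhedron P \<longleftrightarrow>
     Partial_order (leq P) \<and>
     rank P ` Field (leq P) \<subseteq> {0, 1, 2} \<and>
     (\<forall>x y. (x, y) \<in> leq P \<and> x \<noteq> y \<longrightarrow> rank P x < rank P y) \<and>
     (\<forall>C\<in>flags P. \<exists>v\<in>elems P 0. \<exists>e\<in>elems P 1. \<exists>F\<in>elems P 2. C = {v, e, F}) \<and>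
     (\<forall>e\<in>elems P 1. card {v \<in> elems P 0. incident P v e} = 2 \<and>
                     card {F \<in> elems P 2. incident P e F} = 2) \<and>
     connected_graph (vertex_edge_graph P) \<and>
     (\<forall>v\<in>elems P 0. polygonal (Restr (leq P) {G. (v, G) \<in> leq P \<and> G \<noteq> v})) \<and>
     (\<forall>F\<in>elems P 2. polygonal (Restr (leq P) {G. (G, F) \<in> leq P \<and> G \<noteq> F}))"

text \<open>Order isomorphisms of polyhedra preserve ranks, as every flag has one element of each rank
  and the rank is strictly increasing along it.\<close>

definition isomorphic :: "'a ranked_poset \<Rightarrow> 'b ranked_poset \<Rightarrow> bool" where
  "isomorphic P Q \<longleftrightarrow> (\<exists>f. order_iso (leq P) (leq Q) f)"

definition multiple_edges :: "'a ranked_poset \<Rightarrow> bool" where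
  "multiple_edges P \<longleftrightarrow>
     (\<exists>e\<in>elems P 1. \<exists>e'\<in>elems P 1. e \<noteq> e' \<and>
        ends (vertex_edge_graph P) e = ends (vertex_edge_graph P) e')"

text \<open>As \<open>card\<close> of an infinite set is 0, infinite faces or valencies appear here as 0.\<close>

definition has_type :: "'a ranked_poset \<Rightarrow> nat \<Rightarrow> nat \<Rightarrow> bool" where
  "has_type P p q \<longleftrightarrow>
     (\<forall>F\<in>elems P 2. card {e \<in> elems P 1. incident P e F} = p) \<and>
     (\<forall>v\<in>elems P 0. card {e \<in> elems P 1. incident P v e} = q)"

definition tight :: "'a ranked_poset \<Rightarrow> bool" where
  "tight P \<longleftrightarrow>
     finite (Field (leq P)) \<and> (\<exists>p q. has_type P p q \<and> card (flags P) = 2 * p * q)"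


section \<open>Regularity\<close>

definition aut_group :: "'a ranked_poset \<Rightarrow> ('a \<Rightarrow> 'a) monoid" where
  "aut_group P =
     BijGroup (Field (leq P))
       \<lparr>carrier := {f \<in> Bij (Field (leq P)). order_iso (leq P) (leq P) f}\<rparr>"

text \<open>\<open>adjacent_flag P i \<Phi> \<Psi>\<close> says that \<open>\<Psi> = \<Phi>\<^sup>i\<close>.\<close>

definition adjacent_flag :: "'a ranked_poset \<Rightarrow> nat \<Rightarrow> 'a set \<Rightarrow> 'a set \<Rightarrow> bool" where
  "adjacent_flag P i \<Phi> \<Psi> \<longleftrightarrow>
     \<Phi> \<in> flags P \<and> \<Psi> \<in> flags P \<and> \<Psi> \<noteq> \<Phi> \<and>
     {x \<in> \<Psi>. rank P x \<noteq> i} = {x \<in> \<Phi>. rank P x \<noteq> i}"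

definition regular :: "'a ranked_poset \<Rightarrow> bool" where
  "regular P \<longleftrightarrow>
     (\<forall>\<Phi>\<in>flags P. \<forall>\<Psi>\<in>flags P. \<exists>g\<in>carrier (aut_group P). g ` \<Phi> = \<Psi>)"

text \<open>An automorphism of a polyhedron is determined by the image of one flag, so \<open>\<rho> i\<close> is unique
  for \<open>i \<le> 2\<close>; by transitivity on flags the index does not depend on \<open>\<Phi>\<close>.\<close>

definition orientably_regular :: "'a ranked_poset \<Rightarrow> bool" where
  "orientably_regular P \<longleftrightarrow>
     regular P \<and>
     (\<exists>\<Phi>\<in>flags P. \<exists>\<rho> :: nat \<Rightarrow> 'a \<Rightarrow> 'a.
        (\<forall>i\<in>{0, 1, 2}. \<rho> i \<in> carrier (aut_group P) \<and> adjacent_flag P i \<Phi> (\<rho> i ` \<Phi>)) \<and>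
        card (rcosets\<^bsub>aut_group P\<^esub>
                (generate (aut_group P)
                   {\<rho> 0 \<otimes>\<^bsub>aut_group P\<^esub> \<rho> 1, \<rho> 1 \<otimes>\<^bsub>aut_group P\<^esub> \<rho> 2})) = 2)"

definition tight_simple :: "'a ranked_poset \<Rightarrow> bool" where
  "tight_simple P \<longleftrightarrow>
     polyhedron P \<and> tight P \<and> orientably_regular P \<and> \<not> multiple_edges P"


section \<open>The types in the classification\<close>

text \<open>In terms of the prime factorization of \<open>p\<close>: the even \<open>p > 0\<close> are the \<open>p\<close> with a factor
  \<open>P\<^sub>1 = 2\<close>, and \<open>\<alpha>\<^sub>i\<close> is \<open>multiplicity P\<^sub>i p\<close>.

  If \<open>4\<close> divides \<open>q\<close> and \<open>\<alpha>\<^sub>1 = 2\<close> these conditions do not suffice for existence: there is no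
  tight orientably regular polyhedron of type \<open>{12,4}\<close> without multiple edges.\<close>

definition classified_type :: "nat \<Rightarrow> nat \<Rightarrow> bool" where
  "classified_type p q \<longleftrightarrow>
     even p \<and> even q \<and> 4 \<le> q \<and> q < p \<and>
     (2::nat) ^ multiplicity 2 q \<in> {2, 4, 2 ^ (multiplicity 2 p - 1)} \<and>
     (\<forall>r \<in> prime_factors p - {2}. gcd q r = 1 \<or> r ^ multiplicity r p dvd q) \<and>
     q dvd p"

text \<open>The map of type \<open>{p,2}\<close> on the sphere (for \<open>p \<ge> 2\<close>): a cycle of length \<open>p\<close> on the equator,
  whose edge \<open>(1, j)\<close> joins the vertices \<open>(0, j)\<close> and \<open>(0, j + 1 mod p)\<close>, bounding the two
  hemispheres \<open>(2, 0)\<close> and \<open>(2, 1)\<close>.\<close>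

definition sphere_map :: "nat \<Rightarrow> (nat \<times> nat) ranked_poset" where
  "sphere_map p =
     (let V = {0} \<times> {..<p}; E = {1} \<times> {..<p}; F = {2} \<times> {..<2} in
      \<lparr>leq = Id_on (V \<union> E \<union> F) \<union>
             {((0, i), (1, j)) | i j. i < p \<and> j < p \<and> (i = j \<or> i = (j + 1) mod p)} \<union>
             (V \<union> E) \<times> F,
       rank = fst\<rparr>)"

end

theory Submission
  imports Defs "HOL-Algebra.Multiplicative_Group" "HOL-Number_Theory.Cong" "HOL-Library.Nat_Bijection"
begin

text \<open>For a base flag of a tight orientably regular polyhedron of type \<open>{p,q}\<close>, the rotation group is the
  product \<open>\<langle>a\<rangle>\<langle>b\<rangle>\<close> of cyclic groups of orders \<open>p\<close> and \<open>q\<close> with trivial intersection, where \<open>(ab)\<^sup>2 = 1\<close> and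
  conjugation by \<open>\<rho>\<^sub>1\<close> inverts \<open>a\<close> and \<open>b\<close>. There are no multiple edges iff \<open>\<langle>b\<rangle>\<close> is core-free. In that case
  \<open>\<langle>a\<^sup>2\<rangle>\<close> is normal. Indeed, writing \<open>b x\<close> for \<open>x \<in> \<langle>a\<rangle>\<close> as an element of \<open>\<langle>a\<rangle>\<langle>b\<rangle>\<close> and using the pigeonhole
  principle, one finds a nontrivial core \<open>N\<close> of \<open>\<langle>a\<rangle>\<close>; by induction, \<open>\<langle>b\<^sup>2\<rangle>\<close> is normal modulo \<open>N\<close>, and a short
  computation with the mirror symmetry gives the claim.

  So \<open>b a\<^sup>2 b\<^sup>-\<^sup>1 = a\<^sup>2\<^sup>k\<close>, and the exponent \<open>k\<close> modulo \<open>p/2\<close> determines the polyhedron when \<open>q \<ge> 4\<close> is even: its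
  vertices are the integers modulo \<open>p\<close> and its faces the integers modulo \<open>q\<close>. Conversely \<open>k\<close> gives a
  polyhedron iff \<open>k\<^sup>2 \<equiv> 1\<close> and \<open>k + 1\<close> has additive order \<open>q/2\<close> modulo \<open>p/2\<close>. These congruences are solved one
  prime at a time; only at the prime 2 can there be two solutions.\<close>

section \<open>Products of two cyclic groups\<close>

text \<open>Core-freeness is not inherited by quotients: once the core of \<open><a>\<close> is
  divided out, \<open><a>\<close> has become core-free, while \<open><b>\<close> may have acquired a
  core. The induction behind the normality of \<open><a^2>\<close> therefore exchanges the
  generators at every step, and the hypotheses on the group are symmetric in them.

  The order of \<open>k + 1\<close> comes from the action of \<open>b\<close> on the neighbours of
  the base vertex: \<open>b^(2t)\<close> carries vertex 1 to vertex \<open>1 - (2 + 2k)t\<close>,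
  and without multiple edges only trivial powers of \<open>b\<close> fix vertex 1. The condition
  \<open>k^2 = 1\<close> holds because \<open>b^2\<close> commutes with \<open>a^2\<close>.

  At an odd prime \<open>k^2 = 1\<close> leaves only \<open>k = 1\<close> and \<open>k = -1\<close>,
  and the order of \<open>k + 1\<close> decides between them; these are the two alternatives of
  condition (ii). At 2, order 2 modulo 2 would make \<open>k\<close> even, against
  \<open>k^2 = 1\<close>; this is the excluded case in which 2 has multiplicity 2 in
  \<open>p\<close> and 4 divides \<open>q\<close>. For a modulus \<open>2^m\<close> with
  \<open>m \<ge> 3\<close>, the order \<open>2^(m-1)\<close> allows both classes lying over 1 modulo
  \<open>2^(m-1)\<close>, which is where a second polyhedron comes from.\<close>

lemma (in group) intertwine_int_pow:
  assumes "x \<in> carrier G" "y \<in> carrier G" "z \<in> carrier G" and xy: "x \<otimes> y = z \<otimes> x"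
  shows "x \<otimes> y [^] (s::int) = z [^] s \<otimes> x"
proof -
  have xy': "x \<otimes> inv y = inv z \<otimes> x"
    using assms by (metis inv_closed inv_solve_left inv_solve_right m_assoc m_closed)
  show ?thesis
  proof (induction s rule: int_induct[where k = 0])
    case base then show ?case using assms by simp
  next
    case (step1 s)
    have "x \<otimes> y [^] (s + 1) = (x \<otimes> y [^] s) \<otimes> y"
      using assms by (simp add: int_pow_mult m_assoc)
    also have "\<dots> = z [^] s \<otimes> (z \<otimes> x)"
      using assms step1 by (simp add: m_assoc)
    also have "\<dots> = z [^] (s + 1) \<otimes> x"
      using assms by (simp add: int_pow_mult m_assoc)
    finally show ?case .
  next
    case (step2 s)
    have "x \<otimes> y [^] (s - 1) = (x \<otimes> y [^] s) \<otimes> inv y"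
      using assms by (simp add: int_pow_diff m_assoc)
    also have "\<dots> = z [^] s \<otimes> (inv z \<otimes> x)"
      using assms step2 xy' by (simp add: m_assoc)
    also have "\<dots> = z [^] (s - 1) \<otimes> x"
      using assms by (simp add: int_pow_diff m_assoc)
    finally show ?case .
  qed
qed

text \<open>The induction in \<open>square_in_core\<close> ranges over groups on one fixed type, so
  the quotient must live on that type again. Each coset is represented by a chosen element, and
  \<open>c\<close> sends an element to the representative of its coset.\<close>

lemma (in group) quotient_hom_same_type:
  assumes "N \<lhd> G"
  obtains Q :: "'a monoid" and c where "group Q" "c \<in> hom G Q" "c ` carrier G = carrier Q"
    "\<And>x y. x \<in> carrier G \<Longrightarrow> y \<in> carrier G \<Longrightarrow> c x = c y \<longleftrightarrow> x \<otimes> inv y \<in> N"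
proof -
  interpret N: normal N G by fact
  define c where "c x = (SOME y. y \<in> N #> x)" for x
  define Q where "Q = \<lparr>carrier = c ` carrier G, monoid.mult = \<lambda>x y. c (x \<otimes> y), one = c \<one>\<rparr>"
  have c_mem: "c x \<in> N #> x" if "x \<in> carrier G" for x
    unfolding c_def using rcos_self[OF that N.subgroup_axioms] by (rule someI)
  have c_closed [simp]: "c x \<in> carrier G" if "x \<in> carrier G" for x
    using c_mem[OF that] N.elemrcos_carrier that by (meson is_group)
  have coset: "N #> c x = N #> x" if "x \<in> carrier G" for x
    using repr_independence[OF c_mem[OF that] that N.subgroup_axioms] by simp
  have c_eq: "c x = c y \<longleftrightarrow> N #> x = N #> y" if "x \<in> carrier G" "y \<in> carrier G" for x y
    using coset that unfolding c_def by metis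
  have c_hom: "c (c x \<otimes> c y) = c (x \<otimes> y)" if "x \<in> carrier G" "y \<in> carrier G" for x y
    using that by (simp add: c_eq N.rcos_sum[symmetric] coset)
  have c_hom1: "c (c x \<otimes> y) = c (x \<otimes> y)" "c (x \<otimes> c y) = c (x \<otimes> y)"
    if "x \<in> carrier G" "y \<in> carrier G" for x y
    using that by (simp_all add: c_eq N.rcos_sum[symmetric] coset)
  have "group Q"
  proof (rule groupI)
    fix x assume "x \<in> carrier Q"
    then obtain x' where x': "x' \<in> carrier G" "x = c x'" by (auto simp: Q_def)
    then show "\<exists>y\<in>carrier Q. y \<otimes>\<^bsub>Q\<^esub> x = \<one>\<^bsub>Q\<^esub>"
      by (intro bexI[of _ "c (inv x')"]) (auto simp: Q_def c_hom)
  qed (auto simp: Q_def c_hom c_hom1 m_assoc)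
  moreover have "c \<in> hom G Q" by (auto simp: hom_def Q_def c_hom)
  moreover have "c ` carrier G = carrier Q" by (simp add: Q_def)
  moreover have "c x = c y \<longleftrightarrow> x \<otimes> inv y \<in> N" if "x \<in> carrier G" "y \<in> carrier G" for x y
    using that by (metis N.rcos_module rcos_self c_eq is_group repr_independence N.subgroup_axioms)
  ultimately show thesis by (rule that)
qed

text \<open>\<open>mirror\<close> is the trace of an automorphism inverting both generators, on the
  relations that bring \<open>b^j a^i\<close> into normal form. In this shape it passes to quotients
  and is symmetric in the generators, and no automorphism has to be carried along.\<close>

locale tight_group = group G for G (structure) +
  fixes a b
  assumes a_closed [simp, intro]: "a \<in> carrier G"
    and b_closed [simp, intro]: "b \<in> carrier G"
    and finite_carrier: "finite (carrier G)"
    and abab: "a \<otimes> b \<otimes> a \<otimes> b = \<one>"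
    and factorize: "g \<in> carrier G \<Longrightarrow> \<exists>(i::int) (j::int). g = a [^] i \<otimes> b [^] j"
    and trivial_inter: "a [^] (i::int) = b [^] (j::int) \<Longrightarrow> a [^] i = \<one>"
    and mirror: "b [^] (j::int) \<otimes> a [^] (i::int) = a [^] (i'::int) \<otimes> b [^] (j'::int) \<Longrightarrow>
                 b [^] (-j) \<otimes> a [^] (-i) = a [^] (-i') \<otimes> b [^] (-j')"
begin

abbreviation A :: "int \<Rightarrow> 'a" where "A i \<equiv> a [^] i"
abbreviation B :: "int \<Rightarrow> 'a" where "B i \<equiv> b [^] i"

text \<open>With \<open>A 1\<close> and \<open>B 1\<close> kept as powers, \<open>AA\<close> and
  \<open>BB\<close> can merge generators into neighbouring powers.\<close>

declare int_pow_1 [simp del]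

lemma A1: "A 1 = a" and B1: "B 1 = b" by (simp_all add: int_pow_1)

lemma AA: "A i \<otimes> A j = A (i + j)" by (simp add: int_pow_mult)
lemma BB: "B i \<otimes> B j = B (i + j)" by (simp add: int_pow_mult)
lemma AAx: "x \<in> carrier G \<Longrightarrow> A i \<otimes> (A j \<otimes> x) = A (i + j) \<otimes> x"
  by (simp add: int_pow_mult m_assoc [symmetric])
lemma BBx: "x \<in> carrier G \<Longrightarrow> B i \<otimes> (B j \<otimes> x) = B (i + j) \<otimes> x"
  by (simp add: int_pow_mult m_assoc [symmetric])
lemma inv_A: "inv (A i) = A (-i)" by (simp add: int_pow_neg)
lemma inv_B: "inv (B i) = B (-i)" by (simp add: int_pow_neg)

lemmas word_simps = AA BB AAx BBx inv_A inv_B m_assoc inv_mult_group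

lemma cancel_AB:
  "x \<in> carrier G \<Longrightarrow> y \<in> carrier G \<Longrightarrow> A i \<otimes> x = y \<longleftrightarrow> x = A (-i) \<otimes> y"
  "x \<in> carrier G \<Longrightarrow> y \<in> carrier G \<Longrightarrow> B i \<otimes> x = y \<longleftrightarrow> x = B (-i) \<otimes> y"
  "x \<in> carrier G \<Longrightarrow> y \<in> carrier G \<Longrightarrow> x \<otimes> A i = y \<longleftrightarrow> x = y \<otimes> A (-i)"
  "x \<in> carrier G \<Longrightarrow> y \<in> carrier G \<Longrightarrow> x \<otimes> B i = y \<longleftrightarrow> x = y \<otimes> B (-i)"
  by (auto simp: word_simps)

lemma ABAB: "A 1 \<otimes> (B 1 \<otimes> (A 1 \<otimes> B 1)) = \<one>"
  using abab by (simp add: m_assoc A1 B1)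

lemma BA: "B 1 \<otimes> A 1 = A (-1) \<otimes> B (-1)"
  using ABAB by (simp add: cancel_AB word_simps)

lemma trivial_inter': "A i = B j \<Longrightarrow> B j = \<one>"
  using trivial_inter by metis

lemma normal_form_unique:
  assumes "A i \<otimes> B j = A i' \<otimes> B j'"
  shows "A i = A i'" "B j = B j'"
proof -
  have "A (-i') \<otimes> (A i \<otimes> B j) \<otimes> B (-j) = A (-i') \<otimes> (A i' \<otimes> B j') \<otimes> B (-j)"
    by (simp only: assms)
  then have e: "A (i - i') = B (j' - j)"
    by (simp add: word_simps)
  have "A (i - i') = \<one>" "B (j' - j) = \<one>"
    using trivial_inter[OF e] trivial_inter'[OF e] by auto
  then show "A i = A i'" "B j = B j'"
    using AA[of "i - i'" i'] BB[of "j' - j" j] by auto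
qed

text \<open>Every assumption is symmetric in the generators, up to inverting an element or reading
  an equation backwards, so each result about \<open><a>\<close> has a twin about
  \<open><b>\<close>.\<close>

lemma swap: "tight_group G b a"
proof unfold_locales
  show "a \<in> carrier G" "b \<in> carrier G" "finite (carrier G)" by (auto simp: finite_carrier)
  have "A 1 = B (-1) \<otimes> (A (-1) \<otimes> B (-1))"
    using arg_cong[OF BA, of "\<lambda>x. B (-1) \<otimes> x"] by (simp add: word_simps)
  then have "B 1 \<otimes> (A 1 \<otimes> (B 1 \<otimes> A 1)) = \<one>"
    using BA by (simp add: cancel_AB word_simps)
  then show "b \<otimes> a \<otimes> b \<otimes> a = \<one>" by (simp add: m_assoc A1 B1)
next
  fix g assume g: "g \<in> carrier G"
  obtain i j where "inv g = A i \<otimes> B j" using factorize[of "inv g"] g by auto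
  then have "inv (inv g) = B (-j) \<otimes> A (-i)" by (simp add: word_simps)
  then have "g = B (-j) \<otimes> A (-i)" using g by simp
  then show "\<exists>j i. g = B j \<otimes> A i" by blast
next
  fix i j assume "B i = A j" then show "B i = \<one>" using trivial_inter'[of j i] by simp
next
  fix i j i' j' assume "A j \<otimes> B i = B i' \<otimes> A j'"
  from mirror[OF this[symmetric]] show "A (-j) \<otimes> B (-i) = B (-i') \<otimes> A (-j')" by simp
qed

text \<open>Multiplying the mirrored relation by \<open>b\<close> on both sides shows that
  conjugation by \<open>b\<close> takes \<open>a^l\<close> back to \<open>a^i\<close>. Conjugation
  by \<open>b\<close> is thus an involution on the part of \<open><a>\<close> that it keeps inside
  \<open><a>\<close>.\<close>

lemma A_core_shift: "B 1 \<otimes> A i = A l \<otimes> B 1 \<Longrightarrow> B 1 \<otimes> A l = A i \<otimes> B 1"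
proof -
  assume "B 1 \<otimes> A i = A l \<otimes> B 1"
  from mirror[OF this] have "B 1 \<otimes> (B (-1) \<otimes> A (-i)) \<otimes> B 1 = B 1 \<otimes> (A (-l) \<otimes> B (-1)) \<otimes> B 1"
    by simp
  then have "A (-i) \<otimes> B 1 = B 1 \<otimes> A (-l)" by (simp add: word_simps)
  then have "A i \<otimes> (A (-i) \<otimes> B 1) \<otimes> A l = A i \<otimes> (B 1 \<otimes> A (-l)) \<otimes> A l" by simp
  then show ?thesis by (simp add: word_simps)
qed

lemma A_core_shift_inv: "B 1 \<otimes> A i = A l \<otimes> B 1 \<Longrightarrow> B (-1) \<otimes> A i = A l \<otimes> B (-1)"
proof -
  assume "B 1 \<otimes> A i = A l \<otimes> B 1"
  from arg_cong[OF A_core_shift[OF this], of "\<lambda>x. B (-1) \<otimes> x \<otimes> B (-1)"]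
  show ?thesis by (simp add: word_simps)
qed

lemma A_core_comm:
  assumes "B 1 \<otimes> A i = A l \<otimes> B 1" shows "B (2 * t) \<otimes> A i = A i \<otimes> B (2 * t)"
proof -
  have "B 2 \<otimes> A i = B 1 \<otimes> (B 1 \<otimes> A i)" by (simp add: word_simps)
  also have "\<dots> = (B 1 \<otimes> A l) \<otimes> B 1" by (simp only: assms) (simp add: word_simps)
  also have "\<dots> = A i \<otimes> B 2" by (simp only: A_core_shift[OF assms]) (simp add: word_simps)
  finally have "A i \<otimes> B 2 = B 2 \<otimes> A i" ..
  from intertwine_int_pow[OF _ _ _ this, of t] show ?thesis by (simp add: int_pow_pow)
qed

lemma A_core_pow:
  assumes "B 1 \<otimes> A i = A l \<otimes> B 1" shows "B 1 \<otimes> A (i * s) = A (l * s) \<otimes> B 1"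
  using intertwine_int_pow[OF _ _ _ assms, of s] by (simp add: int_pow_pow)

lemma ord_a_pos: "ord a > 0" 
  using ord_ge_1[OF finite_carrier a_closed] by simp

lemma A_eq_iff: "A i = A j \<longleftrightarrow> int (ord a) dvd i - j"
proof -
  have "A i = A j \<longleftrightarrow> A (i - j) = \<one>"
    using AA[of "i - j" j] AA[of i "-j"] AA[of j "-j"] by auto
  then show ?thesis by (simp add: int_pow_eq_id)
qed

text \<open>If \<open>a\<close> has even order \<open>2t\<close>, then \<open>(a^2)^t = 1\<close>
  makes \<open>a^(i*t)\<close> trivial, which forces \<open>i\<close> to be even; if the order is
  odd, adding it to \<open>i\<close> changes the parity.\<close>

lemma A_core_even:
  assumes "B 1 \<otimes> A 2 = A i \<otimes> B 1" shows "\<exists>l. B 1 \<otimes> A 2 = A (2 * l) \<otimes> B 1"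
proof (cases "even i")
  case True then show ?thesis using assms by (auto elim: evenE)
next
  case odd: False
  show ?thesis
  proof (cases "even (ord a)")
    case True
    then obtain t where t: "ord a = 2 * t" by (auto elim: evenE)
    have "A (2 * int t) = A 0" by (subst A_eq_iff) (simp add: t)
    then have "A (i * int t) \<otimes> B 1 = B 1" using A_core_pow[OF assms, of "int t"] by simp
    then have "A (i * int t) = \<one>" by (simp add: r_cancel_one)
    then have "A (i * int t) = A 0" by simp
    then have "2 * int t dvd i * int t" by (subst (asm) A_eq_iff) (simp add: t)
    then have "2 dvd i" using t ord_a_pos by simp
    with odd show ?thesis by simp
  next
    case False
    have "A i = A (i + int (ord a))" by (subst A_eq_iff) simp
    moreover have "even (i + int (ord a))" using odd False by simp
    then obtain l where "i + int (ord a) = 2 * l" by (rule evenE)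
    ultimately show ?thesis using assms by metis
  qed
qed

lemma finite_ranges: "finite (range A)" "finite (range B)"
  by (rule finite_subset[OF _ finite_carrier], auto)+

lemma card_range_A: "card (range A) = ord a"
proof -
  have "range A = A ` {0..<int (ord a)}"
  proof
    show "range A \<subseteq> A ` {0..<int (ord a)}"
    proof
      fix x assume "x \<in> range A"
      then obtain i where "x = A i" by auto
      moreover have "A i = A (i mod int (ord a))" by (subst A_eq_iff) simp
      moreover have "i mod int (ord a) \<in> {0..<int (ord a)}" using ord_a_pos by simp
      ultimately show "x \<in> A ` {0..<int (ord a)}" by blast
    qed
  qed auto
  moreover have "inj_on A {0..<int (ord a)}"
  proof (rule inj_onI)
    fix i j assume "i \<in> {0..<int (ord a)}" "j \<in> {0..<int (ord a)}" "A i = A j"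
    moreover from this have "i mod int (ord a) = j mod int (ord a)"
      by (simp only: A_eq_iff mod_eq_dvd_iff)
    ultimately show "i = j" by simp
  qed
  ultimately show ?thesis by (simp add: card_image)
qed

text \<open>Send \<open>x\<close> in \<open><a>\<close> to the \<open><b>\<close>-factor of
  \<open>b x\<close>. Two elements with the same image differ by an element that \<open>b\<close>
  conjugates into \<open><a>\<close>, so the map is injective. It misses the identity, because
  otherwise \<open>b\<close> would lie in \<open><a>\<close> and hence be trivial.\<close>

lemma core_pigeonhole:
  assumes "b \<noteq> \<one>" and "\<And>i l. B 1 \<otimes> A i = A l \<otimes> B 1 \<Longrightarrow> A i = \<one>"
  shows "card (range A) < card (range B)"
proof -
  have "\<exists>y\<in>range B. \<exists>l. B 1 \<otimes> x = A l \<otimes> y" if "x \<in> range A" for x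
    using factorize[of "B 1 \<otimes> x"] that by blast
  then obtain f where f: "\<And>x. x \<in> range A \<Longrightarrow> f x \<in> range B \<and> (\<exists>l. B 1 \<otimes> x = A l \<otimes> f x)"
    by metis
  have "inj_on f (range A)"
  proof (rule inj_onI)
    fix x x' assume x: "x \<in> range A" "x' \<in> range A" "f x = f x'"
    then obtain i i' where i: "x = A i" "x' = A i'" by auto
    obtain j where j: "f x = B j" using f[OF x(1)] by auto
    obtain l l' where l: "B 1 \<otimes> A i = A l \<otimes> B j" "B 1 \<otimes> A i' = A l' \<otimes> B j"
      using f[OF x(1)] f[OF x(2)] x(3) i j by auto
    have "B 1 \<otimes> A (i - i') = (B 1 \<otimes> A i) \<otimes> A (-i')" by (simp add: word_simps)
    also have "\<dots> = A (l - l') \<otimes> (A l' \<otimes> B j) \<otimes> A (-i')" by (simp only: l(1)) (simp add: word_simps)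
    also have "\<dots> = A (l - l') \<otimes> B 1" by (simp only: l(2)[symmetric]) (simp add: word_simps)
    finally have "A (i - i') = \<one>" by (rule assms(2))
    then show "x = x'" using AA[of "i - i'" i'] i by simp
  qed
  moreover have "f ` range A \<subseteq> range B - {\<one>}"
  proof
    fix y assume "y \<in> f ` range A"
    then obtain x where x: "x \<in> range A" "y = f x" by auto
    then obtain i l where i: "x = A i" "B 1 \<otimes> A i = A l \<otimes> y" using f by blast
    have "y \<noteq> \<one>"
    proof
      assume "y = \<one>"
      with i have "B 1 \<otimes> A i \<otimes> A (-i) = A l \<otimes> A (-i)" by simp
      then have "A (l - i) = B 1" by (simp add: word_simps)
      with trivial_inter' assms(1) show False using B1 by metis
    qed
    then show "y \<in> range B - {\<one>}" using f x by auto
  qed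
  ultimately have "card (range A) \<le> card (range B - {\<one>})"
    by (metis card_image card_mono finite_Diff finite_ranges(2))
  also have "\<dots> < card (range B)"
  proof (rule psubset_card_mono)
    have "B 0 \<in> range B" by blast
    then show "range B - {\<one>} \<subset> range B" by (metis Diff_iff insertI1 int_pow_0 psubsetI Diff_subset)
  qed (rule finite_ranges)
  finally show ?thesis .
qed

end

section \<open>The core of the first factor and the normality of \<open><a^2>\<close>\<close>

context tight_group begin

lemma A_core_conj:
  assumes "B 1 \<otimes> A i = A l \<otimes> B 1" shows "B t \<otimes> A i = A (if even t then i else l) \<otimes> B t"
proof (cases "even t")
  case True
  then obtain s where "t = 2 * s" by (rule evenE)
  then show ?thesis using A_core_comm[OF assms, of s] by simp
next
  case False
  then obtain s where s: "t = 2 * s + 1" by (rule oddE)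
  have "B t \<otimes> A i = B (2 * s) \<otimes> (B 1 \<otimes> A i)" by (simp add: word_simps s)
  also have "\<dots> = (B (2 * s) \<otimes> A l) \<otimes> B 1" by (simp only: assms) (simp add: m_assoc)
  also have "\<dots> = A l \<otimes> B t"
    by (simp only: A_core_comm[OF A_core_shift[OF assms]]) (simp add: word_simps s)
  finally show ?thesis using False by simp
qed

text \<open>A single conjugation by \<open>b\<close> is tested. As this conjugation is an involution
  by \<open>A_core_shift\<close>, the powers \<open>A i\<close> with such \<open>i\<close> form the
  largest normal subgroup contained in \<open><a>\<close>.\<close>

definition core_exponent :: "int \<Rightarrow> bool" where
  "core_exponent i \<longleftrightarrow> (\<exists>l. B 1 \<otimes> A i = A l \<otimes> B 1)"

lemma core_exponent_add:
  assumes "core_exponent i" "core_exponent j" shows "core_exponent (i + j)"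
proof -
  obtain l m where l: "B 1 \<otimes> A i = A l \<otimes> B 1" "B 1 \<otimes> A j = A m \<otimes> B 1"
    using assms by (auto simp: core_exponent_def)
  have "B 1 \<otimes> A (i + j) = (B 1 \<otimes> A i) \<otimes> A j" by (simp add: word_simps)
  also have "\<dots> = A l \<otimes> (B 1 \<otimes> A j)" by (simp only: l(1)) (simp add: m_assoc)
  also have "\<dots> = A (l + m) \<otimes> B 1" by (simp only: l(2)) (simp add: word_simps)
  finally show ?thesis by (auto simp: core_exponent_def)
qed

lemma core_exponent_mult: "core_exponent i \<Longrightarrow> core_exponent (i * s)"
  unfolding core_exponent_def using A_core_pow by blast

lemma core_exponent_uminus: "core_exponent i \<Longrightarrow> core_exponent (- i)"
  using core_exponent_mult[of i "-1"] by simp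

lemma core_exponent_conj:
  assumes "core_exponent i" obtains l where "core_exponent l" "B t \<otimes> A i = A l \<otimes> B t"
proof -
  obtain l where l: "B 1 \<otimes> A i = A l \<otimes> B 1" using assms by (auto simp: core_exponent_def)
  have "core_exponent l" using A_core_shift[OF l] by (auto simp: core_exponent_def)
  with assms that[of "if even t then i else l"] A_core_conj[OF l, of t] show thesis
    by (auto split: if_splits)
qed

lemma core_normal: "A ` {i. core_exponent i} \<lhd> G"
proof (rule normal_invI)
  show "subgroup (A ` {i. core_exponent i}) G"
  proof
    show "A ` {i. core_exponent i} \<subseteq> carrier G" by auto
    have "core_exponent 0" by (auto simp: core_exponent_def intro!: exI[of _ 0])
    then show "\<one> \<in> A ` {i. core_exponent i}" by (metis image_eqI int_pow_0 mem_Collect_eq)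
    fix x assume "x \<in> A ` {i. core_exponent i}"
    then obtain i where i: "x = A i" "core_exponent i" by auto
    show "inv x \<in> A ` {i. core_exponent i}"
      using core_exponent_uminus[OF i(2)] by (auto simp: i(1) inv_A)
    fix y assume "y \<in> A ` {i. core_exponent i}"
    then obtain j where j: "y = A j" "core_exponent j" by auto
    show "x \<otimes> y \<in> A ` {i. core_exponent i}"
      using core_exponent_add[OF i(2) j(2)] by (auto simp: i(1) j(1) AA)
  qed
next
  fix x h assume "x \<in> carrier G" and "h \<in> A ` {i. core_exponent i}"
  then obtain s t i where x: "x = A s \<otimes> B t" and h: "h = A i" "core_exponent i"
    using factorize by blast
  obtain l where l: "core_exponent l" "B t \<otimes> A i = A l \<otimes> B t"
    using core_exponent_conj[OF h(2)] by blast
  have "x \<otimes> h \<otimes> inv x = A s \<otimes> (B t \<otimes> A i) \<otimes> B (-t) \<otimes> A (-s)"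
    by (simp add: x h word_simps)
  also have "\<dots> = A l" by (simp only: l(2)) (simp add: word_simps)
  finally show "x \<otimes> h \<otimes> inv x \<in> A ` {i. core_exponent i}" using l(1) by auto
qed

text \<open>The left half is rewritten by \<open>b a = a^-1 b^-1\<close>, the right half by the
  equivalent \<open>a = b^-1 a^-1 b^-1\<close>. The formula turns knowledge of how \<open>a\<close>
  conjugates \<open>b^2\<close> into knowledge of how \<open>b\<close> conjugates
  \<open>a^2\<close>.\<close>

lemma BAAB: "B 1 \<otimes> A 2 \<otimes> B (-1) = A (-1) \<otimes> B (-2) \<otimes> A (-1) \<otimes> B (-2)"
proof -
  have sw: "A 1 = B (-1) \<otimes> A (-1) \<otimes> B (-1)"
    using arg_cong[OF BA, of "\<lambda>x. B (-1) \<otimes> x"] by (simp add: word_simps)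
  have "B 1 \<otimes> A 2 \<otimes> B (-1) = (B 1 \<otimes> A 1) \<otimes> (A 1 \<otimes> B (-1))" by (simp add: word_simps)
  also have "\<dots> = (A (-1) \<otimes> B (-1)) \<otimes> ((B (-1) \<otimes> A (-1) \<otimes> B (-1)) \<otimes> B (-1))"
    by (simp only: BA) (subst sw, rule refl)
  finally show ?thesis by (simp add: word_simps)
qed

end

theorem square_in_core:
  fixes G :: "'a monoid" (structure)
  assumes "tight_group G a b"
    and "\<And>i l. a [^] (1::int) \<otimes> b [^] (i::int) = b [^] (l::int) \<otimes> a [^] (1::int) \<Longrightarrow> b [^] i = \<one>"
  shows "\<exists>i. b [^] (1::int) \<otimes> a [^] (2::int) = a [^] (i::int) \<otimes> b [^] (1::int)"
  using assms
proof (induction "card (carrier G)" arbitrary: G a b rule: less_induct)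
  case (less G a b)
  interpret tight_group G a b by fact
  interpret swapped: tight_group G b a by (rule swap)
  show ?case
  proof (cases "a = \<one>\<^bsub>G\<^esub> \<or> b = \<one>\<^bsub>G\<^esub>")
    case True
    then show ?thesis
    proof
      assume "a = \<one>\<^bsub>G\<^esub>" then show ?thesis by (intro exI[of _ 0]) simp
    next
      assume "b = \<one>\<^bsub>G\<^esub>" then show ?thesis by (intro exI[of _ 2]) simp
    qed
  next
    case False
    \<comment> \<open>A core-free \<open><b>\<close> is smaller than \<open><a>\<close>. If
      \<open><a>\<close> were core-free as well, the same pigeonhole argument would give the
      opposite inequality.\<close>
    have "card (range B) < card (range A)"
      using swapped.core_pigeonhole less.prems(2) False by blast
    then obtain i0 where i0: "core_exponent i0" "A i0 \<noteq> \<one>\<^bsub>G\<^esub>"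
      using core_pigeonhole False unfolding core_exponent_def by (meson not_less_iff_gr_or_eq)
    obtain Q :: "'a monoid" and c where Q: "group Q" "c \<in> hom G Q" "c ` carrier G = carrier Q"
      and c_eq: "\<And>x y. x \<in> carrier G \<Longrightarrow> y \<in> carrier G \<Longrightarrow>
        c x = c y \<longleftrightarrow> x \<otimes>\<^bsub>G\<^esub> inv\<^bsub>G\<^esub> y \<in> A ` {i. core_exponent i}"
      using quotient_hom_same_type[OF core_normal] by metis
    interpret Q: group Q by fact
    have c_pow: "(c x) [^]\<^bsub>Q\<^esub> (i::int) = c (x [^]\<^bsub>G\<^esub> i)" if "x \<in> carrier G" for x i
      using hom_int_pow[OF Q(2) that is_group Q(1)] by simp
    have c_mult: "c x \<otimes>\<^bsub>Q\<^esub> c y = c (x \<otimes>\<^bsub>G\<^esub> y)" if "x \<in> carrier G" "y \<in> carrier G" for x y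
      using Q(2) that by (simp add: hom_mult)
    have c_one: "c \<one>\<^bsub>G\<^esub> = \<one>\<^bsub>Q\<^esub>" using hom_one[OF Q(2) is_group Q(1)] .
    have c_eqD: "\<exists>s. core_exponent s \<and> x = A s \<otimes>\<^bsub>G\<^esub> y"
      if xy: "x \<in> carrier G" "y \<in> carrier G" "c x = c y" for x y
    proof -
      have "x \<otimes>\<^bsub>G\<^esub> inv\<^bsub>G\<^esub> y \<in> A ` {i. core_exponent i}"
        using c_eq[OF xy(1,2)] xy(3) by simp
      then obtain s where s: "core_exponent s" "x \<otimes>\<^bsub>G\<^esub> inv\<^bsub>G\<^esub> y = A s" by blast
      have "x = x \<otimes>\<^bsub>G\<^esub> inv\<^bsub>G\<^esub> y \<otimes>\<^bsub>G\<^esub> y" using xy by (simp add: m_assoc)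
      then have "x = A s \<otimes>\<^bsub>G\<^esub> y" by (simp only: s(2))
      then show ?thesis using s(1) by blast
    qed
    have c_eqI: "c (A s \<otimes>\<^bsub>G\<^esub> y) = c y" if "core_exponent s" "y \<in> carrier G" for s y
      using that by (subst c_eq) (auto simp: m_assoc)
    have c_core: "c (A s) = \<one>\<^bsub>Q\<^esub>" if "core_exponent s" for s
      using c_eqI[OF that one_closed] c_one by simp
    have tQ: "tight_group Q (c a) (c b)"
    proof unfold_locales
      show "c a \<in> carrier Q" "c b \<in> carrier Q" using Q(3) by auto
      show "finite (carrier Q)" using Q(3) finite_carrier by (metis finite_imageI)
      show "c a \<otimes>\<^bsub>Q\<^esub> c b \<otimes>\<^bsub>Q\<^esub> c a \<otimes>\<^bsub>Q\<^esub> c b = \<one>\<^bsub>Q\<^esub>"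
        by (simp add: c_mult abab c_one)
    next
      fix g assume "g \<in> carrier Q"
      then obtain x where "x \<in> carrier G" "g = c x" using Q(3) by blast
      then show "\<exists>i j. g = (c a) [^]\<^bsub>Q\<^esub> (i::int) \<otimes>\<^bsub>Q\<^esub> (c b) [^]\<^bsub>Q\<^esub> (j::int)"
        using factorize by (fastforce simp: c_pow c_mult)
    next
      fix i j :: int assume "(c a) [^]\<^bsub>Q\<^esub> i = (c b) [^]\<^bsub>Q\<^esub> j"
      then have "c (A i) = c (B j)" by (simp add: c_pow)
      from c_eqD[OF _ _ this] obtain s where s: "core_exponent s" "A i = A s \<otimes>\<^bsub>G\<^esub> B j" by auto
      have "A i \<otimes>\<^bsub>G\<^esub> B 0 = A s \<otimes>\<^bsub>G\<^esub> B j" using s(2) by simp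
      then have "A i = A s" by (rule normal_form_unique(1))
      then show "(c a) [^]\<^bsub>Q\<^esub> i = \<one>\<^bsub>Q\<^esub>" using c_core[OF s(1)] by (simp add: c_pow)
    next
      fix j i i' j' :: int
      assume "(c b) [^]\<^bsub>Q\<^esub> j \<otimes>\<^bsub>Q\<^esub> (c a) [^]\<^bsub>Q\<^esub> i = (c a) [^]\<^bsub>Q\<^esub> i' \<otimes>\<^bsub>Q\<^esub> (c b) [^]\<^bsub>Q\<^esub> j'"
      then have "c (B j \<otimes>\<^bsub>G\<^esub> A i) = c (A i' \<otimes>\<^bsub>G\<^esub> B j')" by (simp add: c_pow c_mult)
      from c_eqD[OF _ _ this] obtain s
        where s: "core_exponent s" "B j \<otimes>\<^bsub>G\<^esub> A i = A s \<otimes>\<^bsub>G\<^esub> (A i' \<otimes>\<^bsub>G\<^esub> B j')" by auto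
      have "B j \<otimes>\<^bsub>G\<^esub> A i = A (s + i') \<otimes>\<^bsub>G\<^esub> B j'" using s(2) by (simp add: word_simps)
      from mirror[OF this] have "B (-j) \<otimes>\<^bsub>G\<^esub> A (-i) = A (-s) \<otimes>\<^bsub>G\<^esub> (A (-i') \<otimes>\<^bsub>G\<^esub> B (-j'))"
        by (simp add: word_simps)
      then have "c (B (-j) \<otimes>\<^bsub>G\<^esub> A (-i)) = c (A (-i') \<otimes>\<^bsub>G\<^esub> B (-j'))"
        using c_eqI[OF core_exponent_uminus[OF s(1)]] by simp
      then show "(c b) [^]\<^bsub>Q\<^esub> (-j) \<otimes>\<^bsub>Q\<^esub> (c a) [^]\<^bsub>Q\<^esub> (-i) = (c a) [^]\<^bsub>Q\<^esub> (-i') \<otimes>\<^bsub>Q\<^esub> (c b) [^]\<^bsub>Q\<^esub> (-j')"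
        by (simp add: c_pow c_mult)
    qed
    then interpret tQ: tight_group Q "c a" "c b" .
    interpret tQs: tight_group Q "c b" "c a" by (rule tQ.swap)
    have smaller: "card (carrier Q) < card (carrier G)"
    proof -
      have "c (A i0) = c \<one>\<^bsub>G\<^esub>" using c_core[OF i0(1)] c_one by simp
      then have "\<not> inj_on c (carrier G)"
        using i0(2) inj_onD[of c "carrier G" "A i0" "\<one>\<^bsub>G\<^esub>"] int_pow_closed[OF a_closed] one_closed by metis
      then have "card (c ` carrier G) \<noteq> card (carrier G)"
        using eq_card_imp_inj_on[OF finite_carrier] by metis
      then show ?thesis using card_image_le[OF finite_carrier, of c] Q(3) by simp
    qed
    \<comment> \<open>Modulo its core \<open><a>\<close> is core-free, so the induction hypothesis
      applies with \<open>c b\<close> and \<open>c a\<close> in the roles of the first and the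
      second generator.\<close>
    have "\<exists>i. (c a) [^]\<^bsub>Q\<^esub> (1::int) \<otimes>\<^bsub>Q\<^esub> (c b) [^]\<^bsub>Q\<^esub> (2::int) = (c b) [^]\<^bsub>Q\<^esub> (i::int) \<otimes>\<^bsub>Q\<^esub> (c a) [^]\<^bsub>Q\<^esub> (1::int)"
    proof (rule less.hyps[OF smaller tQ.swap])
      fix i l :: int
      assume "(c b) [^]\<^bsub>Q\<^esub> (1::int) \<otimes>\<^bsub>Q\<^esub> (c a) [^]\<^bsub>Q\<^esub> i = (c a) [^]\<^bsub>Q\<^esub> l \<otimes>\<^bsub>Q\<^esub> (c b) [^]\<^bsub>Q\<^esub> (1::int)"
      then have "c (B 1 \<otimes>\<^bsub>G\<^esub> A i) = c (A l \<otimes>\<^bsub>G\<^esub> B 1)" by (simp add: c_pow c_mult)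
      from c_eqD[OF _ _ this] obtain s
        where "B 1 \<otimes>\<^bsub>G\<^esub> A i = A s \<otimes>\<^bsub>G\<^esub> (A l \<otimes>\<^bsub>G\<^esub> B 1)" by auto
      then have "B 1 \<otimes>\<^bsub>G\<^esub> A i = A (s + l) \<otimes>\<^bsub>G\<^esub> B 1" by (simp add: word_simps)
      then have "core_exponent i" unfolding core_exponent_def by (rule exI)
      then show "(c a) [^]\<^bsub>Q\<^esub> i = \<one>\<^bsub>Q\<^esub>" using c_core by (simp add: c_pow)
    qed
    then obtain i where "(c a) [^]\<^bsub>Q\<^esub> (1::int) \<otimes>\<^bsub>Q\<^esub> (c b) [^]\<^bsub>Q\<^esub> (2::int) = (c b) [^]\<^bsub>Q\<^esub> (i::int) \<otimes>\<^bsub>Q\<^esub> (c a) [^]\<^bsub>Q\<^esub> (1::int)" ..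
    \<comment> \<open>An even exponent is wanted because even powers of \<open>b\<close> commute
      with the core element \<open>A s\<close> below.\<close>
    from tQs.A_core_even[OF this] obtain k :: int where "(c a) [^]\<^bsub>Q\<^esub> (1::int) \<otimes>\<^bsub>Q\<^esub> (c b) [^]\<^bsub>Q\<^esub> (2::int) = (c b) [^]\<^bsub>Q\<^esub> (2 * k) \<otimes>\<^bsub>Q\<^esub> (c a) [^]\<^bsub>Q\<^esub> (1::int)" ..
    then have "c (A 1 \<otimes>\<^bsub>G\<^esub> B 2) = c (B (2 * k) \<otimes>\<^bsub>G\<^esub> A 1)" by (simp add: c_pow c_mult)
    from c_eqD[OF _ _ this] obtain s where s: "core_exponent s"
      and E1: "A 1 \<otimes>\<^bsub>G\<^esub> B 2 = A s \<otimes>\<^bsub>G\<^esub> (B (2 * k) \<otimes>\<^bsub>G\<^esub> A 1)" by blast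
    have comm: "B (2 * t) \<otimes>\<^bsub>G\<^esub> A s = A s \<otimes>\<^bsub>G\<^esub> B (2 * t)" for t
      using s A_core_comm unfolding core_exponent_def by blast
    have X_pow: "(A s \<otimes>\<^bsub>G\<^esub> B (2 * k)) [^]\<^bsub>G\<^esub> j = A (s * j) \<otimes>\<^bsub>G\<^esub> B (2 * k * j)" for j :: int
      using int_pow_mult_distrib[of "A s" "B (2 * k)" j] comm[of k] by (simp add: int_pow_pow)
    have E1': "A 1 \<otimes>\<^bsub>G\<^esub> B (2 * j) = A (s * j) \<otimes>\<^bsub>G\<^esub> B (2 * k * j) \<otimes>\<^bsub>G\<^esub> A 1" for j
    proof -
      have "A 1 \<otimes>\<^bsub>G\<^esub> B 2 = (A s \<otimes>\<^bsub>G\<^esub> B (2 * k)) \<otimes>\<^bsub>G\<^esub> A 1" using E1 by (simp add: m_assoc)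
      from intertwine_int_pow[OF _ _ _ this, of j] show ?thesis by (simp add: X_pow int_pow_pow)
    qed
    \<comment> \<open>Mirroring and inverting \<open>E1\<close> gives the same relation for
      \<open>a^-1\<close>, with the same \<open>s\<close> and \<open>k\<close>.\<close>
    have E2: "A (-1) \<otimes>\<^bsub>G\<^esub> B 2 = A s \<otimes>\<^bsub>G\<^esub> B (2 * k) \<otimes>\<^bsub>G\<^esub> A (-1)"
    proof -
      have "B (2 * k) \<otimes>\<^bsub>G\<^esub> A 1 = A (1 - s) \<otimes>\<^bsub>G\<^esub> B 2"
        using arg_cong[OF E1, of "\<lambda>x. A (-s) \<otimes>\<^bsub>G\<^esub> x"] by (simp add: word_simps)
      from mirror[OF this] have "B (- 2 * k) \<otimes>\<^bsub>G\<^esub> A (-1) = A (s - 1) \<otimes>\<^bsub>G\<^esub> B (-2)" by simp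
      from arg_cong[OF this, of "\<lambda>x. inv\<^bsub>G\<^esub> x"]
      have "A 1 \<otimes>\<^bsub>G\<^esub> B (2 * k) = B 2 \<otimes>\<^bsub>G\<^esub> A (1 - s)" by (simp add: word_simps)
      from arg_cong[OF this, of "\<lambda>x. A (-1) \<otimes>\<^bsub>G\<^esub> (x \<otimes>\<^bsub>G\<^esub> A s) \<otimes>\<^bsub>G\<^esub> A (-1)"]
      have "A (-1) \<otimes>\<^bsub>G\<^esub> B 2 = B (2 * k) \<otimes>\<^bsub>G\<^esub> A s \<otimes>\<^bsub>G\<^esub> A (-1)" by (simp add: word_simps)
      then show ?thesis by (simp only: comm)
    qed
    \<comment> \<open>Conjugating \<open>b^2\<close> by \<open>a^-1\<close> and then by
      \<open>a\<close> must return \<open>b^2\<close>; comparing the \<open><a>\<close>-factors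
      yields \<open>a^(s(1+k)) = 1\<close>.\<close>
    have "B 2 = A 1 \<otimes>\<^bsub>G\<^esub> (A (-1) \<otimes>\<^bsub>G\<^esub> B 2)" by (simp add: word_simps)
    also have "\<dots> = A s \<otimes>\<^bsub>G\<^esub> (A 1 \<otimes>\<^bsub>G\<^esub> B (2 * k)) \<otimes>\<^bsub>G\<^esub> A (-1)"
      by (simp only: E2) (simp add: word_simps add.commute)
    also have "\<dots> = A (s * (1 + k)) \<otimes>\<^bsub>G\<^esub> B (2 * k * k)"
      by (simp only: E1') (simp add: word_simps algebra_simps)
    finally have "A 0 \<otimes>\<^bsub>G\<^esub> B 2 = A (s * (1 + k)) \<otimes>\<^bsub>G\<^esub> B (2 * k * k)" by simp
    from normal_form_unique(1)[OF this] have n1: "A (s * (1 + k)) = \<one>\<^bsub>G\<^esub>" by simp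
    \<comment> \<open>Now \<open>a\<close> conjugates \<open>b^(2(1+k))\<close> into
      \<open><b>\<close>, so core-freeness makes this element trivial. Its inverse is the
      \<open><b>\<close>-factor left over when \<open>BAAB\<close> is evaluated below.\<close>
    have "A 1 \<otimes>\<^bsub>G\<^esub> B (2 * (1 + k)) = B (2 * k * (1 + k)) \<otimes>\<^bsub>G\<^esub> A 1"
      by (simp only: E1' n1) simp
    then have d1: "B (2 * (1 + k)) = \<one>\<^bsub>G\<^esub>" by (rule less.prems(2))
    have E4: "B (-2) \<otimes>\<^bsub>G\<^esub> A (-1) = A (-1) \<otimes>\<^bsub>G\<^esub> A (-s) \<otimes>\<^bsub>G\<^esub> B (-2 * k)"
      using arg_cong[OF E1'[of "-1"], of "\<lambda>x. A (-1) \<otimes>\<^bsub>G\<^esub> x \<otimes>\<^bsub>G\<^esub> A (-1)"] by (simp add: word_simps)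
    have "B 1 \<otimes>\<^bsub>G\<^esub> A 2 \<otimes>\<^bsub>G\<^esub> B (-1) = A (-1) \<otimes>\<^bsub>G\<^esub> (B (-2) \<otimes>\<^bsub>G\<^esub> A (-1)) \<otimes>\<^bsub>G\<^esub> B (-2)"
      by (simp only: BAAB) (simp add: m_assoc)
    also have "\<dots> = A (-2 - s) \<otimes>\<^bsub>G\<^esub> B (- (2 * (1 + k)))"
      by (simp only: E4) (simp add: word_simps algebra_simps)
    also have "B (- (2 * (1 + k))) = \<one>\<^bsub>G\<^esub>" by (subst inv_B[symmetric]) (simp only: d1 inv_one)
    finally have "B 1 \<otimes>\<^bsub>G\<^esub> A 2 \<otimes>\<^bsub>G\<^esub> B (-1) = A (-2 - s)" by simp
    from arg_cong[OF this, of "\<lambda>x. x \<otimes>\<^bsub>G\<^esub> B 1"]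
    have "B 1 \<otimes>\<^bsub>G\<^esub> A 2 = A (-2 - s) \<otimes>\<^bsub>G\<^esub> B 1" by (simp add: word_simps)
    then show ?thesis by blast
  qed
qed

section \<open>The exponent \<open>k\<close> when the second factor is core-free\<close>

locale tight_simple_group = tight_group G a b for G :: "'a monoid" (structure) and a b +
  assumes corefree: "a [^] (1::int) \<otimes> b [^] (i::int) = b [^] (l::int) \<otimes> a [^] (1::int) \<Longrightarrow> b [^] i = \<one>"
begin

interpretation swapped: tight_group G b a by (rule swap)

lemma B_eq_iff: "B i = B j \<longleftrightarrow> int (ord b) dvd i - j"
  by (rule swapped.A_eq_iff)

lemma ord_b_less_ord_a: "a \<noteq> \<one> \<Longrightarrow> ord b < ord a"
  using swapped.core_pigeonhole corefree by (metis card_range_A swapped.card_range_A)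

lemma exponent_exists: "\<exists>k. B 1 \<otimes> A 2 = A (2 * k) \<otimes> B 1"
  using square_in_core[OF tight_group_axioms] corefree A_core_even by blast

text \<open>If the order of \<open>a\<close> is odd, then \<open>a\<close> is itself an even power
  of \<open>a\<close>, so \<open>b a = a^x b\<close> for some \<open>x\<close>. Comparison with
  \<open>b a = a^-1 b^-1\<close> gives \<open>b^2 = 1\<close>.\<close>

lemma ord_a_even:
  assumes "3 \<le> ord b" shows "even (ord a)"
proof (rule ccontr)
  assume "odd (ord a)"
  then obtain u where "int (ord a) + 1 = 2 * u" by (meson evenE even_of_nat odd_even_add odd_one)
  obtain k where k: "B 1 \<otimes> A 2 = A (2 * k) \<otimes> B 1" using exponent_exists by blast
  have "A 1 = A (2 * u)" by (subst A_eq_iff) (simp flip: \<open>int (ord a) + 1 = 2 * u\<close>)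
  then have "A (2 * k * u) \<otimes> B 1 = B 1 \<otimes> A 1" using A_core_pow[OF k, of u] by simp
  also have "\<dots> = A (-1) \<otimes> B (-1)" by (rule BA)
  finally have "B 1 = B (-1)" by (rule normal_form_unique(2))
  then have "int (ord b) dvd 2" by (simp add: B_eq_iff)
  then have "int (ord b) \<le> 2" by (rule zdvd_imp_le) simp
  with assms show False by simp
qed

context
  fixes k assumes k: "B 1 \<otimes> A 2 = A (2 * k) \<otimes> B 1"
begin

lemma exponent_square: "int (ord a) dvd 2 * (k * k) - 2"
proof -
  have "A 2 \<otimes> B 1 = B 1 \<otimes> A (2 * k)" using A_core_shift[OF k] by simp
  also have "\<dots> = A (2 * k * k) \<otimes> B 1" by (rule A_core_pow[OF k])
  finally have "A 2 = A (2 * k * k)" by (rule normal_form_unique(1))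
  then have "A (2 * (k * k)) = A 2" by (simp add: mult.assoc)
  then show ?thesis by (simp only: A_eq_iff)
qed

lemma B1_A_even: "B 1 \<otimes> A (2 * x) = A (2 * (k * x)) \<otimes> B 1"
  using A_core_pow[OF k, of x] by (simp add: mult.assoc)

lemma Bm1_A_even: "B (-1) \<otimes> A (2 * x) = A (2 * (k * x)) \<otimes> B (-1)"
  by (rule A_core_shift_inv[OF B1_A_even])

lemma B_even_A_even: "B (2 * t) \<otimes> A (2 * x) = A (2 * x) \<otimes> B (2 * t)"
  by (rule A_core_comm[OF B1_A_even])

lemma A_even_B: "A (2 * x) \<otimes> B m = B m \<otimes> A (2 * (if even m then x else k * x))"
proof -
  have "A (2 * x) = A (2 * (k * (k * x)))"
  proof -
    have "2 * x - 2 * (k * (k * x)) = (2 * (k * k) - 2) * (- x)" by (simp add: algebra_simps)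
    then show ?thesis using exponent_square by (metis A_eq_iff dvd_mult2)
  qed
  then show ?thesis
    using A_core_conj[OF B1_A_even[of x], of m] A_core_conj[OF B1_A_even[of "k * x"], of m] by simp
qed

text \<open>With vertex \<open>i\<close> standing for the image of the base vertex under
  \<open>a^i\<close>, this and \<open>B_odd_A1\<close> tell where \<open><b>\<close> sends the
  neighbouring vertex 1. Inverting \<open>BAAB\<close> gives \<open>b^2 a b^2 = a^(-1-2k)\<close>,
  and each further factor \<open>b^2\<close> or \<open>b^-2\<close> passes through the even power of
  \<open>a\<close> already collected.\<close>

lemma B_even_A1: "B (2 * t) \<otimes> A 1 = A (1 - (2 + 2 * k) * t) \<otimes> B (-2 * t)"
proof -
  have "A (-1) \<otimes> B (-2) \<otimes> A (-1) \<otimes> B (-2) = A (2 * k)"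
    using BAAB arg_cong[OF k, of "\<lambda>x. x \<otimes> B (-1)"] by (simp add: word_simps)
  from arg_cong[OF arg_cong[OF this, of "\<lambda>x. A 1 \<otimes> x"], of "\<lambda>x. inv x"]
  have BAB: "B 2 \<otimes> A 1 \<otimes> B 2 = A (-1 - 2 * k)" by (simp add: word_simps algebra_simps)
  have up: "B 2 \<otimes> A 1 = A (-1 - 2 * k) \<otimes> B (-2)"
    using arg_cong[OF BAB, of "\<lambda>x. x \<otimes> B (-2)"] by (simp add: word_simps)
  have down: "B (-2) \<otimes> A 1 = A (3 + 2 * k) \<otimes> B 2"
  proof -
    have "B (2 * 1) \<otimes> A (2 * (1 + k)) = A (2 * (1 + k)) \<otimes> B (2 * 1)" by (rule B_even_A_even)
    then have c: "B 2 \<otimes> A (2 + 2 * k) = A (2 + 2 * k) \<otimes> B 2" by (simp add: algebra_simps)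
    have "A 1 \<otimes> B 2 = B (-2) \<otimes> A (-1 - 2 * k)"
      using arg_cong[OF BAB, of "\<lambda>x. B (-2) \<otimes> x"] by (simp add: word_simps)
    from arg_cong[OF this, of "\<lambda>x. x \<otimes> A (2 + 2 * k)"]
    have "B (-2) \<otimes> A 1 = A 1 \<otimes> (B 2 \<otimes> A (2 + 2 * k))" by (simp add: word_simps)
    then show ?thesis by (simp only: c) (simp add: word_simps)
  qed
  \<comment> \<open>One step for both directions of the induction: \<open>e = 2\<close> with
    \<open>w = 1 - (2 + 2k)\<close>, and \<open>e = -2\<close> with
    \<open>w = 1 + (2 + 2k)\<close>.\<close>
  have step: "B e \<otimes> (B (2 * t) \<otimes> A 1) = A (w - (2 + 2 * k) * t) \<otimes> B (-e - 2 * t)"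
    if ih: "B (2 * t) \<otimes> A 1 = A (1 - (2 + 2 * k) * t) \<otimes> B (-2 * t)"
      and e: "B e \<otimes> A 1 = A w \<otimes> B (-e)" "even e" for e w t
  proof -
    obtain f where f: "- e = 2 * f" using e(2) by (metis even_minus evenE)
    have "B e \<otimes> (B (2 * t) \<otimes> A 1) = (B e \<otimes> A 1) \<otimes> A (2 * (- ((1 + k) * t))) \<otimes> B (-2 * t)"
      by (simp only: ih) (simp add: word_simps algebra_simps)
    also have "\<dots> = A w \<otimes> (B (2 * f) \<otimes> A (2 * (- ((1 + k) * t)))) \<otimes> B (-2 * t)"
      by (simp only: e(1) f) (simp add: m_assoc)
    also have "\<dots> = A (w - (2 + 2 * k) * t) \<otimes> B (-e - 2 * t)"
      by (simp only: B_even_A_even) (simp add: word_simps algebra_simps f)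
    finally show ?thesis .
  qed
  show ?thesis
  proof (induction t rule: int_induct[where k = 0])
    case base then show ?case by simp
  next
    case (step1 t)
    from step[OF step1(2), of 2] up show ?case by (simp add: word_simps algebra_simps)
  next
    case (step2 t)
    from step[OF step2(2), of "-2"] down show ?case by (simp add: word_simps algebra_simps)
  qed
qed

lemma B_odd_A1: "B (2 * t + 1) \<otimes> A 1 = A (-1 - (2 + 2 * k) * t) \<otimes> B (- (2 * t + 1))"
proof -
  have "B (2 * t + 1) \<otimes> A 1 = B 1 \<otimes> (B (2 * t) \<otimes> A 1)" by (simp add: word_simps add.commute)
  also have "\<dots> = (B 1 \<otimes> A 1) \<otimes> A (2 * (- ((1 + k) * t))) \<otimes> B (-2 * t)"
    by (simp only: B_even_A1) (simp add: word_simps algebra_simps)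
  also have "\<dots> = A (-1) \<otimes> (B (-1) \<otimes> A (2 * (- ((1 + k) * t)))) \<otimes> B (-2 * t)"
    by (simp only: BA) (simp add: word_simps)
  also have "\<dots> = A (-1 + 2 * (k * (- ((1 + k) * t)))) \<otimes> B (- (2 * t + 1))"
    by (simp only: Bm1_A_even) (simp add: word_simps algebra_simps)
  \<comment> \<open>Since \<open>2k^2 = 2\<close> modulo the order of \<open>a\<close>, also
    \<open>2k(1+k) = 2(1+k)\<close>.\<close>
  also have "A (-1 + 2 * (k * (- ((1 + k) * t)))) = A (-1 - (2 + 2 * k) * t)"
  proof -
    have "(-1 + 2 * (k * (- ((1 + k) * t)))) - (-1 - (2 + 2 * k) * t) = (2 * (k * k) - 2) * (- t)"
      by (simp add: algebra_simps)
    then show ?thesis using exponent_square by (metis A_eq_iff dvd_mult2)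
  qed
  finally show ?thesis .
qed

text \<open>When the shift in \<open>B_even_A1\<close> vanishes, \<open>a\<close> conjugates
  \<open>b^(-2j)\<close> into \<open><b>\<close>, and core-freeness makes that power
  trivial.\<close>

lemma order_relation: "int (ord a) dvd (2 + 2 * k) * j \<longleftrightarrow> int (ord b) dvd 2 * j"
proof
  assume "int (ord a) dvd (2 + 2 * k) * j"
  then have "A (1 - (2 + 2 * k) * j) = A 1" by (simp add: A_eq_iff)
  with B_even_A1[of j] have "A 1 \<otimes> B (-2 * j) = B (2 * j) \<otimes> A 1" by simp
  then have "B (-2 * j) = B 0" using corefree by simp
  then show "int (ord b) dvd 2 * j" by (simp only: B_eq_iff) simp
next
  assume "int (ord b) dvd 2 * j"
  then have "B (2 * j) = B 0" "B (-2 * j) = B 0" by (simp_all only: B_eq_iff) auto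
  with B_even_A1[of j] have "A 1 = A (1 - (2 + 2 * k) * j)" by simp
  then show "int (ord a) dvd (2 + 2 * k) * j" by (simp add: A_eq_iff)
qed

text \<open>For odd order \<open>2u + 1\<close> the element \<open>b\<close> is the even power
  \<open>b^(2u+2)\<close>, so it commutes with \<open>a^2\<close> and \<open>k\<close> acts as 1.
  \<open>B_odd_A1\<close> at the exponent \<open>2u + 1\<close> then shows that half the order of
  \<open>a\<close> divides the order of \<open>b\<close>, and \<open>order_relation\<close> gives
  the converse divisibility.\<close>

lemma ord_b_odd:
  assumes "odd (ord b)" "even (ord a)" shows "ord a = 2 * ord b"
proof -
  obtain n where n: "ord a = 2 * n" using assms(2) by (rule evenE)
  obtain u where u: "int (ord b) = 2 * u + 1" using assms(1) by (metis even_of_nat oddE)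
  have "2 * (u + 1) - 1 = int (ord b)" using u by simp
  then have b1: "B (2 * (u + 1)) = B 1" by (simp only: B_eq_iff) simp
  have "B (int (ord b)) = B 0" "B (- int (ord b)) = B 0"
    by (simp_all only: B_eq_iff) simp_all
  then have "B 1 \<otimes> A 2 = A 2 \<otimes> B 1"
    using B_even_A_even[of "u + 1" 1] by (simp only: mult_1_right b1)
  then have "A (2 * k) \<otimes> B 1 = A 2 \<otimes> B 1"
    by (simp only: k)
  then have "A (2 * k) = A 2" by (rule normal_form_unique(1))
  then have k2: "2 * int n dvd 2 * k - 2" by (simp only: A_eq_iff) (simp add: n)
  have "A 1 = A (-1 - (2 + 2 * k) * u)"
    using B_odd_A1[of u] by (simp only: u[symmetric] \<open>B (int (ord b)) = B 0\<close> \<open>B (- int (ord b)) = B 0\<close>) simp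
  then have "2 * int n dvd 1 - (-1 - (2 + 2 * k) * u)" by (simp only: A_eq_iff) (simp add: n)
  then have "2 * int n dvd (1 - (-1 - (2 + 2 * k) * u)) - (2 * k - 2) * u"
    using k2 by (rule dvd_diff[OF _ dvd_mult2])
  also have "(1 - (-1 - (2 + 2 * k) * u)) - (2 * k - 2) * u = 2 * int (ord b)"
    by (simp add: u algebra_simps)
  finally have "n dvd ord b" by simp
  moreover have "(2 + 2 * k) * int n = int (ord a) * (1 + k)" by (simp add: n algebra_simps)
  then have "int (ord a) dvd (2 + 2 * k) * int n" by simp
  then have "int (ord b) dvd 2 * int n" by (simp only: order_relation)
  then have "int (ord b) dvd int (2 * n)" by simp
  then have "ord b dvd 2 * n" by (simp only: int_dvd_int_iff)
  then have "ord b dvd n" using assms(1) by (simp add: coprime_dvd_mult_right_iff)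
  ultimately have "n = ord b" by (rule dvd_antisym)
  then show ?thesis using n by simp
qed

end

end

section \<open>The exponent as a solution of congruences\<close>

text \<open>The conditions on \<open>k\<close> at the prime 2: the modulus is
  \<open>2^\<beta>\<close>, and the equivalence for all \<open>j\<close> says that
  \<open>k + 1\<close> has additive order \<open>2^\<delta>\<close>. In the application
  \<open>\<beta>\<close> and \<open>\<delta>\<close> are one less than the multiplicities of 2 in
  \<open>p\<close> and \<open>q\<close>.\<close>

definition two_part_exponent :: "nat \<Rightarrow> nat \<Rightarrow> int \<Rightarrow> bool" where
  "two_part_exponent \<beta> \<delta> k \<longleftrightarrow>
     2 ^ \<beta> dvd (k - 1) * (k + 1) \<and> (\<forall>j. 2 ^ \<beta> dvd (1 + k) * j \<longleftrightarrow> 2 ^ \<delta> dvd j)"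

lemma two_part_exponent_0: "two_part_exponent \<beta> 0 k \<longleftrightarrow> 2 ^ \<beta> dvd k + 1"
proof
  assume "two_part_exponent \<beta> 0 k"
  then have "2 ^ \<beta> dvd (1 + k) * 1" unfolding two_part_exponent_def by (metis one_dvd power_0)
  then show "2 ^ \<beta> dvd k + 1" by (simp add: add.commute)
next
  assume "2 ^ \<beta> dvd k + 1"
  then show "two_part_exponent \<beta> 0 k" by (simp add: two_part_exponent_def add.commute)
qed

text \<open>The only element of order 2 modulo \<open>2^\<beta>\<close> is
  \<open>2^(\<beta>-1)\<close>. From \<open>\<beta> = 2\<close> on this element is even, so
  \<open>k\<close> is odd and \<open>k^2 = 1\<close> follows.\<close>

lemma two_part_exponent_1:
  assumes "2 \<le> \<beta>"
  shows "two_part_exponent \<beta> 1 k \<longleftrightarrow> 2 ^ \<beta> dvd k - (2 ^ (\<beta> - 1) - 1)"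
proof -
  obtain \<gamma> where \<beta>: "\<beta> = Suc (Suc \<gamma>)" using assms by (metis add_2_eq_Suc le_Suc_ex)
  define P where "P = (2::int) ^ Suc \<gamma>"
  have P: "2 ^ \<beta> = 2 * P" "2 ^ (\<beta> - 1) = P" "P \<noteq> 0" "even P" by (simp_all add: \<beta> P_def)
  show ?thesis unfolding P(1,2)
  proof
    assume "two_part_exponent \<beta> 1 k"
    then have h: "\<And>j. 2 * P dvd (1 + k) * j \<longleftrightarrow> 2 dvd j" by (simp add: two_part_exponent_def P)
    have "2 * P dvd (1 + k) * 2" by (subst h) simp
    then have "2 * P dvd 2 * (1 + k)" by (simp only: mult.commute)
    then have "P dvd 1 + k" by (simp only: dvd_mult_cancel_left) simp
    then obtain t where t: "1 + k = P * t" ..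
    have "odd t"
    proof
      assume "even t"
      then have "2 * P dvd (1 + k) * 1" by (auto simp: t)
      then show False by (simp only: h) simp
    qed
    then obtain s where "t = 2 * s + 1" by (rule oddE)
    then have "k - (P - 1) = 2 * P * s" using t by (simp add: algebra_simps)
    then show "2 * P dvd k - (P - 1)" by simp
  next
    assume "2 * P dvd k - (P - 1)"
    then obtain s where "k - (P - 1) = 2 * P * s" ..
    then have k: "1 + k = P * (2 * s + 1)" by (simp add: algebra_simps)
    have "even (1 + k)" using k P(4) by simp
    then obtain t where "k - 1 = 2 * t" by (metis add.commute diff_add_cancel dvd_def even_add odd_one evenE even_diff)
    then have "(k - 1) * (k + 1) = 2 * P * (t * (2 * s + 1))" using k by (simp add: algebra_simps)
    moreover have "2 * P dvd (1 + k) * j \<longleftrightarrow> 2 dvd j" for j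
    proof -
      have "2 * P dvd (1 + k) * j \<longleftrightarrow> P * 2 dvd P * ((2 * s + 1) * j)"
        by (simp only: k mult_ac)
      also have "\<dots> \<longleftrightarrow> 2 dvd (2 * s + 1) * j" using P(3) by (simp only: dvd_mult_cancel_left) simp
      finally show ?thesis by simp
    qed
    ultimately show "two_part_exponent \<beta> 1 k" by (simp add: two_part_exponent_def P)
  qed
qed

text \<open>Order \<open>2^(\<beta>-1)\<close> means that \<open>k + 1\<close> is twice an odd
  number, and the odd factor can be cancelled from \<open>(k - 1)(k + 1)\<close>. The resulting
  congruence is modulo \<open>2^(\<beta>-1)\<close> only, so two classes modulo
  \<open>2^\<beta>\<close> remain.\<close>

lemma two_part_exponent_pred:
  assumes "3 \<le> \<beta>"
  shows "two_part_exponent \<beta> (\<beta> - 1) k \<longleftrightarrow> 2 ^ (\<beta> - 1) dvd k - 1"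
proof -
  obtain \<gamma> where \<beta>: "\<beta> = Suc (Suc (Suc \<gamma>))" using assms by (metis add.commute add_Suc_right add_0 le_Suc_ex numeral_3_eq_3)
  define P where "P = (2::int) ^ Suc \<gamma>"
  have P: "2 ^ \<beta> = 4 * P" "2 ^ (\<beta> - 1) = 2 * P" "P \<noteq> 0" "even P" by (simp_all add: \<beta> P_def)
  show ?thesis unfolding P(1,2)
  proof
    assume "two_part_exponent \<beta> (\<beta> - 1) k"
    then have h: "\<And>j. 4 * P dvd (1 + k) * j \<longleftrightarrow> 2 * P dvd j" and sq: "4 * P dvd (k - 1) * (k + 1)"
      by (simp_all only: two_part_exponent_def P)
    have "4 * P dvd (1 + k) * (2 * P)" by (subst h) simp
    then have "(2 * P) * 2 dvd (2 * P) * (1 + k)" by (simp add: mult_ac)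
    then have "2 dvd 1 + k" using P(3) by (simp only: dvd_mult_cancel_left) simp
    then obtain t where t: "1 + k = 2 * t" ..
    have "odd t"
    proof
      assume "even t"
      then obtain s where "t = 2 * s" ..
      then have "4 * P dvd (1 + k) * P" by (simp add: t)
      then have "P * 2 dvd P * 1" by (simp only: h) (simp add: mult.commute)
      then show False using P(3) by (simp only: dvd_mult_cancel_left) simp
    qed
    have "2 * (2 * P) dvd 2 * ((k - 1) * t)" using sq t by (simp add: add.commute mult_ac)
    then have "2 * P dvd (k - 1) * t" by (simp only: dvd_mult_cancel_left) simp
    moreover have "coprime (2 * P) t"
      using \<open>odd t\<close> by (simp add: P_def coprime_left_2_iff_odd del: power_Suc)
    ultimately show "2 * P dvd k - 1" by (simp add: coprime_dvd_mult_left_iff)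
  next
    assume "2 * P dvd k - 1"
    then obtain s where s: "k - 1 = 2 * P * s" ..
    define t where "t = 1 + P * s"
    have k: "1 + k = 2 * t" using s by (simp add: t_def)
    have "odd t" using P(4) by (simp add: t_def)
    have "coprime (2 * P) t" using \<open>odd t\<close> by (simp add: P_def del: power_Suc)
    have "4 * P dvd (1 + k) * j \<longleftrightarrow> 2 * P dvd j" for j
    proof -
      have "4 * P dvd (1 + k) * j \<longleftrightarrow> 2 * (2 * P) dvd 2 * (t * j)" by (simp add: k mult_ac)
      also have "\<dots> \<longleftrightarrow> 2 * P dvd t * j" by (simp only: dvd_mult_cancel_left) simp
      finally show ?thesis using \<open>coprime (2 * P) t\<close> by (simp add: coprime_dvd_mult_right_iff)
    qed
    moreover have "(k - 1) * (k + 1) = 4 * P * (s * t)" using s k by (simp add: algebra_simps)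
    ultimately show "two_part_exponent \<beta> (\<beta> - 1) k"
      unfolding two_part_exponent_def P(1,2) by simp
  qed
qed

text \<open>These are the conclusions of \<open>exponent_square\<close> and
  \<open>order_relation\<close> for a rotation group, read as conditions on an integer. The standard
  models show that they also suffice for even \<open>p\<close> and \<open>q\<close> with
  \<open>4 \<le> q < p\<close>.\<close>

definition admissible_exponent :: "nat \<Rightarrow> nat \<Rightarrow> int \<Rightarrow> bool" where
  "admissible_exponent p q k \<longleftrightarrow>
     int p dvd 2 * (k * k) - 2 \<and> (\<forall>j. int p dvd (2 + 2 * k) * j \<longleftrightarrow> int q dvd 2 * j)"

lemma admissible_exponent_double:
  "admissible_exponent (2 * n) (2 * h) k \<longleftrightarrow>
     int n dvd (k - 1) * (k + 1) \<and> (\<forall>j. int n dvd (1 + k) * j \<longleftrightarrow> int h dvd j)"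
proof -
  have "int (2 * n) dvd 2 * (k * k) - 2 \<longleftrightarrow> 2 * int n dvd 2 * ((k - 1) * (k + 1))"
    by (simp add: algebra_simps)
  moreover have "int (2 * n) dvd (2 + 2 * k) * j \<longleftrightarrow> 2 * int n dvd 2 * ((1 + k) * j)" for j
    by (simp add: algebra_simps)
  ultimately show ?thesis by (simp add: admissible_exponent_def)
qed

text \<open>Modulo the part \<open>u\<close> shared with \<open>q\<close> the order of
  \<open>k + 1\<close> is all of \<open>u\<close>, so \<open>k + 1\<close> is invertible there and
  \<open>k^2 = 1\<close> gives \<open>k = 1\<close>. The order is prime to \<open>w\<close>, so
  \<open>k + 1\<close> vanishes modulo \<open>w\<close>. Only the prime 2 keeps a condition on the
  order.\<close>

lemma admissible_exponent_iff:
  fixes u w :: nat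
  assumes "odd u" "odd w" "coprime u w"
  shows "admissible_exponent (2 * (2 ^ \<beta> * u * w)) (2 * (2 ^ \<delta> * u)) k \<longleftrightarrow>
     int u dvd k - 1 \<and> int w dvd k + 1 \<and> two_part_exponent \<beta> \<delta> k"
proof -
  have cop: "coprime (2 ^ m) (int u)" "coprime (2 ^ m) (int w)" "coprime (int u) (int w)"
    "coprime (2 ^ m * int u) (int w)" for m
    using assms by (auto simp: coprime_commute)
  have pos: "u > 0" "w > 0" using assms(1,2) by (auto intro: Nat.gr0I)
  show ?thesis unfolding admissible_exponent_double
  proof (intro iffI conjI)
    assume "int (2 ^ \<beta> * u * w) dvd (k - 1) * (k + 1) \<and>
      (\<forall>j. int (2 ^ \<beta> * u * w) dvd (1 + k) * j \<longleftrightarrow> int (2 ^ \<delta> * u) dvd j)"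
    then have sq: "2 ^ \<beta> * int u * int w dvd (k - 1) * (k + 1)"
      and h: "\<And>j. 2 ^ \<beta> * int u * int w dvd (1 + k) * j \<longleftrightarrow> 2 ^ \<delta> * int u dvd j" by simp_all
    have "2 ^ \<beta> * int u * int w dvd (1 + k) * (2 ^ \<delta> * int u)" by (subst h) simp
    then have "int w dvd (1 + k) * (2 ^ \<delta> * int u)" by (rule dvd_mult_right)
    then show w: "int w dvd k + 1" using cop(4)[of \<delta>]
      by (simp add: coprime_commute coprime_dvd_mult_left_iff add.commute)
    show "int u dvd k - 1"
    proof -
      define g where "g = gcd (int u) (1 + k)"
      obtain v where v: "int u = g * v" unfolding g_def by (meson dvd_def gcd_dvd1)
      obtain x where x: "1 + k = g * x" unfolding g_def by (meson dvd_def gcd_dvd2)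
      \<comment> \<open>As \<open>g * v = u\<close> and \<open>g\<close> divides
        \<open>1 + k\<close>, this multiplier annihilates \<open>1 + k\<close>; the order condition
        forces \<open>u\<close> to divide \<open>v\<close>, hence \<open>g = 1\<close>.\<close>
      have "2 ^ \<beta> * int u * int w dvd (1 + k) * (2 ^ \<beta> * v * int w)"
        by (auto simp: v x)
      then have "2 ^ \<delta> * int u dvd 2 ^ \<beta> * v * int w" by (simp only: h)
      then have "int u dvd 2 ^ \<beta> * v * int w" by (rule dvd_mult_right)
      then have "int u dvd 2 ^ \<beta> * v" using cop(3) by (simp only: coprime_dvd_mult_left_iff)
      then have "int u dvd v" using cop(1)[of \<beta>] by (simp add: coprime_dvd_mult_right_iff coprime_commute)
      then have "g * v dvd 1 * v" by (simp add: v)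
      moreover have "v \<noteq> 0" using v pos by auto
      ultimately have "g dvd 1" by (simp only: dvd_mult_cancel_right) simp
      then have "coprime (int u) (k + 1)" by (simp add: g_def coprime_iff_gcd_eq_1 add.commute)
      moreover have "int u dvd (k - 1) * (k + 1)" using sq by (meson dvd_mult_left dvd_mult_right)
      ultimately show ?thesis by (simp add: coprime_dvd_mult_left_iff)
    qed
    show "two_part_exponent \<beta> \<delta> k" unfolding two_part_exponent_def
    proof (intro conjI allI)
      show "2 ^ \<beta> dvd (k - 1) * (k + 1)" using sq by (meson dvd_mult_left)
    next
      fix j
      \<comment> \<open>The extra factor \<open>u\<close> on the right absorbs the odd part, since
        \<open>w\<close> already divides \<open>1 + k\<close>. The order condition for
        \<open>u * j\<close> then speaks about the prime 2 alone.\<close>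
      have "2 ^ \<beta> dvd (1 + k) * j \<longleftrightarrow> 2 ^ \<beta> * int u * int w dvd (1 + k) * (int u * j)"
      proof
        assume "2 ^ \<beta> * int u * int w dvd (1 + k) * (int u * j)"
        then have "2 ^ \<beta> dvd int u * ((1 + k) * j)" by (metis dvd_mult_left mult.left_commute)
        then show "2 ^ \<beta> dvd (1 + k) * j" using cop(1)[of \<beta>] by (simp only: coprime_dvd_mult_right_iff)
      next
        assume "2 ^ \<beta> dvd (1 + k) * j"
        moreover have "int w dvd (1 + k) * j" using w by (simp add: add.commute)
        ultimately have "2 ^ \<beta> * int w dvd (1 + k) * j" using cop(2)[of \<beta>] by (simp only: divides_mult)
        then have "int u * (2 ^ \<beta> * int w) dvd int u * ((1 + k) * j)" by (rule mult_dvd_mono[OF dvd_refl])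
        then show "2 ^ \<beta> * int u * int w dvd (1 + k) * (int u * j)" by (simp only: mult_ac)
      qed
      also have "\<dots> \<longleftrightarrow> 2 ^ \<delta> * int u dvd int u * j" by (simp only: h)
      also have "\<dots> \<longleftrightarrow> int u * 2 ^ \<delta> dvd int u * j" by (simp only: mult.commute)
      also have "\<dots> \<longleftrightarrow> 2 ^ \<delta> dvd j" using pos by (simp only: dvd_mult_cancel_left) simp
      finally show "2 ^ \<beta> dvd (1 + k) * j \<longleftrightarrow> 2 ^ \<delta> dvd j" .
    qed
  next
    assume "int u dvd k - 1 \<and> int w dvd k + 1 \<and> two_part_exponent \<beta> \<delta> k"
    then have u: "int u dvd k - 1" and w: "int w dvd k + 1"
      and sq: "2 ^ \<beta> dvd (k - 1) * (k + 1)" and h: "\<And>j. 2 ^ \<beta> dvd (1 + k) * j \<longleftrightarrow> 2 ^ \<delta> dvd j"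
      by (auto simp: two_part_exponent_def)
    have three: "2 ^ \<beta> * int u * int w dvd x \<longleftrightarrow> 2 ^ \<beta> dvd x \<and> int u dvd x \<and> int w dvd x" for x
      using cop(1)[of \<beta>] cop(4)[of \<beta>] by (meson divides_mult dvd_mult_left dvd_mult_right)
    show "int (2 ^ \<beta> * u * w) dvd (k - 1) * (k + 1)"
      using sq u w by (simp add: three)
    show "\<forall>j. int (2 ^ \<beta> * u * w) dvd (1 + k) * j \<longleftrightarrow> int (2 ^ \<delta> * u) dvd j"
    proof
      fix j
      obtain x where x: "k - 1 = int u * x" using u ..
      have "coprime (int u) 2" using assms(1) by simp
      \<comment> \<open>Modulo \<open>u\<close> the number \<open>1 + k\<close> is 2, which is
        invertible because \<open>u\<close> is odd.\<close>
      have k2: "(1 + k) * j = 2 * j + int u * (x * j)" using x by (simp add: algebra_simps)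
      have "int u dvd (1 + k) * j \<longleftrightarrow> int u dvd 2 * j"
        unfolding k2 by (rule dvd_add_left_iff) simp
      also have "\<dots> \<longleftrightarrow> int u dvd j"
        using \<open>coprime (int u) 2\<close> by (simp only: coprime_dvd_mult_right_iff)
      finally have "int u dvd (1 + k) * j \<longleftrightarrow> int u dvd j" .
      moreover have "int w dvd (1 + k) * j" using w by (simp add: add.commute)
      moreover have "2 ^ \<delta> * int u dvd j \<longleftrightarrow> 2 ^ \<delta> dvd j \<and> int u dvd j"
        using cop(1)[of \<delta>] by (meson divides_mult dvd_mult_left dvd_mult_right)
      ultimately show "int (2 ^ \<beta> * u * w) dvd (1 + k) * j \<longleftrightarrow> int (2 ^ \<delta> * u) dvd j"
        by (simp add: three h)
    qed
  qed
qed

text \<open>\<open>u\<close> is the odd part of \<open>q\<close> and \<open>w\<close> the remaining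
  odd part of \<open>p\<close>. They are coprime because the type condition on odd primes puts the
  whole power of such a prime in \<open>p\<close> on one side.\<close>

lemma classified_type_decompose:
  assumes "classified_type p q"
  obtains u w where "odd u" "odd w" "coprime u w" "multiplicity 2 q \<ge> 1"
    "multiplicity 2 q \<le> multiplicity 2 p"
    "p = 2 * (2 ^ (multiplicity 2 p - 1) * u * w)" "q = 2 * (2 ^ (multiplicity 2 q - 1) * u)"
proof -
  have pq: "p > 0" "q > 0" "q dvd p" "even p" "even q" using assms by (auto simp: classified_type_def)
  define \<alpha> \<gamma> where "\<alpha> = multiplicity 2 p" and "\<gamma> = multiplicity 2 q"
  obtain y where y: "p = 2 ^ \<alpha> * y" "odd y"
    using multiplicity_decompose'[of p 2] pq unfolding \<alpha>_def by auto
  obtain u where u: "q = 2 ^ \<gamma> * u" "odd u"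
    using multiplicity_decompose'[of q 2] pq unfolding \<gamma>_def by auto
  have "u dvd 2 ^ \<alpha> * y" using pq(3) y(1) u(1) by (metis dvd_mult_right)
  moreover have "coprime u (2 ^ \<alpha>)" using u(2) by simp
  ultimately have "u dvd y" by (simp add: coprime_dvd_mult_right_iff)
  then obtain w where w: "y = u * w" ..
  have "coprime u w"
  proof (rule ccontr)
    assume "\<not> coprime u w"
    then have "gcd u w \<noteq> 1" by (simp add: coprime_iff_gcd_eq_1)
    then obtain r where r: "prime r" "r dvd gcd u w" using prime_factor_nat by blast
    have ru: "r dvd u" and rw: "r dvd w" using r(2) by auto
    have "r \<noteq> 2" using ru u(2) by auto
    have "r dvd p" using ru y(1) w by simp
    then have "r \<in> prime_factors p - {2}" using pq(1) r(1) \<open>r \<noteq> 2\<close> by (simp add: prime_factors_dvd)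
    moreover have "gcd q r \<noteq> 1" using ru u(1) r(1)
      by (metis dvd_mult gcd_nat.absorb2 not_prime_1)
    ultimately have "r ^ multiplicity r p dvd q" using assms unfolding classified_type_def by blast
    moreover have "coprime (r ^ multiplicity r p) (2 ^ \<gamma>)"
      using primes_dvd_imp_eq[OF two_is_prime_nat r(1)] \<open>r \<noteq> 2\<close> by auto
    ultimately have "r ^ multiplicity r p dvd u" using u(1) by (simp add: coprime_dvd_mult_right_iff)
    then have "r ^ multiplicity r p * r dvd u * w" using rw by (rule mult_dvd_mono)
    then have "r ^ Suc (multiplicity r p) dvd p" using y(1) w by (simp add: mult.commute)
    then have "Suc (multiplicity r p) \<le> multiplicity r p"
      using pq(1) r(1) by (subst (asm) power_dvd_iff_le_multiplicity) auto
    then show False by simp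
  qed
  moreover have "\<gamma> \<ge> 1" "\<alpha> \<ge> 1"
    using pq(1,2,4,5) unfolding \<gamma>_def \<alpha>_def by (auto simp: Suc_le_eq multiplicity_gt_zero_iff)
  moreover have "\<gamma> \<le> \<alpha>" unfolding \<gamma>_def \<alpha>_def using pq by (intro dvd_imp_multiplicity_le) auto
  moreover have "odd w" using y(2) w by auto
  moreover have "p = 2 * (2 ^ (\<alpha> - 1) * u * w)"
    using y(1) w \<open>\<alpha> \<ge> 1\<close> by (cases \<alpha>) (auto simp: mult_ac)
  moreover have "q = 2 * (2 ^ (\<gamma> - 1) * u)"
    using u(1) \<open>\<gamma> \<ge> 1\<close> by (cases \<gamma>) (auto simp: mult_ac)
  ultimately show thesis using that u(2) unfolding \<alpha>_def \<gamma>_def by blast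
qed

lemma chinese_remainder_exponent:
  fixes u w :: nat
  assumes "odd u" "odd w" "coprime u w"
  obtains k where "int u dvd k - 1" "int w dvd k + 1" "2 ^ \<beta> dvd k - c"
proof -
  obtain x where x: "[x = 1] (mod int u)" "[x = -1] (mod int w)"
    using binary_chinese_remainder_int[of "int u" "int w"] assms(3) by auto
  have "coprime (int u * int w) (2 ^ \<beta>)" using assms by simp
  from binary_chinese_remainder_int[OF this] obtain k
    where k: "[k = x] (mod int u * int w)" "[k = c] (mod 2 ^ \<beta>)" by blast
  have "[k = 1] (mod int u)" "[k = -1] (mod int w)"
    using k(1) x by (meson cong_modulus_mult cong_trans mult.commute cong_dvd_modulus dvd_triv_left dvd_triv_right)+
  then show thesis using that k(2) by (simp add: cong_iff_dvd_diff)
qed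

lemma exponents_congruent:
  fixes u w :: nat
  assumes "odd u" "odd w" "coprime u w"
    and "int u dvd k - 1" "int w dvd k + 1" "int u dvd k' - 1" "int w dvd k' + 1"
    and "2 ^ \<beta> dvd k - k'"
  shows "int (2 * (2 ^ \<beta> * u * w)) dvd 2 * (k - k')"
proof -
  have "int u dvd (k - 1) - (k' - 1)" "int w dvd (k + 1) - (k' + 1)" using assms by (blast intro: dvd_diff)+
  then have "int u * int w dvd k - k'" using assms(3) by (simp add: divides_mult)
  moreover have "coprime (2 ^ \<beta>) (int u * int w)" using assms by simp
  ultimately have "2 ^ \<beta> * (int u * int w) dvd k - k'" using assms(8) by (simp add: divides_mult)
  from mult_dvd_mono[OF dvd_refl[of 2] this]
  show ?thesis by (simp add: mult.assoc)
qed

theorem admissible_exponents_classified: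
  assumes ct: "classified_type p q" and excl: "\<not> (multiplicity 2 p = 2 \<and> 4 dvd q)"
  shows "if 4 \<le> multiplicity 2 p \<and> 2 ^ (multiplicity 2 p - 1) dvd q
    then \<exists>k\<^sub>1 k\<^sub>2. admissible_exponent p q k\<^sub>1 \<and> admissible_exponent p q k\<^sub>2 \<and> \<not> int p dvd 2 * (k\<^sub>1 - k\<^sub>2) \<and>
      (\<forall>k. admissible_exponent p q k \<longrightarrow> int p dvd 2 * (k - k\<^sub>1) \<or> int p dvd 2 * (k - k\<^sub>2))
    else \<exists>k\<^sub>1. admissible_exponent p q k\<^sub>1 \<and>
      (\<forall>k. admissible_exponent p q k \<longrightarrow> int p dvd 2 * (k - k\<^sub>1))"
proof -
  define \<alpha> \<gamma> where "\<alpha> = multiplicity 2 p" and "\<gamma> = multiplicity 2 q"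
  obtain u w where uw: "odd u" "odd w" "coprime u w" and \<gamma>: "\<gamma> \<ge> 1" "\<gamma> \<le> \<alpha>"
    and p: "p = 2 * (2 ^ (\<alpha> - 1) * u * w)" and q: "q = 2 * (2 ^ (\<gamma> - 1) * u)"
    using classified_type_decompose[OF ct] unfolding \<alpha>_def \<gamma>_def by blast
  have adm: "admissible_exponent p q k \<longleftrightarrow>
      int u dvd k - 1 \<and> int w dvd k + 1 \<and> two_part_exponent (\<alpha> - 1) (\<gamma> - 1) k" for k
    unfolding p q by (rule admissible_exponent_iff[OF uw])
  have congruent: "int p dvd 2 * (k - k')"
    if "admissible_exponent p q k" "admissible_exponent p q k'" "2 ^ (\<alpha> - 1) dvd k - k'" for k k'
    using exponents_congruent[OF uw, of k k' "\<alpha> - 1", folded p] that unfolding adm by blast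
  have "q > 0" using ct by (auto simp: classified_type_def)
  have two_pow: "2 ^ m dvd q \<longleftrightarrow> m \<le> \<gamma>" for m
    unfolding \<gamma>_def using \<open>q > 0\<close> by (subst power_dvd_iff_le_multiplicity) auto
  have "(2::nat) ^ \<gamma> \<in> {2, 4, 2 ^ (\<alpha> - 1)}"
    using ct unfolding classified_type_def \<alpha>_def \<gamma>_def by blast
  then have "(2::nat) ^ \<gamma> = 2 ^ 1 \<or> (2::nat) ^ \<gamma> = 2 ^ 2 \<or> (2::nat) ^ \<gamma> = 2 ^ (\<alpha> - 1)" by auto
  moreover have "(2::nat) ^ m = 2 ^ m' \<longleftrightarrow> m = m'" for m m' by simp
  ultimately have \<gamma>': "\<gamma> = 1 \<or> \<gamma> = 2 \<or> \<gamma> = \<alpha> - 1" by (simp only:)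
  show ?thesis
  proof (cases "4 \<le> \<alpha> \<and> 2 ^ (\<alpha> - 1) dvd q")
    case True
    then have \<alpha>: "4 \<le> \<alpha>" "\<gamma> = \<alpha> - 1" using \<gamma>' two_pow[of "\<alpha> - 1"] by auto
    define \<beta> where "\<beta> = \<alpha> - 1"
    have \<beta>: "3 \<le> \<beta>" "\<gamma> - 1 = \<beta> - 1" "\<alpha> - 1 = \<beta>" using \<alpha> by (simp_all add: \<beta>_def)
    define P where "P = (2::int) ^ (\<beta> - 1)"
    have P: "2 ^ \<beta> = 2 * P" "P > 0" using \<beta>(1) unfolding P_def by (cases \<beta>) auto
    \<comment> \<open>In this case the condition at 2 reads \<open>k = 1\<close> modulo
      \<open>2^(\<beta>-1)\<close>. Its two classes modulo \<open>2^\<beta>\<close>, those of 1 and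
      of \<open>1 + 2^(\<beta>-1)\<close>, are realized by \<open>k\<^sub>1\<close> and
      \<open>k\<^sub>2\<close>.\<close>
    have tpe: "two_part_exponent (\<alpha> - 1) (\<gamma> - 1) k \<longleftrightarrow> P dvd k - 1" for k
      unfolding \<beta>(2,3) P_def by (rule two_part_exponent_pred[OF \<beta>(1)])
    obtain k\<^sub>1 where k1: "int u dvd k\<^sub>1 - 1" "int w dvd k\<^sub>1 + 1" "2 ^ \<beta> dvd k\<^sub>1 - 1"
      using chinese_remainder_exponent[OF uw] by blast
    obtain k\<^sub>2 where k2: "int u dvd k\<^sub>2 - 1" "int w dvd k\<^sub>2 + 1" "2 ^ \<beta> dvd k\<^sub>2 - (1 + P)"
      using chinese_remainder_exponent[OF uw] by blast
    obtain s1 where s1: "k\<^sub>1 - 1 = 2 * P * s1" using k1(3) unfolding P(1) ..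
    obtain s2 where s2: "k\<^sub>2 - (1 + P) = 2 * P * s2" using k2(3) unfolding P(1) ..
    have "k\<^sub>1 - 1 = P * (2 * s1)" using s1 by simp
    then have "P dvd k\<^sub>1 - 1" by (rule dvdI)
    then have a1: "admissible_exponent p q k\<^sub>1" using k1 by (simp only: adm tpe)
    have "k\<^sub>2 - 1 = P * (1 + 2 * s2)" using s2 by (simp add: algebra_simps)
    then have "P dvd k\<^sub>2 - 1" by (rule dvdI)
    then have a2: "admissible_exponent p q k\<^sub>2" using k2 by (simp only: adm tpe)
    have "\<not> int p dvd 2 * (k\<^sub>1 - k\<^sub>2)"
    proof
      assume "int p dvd 2 * (k\<^sub>1 - k\<^sub>2)"
      moreover have "int p = 2 * ((2 * P) * (int u * int w))" using p \<beta>(3) P(1) by simp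
      ultimately have "2 * ((2 * P) * (int u * int w)) dvd 2 * (k\<^sub>1 - k\<^sub>2)" by (simp only:)
      then have "(2 * P) * (int u * int w) dvd k\<^sub>1 - k\<^sub>2" by (simp only: dvd_mult_cancel_left) simp
      then have "2 * P dvd k\<^sub>1 - k\<^sub>2" by (rule dvd_mult_left)
      also have "k\<^sub>1 - k\<^sub>2 = P * (2 * s1 - 2 * s2 - 1)" using s1 s2 by (simp add: algebra_simps)
      finally have "P * 2 dvd P * (2 * s1 - 2 * s2 - 1)" by (simp only: mult.commute)
      then have "2 dvd 2 * s1 - 2 * s2 - 1" using P(2) by (simp only: dvd_mult_cancel_left) simp
      then show False by presburger
    qed
    moreover have "int p dvd 2 * (k - k\<^sub>1) \<or> int p dvd 2 * (k - k\<^sub>2)" if k: "admissible_exponent p q k" for k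
    proof -
      have "P dvd k - 1" using k by (simp only: adm tpe)
      then obtain s where s: "k - 1 = P * s" ..
      \<comment> \<open>The parity of \<open>s\<close> tells which of the two classes modulo
        \<open>2^\<beta>\<close> contains \<open>k\<close>.\<close>
      show ?thesis
      proof (cases "even s")
        case True
        then obtain t where "s = 2 * t" ..
        then have "k - k\<^sub>1 = 2 * P * (t - s1)" using s s1 by (simp add: algebra_simps)
        then show ?thesis using congruent[OF k a1] \<beta>(3) P(1) by simp
      next
        case False
        then obtain t where "s = 2 * t + 1" by (rule oddE)
        then have "k - k\<^sub>2 = 2 * P * (t - s2)" using s s2 by (simp add: algebra_simps)
        then show ?thesis using congruent[OF k a2] \<beta>(3) P(1) by simp
      qed
    qed
    ultimately show ?thesis using True a1 a2 unfolding \<alpha>_def by auto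
  next
    case False
    \<comment> \<open>In the remaining cases the order at 2 is 1 or 2, and the condition there is a
      single class: that of \<open>-1\<close>, respectively of
      \<open>2^(\<alpha>-2) - 1\<close>.\<close>
    have "\<exists>c. \<forall>k. two_part_exponent (\<alpha> - 1) (\<gamma> - 1) k \<longleftrightarrow> 2 ^ (\<alpha> - 1) dvd k - c"
    proof (cases "\<gamma> = 1")
      case True
      then show ?thesis by (intro exI[of _ "-1"]) (simp add: two_part_exponent_0)
    next
      case g1: False
      have "\<gamma> = 2"
      proof (rule ccontr)
        assume "\<gamma> \<noteq> 2"
        then have "\<gamma> = \<alpha> - 1" "\<gamma> \<ge> 3" using \<gamma> \<gamma>' g1 by auto
        then show False using False two_pow[of "\<alpha> - 1"] by auto
      qed
      then have "4 dvd q" using two_pow[of 2] by simp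
      \<comment> \<open>For \<open>\<alpha> = 2\<close> the modulus at 2 would be 2, where order 2
        makes \<open>k\<close> even while \<open>k^2 = 1\<close> makes it odd.\<close>
      then have "\<alpha> \<noteq> 2" using excl unfolding \<alpha>_def by simp
      then have "2 \<le> \<alpha> - 1" using \<gamma>(2) \<open>\<gamma> = 2\<close> by simp
      from two_part_exponent_1[OF this] \<open>\<gamma> = 2\<close> show ?thesis by auto
    qed
    then obtain c where c: "\<And>k. two_part_exponent (\<alpha> - 1) (\<gamma> - 1) k \<longleftrightarrow> 2 ^ (\<alpha> - 1) dvd k - c" by blast
    obtain k\<^sub>1 where k1: "int u dvd k\<^sub>1 - 1" "int w dvd k\<^sub>1 + 1" "2 ^ (\<alpha> - 1) dvd k\<^sub>1 - c"
      using chinese_remainder_exponent[OF uw] by blast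
    then have a1: "admissible_exponent p q k\<^sub>1" by (simp only: adm c)
    have "int p dvd 2 * (k - k\<^sub>1)" if k: "admissible_exponent p q k" for k
    proof (rule congruent[OF k a1])
      have "2 ^ (\<alpha> - 1) dvd k - c" using k by (simp only: adm c)
      from dvd_diff[OF this k1(3)] show "2 ^ (\<alpha> - 1) dvd k - k\<^sub>1" by simp
    qed
    then show ?thesis using False a1 unfolding \<alpha>_def by auto
  qed
qed

text \<open>The conditions on \<open>k\<close> are read locally. At an odd prime \<open>r\<close>
  either \<open>k + 1\<close> is invertible, and its order contains the whole power of
  \<open>r\<close> in \<open>p\<close>, or \<open>r\<close> divides \<open>k + 1\<close>, hence not
  \<open>k - 1\<close>, and \<open>k^2 = 1\<close> makes \<open>k + 1\<close> vanish modulo that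
  whole power.\<close>

theorem classified_typeI:
  assumes "even p" "even q" "4 \<le> q" "q < p" and adm: "admissible_exponent p q k"
  shows "classified_type p q"
proof -
  obtain n h where p: "p = 2 * n" and q: "q = 2 * h" using assms(1,2) by (meson evenE)
  have pos: "n > 0" "h > 0" using assms p q by auto
  have sq: "int n dvd (k - 1) * (k + 1)" and iff: "\<And>j. int n dvd (1 + k) * j \<longleftrightarrow> int h dvd j"
    using adm unfolding p q admissible_exponent_double by auto
  have hn: "h dvd n" using iff[of "int n"] by simp
  have "int n dvd (1 + k) * int h" by (subst iff) simp
  have odd_primes: "gcd q r = 1 \<or> r ^ multiplicity r p dvd q" if "r \<in> prime_factors p - {2}" for r
  proof -
    have r: "prime r" "r dvd p" "r \<noteq> 2" using that by (auto dest: in_prime_factors_imp_dvd in_prime_factors_imp_prime)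
    have "odd r" using primes_dvd_imp_eq[OF two_is_prime_nat r(1)] r(3) by auto
    then have cop2: "coprime r 2" by simp
    define e where "e = multiplicity r p"
    have "r ^ e dvd 2 * n" unfolding e_def p[symmetric] by (rule multiplicity_dvd)
    then have en: "r ^ e dvd n" using cop2 by (simp add: coprime_dvd_mult_right_iff)
    have e: "e > 0" unfolding e_def using r pos p by (simp add: prime_multiplicity_gt_zero_iff)
    obtain m where m: "n = r ^ e * m" using en ..
    have rm: "\<not> r dvd m"
    proof
      assume "r dvd m"
      then have "r ^ Suc e dvd p" unfolding p m by (auto simp: mult_ac)
      then have "Suc e \<le> multiplicity r p" using pos p r(1) by (subst (asm) power_dvd_iff_le_multiplicity) auto
      then show False by (simp add: e_def)
    qed
    have pr: "prime (int r)" using r(1) by simp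
    show ?thesis
    proof (cases "int r dvd k + 1")
      case True
      have "\<not> int r dvd k - 1"
      proof
        assume "int r dvd k - 1"
        then have "int r dvd (k + 1) - (k - 1)" using True by (rule dvd_diff[rotated])
        then have "int r dvd int 2" by simp
        then have "r dvd 2" by (simp only: int_dvd_int_iff)
        then show False using r(1,3) by (simp add: primes_dvd_imp_eq)
      qed
      then have "coprime (int r ^ e) (k - 1)" using pr by (simp add: prime_imp_coprime)
      moreover have "int r ^ e dvd (k - 1) * (k + 1)" using sq m by (metis dvd_mult_left of_nat_mult of_nat_power)
      ultimately have "int r ^ e dvd 1 + k" by (simp add: coprime_dvd_mult_right_iff add.commute)
      \<comment> \<open>The cofactor \<open>m\<close> of the power of \<open>r\<close> annihilates
        \<open>1 + k\<close>, so the order \<open>h\<close> divides \<open>m\<close> and is prime to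
        \<open>r\<close>.\<close>
      then have "int n dvd (1 + k) * int m" unfolding m by (simp add: mult_dvd_mono)
      then have "h dvd m" by (simp add: iff)
      then have "\<not> r dvd h" using rm by (meson dvd_trans)
      then have "\<not> r dvd q" using cop2 unfolding q by (simp add: coprime_dvd_mult_right_iff)
      then have "coprime r q" using r(1) by (simp add: prime_imp_coprime)
      then show ?thesis by (simp add: coprime_iff_gcd_eq_1 gcd.commute)
    next
      case False
      then have "coprime (int r ^ e) (1 + k)" using pr by (simp add: prime_imp_coprime add.commute)
      moreover have "int r ^ e dvd (1 + k) * int h"
        using \<open>int n dvd (1 + k) * int h\<close> m by (metis dvd_mult_left of_nat_mult of_nat_power)
      ultimately have "int r ^ e dvd int h" by (simp add: coprime_dvd_mult_right_iff)
      then have "r ^ e dvd h" by (metis int_dvd_int_iff of_nat_power)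
      then show ?thesis unfolding q e_def[symmetric] by simp
    qed
  qed
  have two_part: "(2::nat) ^ multiplicity 2 q \<in> {2, 4, 2 ^ (multiplicity 2 p - 1)}"
  proof -
    define \<beta> d where "\<beta> = multiplicity 2 n" and "d = multiplicity 2 h"
    have mp: "multiplicity 2 p = Suc \<beta>" and mq: "multiplicity 2 q = Suc d"
      unfolding p q \<beta>_def d_def using pos by (simp_all add: multiplicity_times_same)
    have dle: "2 ^ m dvd h \<longleftrightarrow> m \<le> d" "2 ^ m dvd n \<longleftrightarrow> m \<le> \<beta>" for m
      unfolding d_def \<beta>_def using pos by (subst power_dvd_iff_le_multiplicity; auto)+
    show ?thesis
    proof (cases "d = 0")
      case True then show ?thesis by (simp add: mq)
    next
      case False
      then have "even h" using dle(1)[of 1] by simp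
      then have "even n" using hn by (rule dvd_trans)
      then obtain n2 where n2: "n = 2 * n2" ..
      have "odd k"
      proof
        assume "even k"
        moreover have "2 dvd (k - 1) * (k + 1)" using sq \<open>even n\<close> by (metis dvd_trans int_dvd_int_iff of_nat_numeral)
        ultimately show False by simp
      qed
      then obtain t where t: "k = 2 * t + 1" by (rule oddE)
      have k1: "k - 1 = 2 * t" "k + 1 = 2 * (t + 1)" "1 + k = 2 * (t + 1)" using t by simp_all
      \<comment> \<open>Exactly one of \<open>t\<close> and \<open>t + 1\<close> is odd. If it is
        \<open>t + 1\<close>, then \<open>k + 1\<close> is twice an odd number and \<open>h\<close>
        has 2-part \<open>2^(\<beta>-1)\<close>. If it is \<open>t\<close>, then
        \<open>k^2 = 1\<close> makes \<open>2^\<beta>\<close> divide \<open>2(k + 1)\<close>, so the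
        2-part of \<open>h\<close> is at most 2.\<close>
      show ?thesis
      proof (cases "even t")
        case True
        have "int n dvd (1 + k) * int n2" by (simp add: n2 k1)
        then have "h dvd n2" by (simp add: iff)
        then have "2 ^ Suc d dvd n" using dle(1)[of d] n2 by (simp add: mult_dvd_mono dvd_trans)
        then have sd: "Suc d \<le> \<beta>" by (simp only: dle)
        have "2 ^ \<beta> dvd n" by (simp add: dle)
        then have "2 ^ \<beta> dvd 2 * ((t + 1) * int h)"
          using \<open>int n dvd (1 + k) * int h\<close> unfolding k1 mult.assoc
          by (metis dvd_trans int_dvd_int_iff of_nat_numeral of_nat_power)
        then have "2 * 2 ^ (\<beta> - 1) dvd 2 * ((t + 1) * int h)" using \<open>Suc d \<le> \<beta>\<close> by (cases \<beta>) auto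
        then have "2 ^ (\<beta> - 1) dvd (t + 1) * int h" by (simp only: dvd_mult_cancel_left) simp
        moreover have "coprime (2 ^ (\<beta> - 1)) (t + 1)" using True by simp
        ultimately have "2 ^ (\<beta> - 1) dvd int h" by (simp only: coprime_dvd_mult_right_iff)
        then have "2 ^ (\<beta> - 1) dvd h" by (metis int_dvd_int_iff of_nat_numeral of_nat_power)
        then have "\<beta> - 1 \<le> d" by (simp add: dle)
        then have "Suc d = \<beta>" using sd by simp
        then show ?thesis by (simp add: mp mq)
      next
        case odd: False
        obtain m where m: "n = 2 ^ \<beta> * m" using dle(2)[of \<beta>] by (auto elim: dvdE)
        have "odd m"
        proof
          assume "even m"
          then have "2 ^ Suc \<beta> dvd n" unfolding m by (auto simp: mult_ac)
          then have "Suc \<beta> \<le> \<beta>" by (simp only: dle)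
          then show False by simp
        qed
        have "int (2 ^ \<beta>) dvd (k - 1) * (k + 1)" using sq m by (metis dvd_mult_left of_nat_mult)
        then have "2 ^ \<beta> dvd t * (4 * (t + 1))" by (simp add: k1 algebra_simps)
        moreover have "coprime (2 ^ \<beta>) t" using odd by simp
        ultimately have "2 ^ \<beta> dvd 4 * (t + 1)" by (simp only: coprime_dvd_mult_right_iff)
        then have "2 ^ \<beta> * int m dvd (4 * (t + 1)) * int m" by (rule mult_dvd_mono) simp
        then have "int n dvd (1 + k) * int (2 * m)" unfolding k1 m by (simp add: mult_ac)
        then have "h dvd 2 * m" by (simp only: iff int_dvd_int_iff)
        then have "2 ^ d dvd 2 * m" using dle(1)[of d] by (meson dvd_trans le_refl)
        then have "d \<le> 1" using \<open>odd m\<close>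
        proof -
          assume "2 ^ d dvd 2 * m"
          have "\<not> 2 ^ 2 dvd 2 * m" using \<open>odd m\<close> by simp
          then show "d \<le> 1" using \<open>2 ^ d dvd 2 * m\<close> by (metis dvd_trans le_imp_power_dvd not_less_eq_eq numeral_2_eq_2 One_nat_def)
        qed
        then have "d = 1" using False by simp
        then show ?thesis by (simp add: mq)
      qed
    qed
  qed
  show ?thesis
    unfolding classified_type_def using assms(1-4) two_part odd_primes hn by (simp add: p q)
qed

section \<open>Flags of a finite polyhedron\<close>

lemma card_two_unique:
  "card S = 2 \<Longrightarrow> x \<in> S \<Longrightarrow> y \<in> S \<Longrightarrow> z \<in> S \<Longrightarrow> x \<noteq> y \<Longrightarrow> x \<noteq> z \<Longrightarrow> y = z"
  by (auto simp: card_2_iff)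

lemma Field_incidence_order:
  "multigraph G \<Longrightarrow> Field (incidence_order G) = Inl ` verts G \<union> Inr ` edges G"
proof
  show "Inl ` verts G \<union> Inr ` edges G \<subseteq> Field (incidence_order G)"
    by (auto simp: incidence_order_def intro!: FieldI1[of x x for x])
qed (auto simp: incidence_order_def Field_def)

text \<open>Since every element of \<open>X\<close> is strictly below one of \<open>Y\<close> and
  conversely, the isomorphism must carry \<open>X\<close> onto the vertices and \<open>Y\<close>
  onto the edges. Connectedness is rendered as a closure principle, the form in which a property is
  later spread around a vertex or a face.\<close>

lemma polygonalD:
  assumes poly: "polygonal r" and Fr: "Field r = X \<union> Y" and disj: "X \<inter> Y = {}"
    and up: "\<And>x. x \<in> X \<Longrightarrow> \<exists>y\<in>Y. (x, y) \<in> r" and down: "\<And>y. y \<in> Y \<Longrightarrow> \<exists>x\<in>X. (x, y) \<in> r"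
  shows "y \<in> Y \<Longrightarrow> card {x\<in>X. (x, y) \<in> r} = 2"
    and "x \<in> X \<Longrightarrow> card {y\<in>Y. (x, y) \<in> r} = 2"
    and "S \<subseteq> X \<Longrightarrow> s \<in> S \<Longrightarrow>
      (\<And>x x' y. x \<in> S \<Longrightarrow> x' \<in> X \<Longrightarrow> y \<in> Y \<Longrightarrow> (x, y) \<in> r \<Longrightarrow> (x', y) \<in> r \<Longrightarrow> x' \<in> S) \<Longrightarrow> S = X"
proof -
  obtain G :: "('a, 'a) multigraph" and f where mg: "multigraph G" and cg: "connected_graph G"
    and tr: "two_regular G" and iso: "order_iso r (incidence_order G) f"
    using poly unfolding polygonal_def by blast
  have bij: "bij_betw f (X \<union> Y) (Inl ` verts G \<union> Inr ` edges G)"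
    and le: "\<And>x y. x \<in> X \<union> Y \<Longrightarrow> y \<in> X \<union> Y \<Longrightarrow> (x, y) \<in> r \<longleftrightarrow> (f x, f y) \<in> incidence_order G"
    using iso Fr Field_incidence_order[OF mg] unfolding order_iso_def by auto
  have inj: "inj_on f (X \<union> Y)" and im: "f ` (X \<union> Y) = Inl ` verts G \<union> Inr ` edges G"
    using bij by (auto simp: bij_betw_def)
  have strict: "\<exists>v e. f x = Inl v \<and> f y = Inr e \<and> v \<in> verts G \<and> e \<in> edges G \<and> v \<in> ends G e"
    if "x \<in> X" "y \<in> Y" "(x, y) \<in> r" for x y
  proof -
    have "x \<noteq> y" using that disj by auto
    then have "f x \<noteq> f y" using inj that by (meson UnI1 UnI2 inj_onD)
    then show ?thesis using le[of x y] that by (auto simp: incidence_order_def)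
  qed
  have fX: "\<exists>v\<in>verts G. f x = Inl v" if "x \<in> X" for x using up[OF that] strict[OF that] by blast
  have fY: "\<exists>e\<in>edges G. f y = Inr e" if "y \<in> Y" for y using down[OF that] strict that by blast
  have imX: "f ` X = Inl ` verts G"
  proof
    show "Inl ` verts G \<subseteq> f ` X"
    proof
      fix z :: "'a + 'a" assume "z \<in> Inl ` verts G"
      then obtain x where x: "x \<in> X \<union> Y" "z = f x" using im by blast
      have "x \<notin> Y" using fY[of x] \<open>z \<in> Inl ` verts G\<close> x(2) by force
      then show "z \<in> f ` X" using x by blast
    qed
  qed (use fX in auto)
  have imY: "f ` Y = Inr ` edges G"
  proof
    show "Inr ` edges G \<subseteq> f ` Y"
    proof
      fix z :: "'a + 'a" assume "z \<in> Inr ` edges G"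
      then obtain x where x: "x \<in> X \<union> Y" "z = f x" using im by blast
      have "x \<notin> X" using fX[of x] \<open>z \<in> Inr ` edges G\<close> x(2) by force
      then show "z \<in> f ` Y" using x by blast
    qed
  qed (use fY in auto)
  have inc: "(x, y) \<in> r \<longleftrightarrow> v \<in> ends G e"
    if "x \<in> X" "y \<in> Y" "f x = Inl v" "f y = Inr e" for x y v e
  proof -
    have "v \<in> verts G" "e \<in> edges G" using fX[OF that(1)] fY[OF that(2)] that by auto
    then show ?thesis using le[of x y] that by (auto simp: incidence_order_def)
  qed
  { fix y assume y: "y \<in> Y"
    obtain e where e: "e \<in> edges G" "f y = Inr e" using fY[OF y] by blast
    have "f ` {x\<in>X. (x, y) \<in> r} = Inl ` ends G e"
    proof
      show "f ` {x\<in>X. (x, y) \<in> r} \<subseteq> Inl ` ends G e" using inc[OF _ y _ e(2)] fX by fastforce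
      show "Inl ` ends G e \<subseteq> f ` {x\<in>X. (x, y) \<in> r}"
      proof
        fix z assume "z \<in> (Inl ` ends G e :: ('a + 'a) set)"
        then obtain v where v: "v \<in> ends G e" "z = Inl v" by blast
        then have "v \<in> verts G" using mg e by (auto simp: multigraph_def)
        then obtain x where "x \<in> X" "f x = Inl v" using imX by (metis (no_types, lifting) image_iff)
        then show "z \<in> f ` {x\<in>X. (x, y) \<in> r}" using inc[OF _ y _ e(2)] v by force
      qed
    qed
    moreover have "inj_on f {x\<in>X. (x, y) \<in> r}" by (rule inj_on_subset[OF inj]) auto
    moreover have "card (Inl ` ends G e :: ('a + 'a) set) = 2"
      using mg e by (simp add: card_image multigraph_def)
    ultimately show "card {x\<in>X. (x, y) \<in> r} = 2" using card_image by fastforce }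
  { fix x assume x: "x \<in> X"
    obtain v where v: "v \<in> verts G" "f x = Inl v" using fX[OF x] by blast
    have "f ` {y\<in>Y. (x, y) \<in> r} = Inr ` {e\<in>edges G. v \<in> ends G e}"
    proof
      show "f ` {y\<in>Y. (x, y) \<in> r} \<subseteq> Inr ` {e\<in>edges G. v \<in> ends G e}" using inc[OF x _ v(2)] fY by fastforce
      show "Inr ` {e\<in>edges G. v \<in> ends G e} \<subseteq> f ` {y\<in>Y. (x, y) \<in> r}"
      proof
        fix z assume "z \<in> (Inr ` {e\<in>edges G. v \<in> ends G e} :: ('a + 'a) set)"
        then obtain e where e: "e \<in> edges G" "v \<in> ends G e" "z = Inr e" by blast
        then obtain y where "y \<in> Y" "f y = Inr e" using imY by (metis (no_types, lifting) image_iff)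
        then show "z \<in> f ` {y\<in>Y. (x, y) \<in> r}" using inc[OF x _ v(2)] e by force
      qed
    qed
    moreover have "inj_on f {y\<in>Y. (x, y) \<in> r}" by (rule inj_on_subset[OF inj]) auto
    moreover have "card (Inr ` {e\<in>edges G. v \<in> ends G e} :: ('a + 'a) set) = 2"
      using tr v by (simp add: card_image two_regular_def)
    ultimately show "card {y\<in>Y. (x, y) \<in> r} = 2" using card_image by fastforce }
  { assume S: "S \<subseteq> X" "s \<in> S"
      and closed: "\<And>x x' y. x \<in> S \<Longrightarrow> x' \<in> X \<Longrightarrow> y \<in> Y \<Longrightarrow> (x, y) \<in> r \<Longrightarrow> (x', y) \<in> r \<Longrightarrow> x' \<in> S"
    obtain u where u: "u \<in> verts G" "f s = Inl u" using fX S by blast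
    have reach: "v \<in> verts G \<longrightarrow> (\<forall>x\<in>X. f x = Inl v \<longrightarrow> x \<in> S)"
      if "(u, v) \<in> {(x, y). \<exists>e\<in>edges G. {x, y} \<subseteq> ends G e}\<^sup>*" for v
      using that
    proof (induction rule: rtrancl_induct)
      case base
      show ?case using inj S u by (metis UnI1 inj_onD subsetD)
    next
      case (step v w)
      then obtain e where e: "e \<in> edges G" "v \<in> ends G e" "w \<in> ends G e" by auto
      then have vw: "v \<in> verts G" "w \<in> verts G" using mg by (auto simp: multigraph_def)
      obtain x where x: "x \<in> X" "f x = Inl v" using imX vw by (metis (no_types, lifting) image_iff)
      obtain y where y: "y \<in> Y" "f y = Inr e" using imY e by (metis (no_types, lifting) image_iff)
      have "x \<in> S" using step.IH vw x by blast
      then show ?case using closed[OF _ _ y(1)] inc[OF _ y(1) _ y(2)] e x by blast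
    qed
    show "S = X"
    proof
      show "X \<subseteq> S"
      proof
        fix x assume x: "x \<in> X"
        obtain v where v: "v \<in> verts G" "f x = Inl v" using fX[OF x] by blast
        have "(u, v) \<in> {(x, y). \<exists>e\<in>edges G. {x, y} \<subseteq> ends G e}\<^sup>*"
          using cg u v unfolding connected_graph_def by blast
        from reach[OF this] v x show "x \<in> S" by blast
      qed
    qed (rule S) }
qed

text \<open>The poset serves as its own graph, with the lower level as vertices and the upper level
  as edges.\<close>

lemma polygonalI:
  assumes Fr: "Field r = X \<union> Y" and disj: "X \<inter> Y = {}" and refl: "\<And>x. x \<in> X \<union> Y \<Longrightarrow> (x, x) \<in> r"
    and strict: "\<And>x y. (x, y) \<in> r \<Longrightarrow> x \<noteq> y \<Longrightarrow> x \<in> X \<and> y \<in> Y"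
    and cY: "\<And>y. y \<in> Y \<Longrightarrow> card {x\<in>X. (x, y) \<in> r} = 2"
    and cX: "\<And>x. x \<in> X \<Longrightarrow> card {y\<in>Y. (x, y) \<in> r} = 2"
    and conn: "\<And>x x'. x \<in> X \<Longrightarrow> x' \<in> X \<Longrightarrow> (x, x') \<in> {(x, x'). x \<in> X \<and> x' \<in> X \<and> (\<exists>y\<in>Y. (x, y) \<in> r \<and> (x', y) \<in> r)}\<^sup>*"
  shows "polygonal r"
proof -
  define G where "G = \<lparr>verts = X, edges = Y, ends = (\<lambda>y. {x\<in>X. (x, y) \<in> r})\<rparr>"
  define f where "f z = (if z \<in> X then Inl z else Inr z :: 'a + 'a)" for z
  have mg: "multigraph G" using cY by (auto simp: G_def multigraph_def)
  have "{(x, x'). x \<in> X \<and> x' \<in> X \<and> (\<exists>y\<in>Y. (x, y) \<in> r \<and> (x', y) \<in> r)}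
      \<subseteq> {(x, y). \<exists>e\<in>edges G. {x, y} \<subseteq> ends G e}" by (auto simp: G_def)
  then have "connected_graph G" using conn unfolding connected_graph_def
    by (metis (no_types, lifting) G_def multigraph.select_convs(1) rtrancl_mono subsetD)
  moreover have "two_regular G" using cX by (auto simp: two_regular_def G_def cong: conj_cong)
  moreover have "order_iso r (incidence_order G) f" unfolding order_iso_def Field_incidence_order[OF mg] Fr
  proof
    show "bij_betw f (X \<union> Y) (Inl ` verts G \<union> Inr ` edges G)"
      using disj by (auto simp: bij_betw_def inj_on_def f_def G_def image_def)
    show "\<forall>x\<in>X \<union> Y. \<forall>y\<in>X \<union> Y. (x, y) \<in> r \<longleftrightarrow> (f x, f y) \<in> incidence_order G"
    proof (intro ballI)
      fix x y assume xy: "x \<in> X \<union> Y" "y \<in> X \<union> Y"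
      have "(f x, f y) \<in> incidence_order G \<longleftrightarrow> x = y \<or> x \<in> X \<and> y \<in> Y \<and> (x, y) \<in> r"
        using xy disj by (cases "x \<in> X"; cases "y \<in> X") (auto simp: f_def G_def incidence_order_def)
      then show "(x, y) \<in> r \<longleftrightarrow> (f x, f y) \<in> incidence_order G"
        using strict[of x y] refl[of x] xy by metis
    qed
  qed
  ultimately show ?thesis using mg unfolding polygonal_def by blast
qed

locale finite_polyhedron =
  fixes P :: "'a ranked_poset"
  assumes polyhedron: "polyhedron P" and finite_Field: "finite (Field (leq P))"
begin

abbreviation le :: "'a \<Rightarrow> 'a \<Rightarrow> bool" (infix "\<sqsubseteq>" 50) where "x \<sqsubseteq> y \<equiv> (x, y) \<in> leq P"
abbreviation "V \<equiv> elems P 0"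
abbreviation "E \<equiv> elems P 1"
abbreviation "F \<equiv> elems P 2"

lemma
  shows flags_ranks: "C \<in> flags P \<Longrightarrow> \<exists>v\<in>V. \<exists>e\<in>E. \<exists>f\<in>F. C = {v, e, f}"
    and edge_cards: "e \<in> E \<Longrightarrow> card {v\<in>V. incident P v e} = 2 \<and> card {f\<in>F. incident P e f} = 2"
    and graph_connected: "connected_graph (vertex_edge_graph P)"
    and vertex_figure_polygonal: "v \<in> V \<Longrightarrow> polygonal (Restr (leq P) {G. v \<sqsubseteq> G \<and> G \<noteq> v})"
    and face_polygonal: "f \<in> F \<Longrightarrow> polygonal (Restr (leq P) {G. G \<sqsubseteq> f \<and> G \<noteq> f})"
  using polyhedron by (simp_all add: polyhedron_def)

lemma partial_order: "Partial_order (leq P)"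
  and rank_less: "x \<sqsubseteq> y \<Longrightarrow> x \<noteq> y \<Longrightarrow> rank P x < rank P y"
  using polyhedron by (auto simp: polyhedron_def)

lemma le_refl: "x \<in> Field (leq P) \<Longrightarrow> x \<sqsubseteq> x"
  using partial_order by (auto simp: partial_order_on_def preorder_on_def refl_on_def)

lemma le_trans: "x \<sqsubseteq> y \<Longrightarrow> y \<sqsubseteq> z \<Longrightarrow> x \<sqsubseteq> z"
  using partial_order unfolding partial_order_on_def preorder_on_def by (meson transE)

lemma Field_cases: "x \<in> Field (leq P) \<Longrightarrow> x \<in> V \<or> x \<in> E \<or> x \<in> F"
  using polyhedron by (auto simp: polyhedron_def elems_def)

lemma elems_Field: "x \<in> elems P i \<Longrightarrow> x \<in> Field (leq P)"
  by (simp add: elems_def)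

lemma same_rank: "x \<sqsubseteq> y \<Longrightarrow> rank P x = rank P y \<Longrightarrow> x = y"
  using rank_less by force

lemma incident_rank:
  assumes "x \<in> elems P i" "y \<in> elems P j" "i < j" shows "incident P x y \<longleftrightarrow> x \<sqsubseteq> y"
  using rank_less[of y x] assms unfolding incident_def elems_def by force

definition flag :: "'a \<Rightarrow> 'a \<Rightarrow> 'a \<Rightarrow> bool" where
  "flag v e f \<longleftrightarrow> v \<in> V \<and> e \<in> E \<and> f \<in> F \<and> v \<sqsubseteq> e \<and> e \<sqsubseteq> f"

lemma flag_le: "flag v e f \<Longrightarrow> v \<sqsubseteq> f"
  unfolding flag_def using le_trans by blast

lemma flag_elems: "flag v e f \<Longrightarrow> {v, e, f} \<in> flags P"
proof -
  assume fl: "flag v e f"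
  then have F: "v \<in> Field (leq P)" "e \<in> Field (leq P)" "f \<in> Field (leq P)"
    by (auto simp: flag_def elems_Field)
  have ch: "{v, e, f} \<in> Chains (leq P)"
    using fl flag_le[OF fl] le_refl[OF F(1)] le_refl[OF F(2)] le_refl[OF F(3)] by (auto simp: Chains_def flag_def)
  have "D = {v, e, f}" if D: "D \<in> Chains (leq P)" "{v, e, f} \<subseteq> D" for D
  proof
    show "D \<subseteq> {v, e, f}"
    proof
      fix d assume d: "d \<in> D"
      then have dF: "d \<in> Field (leq P)" using D by (auto simp: Chains_def intro: FieldI1)
      have same: "d = x" if x: "x \<in> {v, e, f}" "rank P x = rank P d" for x
      proof -
        have "x \<in> D" using x D(2) by blast
        then have "x \<sqsubseteq> d \<or> d \<sqsubseteq> x" using D(1) d by (auto simp: Chains_def)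
        then show ?thesis using same_rank x(2) by metis
      qed
      have "rank P v = 0" "rank P e = 1" "rank P f = 2" using fl by (auto simp: flag_def elems_def)
      moreover have "rank P d = 0 \<or> rank P d = 1 \<or> rank P d = 2"
        using Field_cases[OF dF] by (auto simp: elems_def)
      ultimately show "d \<in> {v, e, f}" using same[of v] same[of e] same[of f] by auto
    qed
  qed (rule D)
  then show ?thesis unfolding flags_def using ch by (intro CollectI conjI ballI impI)
qed

lemma flags_eq: "flags P = {{v, e, f} | v e f. flag v e f}"
proof
  show "flags P \<subseteq> {{v, e, f} | v e f. flag v e f}"
  proof
    fix C assume C: "C \<in> flags P"
    then obtain v e f where ve: "v \<in> V" "e \<in> E" "f \<in> F" "C = {v, e, f}"
      using flags_ranks by blast
    have "incident P v e" "incident P e f" using C ve by (auto simp: flags_def Chains_def incident_def)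
    then have "flag v e f" using ve incident_rank[of v 0 e 1] incident_rank[of e 1 f 2] by (auto simp: flag_def)
    then show "C \<in> {{v, e, f} | v e f. flag v e f}" using ve by blast
  qed
qed (use flag_elems in auto)

lemma flag_inj:
  assumes "flag v e f" "flag v' e' f'" "{v, e, f} = {v', e', f'}" shows "v = v'" "e = e'" "f = f'"
proof -
  have r: "rank P v = 0" "rank P e = 1" "rank P f = 2" "rank P v' = 0" "rank P e' = 1" "rank P f' = 2"
    using assms(1,2) by (auto simp: flag_def elems_def)
  have "v \<in> {v', e', f'}" "e \<in> {v', e', f'}" "f \<in> {v', e', f'}" using assms(3) by auto
  then show "v = v'" "e = e'" "f = f'" using r by auto
qed

text \<open>Finiteness gives a maximal chain above \<open>C\<close>, and maximal chains are
  flags.\<close>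

lemma chain_extends:
  assumes "C \<in> Chains (leq P)" obtains v e f where "flag v e f" "C \<subseteq> {v, e, f}"
proof -
  let ?S = "{D \<in> Chains (leq P). C \<subseteq> D}"
  have "?S \<subseteq> Pow (Field (leq P))" by (auto simp: Chains_def intro: FieldI1)
  then have "finite ?S" by (rule finite_subset) (simp add: finite_Field)
  moreover have "?S \<noteq> {}" using assms by auto
  ultimately have "\<exists>D\<in>?S. \<forall>D'\<in>?S. D \<subseteq> D' \<longrightarrow> D = D'" by (rule finite_has_maximal)
  then obtain D where D: "D \<in> ?S" "\<forall>D'\<in>?S. D \<subseteq> D' \<longrightarrow> D = D'" ..
  have "D \<in> flags P" unfolding flags_def
  proof (intro CollectI conjI ballI impI)
    show "D \<in> Chains (leq P)" using D(1) by simp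
    fix D' assume D': "D' \<in> Chains (leq P)" "D \<subseteq> D'"
    have "D' \<in> ?S" using D(1) D' by auto
    from D(2)[rule_format, OF this D'(2)] show "D' = D" by (rule sym)
  qed
  then obtain v e f where "flag v e f" "D = {v, e, f}" unfolding flags_eq by auto
  then show thesis using that D(1) by simp
qed

lemma flag_through:
  assumes "x \<in> Field (leq P)" obtains v e f where "flag v e f" "x = v \<or> x = e \<or> x = f"
  using chain_extends[of "{x}"] le_refl[OF assms] by (auto simp: Chains_def)

lemma flag_through_V: "v \<in> V \<Longrightarrow> \<exists>e f. flag v e f"
  by (rule flag_through[of v]) (auto simp: flag_def elems_def)

lemma flag_through_E: "e \<in> E \<Longrightarrow> \<exists>v f. flag v e f"
  by (rule flag_through[of e]) (auto simp: flag_def elems_def)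

lemma flag_through_F: "f \<in> F \<Longrightarrow> \<exists>v e. flag v e f"
  by (rule flag_through[of f]) (auto simp: flag_def elems_def)

lemma flag_through_VF: 
  assumes "v \<in> V" "f \<in> F" "v \<sqsubseteq> f" shows "\<exists>e. flag v e f"
proof -
  have "{v, f} \<in> Chains (leq P)" using assms le_refl by (auto simp: Chains_def elems_def)
  then obtain v' e' f' where fl: "flag v' e' f'" "{v, f} \<subseteq> {v', e', f'}" by (rule chain_extends)
  have "v = v'" "f = f'" using fl assms by (auto simp: flag_def elems_def)
  then show ?thesis using fl by blast
qed

lemma card_vertices_edge: "e \<in> E \<Longrightarrow> card {v\<in>V. v \<sqsubseteq> e} = 2"
proof -
  assume e: "e \<in> E"
  have "{v\<in>V. incident P v e} = {v\<in>V. v \<sqsubseteq> e}" using incident_rank[of _ 0 e 1] e by auto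
  then show ?thesis using edge_cards[OF e] by simp
qed

lemma card_faces_edge: "e \<in> E \<Longrightarrow> card {f\<in>F. e \<sqsubseteq> f} = 2"
proof -
  assume e: "e \<in> E"
  have "{f\<in>F. incident P e f} = {f\<in>F. e \<sqsubseteq> f}" using incident_rank[of e 1 _ 2] e by auto
  then show ?thesis using edge_cards[OF e] by simp
qed

lemma
  assumes v: "v \<in> V"
  shows card_edges_vertex_face: "f \<in> F \<Longrightarrow> v \<sqsubseteq> f \<Longrightarrow> card {e\<in>E. v \<sqsubseteq> e \<and> e \<sqsubseteq> f} = 2"
    and vertex_figure_connected: "S \<subseteq> {e\<in>E. v \<sqsubseteq> e} \<Longrightarrow> s \<in> S \<Longrightarrow>
      (\<And>e e' f. e \<in> S \<Longrightarrow> flag v e f \<Longrightarrow> flag v e' f \<Longrightarrow> e' \<in> S) \<Longrightarrow> S = {e\<in>E. v \<sqsubseteq> e}"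
proof -
  define r where "r = Restr (leq P) {G. v \<sqsubseteq> G \<and> G \<noteq> v}"
  define X Y where "X = {e\<in>E. v \<sqsubseteq> e}" and "Y = {f\<in>F. v \<sqsubseteq> f}"
  have poly: "polygonal r" unfolding r_def by (rule vertex_figure_polygonal[OF v])
  have r_iff: "(x, y) \<in> r \<longleftrightarrow> x \<sqsubseteq> y" if "x \<in> X" "y \<in> Y" for x y
    using that v by (auto simp: r_def X_def Y_def elems_def)
  have Fr: "Field r = X \<union> Y"
  proof
    show "Field r \<subseteq> X \<union> Y"
    proof
      fix x assume "x \<in> Field r"
      then have x: "v \<sqsubseteq> x" "x \<noteq> v" by (auto simp: r_def Field_def)
      then have "x \<in> Field (leq P)" by (auto intro: FieldI2)
      moreover have "x \<notin> V" using rank_less[OF x(1)] x(2) v by (auto simp: elems_def)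
      ultimately show "x \<in> X \<union> Y" using Field_cases x(1) by (auto simp: X_def Y_def)
    qed
    show "X \<union> Y \<subseteq> Field r"
    proof
      fix x assume x: "x \<in> X \<union> Y"
      then have "(x, x) \<in> r" using le_refl v by (auto simp: r_def X_def Y_def elems_def)
      then show "x \<in> Field r" by (rule FieldI1)
    qed
  qed
  have disj: "X \<inter> Y = {}" by (auto simp: X_def Y_def elems_def)
  have up: "\<exists>y\<in>Y. (x, y) \<in> r" if x: "x \<in> X" for x
  proof -
    obtain v' f where "flag v' x f" using flag_through_E x unfolding X_def by blast
    then have "f \<in> Y" "x \<sqsubseteq> f" using x le_trans by (auto simp: X_def Y_def flag_def)
    then show ?thesis using r_iff x by blast
  qed
  have down: "\<exists>x\<in>X. (x, y) \<in> r" if y: "y \<in> Y" for y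
  proof -
    obtain e where "flag v e y" using flag_through_VF v y unfolding Y_def by blast
    then have "e \<in> X" "e \<sqsubseteq> y" by (auto simp: X_def flag_def)
    then show ?thesis using r_iff y by blast
  qed
  note pd = polygonalD[OF poly Fr disj up down]
  { assume f: "f \<in> F" "v \<sqsubseteq> f"
    then have "f \<in> Y" by (simp add: Y_def)
    have "{e\<in>E. v \<sqsubseteq> e \<and> e \<sqsubseteq> f} = {x \<in> X. (x, f) \<in> r}" using r_iff[OF _ \<open>f \<in> Y\<close>] by (auto simp: X_def)
    then show "card {e\<in>E. v \<sqsubseteq> e \<and> e \<sqsubseteq> f} = 2" using pd(1)[OF _ _ \<open>f \<in> Y\<close>] by simp }
  { assume S: "S \<subseteq> {e\<in>E. v \<sqsubseteq> e}" "s \<in> S"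
      and closed: "\<And>e e' f. e \<in> S \<Longrightarrow> flag v e f \<Longrightarrow> flag v e' f \<Longrightarrow> e' \<in> S"
    have "S = X"
    proof (rule pd(3)[OF _ _ _ S(2)])
      show "S \<subseteq> X" using S by (simp add: X_def)
      fix x x' y assume xy: "x \<in> S" "x' \<in> X" "y \<in> Y" "(x, y) \<in> r" "(x', y) \<in> r"
      moreover from xy have "x \<in> X" using S by (auto simp: X_def)
      ultimately have "flag v x y" "flag v x' y" using v r_iff by (auto simp: flag_def X_def Y_def)
      then show "x' \<in> S" using closed xy by blast
    qed
    then show "S = {e\<in>E. v \<sqsubseteq> e}" by (simp add: X_def) }
qed

lemma
  assumes f: "f \<in> F"
  shows face_connected: "S \<subseteq> {v\<in>V. v \<sqsubseteq> f} \<Longrightarrow> s \<in> S \<Longrightarrow>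
      (\<And>v v' e. v \<in> S \<Longrightarrow> flag v e f \<Longrightarrow> flag v' e f \<Longrightarrow> v' \<in> S) \<Longrightarrow> S = {v\<in>V. v \<sqsubseteq> f}"
proof -
  define r where "r = Restr (leq P) {G. G \<sqsubseteq> f \<and> G \<noteq> f}"
  define X Y where "X = {v\<in>V. v \<sqsubseteq> f}" and "Y = {e\<in>E. e \<sqsubseteq> f}"
  have poly: "polygonal r" unfolding r_def by (rule face_polygonal[OF f])
  have r_iff: "(x, y) \<in> r \<longleftrightarrow> x \<sqsubseteq> y" if "x \<in> X" "y \<in> Y" for x y
    using that f by (auto simp: r_def X_def Y_def elems_def)
  have Fr: "Field r = X \<union> Y"
  proof
    show "Field r \<subseteq> X \<union> Y"
    proof
      fix x assume "x \<in> Field r"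
      then have x: "x \<sqsubseteq> f" "x \<noteq> f" by (auto simp: r_def Field_def)
      then have "x \<in> Field (leq P)" by (auto intro: FieldI1)
      moreover have "x \<notin> F" using rank_less[OF x(1)] x(2) f by (auto simp: elems_def)
      ultimately show "x \<in> X \<union> Y" using Field_cases x(1) by (auto simp: X_def Y_def)
    qed
    show "X \<union> Y \<subseteq> Field r"
    proof
      fix x assume x: "x \<in> X \<union> Y"
      then have "(x, x) \<in> r" using le_refl f by (auto simp: r_def X_def Y_def elems_def)
      then show "x \<in> Field r" by (rule FieldI1)
    qed
  qed
  have disj: "X \<inter> Y = {}" by (auto simp: X_def Y_def elems_def)
  have down: "\<exists>x\<in>X. (x, y) \<in> r" if y: "y \<in> Y" for y
  proof -
    obtain v f' where "flag v y f'" using flag_through_E y unfolding Y_def by blast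
    then have "v \<in> X" "v \<sqsubseteq> y" using y le_trans by (auto simp: X_def Y_def flag_def)
    then show ?thesis using r_iff y by blast
  qed
  have up: "\<exists>y\<in>Y. (x, y) \<in> r" if x: "x \<in> X" for x
  proof -
    obtain e where "flag x e f" using flag_through_VF f x unfolding X_def by blast
    then have "e \<in> Y" "x \<sqsubseteq> e" by (auto simp: Y_def flag_def)
    then show ?thesis using r_iff x by blast
  qed
  note pd = polygonalD[OF poly Fr disj up down]
  { assume S: "S \<subseteq> {v\<in>V. v \<sqsubseteq> f}" "s \<in> S"
      and closed: "\<And>v v' e. v \<in> S \<Longrightarrow> flag v e f \<Longrightarrow> flag v' e f \<Longrightarrow> v' \<in> S"
    have "S = X"
    proof (rule pd(3)[OF _ _ _ S(2)])
      show "S \<subseteq> X" using S by (simp add: X_def)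
      fix x x' y assume xy: "x \<in> S" "x' \<in> X" "y \<in> Y" "(x, y) \<in> r" "(x', y) \<in> r"
      moreover from xy have "x \<in> X" using S by (auto simp: X_def)
      ultimately have "flag x y f" "flag x' y f" using f r_iff by (auto simp: flag_def X_def Y_def)
      then show "x' \<in> S" using closed xy by blast
    qed
    then show "S = {v\<in>V. v \<sqsubseteq> f}" by (simp add: X_def) }
qed

text \<open>Once two elements of a flag are fixed there are exactly two choices for the third. In
  this form the diamond conditions drive every argument that moves between adjacent flags.\<close>

lemma vertex_unique: "flag v e f \<Longrightarrow> flag v' e f \<Longrightarrow> flag v'' e f \<Longrightarrow> v' \<noteq> v \<Longrightarrow> v'' \<noteq> v \<Longrightarrow> v' = v''"
  using card_two_unique[OF card_vertices_edge, of e v v' v''] by (simp add: flag_def)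

lemma edge_unique: "flag v e f \<Longrightarrow> flag v e' f \<Longrightarrow> flag v e'' f \<Longrightarrow> e' \<noteq> e \<Longrightarrow> e'' \<noteq> e \<Longrightarrow> e' = e''"
  using card_two_unique[OF card_edges_vertex_face, of v f e e' e''] flag_le[of v e f] by (simp add: flag_def)

lemma face_unique: "flag v e f \<Longrightarrow> flag v e f' \<Longrightarrow> flag v e f'' \<Longrightarrow> f' \<noteq> f \<Longrightarrow> f'' \<noteq> f \<Longrightarrow> f' = f''"
  using card_two_unique[OF card_faces_edge, of e f f' f''] by (simp add: flag_def)

text \<open>An induction rule for the flags at one vertex. \<open>S\<close> collects the edges all
  of whose flags at \<open>v\<close> satisfy \<open>T\<close>; it is closed under passing to the
  other edge of a face at \<open>v\<close>.\<close>

lemma vertex_flags_connected: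
  assumes base: "flag v e0 f0" "T e0 f0"
    and step1: "\<And>e f e'. flag v e f \<Longrightarrow> flag v e' f \<Longrightarrow> e' \<noteq> e \<Longrightarrow> T e f \<Longrightarrow> T e' f"
    and step2: "\<And>e f f'. flag v e f \<Longrightarrow> flag v e f' \<Longrightarrow> f' \<noteq> f \<Longrightarrow> T e f \<Longrightarrow> T e f'"
    and goal: "flag v e f"
  shows "T e f"
proof -
  define S where "S = {e\<in>E. v \<sqsubseteq> e \<and> (\<forall>f. flag v e f \<longrightarrow> T e f)}"
  have all: "e \<in> S" if "flag v e f" "T e f" for e f
    using that step2 unfolding S_def flag_def by blast
  have "S = {e\<in>E. v \<sqsubseteq> e}"
  proof (rule vertex_figure_connected)
    show "v \<in> V" using base by (simp add: flag_def)
    show "e0 \<in> S" using all base by blast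
    show "e' \<in> S" if h: "e \<in> S" "flag v e f" "flag v e' f" for e e' f
    proof -
      have "T e f" using h(1,2) by (simp add: S_def)
      then have "T e' f" using step1[OF h(2,3)] by (cases "e' = e") simp_all
      then show ?thesis by (rule all[OF h(3)])
    qed
  qed (auto simp: S_def)
  then show ?thesis using goal unfolding S_def flag_def by blast
qed

lemma face_flags_connected:
  assumes base: "flag v0 e0 f" "T v0 e0"
    and step0: "\<And>v e v'. flag v e f \<Longrightarrow> flag v' e f \<Longrightarrow> v' \<noteq> v \<Longrightarrow> T v e \<Longrightarrow> T v' e"
    and step1: "\<And>v e e'. flag v e f \<Longrightarrow> flag v e' f \<Longrightarrow> e' \<noteq> e \<Longrightarrow> T v e \<Longrightarrow> T v e'"
    and goal: "flag v e f"
  shows "T v e"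
proof -
  define S where "S = {v\<in>V. v \<sqsubseteq> f \<and> (\<forall>e. flag v e f \<longrightarrow> T v e)}"
  have all: "v \<in> S" if "flag v e f" "T v e" for v e
    using that step1 flag_le[OF that(1)] unfolding S_def flag_def by blast
  have "S = {v\<in>V. v \<sqsubseteq> f}"
  proof (rule face_connected)
    show "f \<in> F" using base by (simp add: flag_def)
    show "v0 \<in> S" using all base by blast
    show "v' \<in> S" if h: "v \<in> S" "flag v e f" "flag v' e f" for v v' e
    proof -
      have "T v e" using h(1,2) by (simp add: S_def)
      then have "T v' e" using step0[OF h(2,3)] by (cases "v' = v") simp_all
      then show ?thesis by (rule all[OF h(3)])
    qed
  qed (auto simp: S_def)
  then show ?thesis using goal flag_le[OF goal] unfolding S_def flag_def by blast
qed

text \<open>Flag-connectedness as an induction rule: \<open>vertex_flags_connected\<close> spreads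
  \<open>T\<close> over all flags at one vertex, and \<open>step0\<close> takes it to the other end
  of an edge, so that it follows paths in the connected graph.\<close>

lemma flags_connected:
  assumes base: "flag v0 e0 f0" "T v0 e0 f0"
    and step0: "\<And>v e f v'. flag v e f \<Longrightarrow> flag v' e f \<Longrightarrow> v' \<noteq> v \<Longrightarrow> T v e f \<Longrightarrow> T v' e f"
    and step1: "\<And>v e f e'. flag v e f \<Longrightarrow> flag v e' f \<Longrightarrow> e' \<noteq> e \<Longrightarrow> T v e f \<Longrightarrow> T v e' f"
    and step2: "\<And>v e f f'. flag v e f \<Longrightarrow> flag v e f' \<Longrightarrow> f' \<noteq> f \<Longrightarrow> T v e f \<Longrightarrow> T v e f'"
    and goal: "flag v e f"
  shows "T v e f"
proof -
  let ?U = "\<lambda>v. \<forall>e f. flag v e f \<longrightarrow> T v e f"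
  have local: "?U v" if h: "flag v e f" "T v e f" for v e f
  proof (intro allI impI)
    fix e' f' assume "flag v e' f'"
    from h step1 step2 this show "T v e' f'" by (rule vertex_flags_connected)
  qed
  have "v0 \<in> V" "v \<in> V" using base goal by (auto simp: flag_def)
  then have "(v0, v) \<in> {(x, y). \<exists>e\<in>E. {x, y} \<subseteq> ends (vertex_edge_graph P) e}\<^sup>*"
    using graph_connected unfolding connected_graph_def
    by (auto simp: vertex_edge_graph_def)
  then have "?U v"
  proof (induction rule: rtrancl_induct)
    case base
    then show ?case using local assms(1,2) by blast
  next
    case (step v w)
    then obtain e where e: "e \<in> E" "v \<in> V" "w \<in> V" "incident P v e" "incident P w e"
      by (auto simp: vertex_edge_graph_def)
    then have "v \<sqsubseteq> e" "w \<sqsubseteq> e" using incident_rank[of _ 0 e 1] by auto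
    moreover obtain u f where "flag u e f" using flag_through_E e by blast
    ultimately have fl: "flag v e f" "flag w e f" using e by (auto simp: flag_def)
    then have "T w e f" using step.IH step0[of v e f w] by (cases "w = v") auto
    then show ?case using local fl by blast
  qed
  then show ?thesis using goal by blast
qed

end

section \<open>Automorphisms\<close>

context finite_polyhedron begin

abbreviation aut_mult :: "('a \<Rightarrow> 'a) \<Rightarrow> ('a \<Rightarrow> 'a) \<Rightarrow> 'a \<Rightarrow> 'a" (infixl "\<cdot>" 70) where
  "g \<cdot> h \<equiv> g \<otimes>\<^bsub>aut_group P\<^esub> h"

abbreviation Aut :: "('a \<Rightarrow> 'a) set" where "Aut \<equiv> carrier (aut_group P)"

lemma Aut_iff: "g \<in> Aut \<longleftrightarrow> g \<in> Bij (Field (leq P)) \<and>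
    (\<forall>x\<in>Field (leq P). \<forall>y\<in>Field (leq P). x \<sqsubseteq> y \<longleftrightarrow> g x \<sqsubseteq> g y)"
  by (auto simp: aut_group_def order_iso_def Bij_def)

lemma Aut_mult_eq: "g \<in> Aut \<Longrightarrow> h \<in> Aut \<Longrightarrow> g \<cdot> h = compose (Field (leq P)) g h"
  by (simp add: aut_group_def BijGroup_def)

lemma Aut_closed: "g \<in> Aut \<Longrightarrow> x \<in> Field (leq P) \<Longrightarrow> g x \<in> Field (leq P)"
  using Bij_imp_funcset[of g] by (auto simp: Aut_iff)

lemma Aut_inj: "g \<in> Aut \<Longrightarrow> x \<in> Field (leq P) \<Longrightarrow> y \<in> Field (leq P) \<Longrightarrow> g x = g y \<longleftrightarrow> x = y"
  by (auto simp: Aut_iff Bij_def bij_betw_def inj_on_def)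

lemma Aut_mono: "g \<in> Aut \<Longrightarrow> x \<sqsubseteq> y \<Longrightarrow> g x \<sqsubseteq> g y"
  using FieldI1[of x y] FieldI2[of x y] by (auto simp: Aut_iff)

lemma Aut_group: "group (aut_group P)"
proof -
  let ?S = "Field (leq P)"
  interpret Bij: group "BijGroup ?S" by (rule group_BijGroup)
  have "subgroup Aut (BijGroup ?S)"
  proof
    show "Aut \<subseteq> carrier (BijGroup ?S)" by (auto simp: Aut_iff BijGroup_def)
    show "\<one>\<^bsub>BijGroup ?S\<^esub> \<in> Aut" by (auto simp: Aut_iff BijGroup_def id_Bij)
  next
    fix g h assume gh: "g \<in> Aut" "h \<in> Aut"
    then have "g \<otimes>\<^bsub>BijGroup ?S\<^esub> h = compose ?S g h" by (simp add: BijGroup_def Aut_iff)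
    moreover have "compose ?S g h \<in> Bij ?S" using gh by (simp add: Aut_iff compose_Bij)
    moreover have "x \<sqsubseteq> y \<longleftrightarrow> compose ?S g h x \<sqsubseteq> compose ?S g h y" if "x \<in> ?S" "y \<in> ?S" for x y
      using gh that Aut_closed[OF gh(2)] by (simp add: Aut_iff compose_def)
    ultimately show "g \<otimes>\<^bsub>BijGroup ?S\<^esub> h \<in> Aut" by (simp add: Aut_iff)
  next
    fix g assume g: "g \<in> Aut"
    then have gB: "g \<in> Bij ?S" by (simp add: Aut_iff)
    have gi: "g (inv_into ?S g x) = x" "inv_into ?S g x \<in> ?S" if "x \<in> ?S" for x
      using gB that by (auto simp: Bij_def bij_betw_def f_inv_into_f inv_into_into)
    have "x \<sqsubseteq> y \<longleftrightarrow> inv_into ?S g x \<sqsubseteq> inv_into ?S g y" if "x \<in> ?S" "y \<in> ?S" for x y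
      using g gi[OF that(1)] gi[OF that(2)] unfolding Aut_iff by metis
    then show "inv\<^bsub>BijGroup ?S\<^esub> g \<in> Aut"
      using gB by (simp add: Aut_iff inv_BijGroup restrict_inv_into_Bij)
  qed
  then have "group (BijGroup ?S\<lparr>carrier := Aut\<rparr>)" by (rule Bij.subgroup_imp_group)
  then show ?thesis by (simp add: aut_group_def)
qed

sublocale Aut: group "aut_group P" by (rule Aut_group)

lemma Aut_mult_apply: "g \<in> Aut \<Longrightarrow> h \<in> Aut \<Longrightarrow> x \<in> Field (leq P) \<Longrightarrow> (g \<cdot> h) x = g (h x)"
  by (simp add: Aut_mult_eq compose_def)

lemma Aut_one_apply: "x \<in> Field (leq P) \<Longrightarrow> \<one>\<^bsub>aut_group P\<^esub> x = x"
  by (simp add: aut_group_def BijGroup_def)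

lemma finite_Aut: "finite Aut"
proof (rule finite_subset)
  show "Aut \<subseteq> Field (leq P) \<rightarrow>\<^sub>E Field (leq P)"
  proof
    fix g assume "g \<in> Aut"
    then have "g \<in> Bij (Field (leq P))" by (simp only: Aut_iff)
    then show "g \<in> Field (leq P) \<rightarrow>\<^sub>E Field (leq P)"
      unfolding PiE_def by (intro IntI Bij_imp_funcset Bij_imp_extensional)
  qed
qed (simp add: finite_Field finite_PiE)

lemma flag_Field: "flag v e f \<Longrightarrow> v \<in> Field (leq P) \<and> e \<in> Field (leq P) \<and> f \<in> Field (leq P)"
  by (simp add: flag_def elems_def)

text \<open>Order automorphisms preserve ranks because the image of a flag is a strict chain of
  three elements, whose ranks can only be 0, 1 and 2.\<close>

lemma Aut_flag:
  assumes g: "g \<in> Aut" and fl: "flag v e f" shows "flag (g v) (g e) (g f)"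
proof -
  note F = flag_Field[OF fl]
  have le: "v \<sqsubseteq> e" "e \<sqsubseteq> f" "v \<noteq> e" "e \<noteq> f" using fl by (auto simp: flag_def elems_def)
  have "rank P (g v) < rank P (g e)" "rank P (g e) < rank P (g f)"
    using rank_less[OF Aut_mono[OF g le(1)]] rank_less[OF Aut_mono[OF g le(2)]] le F
    by (simp_all add: Aut_inj[OF g])
  moreover have "rank P (g f) \<le> 2"
    using Field_cases[OF Aut_closed[OF g, of f]] F by (auto simp: elems_def)
  ultimately have "rank P (g v) = 0" "rank P (g e) = 1" "rank P (g f) = 2" by auto
  then show ?thesis using F Aut_closed[OF g] Aut_mono[OF g] le by (simp add: flag_def elems_def)
qed

lemma Aut_elems: "g \<in> Aut \<Longrightarrow> x \<in> elems P i \<Longrightarrow> g x \<in> elems P i"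
proof -
  assume g: "g \<in> Aut" and x: "x \<in> elems P i"
  obtain v e f where fl: "flag v e f" "x = v \<or> x = e \<or> x = f"
    using flag_through[OF elems_Field[OF x]] .
  then show ?thesis using Aut_flag[OF g fl(1)] x by (auto simp: flag_def elems_def)
qed

lemma flag_cong: "flag v e f \<Longrightarrow> flag v' e f' \<Longrightarrow> flag v e f'"
  by (simp add: flag_def)

text \<open>Two automorphisms that agree on a flag agree on its adjacent flags, because an adjacent
  flag is unique; flag-connectedness does the rest.\<close>

lemma Aut_eqI:
  assumes g: "g \<in> Aut" "h \<in> Aut" and fl: "flag v e f" and eq: "g v = h v" "g e = h e" "g f = h f"
  shows "g = h"
proof -
  have step: "g u = h u \<and> g d = h d \<and> g c = h c" if "flag u d c" for u d c
  proof (rule flags_connected[OF fl _ _ _ _ that,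
        where T = "\<lambda>v e f. g v = h v \<and> g e = h e \<and> g f = h f"])
    show "g v = h v \<and> g e = h e \<and> g f = h f" using eq by simp
    fix v e f v'
    assume h: "flag v e f" "flag v' e f" "v' \<noteq> v" "g v = h v \<and> g e = h e \<and> g f = h f"
    have "g v' \<noteq> g v" "h v' \<noteq> h v" using h(3) flag_Field[OF h(1)] flag_Field[OF h(2)] by (simp_all add: Aut_inj g)
    moreover have "flag (g v) (g e) (g f)" "flag (g v') (g e) (g f)" "flag (h v') (h e) (h f)"
      using Aut_flag[OF g(1) h(1)] Aut_flag[OF g(1) h(2)] Aut_flag[OF g(2) h(2)] by simp_all
    ultimately show "g v' = h v' \<and> g e = h e \<and> g f = h f"
      using h(4) vertex_unique[of "g v" "g e" "g f" "g v'" "h v'"] by simp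
  next
    fix v e f e'
    assume h: "flag v e f" "flag v e' f" "e' \<noteq> e" "g v = h v \<and> g e = h e \<and> g f = h f"
    have "g e' \<noteq> g e" "h e' \<noteq> h e" using h(3) flag_Field[OF h(1)] flag_Field[OF h(2)] by (simp_all add: Aut_inj g)
    moreover have "flag (g v) (g e) (g f)" "flag (g v) (g e') (g f)" "flag (h v) (h e') (h f)"
      using Aut_flag[OF g(1) h(1)] Aut_flag[OF g(1) h(2)] Aut_flag[OF g(2) h(2)] by simp_all
    ultimately show "g v = h v \<and> g e' = h e' \<and> g f = h f"
      using h(4) edge_unique[of "g v" "g e" "g f" "g e'" "h e'"] by simp
  next
    fix v e f f'
    assume h: "flag v e f" "flag v e f'" "f' \<noteq> f" "g v = h v \<and> g e = h e \<and> g f = h f"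
    have "g f' \<noteq> g f" "h f' \<noteq> h f" using h(3) flag_Field[OF h(1)] flag_Field[OF h(2)] by (simp_all add: Aut_inj g)
    moreover have "flag (g v) (g e) (g f)" "flag (g v) (g e) (g f')" "flag (h v) (h e) (h f')"
      using Aut_flag[OF g(1) h(1)] Aut_flag[OF g(1) h(2)] Aut_flag[OF g(2) h(2)] by simp_all
    ultimately show "g v = h v \<and> g e = h e \<and> g f' = h f'"
      using h(4) face_unique[of "g v" "g e" "g f" "g f'" "h f'"] by simp
  qed
  have "g x = h x" if x: "x \<in> Field (leq P)" for x
  proof -
    obtain v e f where "flag v e f" "x = v \<or> x = e \<or> x = f" using flag_through[OF x] .
    then show ?thesis using step[of v e f] by blast
  qed
  moreover have "g \<in> extensional (Field (leq P))" "h \<in> extensional (Field (leq P))"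
    using g by (auto simp: Aut_iff Bij_def)
  ultimately show ?thesis by (rule extensionalityI[rotated 2])
qed

end

section \<open>Distinguished generators and rotations at a base flag\<close>

locale rooted_polyhedron = finite_polyhedron P for P :: "'a ranked_poset" +
  fixes v\<^sub>0 e\<^sub>0 f\<^sub>0 :: 'a and \<rho>\<^sub>0 \<rho>\<^sub>1 \<rho>\<^sub>2 :: "'a \<Rightarrow> 'a"
  assumes base_flag: "flag v\<^sub>0 e\<^sub>0 f\<^sub>0"
    and \<rho>_Aut [simp]: "\<rho>\<^sub>0 \<in> Aut" "\<rho>\<^sub>1 \<in> Aut" "\<rho>\<^sub>2 \<in> Aut"
    and \<rho>\<^sub>0: "\<rho>\<^sub>0 e\<^sub>0 = e\<^sub>0" "\<rho>\<^sub>0 f\<^sub>0 = f\<^sub>0" "\<rho>\<^sub>0 v\<^sub>0 \<noteq> v\<^sub>0"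
    and \<rho>\<^sub>1: "\<rho>\<^sub>1 v\<^sub>0 = v\<^sub>0" "\<rho>\<^sub>1 f\<^sub>0 = f\<^sub>0" "\<rho>\<^sub>1 e\<^sub>0 \<noteq> e\<^sub>0"
    and \<rho>\<^sub>2: "\<rho>\<^sub>2 v\<^sub>0 = v\<^sub>0" "\<rho>\<^sub>2 e\<^sub>0 = e\<^sub>0" "\<rho>\<^sub>2 f\<^sub>0 \<noteq> f\<^sub>0"
begin

lemma base_Field [simp]: "v\<^sub>0 \<in> Field (leq P)" "e\<^sub>0 \<in> Field (leq P)" "f\<^sub>0 \<in> Field (leq P)"
  using flag_Field[OF base_flag] by auto

lemma base_eqI: "g \<in> Aut \<Longrightarrow> h \<in> Aut \<Longrightarrow> g v\<^sub>0 = h v\<^sub>0 \<Longrightarrow> g e\<^sub>0 = h e\<^sub>0 \<Longrightarrow> g f\<^sub>0 = h f\<^sub>0 \<Longrightarrow> g = h"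
  by (rule Aut_eqI[OF _ _ base_flag])

lemma moved_flags: "flag (\<rho>\<^sub>0 v\<^sub>0) e\<^sub>0 f\<^sub>0" "flag v\<^sub>0 (\<rho>\<^sub>1 e\<^sub>0) f\<^sub>0" "flag v\<^sub>0 e\<^sub>0 (\<rho>\<^sub>2 f\<^sub>0)"
  using Aut_flag[OF \<rho>_Aut(1) base_flag] Aut_flag[OF \<rho>_Aut(2) base_flag] Aut_flag[OF \<rho>_Aut(3) base_flag]
  by (simp_all add: \<rho>\<^sub>0 \<rho>\<^sub>1 \<rho>\<^sub>2)

lemma \<rho>_square: "\<rho>\<^sub>0 \<cdot> \<rho>\<^sub>0 = \<one>\<^bsub>aut_group P\<^esub>" "\<rho>\<^sub>1 \<cdot> \<rho>\<^sub>1 = \<one>\<^bsub>aut_group P\<^esub>" "\<rho>\<^sub>2 \<cdot> \<rho>\<^sub>2 = \<one>\<^bsub>aut_group P\<^esub>"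
proof -
  have "\<rho>\<^sub>0 (\<rho>\<^sub>0 v\<^sub>0) = v\<^sub>0"
  proof (rule vertex_unique[OF moved_flags(1) _ base_flag])
    show "flag (\<rho>\<^sub>0 (\<rho>\<^sub>0 v\<^sub>0)) e\<^sub>0 f\<^sub>0" using Aut_flag[OF \<rho>_Aut(1) moved_flags(1)] by (simp add: \<rho>\<^sub>0)
    show "\<rho>\<^sub>0 (\<rho>\<^sub>0 v\<^sub>0) \<noteq> \<rho>\<^sub>0 v\<^sub>0" using \<rho>\<^sub>0(3) by (simp add: Aut_inj Aut_closed)
  qed (use \<rho>\<^sub>0 in auto)
  then show "\<rho>\<^sub>0 \<cdot> \<rho>\<^sub>0 = \<one>\<^bsub>aut_group P\<^esub>"
    by (intro base_eqI) (simp_all add: Aut_mult_apply Aut_one_apply \<rho>\<^sub>0)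
  have "\<rho>\<^sub>1 (\<rho>\<^sub>1 e\<^sub>0) = e\<^sub>0"
  proof (rule edge_unique[OF moved_flags(2) _ base_flag])
    show "flag v\<^sub>0 (\<rho>\<^sub>1 (\<rho>\<^sub>1 e\<^sub>0)) f\<^sub>0" using Aut_flag[OF \<rho>_Aut(2) moved_flags(2)] by (simp add: \<rho>\<^sub>1)
    show "\<rho>\<^sub>1 (\<rho>\<^sub>1 e\<^sub>0) \<noteq> \<rho>\<^sub>1 e\<^sub>0" using \<rho>\<^sub>1(3) by (simp add: Aut_inj Aut_closed)
  qed (use \<rho>\<^sub>1 in auto)
  then show "\<rho>\<^sub>1 \<cdot> \<rho>\<^sub>1 = \<one>\<^bsub>aut_group P\<^esub>"
    by (intro base_eqI) (simp_all add: Aut_mult_apply Aut_one_apply \<rho>\<^sub>1)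
  have "\<rho>\<^sub>2 (\<rho>\<^sub>2 f\<^sub>0) = f\<^sub>0"
  proof (rule face_unique[OF moved_flags(3) _ base_flag])
    show "flag v\<^sub>0 e\<^sub>0 (\<rho>\<^sub>2 (\<rho>\<^sub>2 f\<^sub>0))" using Aut_flag[OF \<rho>_Aut(3) moved_flags(3)] by (simp add: \<rho>\<^sub>2)
    show "\<rho>\<^sub>2 (\<rho>\<^sub>2 f\<^sub>0) \<noteq> \<rho>\<^sub>2 f\<^sub>0" using \<rho>\<^sub>2(3) by (simp add: Aut_inj Aut_closed)
  qed (use \<rho>\<^sub>2 in auto)
  then show "\<rho>\<^sub>2 \<cdot> \<rho>\<^sub>2 = \<one>\<^bsub>aut_group P\<^esub>"
    by (intro base_eqI) (simp_all add: Aut_mult_apply Aut_one_apply \<rho>\<^sub>2)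
qed

lemma \<rho>_inv: "inv\<^bsub>aut_group P\<^esub> \<rho>\<^sub>0 = \<rho>\<^sub>0" "inv\<^bsub>aut_group P\<^esub> \<rho>\<^sub>1 = \<rho>\<^sub>1" "inv\<^bsub>aut_group P\<^esub> \<rho>\<^sub>2 = \<rho>\<^sub>2"
  using \<rho>_square by (simp_all add: Aut.inv_equality)

lemma \<rho>_cancel:
  "g \<in> Aut \<Longrightarrow> g \<cdot> \<rho>\<^sub>0 \<cdot> \<rho>\<^sub>0 = g" "g \<in> Aut \<Longrightarrow> g \<cdot> \<rho>\<^sub>1 \<cdot> \<rho>\<^sub>1 = g" "g \<in> Aut \<Longrightarrow> g \<cdot> \<rho>\<^sub>2 \<cdot> \<rho>\<^sub>2 = g"
  by (simp_all add: Aut.m_assoc \<rho>_square)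

text \<open>\<open>\<rho>\<^sub>2\<close> fixes the base edge and one of its ends, hence also the
  other; dually for \<open>\<rho>\<^sub>0\<close> and the two faces at the base edge. The two
  products therefore agree on the base flag.\<close>

lemma \<rho>_commute: "\<rho>\<^sub>0 \<cdot> \<rho>\<^sub>2 = \<rho>\<^sub>2 \<cdot> \<rho>\<^sub>0"
proof -
  have "\<rho>\<^sub>2 (\<rho>\<^sub>0 v\<^sub>0) = \<rho>\<^sub>0 v\<^sub>0"
  proof (rule vertex_unique[OF base_flag _ moved_flags(1)])
    have "flag (\<rho>\<^sub>2 (\<rho>\<^sub>0 v\<^sub>0)) e\<^sub>0 (\<rho>\<^sub>2 f\<^sub>0)" using Aut_flag[OF \<rho>_Aut(3) moved_flags(1)] by (simp add: \<rho>\<^sub>2)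
    then show "flag (\<rho>\<^sub>2 (\<rho>\<^sub>0 v\<^sub>0)) e\<^sub>0 f\<^sub>0" by (rule flag_cong[OF _ base_flag])
    have "\<rho>\<^sub>2 (\<rho>\<^sub>0 v\<^sub>0) \<noteq> \<rho>\<^sub>2 v\<^sub>0" using \<rho>\<^sub>0(3) by (simp add: Aut_inj Aut_closed)
    then show "\<rho>\<^sub>2 (\<rho>\<^sub>0 v\<^sub>0) \<noteq> v\<^sub>0" by (simp add: \<rho>\<^sub>2)
  qed (rule \<rho>\<^sub>0)
  moreover have "\<rho>\<^sub>0 (\<rho>\<^sub>2 f\<^sub>0) = \<rho>\<^sub>2 f\<^sub>0"
  proof (rule face_unique[OF base_flag _ moved_flags(3)])
    have "flag (\<rho>\<^sub>0 v\<^sub>0) e\<^sub>0 (\<rho>\<^sub>0 (\<rho>\<^sub>2 f\<^sub>0))" using Aut_flag[OF \<rho>_Aut(1) moved_flags(3)] by (simp add: \<rho>\<^sub>0)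
    then show "flag v\<^sub>0 e\<^sub>0 (\<rho>\<^sub>0 (\<rho>\<^sub>2 f\<^sub>0))" by (rule flag_cong[OF base_flag])
    have "\<rho>\<^sub>0 (\<rho>\<^sub>2 f\<^sub>0) \<noteq> \<rho>\<^sub>0 f\<^sub>0" using \<rho>\<^sub>2(3) by (simp add: Aut_inj Aut_closed)
    then show "\<rho>\<^sub>0 (\<rho>\<^sub>2 f\<^sub>0) \<noteq> f\<^sub>0" by (simp add: \<rho>\<^sub>0)
  qed (rule \<rho>\<^sub>2)
  ultimately show ?thesis by (intro base_eqI) (simp_all add: Aut_mult_apply \<rho>\<^sub>0 \<rho>\<^sub>2)
qed

definition a :: "'a \<Rightarrow> 'a" where "a = \<rho>\<^sub>0 \<cdot> \<rho>\<^sub>1"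
definition b :: "'a \<Rightarrow> 'a" where "b = \<rho>\<^sub>1 \<cdot> \<rho>\<^sub>2"
definition Plus :: "('a \<Rightarrow> 'a) set" where "Plus = generate (aut_group P) {a, b}"

lemma ab_Aut [simp]: "a \<in> Aut" "b \<in> Aut" by (simp_all add: a_def b_def)

lemma Plus_subgroup: "subgroup Plus (aut_group P)"
  unfolding Plus_def by (rule Aut.generate_is_subgroup) simp

lemma ab_Plus: "a \<in> Plus" "b \<in> Plus" unfolding Plus_def by (auto intro: generate.incl)

lemma Plus_Aut: "g \<in> Plus \<Longrightarrow> g \<in> Aut"
  using subgroup.subset[OF Plus_subgroup] by blast

lemma Plus_mult: "g \<in> Plus \<Longrightarrow> h \<in> Plus \<Longrightarrow> g \<cdot> h \<in> Plus"
  by (rule subgroup.m_closed[OF Plus_subgroup])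

lemma Plus_inv: "g \<in> Plus \<Longrightarrow> inv\<^bsub>aut_group P\<^esub> g \<in> Plus"
  by (rule subgroup.m_inv_closed[OF Plus_subgroup])

lemma ab_inv: "inv\<^bsub>aut_group P\<^esub> a = \<rho>\<^sub>1 \<cdot> \<rho>\<^sub>0" "inv\<^bsub>aut_group P\<^esub> b = \<rho>\<^sub>2 \<cdot> \<rho>\<^sub>1"
  by (simp_all add: a_def b_def Aut.inv_mult_group \<rho>_inv)

lemma image_flag: "h \<in> Aut \<Longrightarrow> flag (h v\<^sub>0) (h e\<^sub>0) (h f\<^sub>0)"
  by (rule Aut_flag[OF _ base_flag])

lemma adjacent_image_0:
  assumes h: "h \<in> Aut" and fl: "flag v (h e\<^sub>0) (h f\<^sub>0)" "v \<noteq> h v\<^sub>0"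
  shows "(h \<cdot> \<rho>\<^sub>0) v\<^sub>0 = v" "(h \<cdot> \<rho>\<^sub>0) e\<^sub>0 = h e\<^sub>0" "(h \<cdot> \<rho>\<^sub>0) f\<^sub>0 = h f\<^sub>0"
proof -
  have "h (\<rho>\<^sub>0 v\<^sub>0) \<noteq> h v\<^sub>0" using \<rho>\<^sub>0(3) by (simp add: Aut_inj Aut_closed h)
  from vertex_unique[OF image_flag[OF h] Aut_flag[OF h moved_flags(1)] fl(1) this fl(2)]
  show "(h \<cdot> \<rho>\<^sub>0) v\<^sub>0 = v" by (simp add: Aut_mult_apply h)
qed (simp_all add: Aut_mult_apply h \<rho>\<^sub>0)

lemma adjacent_image_1:
  assumes h: "h \<in> Aut" and fl: "flag (h v\<^sub>0) e (h f\<^sub>0)" "e \<noteq> h e\<^sub>0"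
  shows "(h \<cdot> \<rho>\<^sub>1) v\<^sub>0 = h v\<^sub>0" "(h \<cdot> \<rho>\<^sub>1) e\<^sub>0 = e" "(h \<cdot> \<rho>\<^sub>1) f\<^sub>0 = h f\<^sub>0"
proof -
  have "h (\<rho>\<^sub>1 e\<^sub>0) \<noteq> h e\<^sub>0" using \<rho>\<^sub>1(3) by (simp add: Aut_inj Aut_closed h)
  from edge_unique[OF image_flag[OF h] Aut_flag[OF h moved_flags(2)] fl(1) this fl(2)]
  show "(h \<cdot> \<rho>\<^sub>1) e\<^sub>0 = e" by (simp add: Aut_mult_apply h)
qed (simp_all add: Aut_mult_apply h \<rho>\<^sub>1)

lemma adjacent_image_2:
  assumes h: "h \<in> Aut" and fl: "flag (h v\<^sub>0) (h e\<^sub>0) f" "f \<noteq> h f\<^sub>0"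
  shows "(h \<cdot> \<rho>\<^sub>2) v\<^sub>0 = h v\<^sub>0" "(h \<cdot> \<rho>\<^sub>2) e\<^sub>0 = h e\<^sub>0" "(h \<cdot> \<rho>\<^sub>2) f\<^sub>0 = f"
proof -
  have "h (\<rho>\<^sub>2 f\<^sub>0) \<noteq> h f\<^sub>0" using \<rho>\<^sub>2(3) by (simp add: Aut_inj Aut_closed h)
  from face_unique[OF image_flag[OF h] Aut_flag[OF h moved_flags(3)] fl(1) this fl(2)]
  show "(h \<cdot> \<rho>\<^sub>2) f\<^sub>0 = f" by (simp add: Aut_mult_apply h)
qed (simp_all add: Aut_mult_apply h \<rho>\<^sub>2)

text \<open>Multiplying \<open>h\<close> on the right by a generator replaces the image of the base
  flag by an adjacent flag. A set closed under the three right multiplications therefore reaches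
  every flag; it is applied to the whole group, and to \<open>Plus\<close> together with its
  coset.\<close>

lemma flag_image_in:
  assumes H: "H \<subseteq> Aut" "\<one>\<^bsub>aut_group P\<^esub> \<in> H"
    "\<And>h. h \<in> H \<Longrightarrow> h \<cdot> \<rho>\<^sub>0 \<in> H" "\<And>h. h \<in> H \<Longrightarrow> h \<cdot> \<rho>\<^sub>1 \<in> H" "\<And>h. h \<in> H \<Longrightarrow> h \<cdot> \<rho>\<^sub>2 \<in> H"
    and fl: "flag v e f"
  shows "\<exists>h\<in>H. h v\<^sub>0 = v \<and> h e\<^sub>0 = e \<and> h f\<^sub>0 = f"
proof -
  let ?T = "\<lambda>v e f. \<exists>h\<in>H. h v\<^sub>0 = v \<and> h e\<^sub>0 = e \<and> h f\<^sub>0 = f"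
  show "?T v e f"
  proof (rule flags_connected[where T = ?T, OF base_flag _ _ _ _ fl])
    show "?T v\<^sub>0 e\<^sub>0 f\<^sub>0" using H(2) Aut_one_apply base_Field by blast
    fix v e f v' assume fl: "flag v e f" "flag v' e f" "v' \<noteq> v" "?T v e f"
    then obtain h where h: "h \<in> H" "v = h v\<^sub>0" "e = h e\<^sub>0" "f = h f\<^sub>0" by blast
    have "h \<in> Aut" using h(1) H(1) by blast
    then show "?T v' e f" using adjacent_image_0[of h v'] fl(2,3) H(3)[OF h(1)] h by blast
  next
    fix v e f e' assume fl: "flag v e f" "flag v e' f" "e' \<noteq> e" "?T v e f"
    then obtain h where h: "h \<in> H" "v = h v\<^sub>0" "e = h e\<^sub>0" "f = h f\<^sub>0" by blast
    have "h \<in> Aut" using h(1) H(1) by blast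
    then show "?T v e' f" using adjacent_image_1[of h e'] fl(2,3) H(4)[OF h(1)] h by blast
  next
    fix v e f f' assume fl: "flag v e f" "flag v e f'" "f' \<noteq> f" "?T v e f"
    then obtain h where h: "h \<in> H" "v = h v\<^sub>0" "e = h e\<^sub>0" "f = h f\<^sub>0" by blast
    have "h \<in> Aut" using h(1) H(1) by blast
    then show "?T v e f'" using adjacent_image_2[of h f'] fl(2,3) H(5)[OF h(1)] h by blast
  qed
qed

lemma flag_image: "flag v e f \<Longrightarrow> \<exists>h\<in>Aut. h v\<^sub>0 = v \<and> h e\<^sub>0 = e \<and> h f\<^sub>0 = f"
  by (rule flag_image_in[of Aut]) simp_all

text \<open>The union of \<open>Plus\<close> and its coset by \<open>\<rho>\<^sub>1\<close> is
  closed under right multiplication by the three generators, so it reaches the image of the base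
  flag under \<open>g\<close>, and this image determines \<open>g\<close>.\<close>

lemma Aut_Plus_cases:
  assumes "g \<in> Aut" shows "g \<in> Plus \<or> g \<cdot> \<rho>\<^sub>1 \<in> Plus"
proof -
  let ?H = "{h \<in> Aut. h \<in> Plus \<or> h \<cdot> \<rho>\<^sub>1 \<in> Plus}"
  have H1: "h \<cdot> \<rho>\<^sub>1 \<in> ?H" if "h \<in> ?H" for h
    using that by (auto simp: \<rho>_cancel)
  have H0: "h \<cdot> \<rho>\<^sub>0 \<in> ?H" if h: "h \<in> ?H" for h
  proof (cases "h \<in> Plus")
    case True
    have "h \<cdot> \<rho>\<^sub>0 \<cdot> \<rho>\<^sub>1 = h \<cdot> a" using h by (simp add: a_def Aut.m_assoc)
    then show ?thesis using Plus_mult[OF True ab_Plus(1)] h by simp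
  next
    case False
    have "h \<cdot> \<rho>\<^sub>0 = (h \<cdot> \<rho>\<^sub>1) \<cdot> (\<rho>\<^sub>1 \<cdot> \<rho>\<^sub>0)" using h by (simp add: Aut.m_assoc[symmetric] \<rho>_cancel)
    then show ?thesis using Plus_mult[OF _ Plus_inv[OF ab_Plus(1)], of "h \<cdot> \<rho>\<^sub>1"] h False by (auto simp: ab_inv)
  qed
  have H2: "h \<cdot> \<rho>\<^sub>2 \<in> ?H" if h: "h \<in> ?H" for h
  proof (cases "h \<in> Plus")
    case True
    have "h \<cdot> \<rho>\<^sub>2 \<cdot> \<rho>\<^sub>1 = h \<cdot> (\<rho>\<^sub>2 \<cdot> \<rho>\<^sub>1)" using h by (simp add: Aut.m_assoc)
    then show ?thesis using Plus_mult[OF True Plus_inv[OF ab_Plus(2)]] h by (simp add: ab_inv)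
  next
    case False
    have "h \<cdot> \<rho>\<^sub>2 = (h \<cdot> \<rho>\<^sub>1) \<cdot> b" using h by (simp add: b_def Aut.m_assoc[symmetric] \<rho>_cancel)
    then show ?thesis using Plus_mult[OF _ ab_Plus(2), of "h \<cdot> \<rho>\<^sub>1"] h False by auto
  qed
  have "\<one>\<^bsub>aut_group P\<^esub> \<in> ?H" using subgroup.one_closed[OF Plus_subgroup] by simp
  from flag_image_in[OF _ this H0 H1 H2 Aut_flag[OF assms base_flag]]
  obtain h where h: "h \<in> ?H" "h v\<^sub>0 = g v\<^sub>0" "h e\<^sub>0 = g e\<^sub>0" "h f\<^sub>0 = g f\<^sub>0" by blast
  then have "h = g" using assms by (intro base_eqI) auto
  then show ?thesis using h(1) by blast
qed

text \<open>The rotations have index 1 or 2 by \<open>Aut_Plus_cases\<close>, so orientability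
  amounts to \<open>\<rho>\<^sub>1\<close> not being a rotation.\<close>

lemma index_Plus: "card (rcosets\<^bsub>aut_group P\<^esub> Plus) = 2 \<longleftrightarrow> \<rho>\<^sub>1 \<notin> Plus"
proof -
  have lag: "card (rcosets\<^bsub>aut_group P\<^esub> Plus) * card Plus = card Aut"
    using Aut.lagrange[OF Plus_subgroup] by (simp add: order_def mult.commute)
  have fin: "finite Plus" using finite_Aut Plus_Aut by (meson finite_subset subsetI)
  have pos: "card Plus > 0" using fin ab_Plus by (auto simp: card_gt_0_iff)
  show ?thesis
  proof (cases "\<rho>\<^sub>1 \<in> Plus")
    case True
    have "g \<in> Plus" if "g \<in> Aut" for g
      using Aut_Plus_cases[OF that] Plus_mult[OF _ True, of "g \<cdot> \<rho>\<^sub>1"] that by (auto simp: \<rho>_cancel)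
    then have "Plus = Aut" using Plus_Aut by blast
    then show ?thesis using lag pos True by simp
  next
    case False
    have "Aut = Plus \<union> (\<lambda>g. g \<cdot> \<rho>\<^sub>1) ` Plus"
    proof
      show "Aut \<subseteq> Plus \<union> (\<lambda>g. g \<cdot> \<rho>\<^sub>1) ` Plus"
      proof
        fix g assume g: "g \<in> Aut"
        then have "g = (g \<cdot> \<rho>\<^sub>1) \<cdot> \<rho>\<^sub>1" by (simp add: \<rho>_cancel)
        then show "g \<in> Plus \<union> (\<lambda>g. g \<cdot> \<rho>\<^sub>1) ` Plus" using Aut_Plus_cases[OF g] by blast
      qed
    qed (use Plus_Aut in auto)
    moreover have "Plus \<inter> (\<lambda>g. g \<cdot> \<rho>\<^sub>1) ` Plus = {}"
    proof -
      have "g \<cdot> \<rho>\<^sub>1 \<notin> Plus" if g: "g \<in> Plus" for g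
      proof
        assume "g \<cdot> \<rho>\<^sub>1 \<in> Plus"
        then have "inv\<^bsub>aut_group P\<^esub> g \<cdot> (g \<cdot> \<rho>\<^sub>1) \<in> Plus" using Plus_mult Plus_inv g by blast
        moreover have "inv\<^bsub>aut_group P\<^esub> g \<cdot> (g \<cdot> \<rho>\<^sub>1) = \<rho>\<^sub>1"
          using Plus_Aut[OF g] by (simp add: Aut.m_assoc[symmetric])
        ultimately show False using False by simp
      qed
      then show ?thesis by blast
    qed
    moreover have "inj_on (\<lambda>g. g \<cdot> \<rho>\<^sub>1) Plus"
      by (rule inj_onI) (simp add: Plus_Aut Aut.right_cancel)
    ultimately have "card Aut = 2 * card Plus"
      using fin by (simp add: card_Un_disjoint card_image)
    then show ?thesis using lag pos False by simp
  qed
qed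

end

section \<open>The rotation group of a tight polyhedron\<close>

context finite_polyhedron begin

lemma Aut_inv_apply: "g \<in> Aut \<Longrightarrow> x \<in> Field (leq P) \<Longrightarrow> g x = y \<Longrightarrow> (inv\<^bsub>aut_group P\<^esub> g) y = x"
  using Aut_mult_apply[of "inv\<^bsub>aut_group P\<^esub> g" g x] Aut_one_apply[of x] by simp

lemma Aut_pow_fix:
  assumes g: "g \<in> Aut" and x: "x \<in> Field (leq P)" "g x = x"
  shows "(g [^]\<^bsub>aut_group P\<^esub> (i::int)) x = x"
proof (induction i rule: int_induct[where k = 0])
  case base then show ?case using x by (simp add: Aut_one_apply)
next
  case (step1 i)
  then show ?case using g x by (simp add: Aut.int_pow_mult Aut_mult_apply)
next
  case (step2 i)
  have "(inv\<^bsub>aut_group P\<^esub> g) x = x" using Aut_inv_apply[OF g x] .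
  then show ?case using step2 g x by (simp add: Aut.int_pow_diff Aut_mult_apply)
qed

end

locale tight_simple_rooted = rooted_polyhedron P v\<^sub>0 e\<^sub>0 f\<^sub>0 \<rho>\<^sub>0 \<rho>\<^sub>1 \<rho>\<^sub>2
  for P :: "'a ranked_poset" and v\<^sub>0 e\<^sub>0 f\<^sub>0 :: 'a and \<rho>\<^sub>0 \<rho>\<^sub>1 \<rho>\<^sub>2 +
  fixes p q :: nat
  assumes orientable: "\<rho>\<^sub>1 \<notin> Plus"
    and face_size: "f \<in> F \<Longrightarrow> card {e\<in>E. e \<sqsubseteq> f} = p"
    and valency: "v \<in> V \<Longrightarrow> card {e\<in>E. v \<sqsubseteq> e} = q"
    and card_flags: "card (flags P) = 2 * p * q"
    and simple: "e \<in> E \<Longrightarrow> e' \<in> E \<Longrightarrow> {v\<in>V. v \<sqsubseteq> e} = {v\<in>V. v \<sqsubseteq> e'} \<Longrightarrow> e = e'"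
begin

abbreviation A :: "int \<Rightarrow> 'a \<Rightarrow> 'a" where "A i \<equiv> a [^]\<^bsub>aut_group P\<^esub> i"
abbreviation B :: "int \<Rightarrow> 'a \<Rightarrow> 'a" where "B i \<equiv> b [^]\<^bsub>aut_group P\<^esub> i"

lemma a_face: "a f\<^sub>0 = f\<^sub>0" and b_vertex: "b v\<^sub>0 = v\<^sub>0"
  by (simp_all add: a_def b_def Aut_mult_apply \<rho>\<^sub>0 \<rho>\<^sub>1 \<rho>\<^sub>2)

lemma ab_eq: "a \<cdot> b = \<rho>\<^sub>0 \<cdot> \<rho>\<^sub>2"
proof -
  have "a \<cdot> b = (\<rho>\<^sub>0 \<cdot> \<rho>\<^sub>1 \<cdot> \<rho>\<^sub>1) \<cdot> \<rho>\<^sub>2" unfolding a_def b_def by (simp only: Aut.m_assoc Aut.m_closed \<rho>_Aut)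
  then show ?thesis by (simp add: \<rho>_cancel)
qed

lemma ab_edge: "(a \<cdot> b) e\<^sub>0 = e\<^sub>0"
  by (simp add: ab_eq Aut_mult_apply \<rho>\<^sub>0 \<rho>\<^sub>2)

lemma abab: "a \<cdot> b \<cdot> a \<cdot> b = \<one>\<^bsub>aut_group P\<^esub>"
proof -
  have "a \<cdot> b \<cdot> a \<cdot> b = (a \<cdot> b) \<cdot> (a \<cdot> b)" by (simp add: Aut.m_assoc)
  also have "\<dots> = (\<rho>\<^sub>0 \<cdot> \<rho>\<^sub>2) \<cdot> (\<rho>\<^sub>2 \<cdot> \<rho>\<^sub>0)" by (simp only: ab_eq) (simp only: \<rho>_commute)
  also have "\<dots> = (\<rho>\<^sub>0 \<cdot> \<rho>\<^sub>2 \<cdot> \<rho>\<^sub>2) \<cdot> \<rho>\<^sub>0" by (simp add: Aut.m_assoc)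
  finally show ?thesis by (simp add: \<rho>_cancel \<rho>_square)
qed

lemma A_face: "A i f\<^sub>0 = f\<^sub>0" by (rule Aut_pow_fix) (simp_all add: a_face)
lemma B_vertex: "B i v\<^sub>0 = v\<^sub>0" by (rule Aut_pow_fix) (simp_all add: b_vertex)

lemma A_Plus: "A i \<in> Plus" and B_Plus: "B i \<in> Plus"
  using Aut.subgroup_int_pow_closed[OF Plus_subgroup] ab_Plus by auto

lemma AB_Aut [simp]: "A i \<in> Aut" "B i \<in> Aut" by simp_all

lemma \<rho>_notin_Plus: "\<rho>\<^sub>0 \<notin> Plus" "\<rho>\<^sub>2 \<notin> Plus"
proof -
  have "\<rho>\<^sub>0 \<cdot> a = \<rho>\<^sub>1" by (simp add: a_def Aut.m_assoc[symmetric] \<rho>_square)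
  then show "\<rho>\<^sub>0 \<notin> Plus" using Plus_mult[OF _ ab_Plus(1)] orientable by metis
  have "b \<cdot> \<rho>\<^sub>2 = \<rho>\<^sub>1" by (simp add: b_def \<rho>_cancel)
  then show "\<rho>\<^sub>2 \<notin> Plus" using Plus_mult[OF ab_Plus(2)] orientable by metis
qed

text \<open>An automorphism that fixes two elements of the base flag and moves the third is one of
  the three reflections, and none of these is a rotation in the orientable case.\<close>

lemma Plus_stabilizers:
  assumes g: "g \<in> Plus"
  shows "g v\<^sub>0 = v\<^sub>0 \<Longrightarrow> g f\<^sub>0 = f\<^sub>0 \<Longrightarrow> g = \<one>\<^bsub>aut_group P\<^esub>"
    and "g e\<^sub>0 = e\<^sub>0 \<Longrightarrow> g f\<^sub>0 = f\<^sub>0 \<Longrightarrow> g = \<one>\<^bsub>aut_group P\<^esub>"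
    and "g v\<^sub>0 = v\<^sub>0 \<Longrightarrow> g e\<^sub>0 = e\<^sub>0 \<Longrightarrow> g = \<one>\<^bsub>aut_group P\<^esub>"
proof -
  note gA = Plus_Aut[OF g]
  note im = image_flag[OF gA]
  have one: "g = \<one>\<^bsub>aut_group P\<^esub>" if "g v\<^sub>0 = v\<^sub>0" "g e\<^sub>0 = e\<^sub>0" "g f\<^sub>0 = f\<^sub>0"
    using that gA by (intro base_eqI) (simp_all add: Aut_one_apply)
  { assume h: "g v\<^sub>0 = v\<^sub>0" "g f\<^sub>0 = f\<^sub>0"
    have "g e\<^sub>0 = e\<^sub>0"
    proof (rule ccontr)
      assume "g e\<^sub>0 \<noteq> e\<^sub>0"
      then have "g e\<^sub>0 = \<rho>\<^sub>1 e\<^sub>0" using edge_unique[OF base_flag _ moved_flags(2)] im h \<rho>\<^sub>1(3) by simp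
      then have "g = \<rho>\<^sub>1" using h gA by (intro base_eqI) (simp_all add: \<rho>\<^sub>1)
      then show False using g orientable by simp
    qed
    then show "g = \<one>\<^bsub>aut_group P\<^esub>" using one h by simp }
  { assume h: "g e\<^sub>0 = e\<^sub>0" "g f\<^sub>0 = f\<^sub>0"
    have "g v\<^sub>0 = v\<^sub>0"
    proof (rule ccontr)
      assume "g v\<^sub>0 \<noteq> v\<^sub>0"
      then have "g v\<^sub>0 = \<rho>\<^sub>0 v\<^sub>0" using vertex_unique[OF base_flag _ moved_flags(1)] im h \<rho>\<^sub>0(3) by simp
      then have "g = \<rho>\<^sub>0" using h gA by (intro base_eqI) (simp_all add: \<rho>\<^sub>0)
      then show False using g \<rho>_notin_Plus by simp
    qed
    then show "g = \<one>\<^bsub>aut_group P\<^esub>" using one h by simp }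
  { assume h: "g v\<^sub>0 = v\<^sub>0" "g e\<^sub>0 = e\<^sub>0"
    have "g f\<^sub>0 = f\<^sub>0"
    proof (rule ccontr)
      assume "g f\<^sub>0 \<noteq> f\<^sub>0"
      then have "g f\<^sub>0 = \<rho>\<^sub>2 f\<^sub>0" using face_unique[OF base_flag _ moved_flags(3)] im h \<rho>\<^sub>2(3) by simp
      then have "g = \<rho>\<^sub>2" using h gA by (intro base_eqI) (simp_all add: \<rho>\<^sub>2)
      then show False using g \<rho>_notin_Plus by simp
    qed
    then show "g = \<one>\<^bsub>aut_group P\<^esub>" using one h by simp }
qed

lemma pow_difference:
  assumes "g \<in> Aut" "x \<in> Field (leq P)" "(g [^]\<^bsub>aut_group P\<^esub> (i::int)) x = (g [^]\<^bsub>aut_group P\<^esub> (j::int)) x"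
  shows "(g [^]\<^bsub>aut_group P\<^esub> (i - j)) x = x"
proof -
  have "(g [^]\<^bsub>aut_group P\<^esub> (i - j)) = g [^]\<^bsub>aut_group P\<^esub> (-j) \<cdot> g [^]\<^bsub>aut_group P\<^esub> i"
    using assms(1) by (simp add: Aut.int_pow_mult[symmetric])
  then have "(g [^]\<^bsub>aut_group P\<^esub> (i - j)) x = (g [^]\<^bsub>aut_group P\<^esub> (-j)) ((g [^]\<^bsub>aut_group P\<^esub> i) x)"
    using assms by (simp add: Aut_mult_apply)
  also have "\<dots> = (g [^]\<^bsub>aut_group P\<^esub> (-j)) ((g [^]\<^bsub>aut_group P\<^esub> j) x)" by (simp only: assms(3))
  also have "\<dots> = (g [^]\<^bsub>aut_group P\<^esub> (-j) \<cdot> g [^]\<^bsub>aut_group P\<^esub> j) x" using assms by (simp add: Aut_mult_apply)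
  also have "g [^]\<^bsub>aut_group P\<^esub> (-j) \<cdot> g [^]\<^bsub>aut_group P\<^esub> j = \<one>\<^bsub>aut_group P\<^esub>"
    using assms(1) by (simp add: Aut.int_pow_mult[symmetric])
  finally show ?thesis using assms by (simp add: Aut_one_apply)
qed

lemma pow_eqI:
  assumes "g \<in> Aut" "g [^]\<^bsub>aut_group P\<^esub> (i - j :: int) = \<one>\<^bsub>aut_group P\<^esub>"
  shows "g [^]\<^bsub>aut_group P\<^esub> i = g [^]\<^bsub>aut_group P\<^esub> j"
  using Aut.int_pow_mult[OF assms(1), of "i - j" j] assms by simp

lemma A_vertex_inj: "A i v\<^sub>0 = A j v\<^sub>0 \<Longrightarrow> A i = A j"
  by (rule pow_eqI) (auto intro!: Plus_stabilizers(1)[OF A_Plus] pow_difference simp: A_face)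

lemma A_edge_inj: "A i e\<^sub>0 = A j e\<^sub>0 \<Longrightarrow> A i = A j"
  by (rule pow_eqI) (auto intro!: Plus_stabilizers(2)[OF A_Plus] pow_difference simp: A_face)

lemma B_edge_inj: "B i e\<^sub>0 = B j e\<^sub>0 \<Longrightarrow> B i = B j"
  by (rule pow_eqI) (auto intro!: Plus_stabilizers(3)[OF B_Plus] pow_difference simp: B_vertex)

lemma B_face_inj: "B i f\<^sub>0 = B j f\<^sub>0 \<Longrightarrow> B i = B j"
  by (rule pow_eqI) (auto intro!: Plus_stabilizers(1)[OF B_Plus] pow_difference simp: B_vertex)

lemma A_succ: "A i \<cdot> a = A (i + 1)" "A i \<cdot> inv\<^bsub>aut_group P\<^esub> a = A (i - 1)"
  and B_succ: "B i \<cdot> b = B (i + 1)" "B i \<cdot> inv\<^bsub>aut_group P\<^esub> b = B (i - 1)"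
  by (simp_all add: Aut.int_pow_mult Aut.int_pow_diff)

lemma face_edges: "{e\<in>E. e \<sqsubseteq> f\<^sub>0} = range (\<lambda>i. A i e\<^sub>0)"
proof
  show "range (\<lambda>i. A i e\<^sub>0) \<subseteq> {e\<in>E. e \<sqsubseteq> f\<^sub>0}"
    using image_flag[OF AB_Aut(1)] by (auto simp: flag_def A_face)
  show "{e\<in>E. e \<sqsubseteq> f\<^sub>0} \<subseteq> range (\<lambda>i. A i e\<^sub>0)"
  proof
    fix e assume "e \<in> {e\<in>E. e \<sqsubseteq> f\<^sub>0}"
    moreover from this obtain v f where "flag v e f" using flag_through_E by blast
    ultimately have fl: "flag v e f\<^sub>0" using base_flag by (simp add: flag_def)
    \<comment> \<open>The dihedral group generated by \<open>\<rho>\<^sub>0\<close> and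
      \<open>\<rho>\<^sub>1\<close>, listed as two cosets of \<open><a>\<close>; it fixes the base
      face and is closed under right multiplication by both reflections.\<close>
    let ?H = "range A \<union> range (\<lambda>i. A i \<cdot> \<rho>\<^sub>1)"
    let ?T = "\<lambda>v e. \<exists>h\<in>?H. h v\<^sub>0 = v \<and> h e\<^sub>0 = e"
    have H: "h \<in> Aut" "h f\<^sub>0 = f\<^sub>0" if "h \<in> ?H" for h
      using that by (auto simp: Aut_mult_apply \<rho>\<^sub>1 A_face)
    have H0: "h \<cdot> \<rho>\<^sub>0 \<in> ?H" if "h \<in> ?H" for h
    proof -
      have "A i \<cdot> \<rho>\<^sub>0 = A (i + 1) \<cdot> \<rho>\<^sub>1" for i
        unfolding A_succ[symmetric] by (simp add: a_def Aut.m_assoc \<rho>_square)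
      moreover have "A i \<cdot> \<rho>\<^sub>1 \<cdot> \<rho>\<^sub>0 = A (i - 1)" for i
        unfolding A_succ[symmetric] by (simp add: ab_inv Aut.m_assoc)
      ultimately show ?thesis using that by auto
    qed
    have H1: "h \<cdot> \<rho>\<^sub>1 \<in> ?H" if "h \<in> ?H" for h
      using that by (auto simp: \<rho>_cancel)
    have "?T v e"
    proof (rule face_flags_connected[where T = ?T, OF base_flag _ _ _ fl])
      have "A 0 v\<^sub>0 = v\<^sub>0" "A 0 e\<^sub>0 = e\<^sub>0" by (simp_all add: Aut_one_apply)
      then show "?T v\<^sub>0 e\<^sub>0" by blast
    next
      fix v e v' assume fl: "flag v e f\<^sub>0" "flag v' e f\<^sub>0" "v' \<noteq> v" "?T v e"
      then obtain h where h: "h \<in> ?H" "v = h v\<^sub>0" "e = h e\<^sub>0" by blast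
      then show "?T v' e"
        using adjacent_image_0[OF H(1)[OF h(1)], of v'] fl(2,3) H0[OF h(1)] H(2)[OF h(1)] by auto
    next
      fix v e e' assume fl: "flag v e f\<^sub>0" "flag v e' f\<^sub>0" "e' \<noteq> e" "?T v e"
      then obtain h where h: "h \<in> ?H" "v = h v\<^sub>0" "e = h e\<^sub>0" by blast
      then show "?T v e'"
        using adjacent_image_1[OF H(1)[OF h(1)], of e'] fl(2,3) H1[OF h(1)] H(2)[OF h(1)] by auto
    qed
    then obtain h where h: "h \<in> ?H" "h e\<^sub>0 = e" by blast
    show "e \<in> range (\<lambda>i. A i e\<^sub>0)"
    proof (cases "h \<in> range A")
      case True then show ?thesis using h by blast
    next
      case False
      then obtain i where i: "h = A i \<cdot> \<rho>\<^sub>1" using h by blast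
      \<comment> \<open>Right multiplication by \<open>\<rho>\<^sub>0\<close> leaves the image of
        the base edge unchanged and leads back into \<open><a>\<close>.\<close>
      have "A i \<cdot> \<rho>\<^sub>1 \<cdot> \<rho>\<^sub>0 = A (i - 1)"
        unfolding A_succ[symmetric] by (simp add: ab_inv Aut.m_assoc)
      then have "A (i - 1) e\<^sub>0 = (h \<cdot> \<rho>\<^sub>0) e\<^sub>0" by (simp add: i)
      also have "\<dots> = e" using h H(1)[OF h(1)] by (simp add: Aut_mult_apply \<rho>\<^sub>0)
      finally show ?thesis by blast
    qed
  qed
qed

lemma vertex_edges: "{e\<in>E. v\<^sub>0 \<sqsubseteq> e} = range (\<lambda>i. B i e\<^sub>0)"
proof
  show "range (\<lambda>i. B i e\<^sub>0) \<subseteq> {e\<in>E. v\<^sub>0 \<sqsubseteq> e}"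
    using image_flag[OF AB_Aut(2)] by (auto simp: flag_def B_vertex)
  show "{e\<in>E. v\<^sub>0 \<sqsubseteq> e} \<subseteq> range (\<lambda>i. B i e\<^sub>0)"
  proof
    fix e assume "e \<in> {e\<in>E. v\<^sub>0 \<sqsubseteq> e}"
    moreover from this obtain v f where "flag v e f" using flag_through_E by blast
    ultimately have fl: "flag v\<^sub>0 e f" using base_flag by (simp add: flag_def)
    let ?H = "range B \<union> range (\<lambda>i. B i \<cdot> \<rho>\<^sub>1)"
    let ?T = "\<lambda>e f. \<exists>h\<in>?H. h e\<^sub>0 = e \<and> h f\<^sub>0 = f"
    have H: "h \<in> Aut" "h v\<^sub>0 = v\<^sub>0" if "h \<in> ?H" for h
      using that by (auto simp: Aut_mult_apply \<rho>\<^sub>1 B_vertex)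
    have B\<rho>: "B i \<cdot> \<rho>\<^sub>1 \<cdot> \<rho>\<^sub>2 = B (i + 1)" for i
      unfolding B_succ[symmetric] by (simp add: b_def Aut.m_assoc)
    have H2: "h \<cdot> \<rho>\<^sub>2 \<in> ?H" if "h \<in> ?H" for h
    proof -
      have "B i \<cdot> \<rho>\<^sub>2 = B (i - 1) \<cdot> \<rho>\<^sub>1" for i
        unfolding B_succ[symmetric] by (simp add: ab_inv Aut.m_assoc \<rho>_square)
      then show ?thesis using that B\<rho> by auto
    qed
    have H1: "h \<cdot> \<rho>\<^sub>1 \<in> ?H" if "h \<in> ?H" for h
      using that by (auto simp: \<rho>_cancel)
    have "?T e f"
    proof (rule vertex_flags_connected[where T = ?T, OF base_flag _ _ _ fl])
      have "B 0 e\<^sub>0 = e\<^sub>0" "B 0 f\<^sub>0 = f\<^sub>0" by (simp_all add: Aut_one_apply)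
      then show "?T e\<^sub>0 f\<^sub>0" by blast
    next
      fix e f e' assume fl: "flag v\<^sub>0 e f" "flag v\<^sub>0 e' f" "e' \<noteq> e" "?T e f"
      then obtain h where h: "h \<in> ?H" "e = h e\<^sub>0" "f = h f\<^sub>0" by blast
      then show "?T e' f"
        using adjacent_image_1[OF H(1)[OF h(1)], of e'] fl(2,3) H1[OF h(1)] H(2)[OF h(1)] by auto
    next
      fix e f f' assume fl: "flag v\<^sub>0 e f" "flag v\<^sub>0 e f'" "f' \<noteq> f" "?T e f"
      then obtain h where h: "h \<in> ?H" "e = h e\<^sub>0" "f = h f\<^sub>0" by blast
      then show "?T e f'"
        using adjacent_image_2[OF H(1)[OF h(1)], of f'] fl(2,3) H2[OF h(1)] H(2)[OF h(1)] by auto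
    qed
    then obtain h where h: "h \<in> ?H" "h e\<^sub>0 = e" by blast
    show "e \<in> range (\<lambda>i. B i e\<^sub>0)"
    proof (cases "h \<in> range B")
      case True then show ?thesis using h by blast
    next
      case False
      then obtain i where i: "h = B i \<cdot> \<rho>\<^sub>1" using h by blast
      have "B (i + 1) e\<^sub>0 = (h \<cdot> \<rho>\<^sub>2) e\<^sub>0" using B\<rho>[of i] by (simp add: i)
      also have "\<dots> = e" using h H(1)[OF h(1)] by (simp add: Aut_mult_apply \<rho>\<^sub>2)
      finally show ?thesis by blast
    qed
  qed
qed

lemma card_range: "card (range A) = p" "card (range B) = q"
proof -
  have "inj_on (\<lambda>g. g e\<^sub>0) (range A)" by (rule inj_onI) (auto dest: A_edge_inj)
  then have "card (range A) = card ((\<lambda>g. g e\<^sub>0) ` range A)" by (rule card_image[symmetric])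
  also have "(\<lambda>g. g e\<^sub>0) ` range A = {e\<in>E. e \<sqsubseteq> f\<^sub>0}" unfolding face_edges by auto
  finally show "card (range A) = p" using face_size base_flag by (simp add: flag_def)
  have "inj_on (\<lambda>g. g e\<^sub>0) (range B)" by (rule inj_onI) (auto dest: B_edge_inj)
  then have "card (range B) = card ((\<lambda>g. g e\<^sub>0) ` range B)" by (rule card_image[symmetric])
  also have "(\<lambda>g. g e\<^sub>0) ` range B = {e\<in>E. v\<^sub>0 \<sqsubseteq> e}" unfolding vertex_edges by auto
  finally show "card (range B) = q" using valency base_flag by (simp add: flag_def)
qed

text \<open>The automorphisms act simply transitively on the flags, and the rotations are half of
  them.\<close>

lemma card_Plus: "card Plus = p * q"
proof -
  have "bij_betw (\<lambda>g. {g v\<^sub>0, g e\<^sub>0, g f\<^sub>0}) Aut (flags P)"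
    unfolding bij_betw_def
  proof
    show "inj_on (\<lambda>g. {g v\<^sub>0, g e\<^sub>0, g f\<^sub>0}) Aut"
    proof (rule inj_onI)
      fix g h assume gh: "g \<in> Aut" "h \<in> Aut" "{g v\<^sub>0, g e\<^sub>0, g f\<^sub>0} = {h v\<^sub>0, h e\<^sub>0, h f\<^sub>0}"
      from flag_inj[OF image_flag[OF gh(1)] image_flag[OF gh(2)] gh(3)] show "g = h"
        by (intro base_eqI gh)
    qed
    show "(\<lambda>g. {g v\<^sub>0, g e\<^sub>0, g f\<^sub>0}) ` Aut = flags P"
    proof
      show "(\<lambda>g. {g v\<^sub>0, g e\<^sub>0, g f\<^sub>0}) ` Aut \<subseteq> flags P" using image_flag flag_elems by blast
      show "flags P \<subseteq> (\<lambda>g. {g v\<^sub>0, g e\<^sub>0, g f\<^sub>0}) ` Aut"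
      proof
        fix C assume "C \<in> flags P"
        then obtain v e f where "flag v e f" "C = {v, e, f}" unfolding flags_eq by blast
        then show "C \<in> (\<lambda>g. {g v\<^sub>0, g e\<^sub>0, g f\<^sub>0}) ` Aut" using flag_image[of v e f] by blast
      qed
    qed
  qed
  then have "card Aut = 2 * p * q" using card_flags by (simp add: bij_betw_same_card)
  moreover have "card (rcosets\<^bsub>aut_group P\<^esub> Plus) = 2" using index_Plus orientable by simp
  ultimately show ?thesis using Aut.lagrange[OF Plus_subgroup] by (simp add: order_def)
qed

lemma A_B_trivial: "A i = B j \<Longrightarrow> A i = \<one>\<^bsub>aut_group P\<^esub>"
  by (rule Plus_stabilizers(1)[OF A_Plus _ A_face]) (simp add: B_vertex)

text \<open>Here tightness enters: trivial intersection makes the \<open>p * q\<close> products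
  distinct, and \<open>card_Plus\<close> says that there are no further rotations.\<close>

lemma Plus_eq: "g \<in> Plus \<Longrightarrow> \<exists>i j. g = A i \<cdot> B j"
proof -
  let ?m = "\<lambda>(x, y). x \<cdot> y"
  have "inj_on ?m (range A \<times> range B)"
  proof (rule inj_onI, clarify)
    fix i j i' j' assume e: "A i \<cdot> B j = A i' \<cdot> B j'"
    have "A (i - i') = A (-i') \<cdot> (A i \<cdot> B j) \<cdot> B (-j)"
    proof -
      have "A (-i') \<cdot> (A i \<cdot> B j) \<cdot> B (-j) = (A (-i') \<cdot> A i) \<cdot> (B j \<cdot> B (-j))" by (simp add: Aut.m_assoc)
      then show ?thesis by (simp add: Aut.int_pow_mult[symmetric])
    qed
    also have "\<dots> = (A (-i') \<cdot> A i') \<cdot> (B j' \<cdot> B (-j))" unfolding e by (simp add: Aut.m_assoc)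
    also have "\<dots> = B (j' - j)" by (simp add: Aut.int_pow_mult[symmetric])
    finally have "A (i - i') = \<one>\<^bsub>aut_group P\<^esub>" "B (j' - j) = \<one>\<^bsub>aut_group P\<^esub>" using A_B_trivial by metis+
    then show "A i = A i' \<and> B j = B j'" using pow_eqI[OF ab_Aut(1)] pow_eqI[OF ab_Aut(2)] by metis
  qed
  then have "card (?m ` (range A \<times> range B)) = p * q"
    by (simp add: card_image card_cartesian_product card_range)
  moreover have "?m ` (range A \<times> range B) \<subseteq> Plus" using Plus_mult A_Plus B_Plus by auto
  moreover have "finite Plus" using finite_Aut Plus_Aut by (meson finite_subset subsetI)
  ultimately have "?m ` (range A \<times> range B) = Plus" using card_Plus by (intro card_subset_eq) auto
  moreover assume "g \<in> Plus"
  ultimately have "g \<in> ?m ` (range A \<times> range B)" by simp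
  then show "\<exists>i j. g = A i \<cdot> B j" by auto
qed

lemma \<rho>\<^sub>1_conj: "\<rho>\<^sub>1 \<cdot> A i = A (-i) \<cdot> \<rho>\<^sub>1" "\<rho>\<^sub>1 \<cdot> B i = B (-i) \<cdot> \<rho>\<^sub>1"
proof -
  have "\<rho>\<^sub>1 \<cdot> a = inv\<^bsub>aut_group P\<^esub> a \<cdot> \<rho>\<^sub>1" by (simp add: ab_inv) (simp add: a_def Aut.m_assoc)
  from Aut.intertwine_int_pow[OF _ _ _ this, of i] show "\<rho>\<^sub>1 \<cdot> A i = A (-i) \<cdot> \<rho>\<^sub>1"
    by (simp add: Aut.int_pow_inv Aut.int_pow_neg)
  have "\<rho>\<^sub>1 \<cdot> b = inv\<^bsub>aut_group P\<^esub> b \<cdot> \<rho>\<^sub>1"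
    by (simp add: ab_inv) (simp add: b_def Aut.m_assoc \<rho>_square Aut.m_assoc[symmetric])
  from Aut.intertwine_int_pow[OF _ _ _ this, of i] show "\<rho>\<^sub>1 \<cdot> B i = B (-i) \<cdot> \<rho>\<^sub>1"
    by (simp add: Aut.int_pow_inv Aut.int_pow_neg)
qed

definition "PlusG = aut_group P\<lparr>carrier := Plus\<rparr>"

lemma PlusG_simps: "carrier PlusG = Plus" "g \<otimes>\<^bsub>PlusG\<^esub> h = g \<cdot> h" "\<one>\<^bsub>PlusG\<^esub> = \<one>\<^bsub>aut_group P\<^esub>"
  "a [^]\<^bsub>PlusG\<^esub> (i::int) = A i" "b [^]\<^bsub>PlusG\<^esub> (i::int) = B i"
  using Aut.int_pow_consistent[OF Plus_subgroup] ab_Plus by (simp_all add: PlusG_def)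

lemma tight_simple_group: "tight_simple_group PlusG a b"
proof (intro tight_simple_group.intro tight_group.intro tight_group_axioms.intro tight_simple_group_axioms.intro)
  show "group PlusG" unfolding PlusG_def by (rule Aut.subgroup_imp_group[OF Plus_subgroup])
  show "finite (carrier PlusG)" using finite_Aut Plus_Aut by (simp add: PlusG_simps) (meson finite_subset subsetI)
  show "a \<in> carrier PlusG" "b \<in> carrier PlusG" by (simp_all add: PlusG_simps ab_Plus)
  show "a \<otimes>\<^bsub>PlusG\<^esub> b \<otimes>\<^bsub>PlusG\<^esub> a \<otimes>\<^bsub>PlusG\<^esub> b = \<one>\<^bsub>PlusG\<^esub>" by (simp add: PlusG_simps abab)
  show "\<exists>i j. g = a [^]\<^bsub>PlusG\<^esub> (i::int) \<otimes>\<^bsub>PlusG\<^esub> b [^]\<^bsub>PlusG\<^esub> (j::int)" if "g \<in> carrier PlusG" for g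
    using that Plus_eq by (simp add: PlusG_simps)
  show "a [^]\<^bsub>PlusG\<^esub> i = \<one>\<^bsub>PlusG\<^esub>" if "a [^]\<^bsub>PlusG\<^esub> i = b [^]\<^bsub>PlusG\<^esub> j" for i j :: int
    using that A_B_trivial by (simp add: PlusG_simps)
  show "b [^]\<^bsub>PlusG\<^esub> (-j) \<otimes>\<^bsub>PlusG\<^esub> a [^]\<^bsub>PlusG\<^esub> (-i) = a [^]\<^bsub>PlusG\<^esub> (-i') \<otimes>\<^bsub>PlusG\<^esub> b [^]\<^bsub>PlusG\<^esub> (-j')"
    if "b [^]\<^bsub>PlusG\<^esub> j \<otimes>\<^bsub>PlusG\<^esub> a [^]\<^bsub>PlusG\<^esub> i = a [^]\<^bsub>PlusG\<^esub> i' \<otimes>\<^bsub>PlusG\<^esub> b [^]\<^bsub>PlusG\<^esub> j'" for i j i' j' :: int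
  proof -
    \<comment> \<open>Both sides are conjugated by \<open>\<rho>\<^sub>1\<close>, which inverts
      \<open>a\<close> and \<open>b\<close>.\<close>
    have e: "B j \<cdot> A i = A i' \<cdot> B j'" using that by (simp add: PlusG_simps)
    have "\<rho>\<^sub>1 \<cdot> (B j \<cdot> A i) = B (-j) \<cdot> A (-i) \<cdot> \<rho>\<^sub>1"
      by (simp add: Aut.m_assoc[symmetric] \<rho>\<^sub>1_conj) (simp add: Aut.m_assoc \<rho>\<^sub>1_conj)
    moreover have "\<rho>\<^sub>1 \<cdot> (A i' \<cdot> B j') = A (-i') \<cdot> B (-j') \<cdot> \<rho>\<^sub>1"
      by (simp add: Aut.m_assoc[symmetric] \<rho>\<^sub>1_conj) (simp add: Aut.m_assoc \<rho>\<^sub>1_conj)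
    ultimately have "B (-j) \<cdot> A (-i) \<cdot> \<rho>\<^sub>1 = A (-i') \<cdot> B (-j') \<cdot> \<rho>\<^sub>1" using e by simp
    then show ?thesis by (simp add: PlusG_simps)
  qed
  show "b [^]\<^bsub>PlusG\<^esub> j = \<one>\<^bsub>PlusG\<^esub>"
    if "a [^]\<^bsub>PlusG\<^esub> (1::int) \<otimes>\<^bsub>PlusG\<^esub> b [^]\<^bsub>PlusG\<^esub> j = b [^]\<^bsub>PlusG\<^esub> l \<otimes>\<^bsub>PlusG\<^esub> a [^]\<^bsub>PlusG\<^esub> (1::int)" for j l :: int
  proof -
    \<comment> \<open>If \<open>a b^j = b^l a\<close>, then \<open>b^l\<close> fixes the base vertex
      and its neighbour \<open>\<rho>\<^sub>0 v\<^sub>0\<close>. No other edge has the same two ends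
      as the base edge, so \<open>b^l\<close> fixes that edge too and is trivial.\<close>
    have e: "a \<cdot> B j = B l \<cdot> a" using that by (simp add: PlusG_simps)
    have av: "a v\<^sub>0 = \<rho>\<^sub>0 v\<^sub>0" by (simp add: a_def Aut_mult_apply \<rho>\<^sub>1)
    have "B l (\<rho>\<^sub>0 v\<^sub>0) = (B l \<cdot> a) v\<^sub>0" by (simp add: Aut_mult_apply av)
    also have "\<dots> = \<rho>\<^sub>0 v\<^sub>0" unfolding e[symmetric] by (simp add: Aut_mult_apply B_vertex av)
    finally have fixes_nbr: "B l (\<rho>\<^sub>0 v\<^sub>0) = \<rho>\<^sub>0 v\<^sub>0" .
    have two: "{v\<in>V. v \<sqsubseteq> e} = {v\<^sub>0, \<rho>\<^sub>0 v\<^sub>0}" if e: "e \<in> E" "v\<^sub>0 \<sqsubseteq> e" "\<rho>\<^sub>0 v\<^sub>0 \<sqsubseteq> e" for e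
    proof -
      have "{v\<^sub>0, \<rho>\<^sub>0 v\<^sub>0} = {v\<in>V. v \<sqsubseteq> e}"
      proof (rule card_subset_eq)
        show "finite {v\<in>V. v \<sqsubseteq> e}" using card_vertices_edge[OF e(1)] by (simp add: card_ge_0_finite)
        show "{v\<^sub>0, \<rho>\<^sub>0 v\<^sub>0} \<subseteq> {v\<in>V. v \<sqsubseteq> e}" using e base_flag moved_flags(1) by (auto simp: flag_def)
        show "card {v\<^sub>0, \<rho>\<^sub>0 v\<^sub>0} = card {v\<in>V. v \<sqsubseteq> e}" using card_vertices_edge[OF e(1)] \<rho>\<^sub>0(3) by simp
      qed
      then show ?thesis ..
    qed
    have le: "e\<^sub>0 \<in> E" "v\<^sub>0 \<sqsubseteq> e\<^sub>0" "\<rho>\<^sub>0 v\<^sub>0 \<sqsubseteq> e\<^sub>0" using base_flag moved_flags(1) by (auto simp: flag_def)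
    have "B l e\<^sub>0 \<in> E" "v\<^sub>0 \<sqsubseteq> B l e\<^sub>0" "\<rho>\<^sub>0 v\<^sub>0 \<sqsubseteq> B l e\<^sub>0"
      using Aut_elems[OF AB_Aut(2) le(1)] Aut_mono[OF AB_Aut(2) le(2), of l] Aut_mono[OF AB_Aut(2) le(3), of l]
      by (simp_all add: fixes_nbr B_vertex)
    from simple[OF this(1) le(1)] two[OF this] two[OF le] have "B l e\<^sub>0 = e\<^sub>0" by simp
    then have "B l = \<one>\<^bsub>aut_group P\<^esub>" by (rule Plus_stabilizers(3)[OF B_Plus B_vertex])
    then have "a \<cdot> B j = a" using e by simp
    then have "B j = \<one>\<^bsub>aut_group P\<^esub>" by simp
    then show ?thesis by (simp add: PlusG_simps)
  qed
qed

end

section \<open>Standard models\<close>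

lemma order_iso_sym:
  assumes "order_iso r s f" shows "order_iso s r (inv_into (Field r) f)"
proof -
  have bij: "bij_betw f (Field r) (Field s)"
    and le: "\<And>x y. x \<in> Field r \<Longrightarrow> y \<in> Field r \<Longrightarrow> (x, y) \<in> r \<longleftrightarrow> (f x, f y) \<in> s"
    using assms by (auto simp: order_iso_def)
  show ?thesis unfolding order_iso_def
  proof (intro conjI ballI)
    show "bij_betw (inv_into (Field r) f) (Field s) (Field r)" using bij by (rule bij_betw_inv_into)
    fix x y assume xy: "x \<in> Field s" "y \<in> Field s"
    have "f (inv_into (Field r) f x) = x" "f (inv_into (Field r) f y) = y"
      using bij xy by (auto simp: bij_betw_def f_inv_into_f)
    moreover have "inv_into (Field r) f x \<in> Field r" "inv_into (Field r) f y \<in> Field r"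
      using bij xy by (auto simp: bij_betw_def inv_into_into)
    ultimately show "(x, y) \<in> s \<longleftrightarrow> (inv_into (Field r) f x, inv_into (Field r) f y) \<in> r"
      using le[of "inv_into (Field r) f x" "inv_into (Field r) f y"] by simp
  qed
qed

lemma isomorphic_sym: "isomorphic P Q \<Longrightarrow> isomorphic Q P"
  unfolding isomorphic_def using order_iso_sym by blast

text \<open>The theorem wants polyhedra on the natural numbers, so a rank and two residues are
  packed into one number. Residues are nonnegative, hence \<open>nat\<close> loses nothing.\<close>

definition code :: "nat \<Rightarrow> int \<Rightarrow> int \<Rightarrow> nat" where
  "code r x m = prod_encode (r, prod_encode (nat x, nat m))"

definition model_vertex :: "nat \<Rightarrow> int \<Rightarrow> nat" where
  "model_vertex p x = code 0 (x mod int p) 0"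

definition model_edge :: "nat \<Rightarrow> nat \<Rightarrow> int \<Rightarrow> int \<Rightarrow> nat" where
  "model_edge p q x m = code 1 (x mod int p) (m mod int q)"

definition model_face :: "nat \<Rightarrow> int \<Rightarrow> nat" where
  "model_face q j = code 2 (j mod int q) 0"

text \<open>The exponent of \<open>a\<close> in the normal form of \<open>b^m a\<close>, as computed
  in \<open>B_even_A1\<close> and \<open>B_odd_A1\<close>, with both parities of \<open>m\<close> in
  one formula.\<close>

definition neighbour :: "int \<Rightarrow> int \<Rightarrow> int" where
  "neighbour k m = (if even m then 1 else - 1) - (2 + 2 * k) * (m div 2)"

text \<open>The edge \<open>(x, m)\<close>, for even \<open>x\<close>, stands for the image of the base edge under \<open>a\<^sup>x b\<^sup>m\<close>. It joins the
  vertices \<open>x\<close> and \<open>x + neighbour k m\<close>, as \<open>b\<^sup>m a\<close> sends the base vertex to vertex \<open>neighbour k m\<close>, and lies on the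
  faces \<open>m\<close> and \<open>m - 1\<close>.\<close>

definition model :: "nat \<Rightarrow> nat \<Rightarrow> int \<Rightarrow> nat ranked_poset" where
  "model p q k =
     \<lparr>leq = Id_on (range (model_vertex p) \<union> {model_edge p q x m | x m. even x} \<union> range (model_face q)) \<union>
        {(model_vertex p x, model_edge p q y m) | x y m.
           even y \<and> (x mod int p = y mod int p \<or> x mod int p = (y + neighbour k m) mod int p)} \<union>
        {(model_edge p q x m, model_face q j) | x m j.
           even x \<and> (j mod int q = m mod int q \<or> j mod int q = (m - 1) mod int q)} \<union>
        {(model_vertex p x, model_face q j) | x j. True},
      rank = (\<lambda>z. fst (prod_decode z))\<rparr>"

text \<open>Maps on the model are given by three coordinate functions. By
  \<open>model_map_apply\<close> these may be evaluated at any representatives once they respect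
  residues.\<close>

definition model_map :: "(int \<Rightarrow> 'b) \<Rightarrow> (int \<Rightarrow> int \<Rightarrow> 'b) \<Rightarrow> (int \<Rightarrow> 'b) \<Rightarrow> nat \<Rightarrow> 'b" where
  "model_map gv ge gf z =
     (case prod_decode z of (r, y) \<Rightarrow> case prod_decode y of (x, m) \<Rightarrow>
        if r = 0 then gv (int x) else if r = 1 then ge (int x) (int m) else gf (int x))"

context
  fixes p q :: nat
  assumes pos: "p > 0" "q > 0"
begin

lemma model_vertex_eq: "model_vertex p x = model_vertex p y \<longleftrightarrow> x mod int p = y mod int p"
  using pos by (simp add: model_vertex_def code_def eq_nat_nat_iff)

lemma model_face_eq: "model_face q x = model_face q y \<longleftrightarrow> x mod int q = y mod int q"
  using pos by (simp add: model_face_def code_def eq_nat_nat_iff)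

lemma model_edge_eq:
  "model_edge p q x m = model_edge p q y m' \<longleftrightarrow> x mod int p = y mod int p \<and> m mod int q = m' mod int q"
  using pos by (simp add: model_edge_def code_def eq_nat_nat_iff)

lemma model_neq [simp]:
  "model_vertex p x \<noteq> model_edge p q y m" "model_vertex p x \<noteq> model_face q j" "model_edge p q y m \<noteq> model_face q j"
  "model_edge p q y m \<noteq> model_vertex p x" "model_face q j \<noteq> model_vertex p x" "model_face q j \<noteq> model_edge p q y m"
  by (simp_all add: model_vertex_def model_edge_def model_face_def code_def)

lemma model_rank [simp]:
  "rank (model p' q' k) (model_vertex p x) = 0" "rank (model p' q' k) (model_edge p q x m) = 1"
  "rank (model p' q' k) (model_face q j) = 2"
  by (simp_all add: model_def model_vertex_def model_edge_def model_face_def code_def)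

lemma model_map_apply:
  "(\<And>x. gv (x mod int p) = gv x) \<Longrightarrow> model_map gv ge gf (model_vertex p x) = gv x"
  "(\<And>x m. ge (x mod int p) (m mod int q) = ge x m) \<Longrightarrow> model_map gv ge gf (model_edge p q x m) = ge x m"
  "(\<And>x. gf (x mod int q) = gf x) \<Longrightarrow> model_map gv ge gf (model_face q x) = gf x"
  using pos by (simp_all add: model_map_def model_vertex_def model_edge_def model_face_def code_def)

lemma Field_model:
  "Field (leq (model p q k)) = range (model_vertex p) \<union> {model_edge p q x m | x m. even x} \<union> range (model_face q)"
proof
  show "range (model_vertex p) \<union> {model_edge p q x m | x m. even x} \<union> range (model_face q) \<subseteq> Field (leq (model p q k))"
  proof
    fix z assume "z \<in> range (model_vertex p) \<union> {model_edge p q x m | x m. even x} \<union> range (model_face q)"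
    then have "(z, z) \<in> leq (model p q k)"
      unfolding model_def ranked_poset.select_convs by - (rule UnI1, rule UnI1, rule UnI1, rule Id_onI)
    then show "z \<in> Field (leq (model p q k))" by (rule FieldI1)
  qed
  show "Field (leq (model p q k)) \<subseteq> range (model_vertex p) \<union> {model_edge p q x m | x m. even x} \<union> range (model_face q)"
    unfolding model_def Field_def by fastforce
qed

lemma model_le_edge_face:
  assumes "even x"
  shows "(model_edge p q x m, model_face q j) \<in> leq (model p q k) \<longleftrightarrow>
    j mod int q = m mod int q \<or> j mod int q = (m - 1) mod int q" (is "?l = ?r")
proof
  assume ?l
  then obtain x' m' j' where "model_edge p q x m = model_edge p q x' m'" "model_face q j = model_face q j'"
    "j' mod int q = m' mod int q \<or> j' mod int q = (m' - 1) mod int q"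
    by (auto simp: model_def)
  then show ?r unfolding model_edge_eq model_face_eq by (metis mod_diff_left_eq)
qed (use assms in \<open>auto simp: model_def\<close>)

lemma model_le_vertex_face: "(model_vertex p x, model_face q j) \<in> leq (model p q k)"
  by (auto simp: model_def)

lemma model_le_refl: "z \<in> Field (leq (model p q k)) \<Longrightarrow> (z, z) \<in> leq (model p q k)"
  unfolding Field_model unfolding model_def ranked_poset.select_convs
  by (rule UnI1, rule UnI1, rule UnI1, rule Id_onI)

lemma model_not_le [simp]:
  "(model_edge p q x m, model_vertex p y) \<notin> leq (model p q k)"
  "(model_face q j, model_vertex p y) \<notin> leq (model p q k)"
  "(model_face q j, model_edge p q x m) \<notin> leq (model p q k)"
  by (auto simp: model_def)

lemma model_le_same [simp]:
  "(model_vertex p x, model_vertex p y) \<in> leq (model p q k) \<longleftrightarrow> model_vertex p x = model_vertex p y"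
  "even x \<Longrightarrow> (model_edge p q x m, model_edge p q y m') \<in> leq (model p q k) \<longleftrightarrow> model_edge p q x m = model_edge p q y m'"
  "(model_face q j, model_face q j') \<in> leq (model p q k) \<longleftrightarrow> model_face q j = model_face q j'"
  by (auto simp: model_def) metis

end

locale model_params =
  fixes p q :: nat and k :: int
  assumes even_p: "even p" and even_q: "even q" and q_bounds: "4 \<le> q" "q < p"
    and admissible: "admissible_exponent p q k"
begin

lemma pos: "p > 0" "q > 0" using q_bounds by auto

lemma exponent_dvd: "int p dvd (2 + 2 * k) * j \<longleftrightarrow> int q dvd 2 * j"
  and exponent_square: "int p dvd 2 * (k * k) - 2"
  using admissible by (auto simp: admissible_exponent_def)

lemma odd_neighbour: "odd (neighbour k m)" by (simp add: neighbour_def)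

lemma neighbour_even: "neighbour k (2 * t) = 1 - (2 + 2 * k) * t"
  and neighbour_odd: "neighbour k (2 * t + 1) = -1 - (2 + 2 * k) * t"
  by (simp_all add: neighbour_def)

lemma neighbour_cong: "m mod int q = m' mod int q \<Longrightarrow> neighbour k m mod int p = neighbour k m' mod int p"
proof -
  assume "m mod int q = m' mod int q"
  then have "int q dvd m - m'" by (simp only: mod_eq_dvd_iff)
  moreover from this have "even (m - m')" using even_q by (meson dvd_trans even_of_nat)
  then obtain t where t: "m = m' + 2 * t" by (metis add_diff_cancel_left' diff_add_cancel evenE add.commute)
  ultimately have "int q dvd 2 * t" by simp
  then have "int p dvd (2 + 2 * k) * (- t)" by (simp only: exponent_dvd) simp
  moreover have "neighbour k m - neighbour k m' = (2 + 2 * k) * (- t)"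
    by (simp add: neighbour_def t algebra_simps)
  ultimately show ?thesis by (simp only: mod_eq_dvd_iff)
qed

text \<open>In coordinates this is the absence of multiple edges. For \<open>m\<close> and
  \<open>m'\<close> of equal parity it is the order condition on \<open>2 + 2k\<close>.\<close>

lemma neighbour_inj:
  assumes "neighbour k m mod int p = neighbour k m' mod int p" shows "m mod int q = m' mod int q"
proof -
  have d: "int p dvd neighbour k m - neighbour k m'" using assms by (simp only: mod_eq_dvd_iff)
  \<comment> \<open>For opposite parities \<open>1 + k\<close> would be invertible modulo
    \<open>p/2\<close>, so its order \<open>q/2\<close> would be a multiple of \<open>p/2\<close>,
    against \<open>q < p\<close>.\<close>
  have mixed: False if h: "int p dvd neighbour k (2 * t) - neighbour k (2 * t' + 1)" for t t'
  proof -
    obtain n where n: "p = 2 * n" using even_p by (rule evenE)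
    have "neighbour k (2 * t) - neighbour k (2 * t' + 1) = 2 * (1 - (1 + k) * (t - t'))"
      by (simp only: neighbour_even neighbour_odd) (simp add: algebra_simps)
    then have "2 * int n dvd 2 * (1 - (1 + k) * (t - t'))" using h n by simp
    then have 1: "int n dvd 1 - (1 + k) * (t - t')" by (simp only: dvd_mult_cancel_left) simp
    obtain l where l: "q = 2 * l" using even_q by (rule evenE)
    have "int p dvd (2 + 2 * k) * int l" by (simp only: exponent_dvd) (simp add: l)
    moreover have "(2 + 2 * k) * int l = 2 * ((1 + k) * int l)" by (simp add: algebra_simps)
    ultimately have "2 * int n dvd 2 * ((1 + k) * int l)" by (simp add: n)
    then have "int n dvd (1 + k) * int l" by (simp only: dvd_mult_cancel_left) simp
    then have "int n dvd (1 - (1 + k) * (t - t')) * int l + ((1 + k) * int l) * (t - t')"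
      using 1 by simp
    also have "(1 - (1 + k) * (t - t')) * int l + ((1 + k) * int l) * (t - t') = int l"
      by (simp add: algebra_simps)
    finally have "n dvd l" by (simp only: int_dvd_int_iff)
    then have "n \<le> l" using pos l by (intro dvd_imp_le) auto
    then show False using q_bounds n l by simp
  qed
  have same: "int q dvd 2 * (t - t')" if h: "int p dvd (2 + 2 * k) * t' - (2 + 2 * k) * t" for t t'
  proof -
    have "int p dvd (2 + 2 * k) * (t' - t)" using h by (simp add: right_diff_distrib)
    then have "int q dvd 2 * (t' - t)" by (simp only: exponent_dvd)
    moreover have "2 * (t - t') = - (2 * (t' - t))" by simp
    ultimately show ?thesis by (metis dvd_minus_iff)
  qed
  have "int q dvd m - m'"
  proof (cases "even m"; cases "even m'")
    assume "even m" "even m'"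
    then obtain t t' where t: "m = 2 * t" "m' = 2 * t'" by (meson evenE)
    have "int q dvd 2 * (t - t')" using d unfolding t neighbour_even by (intro same) (simp add: algebra_simps)
    then show ?thesis by (simp add: t)
  next
    assume "odd m" "odd m'"
    then obtain t t' where t: "m = 2 * t + 1" "m' = 2 * t' + 1" by (meson oddE)
    have "int q dvd 2 * (t - t')" using d unfolding t neighbour_odd by (intro same) (simp add: algebra_simps)
    then show ?thesis by (simp add: t)
  next
    assume "even m" "odd m'"
    then obtain t t' where "m = 2 * t" "m' = 2 * t' + 1" by (meson evenE oddE)
    then show ?thesis using mixed d by blast
  next
    assume "odd m" "even m'"
    then obtain t t' where "m = 2 * t + 1" "m' = 2 * t'" by (meson evenE oddE)
    then show ?thesis using mixed d by (metis dvd_diff_commute)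
  qed
  then show ?thesis by (simp only: mod_eq_dvd_iff)
qed

lemma parity_mod: "x mod int p = y mod int p \<Longrightarrow> even x \<longleftrightarrow> even y"
  using even_p by (metis dvd_mod_iff even_of_nat)

lemma model_le_vertex_edge:
  assumes "even y"
  shows "(model_vertex p x, model_edge p q y m) \<in> leq (model p q k) \<longleftrightarrow>
    x mod int p = y mod int p \<or> x mod int p = (y + neighbour k m) mod int p" (is "?l = ?r")
proof
  assume ?l
  then obtain x' y' m' where e: "model_vertex p x = model_vertex p x'" "model_edge p q y m = model_edge p q y' m'"
    and h: "x' mod int p = y' mod int p \<or> x' mod int p = (y' + neighbour k m') mod int p"
    by (auto simp: model_def model_neq[OF pos])
  have c: "x mod int p = x' mod int p" "y mod int p = y' mod int p" "m mod int q = m' mod int q"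
    using e by (simp_all add: model_vertex_eq[OF pos] model_edge_eq[OF pos])
  have "(y + neighbour k m) mod int p = (y' + neighbour k m') mod int p"
    by (rule mod_add_cong[OF c(2) neighbour_cong[OF c(3)]])
  then show ?r using h c by simp
qed (use assms in \<open>auto simp: model_def\<close>)

text \<open>Between different levels the incidences of \<open>R\<close> are prescribed in
  coordinates, and within a level the order is equality because ranks increase strictly. So the
  coordinate map preserves and reflects the order.\<close>

lemma model_isomorphic:
  fixes R :: "'b ranked_poset"
  assumes R: "finite_polyhedron R"
    and gv: "\<And>x. gv (x mod int p) = gv x" and ge: "\<And>x m. ge (x mod int p) (m mod int q) = ge x m"
    and gf: "\<And>j. gf (j mod int q) = gf j"
    and gv_img: "range gv = elems R 0" and ge_img: "{ge x m | x m. even x} = elems R 1"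
    and gf_img: "range gf = elems R 2"
    and gv_inj: "\<And>x y. gv x = gv y \<Longrightarrow> x mod int p = y mod int p"
    and ge_inj: "\<And>x y m m'. even x \<Longrightarrow> even y \<Longrightarrow> ge x m = ge y m' \<Longrightarrow> x mod int p = y mod int p \<and> m mod int q = m' mod int q"
    and gf_inj: "\<And>i j. gf i = gf j \<Longrightarrow> i mod int q = j mod int q"
    and ve: "\<And>x y m. even y \<Longrightarrow> (gv x, ge y m) \<in> leq R \<longleftrightarrow> x mod int p = y mod int p \<or> x mod int p = (y + neighbour k m) mod int p"
    and ef: "\<And>x m j. even x \<Longrightarrow> (ge x m, gf j) \<in> leq R \<longleftrightarrow> j mod int q = m mod int q \<or> j mod int q = (m - 1) mod int q"
    and vf: "\<And>x j. (gv x, gf j) \<in> leq R"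
  shows "isomorphic (model p q k) R"
proof -
  interpret R: finite_polyhedron R by (rule R)
  define g where "g = model_map gv ge gf"
  have g: "g (model_vertex p x) = gv x" "g (model_edge p q x m) = ge x m" "g (model_face q j) = gf j" for x m j
    unfolding g_def by (rule model_map_apply[OF pos]; simp only: gv ge gf)+
  have elems: "gv x \<in> elems R 0" "even x \<Longrightarrow> ge x m \<in> elems R 1" "gf j \<in> elems R 2" for x m j
    using gv_img ge_img gf_img by auto
  have rank: "rank R (gv x) = 0" "even x \<Longrightarrow> rank R (ge x m) = 1" "rank R (gf j) = 2" for x m j
    using elems by (auto simp: elems_def)
  have refl: "(gv x, gv x) \<in> leq R" "even x \<Longrightarrow> (ge x m, ge x m) \<in> leq R" "(gf j, gf j) \<in> leq R" for x m j
    using elems R.le_refl by (auto simp: elems_def)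
  have nle: "(y, x) \<notin> leq R" if "rank R x < rank R y" for x y
    using R.rank_less[of y x] that by fastforce
  have Field_R: "Field (leq R) = range gv \<union> {ge x m | x m. even x} \<union> range gf"
    unfolding gv_img ge_img gf_img using R.Field_cases by (auto simp: elems_def)
  let ?M = "leq (model p q k)"
  have cases: "(\<exists>x. z = model_vertex p x) \<or> (\<exists>x m. even x \<and> z = model_edge p q x m) \<or> (\<exists>j. z = model_face q j)"
    if "z \<in> Field ?M" for z
    using that unfolding Field_model[OF pos] by auto
  have le: "(z, z') \<in> ?M \<longleftrightarrow> (g z, g z') \<in> leq R" if z: "z \<in> Field ?M" "z' \<in> Field ?M" for z z'
  proof -
    have vv: "(gv x, gv y) \<in> leq R \<longleftrightarrow> model_vertex p x = model_vertex p y" for x y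
      using R.same_rank[of "gv x" "gv y"] rank gv_inj[of x y] gv[of x] gv[of y] refl(1)[of x] model_vertex_eq[OF pos, of x y] by metis
    have ee: "(ge x m, ge y m') \<in> leq R \<longleftrightarrow> model_edge p q x m = model_edge p q y m'" if "even x" "even y" for x y m m'
      using R.same_rank[of "ge x m" "ge y m'"] rank(2) that ge_inj[of x y m m'] ge[of x m] ge[of y m'] refl(2)[of x m]
        model_edge_eq[OF pos, of x m y m'] by metis
    have ff: "(gf i, gf j) \<in> leq R \<longleftrightarrow> model_face q i = model_face q j" for i j
      using R.same_rank[of "gf i" "gf j"] rank gf_inj[of i j] gf[of i] gf[of j] refl(3)[of i] model_face_eq[OF pos, of i j] by metis
    note s = vv ee ff ve ef vf model_le_vertex_edge model_le_edge_face[OF pos] model_le_vertex_face[OF pos] g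
      model_not_le[OF pos] model_le_same[OF pos] nle rank
    from cases[OF z(1)] cases[OF z(2)] show ?thesis
      by (elim disjE exE conjE; hypsubst) (simp_all add: s)
  qed
  have inj: "inj_on g (Field ?M)"
  proof (rule inj_onI)
    fix z z' assume z: "z \<in> Field ?M" "z' \<in> Field ?M" "g z = g z'"
    have "(g z, g z') \<in> leq R" "(g z', g z) \<in> leq R"
      using le[OF z(1) z(1)] z model_le_refl[OF pos z(1)] by auto
    then have "(z, z') \<in> ?M" "(z', z) \<in> ?M" using le z by auto
    then have "z = z'" if "True" using cases[OF z(1)] cases[OF z(2)]
      by (elim disjE exE conjE; hypsubst) (simp_all add: model_not_le[OF pos] model_le_same[OF pos])
    then show "z = z'" by simp
  qed
  have "g ` {model_edge p q x m | x m. even x} = {ge x m | x m. even x}"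
  proof
    show "{ge x m | x m. even x} \<subseteq> g ` {model_edge p q x m | x m. even x}"
    proof
      fix y assume "y \<in> {ge x m | x m. even x}"
      then obtain x m where "even x" "y = g (model_edge p q x m)" using g(2) by auto
      then show "y \<in> g ` {model_edge p q x m | x m. even x}" by blast
    qed
  qed (auto simp: g, blast)
  then have img: "g ` Field ?M = Field (leq R)"
    unfolding Field_model[OF pos] Field_R image_Un by (simp add: image_image g)
  show ?thesis unfolding isomorphic_def order_iso_def bij_betw_def
    by (intro exI[of _ g] conjI ballI inj img le)
qed

end

text \<open>\<open>k\<close> enters the model only through \<open>2k\<close> modulo
  \<open>p\<close>.\<close>

lemma model_cong:
  assumes "int p dvd 2 * (k - k')" shows "model p q k = model p q k'"
proof -
  have "neighbour k m mod int p = neighbour k' m mod int p" for m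
  proof -
    have "neighbour k m - neighbour k' m = 2 * (k - k') * (- (m div 2))"
      by (simp add: neighbour_def algebra_simps)
    then show ?thesis using assms by (simp only: mod_eq_dvd_iff dvd_mult2)
  qed
  then have "(y + neighbour k m) mod int p = (y + neighbour k' m) mod int p" for y m
    by (metis mod_add_right_eq)
  then show ?thesis unfolding model_def by simp
qed

section \<open>Recognizing the polyhedron from its rotation group\<close>

context tight_simple_rooted begin

interpretation PG: tight_simple_group PlusG a b by (rule tight_simple_group)

lemma ord_ab: "group.ord PlusG a = p" "group.ord PlusG b = q"
  using PG.card_range_A tight_group.card_range_A[OF PG.swap] card_range by (simp_all add: PlusG_simps)

lemma A_eq_iff: "A i = A j \<longleftrightarrow> int p dvd i - j" and B_eq_iff: "B i = B j \<longleftrightarrow> int q dvd i - j"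
  using PG.A_eq_iff PG.B_eq_iff by (simp_all add: PlusG_simps ord_ab)

lemma q_ge_2: "2 \<le> q" and p_ge_2: "2 \<le> p"
proof -
  have fl: "v\<^sub>0 \<in> V" "f\<^sub>0 \<in> F" "v\<^sub>0 \<sqsubseteq> f\<^sub>0" using base_flag flag_le[OF base_flag] by (auto simp: flag_def)
  have fin: "finite {e\<in>E. Q e}" for Q
    by (rule finite_subset[OF _ finite_Field]) (auto simp: elems_def)
  have "card {e\<in>E. v\<^sub>0 \<sqsubseteq> e \<and> e \<sqsubseteq> f\<^sub>0} \<le> card {e\<in>E. v\<^sub>0 \<sqsubseteq> e}"
    "card {e\<in>E. v\<^sub>0 \<sqsubseteq> e \<and> e \<sqsubseteq> f\<^sub>0} \<le> card {e\<in>E. e \<sqsubseteq> f\<^sub>0}"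
    by (rule card_mono[OF fin]; auto)+
  then show "2 \<le> q" "2 \<le> p"
    using card_edges_vertex_face[OF fl] valency[OF fl(1)] face_size[OF fl(2)] by auto
qed

lemma vertex_form:
  assumes "v \<in> V" shows "\<exists>i. v = A i v\<^sub>0"
proof -
  obtain e f where "flag v e f" using flag_through_V assms by blast
  then obtain g where g: "g \<in> Aut" "g v\<^sub>0 = v" using flag_image by blast
  then have "(g \<cdot> \<rho>\<^sub>1) v\<^sub>0 = v" by (simp add: Aut_mult_apply \<rho>\<^sub>1)
  then obtain h where h: "h \<in> Plus" "h v\<^sub>0 = v" using Aut_Plus_cases g by blast
  then obtain i j where "h = A i \<cdot> B j" using Plus_eq by blast
  then show ?thesis using h by (auto simp: Aut_mult_apply B_vertex)
qed

lemma face_form: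
  assumes "f \<in> F" shows "\<exists>j. f = B j f\<^sub>0"
proof -
  obtain v e where "flag v e f" using flag_through_F assms by blast
  then obtain g where g: "g \<in> Aut" "g f\<^sub>0 = f" using flag_image by blast
  then have "(g \<cdot> \<rho>\<^sub>1) f\<^sub>0 = f" by (simp add: Aut_mult_apply \<rho>\<^sub>1)
  then obtain h where h: "h \<in> Plus" "h f\<^sub>0 = f" using Aut_Plus_cases g by blast
  \<comment> \<open>Factorizing the inverse yields the opposite order of the factors; the right-hand
    one then lies in \<open><a>\<close> and fixes the base face.\<close>
  then obtain i j where "inv\<^bsub>aut_group P\<^esub> h = A i \<cdot> B j" using Plus_eq Plus_inv by blast
  then have "inv\<^bsub>aut_group P\<^esub> (inv\<^bsub>aut_group P\<^esub> h) = B (-j) \<cdot> A (-i)"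
    by (simp add: Aut.inv_mult_group Aut.int_pow_neg)
  then have "h = B (-j) \<cdot> A (-i)" using Plus_Aut[OF h(1)] by simp
  then show ?thesis using h by (auto simp: Aut_mult_apply A_face)
qed

lemma edge_form:
  assumes "e \<in> E" shows "\<exists>i j. e = (A i \<cdot> B j) e\<^sub>0"
proof -
  obtain v f where "flag v e f" using flag_through_E assms by blast
  then obtain g where g: "g \<in> Aut" "g e\<^sub>0 = e" using flag_image by blast
  have "\<exists>h\<in>Plus. h e\<^sub>0 = e"
  proof (cases "g \<in> Plus")
    case False
    \<comment> \<open>\<open>\<rho>\<^sub>2\<close> fixes the base edge, so \<open>g\<close> may be
      replaced by \<open>g \<cdot> \<rho>\<^sub>2 = g \<cdot> \<rho>\<^sub>1 \<cdot> b\<close>,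
      which is a rotation.\<close>
    then have "g \<cdot> \<rho>\<^sub>1 \<in> Plus" using Aut_Plus_cases g by blast
    then have "g \<cdot> \<rho>\<^sub>1 \<cdot> b \<in> Plus" using Plus_mult ab_Plus by blast
    moreover have "g \<cdot> \<rho>\<^sub>1 \<cdot> b = (g \<cdot> \<rho>\<^sub>1 \<cdot> \<rho>\<^sub>1) \<cdot> \<rho>\<^sub>2" using g by (simp add: b_def Aut.m_assoc)
    ultimately have "g \<cdot> \<rho>\<^sub>2 \<in> Plus" using g by (simp add: \<rho>_cancel)
    moreover have "(g \<cdot> \<rho>\<^sub>2) e\<^sub>0 = e" using g by (simp add: Aut_mult_apply \<rho>\<^sub>2)
    ultimately show ?thesis by blast
  qed (use g in blast)
  then obtain h where h: "h \<in> Plus" "h e\<^sub>0 = e" by blast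
  obtain i j where "h = A i \<cdot> B j" using Plus_eq[OF h(1)] by blast
  then show ?thesis using h(2) by blast
qed

lemma moved_vertex: "A 1 v\<^sub>0 = \<rho>\<^sub>0 v\<^sub>0"
  by (simp add: a_def Aut_mult_apply \<rho>\<^sub>1)

lemma moved_face: "B (-1) f\<^sub>0 = \<rho>\<^sub>2 f\<^sub>0"
proof -
  have "B (-1) = \<rho>\<^sub>2 \<cdot> \<rho>\<^sub>1" by (simp add: Aut.int_pow_neg ab_inv)
  then show ?thesis by (simp add: Aut_mult_apply \<rho>\<^sub>1)
qed

text \<open>All vertices have the form \<open>A l v\<^sub>0\<close> and \<open><a>\<close> fixes the
  base face, so every vertex lies on it. \<open><b>\<close> carries the base face to every other
  face.\<close>

lemma vertex_le_face: "A i v\<^sub>0 \<sqsubseteq> B j f\<^sub>0"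
proof -
  have le: "A l v\<^sub>0 \<sqsubseteq> f\<^sub>0" for l
    using Aut_mono[OF AB_Aut(1) flag_le[OF base_flag], of l] by (simp add: A_face)
  have "v\<^sub>0 \<in> V" using base_flag by (simp add: flag_def)
  then have "B (-j) (A i v\<^sub>0) \<in> V" by (rule Aut_elems[OF AB_Aut(2) Aut_elems[OF AB_Aut(1)]])
  then obtain l where "B (-j) (A i v\<^sub>0) = A l v\<^sub>0" using vertex_form by blast
  then have "B (-j) (A i v\<^sub>0) \<sqsubseteq> f\<^sub>0" using le by simp
  then have "B j (B (-j) (A i v\<^sub>0)) \<sqsubseteq> B j f\<^sub>0" by (rule Aut_mono[OF AB_Aut(2)])
  moreover have "B j (B (-j) (A i v\<^sub>0)) = (B j \<cdot> B (-j)) (A i v\<^sub>0)" by (simp add: Aut_mult_apply Aut_closed)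
  moreover have "B j \<cdot> B (-j) = \<one>\<^bsub>aut_group P\<^esub>" by (simp add: Aut.int_pow_mult[symmetric])
  ultimately show ?thesis by (simp add: Aut_one_apply Aut_closed)
qed

lemma edge_ends:
  assumes "e \<in> E" "x \<in> V" "y \<in> V" "x \<sqsubseteq> e" "y \<sqsubseteq> e" "x \<noteq> y" "z \<in> V"
  shows "z \<sqsubseteq> e \<longleftrightarrow> z = x \<or> z = y"
  using card_two_unique[OF card_vertices_edge[OF assms(1)], of x y z] assms by auto

lemma edge_faces:
  assumes "e \<in> E" "x \<in> F" "y \<in> F" "e \<sqsubseteq> x" "e \<sqsubseteq> y" "x \<noteq> y" "z \<in> F"
  shows "e \<sqsubseteq> z \<longleftrightarrow> z = x \<or> z = y"
  using card_two_unique[OF card_faces_edge[OF assms(1)], of x y z] assms by auto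

lemma base_elems: "v\<^sub>0 \<in> V" "e\<^sub>0 \<in> E" "f\<^sub>0 \<in> F"
  using base_flag by (auto simp: flag_def)

lemma base_le: "v\<^sub>0 \<sqsubseteq> e\<^sub>0" "A 1 v\<^sub>0 \<sqsubseteq> e\<^sub>0" "e\<^sub>0 \<sqsubseteq> f\<^sub>0" "e\<^sub>0 \<sqsubseteq> B (-1) f\<^sub>0"
  using base_flag moved_flags unfolding moved_vertex moved_face flag_def by auto

theorem large_valency:
  assumes "3 \<le> q"
  obtains "odd q" "p = 2 * q"
    | k where "even q" "even p" "4 \<le> q" "q < p" "admissible_exponent p q k" "isomorphic (model p q k) P"
proof -
  obtain k :: int where k: "b [^]\<^bsub>PlusG\<^esub> (1::int) \<otimes>\<^bsub>PlusG\<^esub> a [^]\<^bsub>PlusG\<^esub> (2::int) =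
      a [^]\<^bsub>PlusG\<^esub> (2 * k) \<otimes>\<^bsub>PlusG\<^esub> b [^]\<^bsub>PlusG\<^esub> (1::int)"
    using PG.exponent_exists by blast
  have ep: "even p" using PG.ord_a_even assms by (simp add: ord_ab)
  show thesis
  proof (cases "even q")
    case False
    then have "p = 2 * q" using PG.ord_b_odd[OF k] ep by (simp add: ord_ab)
    then show thesis using that(1) False by simp
  next
    case True
    have q4: "4 \<le> q" using assms True by (cases "q = 3") auto
    have "a \<noteq> \<one>\<^bsub>PlusG\<^esub>"
    proof
      assume "a = \<one>\<^bsub>PlusG\<^esub>"
      then have "A 1 = A 0" by (simp add: PlusG_simps)
      then have "int p dvd 1" by (simp only: A_eq_iff) simp
      then show False using p_ge_2 by simp
    qed
    then have qp: "q < p" using PG.ord_b_less_ord_a by (simp add: ord_ab)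
    have adm: "admissible_exponent p q k"
      using PG.exponent_square[OF k] PG.order_relation[OF k] by (simp add: admissible_exponent_def ord_ab)
    interpret M: model_params p q k
      by unfold_locales (use ep True q4 qp adm in auto)
    have BA: "B m \<cdot> A 1 = A (neighbour k m) \<cdot> B (-m)" for m
    proof (cases "even m")
      case True
      then obtain t where t: "m = 2 * t" ..
      show ?thesis using PG.B_even_A1[OF k, of t] unfolding t M.neighbour_even by (simp add: PlusG_simps)
    next
      case False
      then obtain t where t: "m = 2 * t + 1" by (rule oddE)
      show ?thesis using PG.B_odd_A1[OF k, of t] unfolding t M.neighbour_odd by (simp add: PlusG_simps)
    qed
    \<comment> \<open>Even powers of \<open>a\<close> can be moved across \<open>b^m\<close>, so
      \<open>A x \<cdot> B m\<close> with even \<open>x\<close> sends the base face to face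
      \<open>m\<close>. This determines the faces at the edge labelled
      \<open>(x, m)\<close>.\<close>
    have AevenB: "\<exists>y. A x \<cdot> B m = B m \<cdot> A y" if "even x" for x m
      using that PG.A_even_B[OF k, of _ m] by (auto elim!: evenE simp: PlusG_simps)
    have A_mod: "A (x mod int p) = A x" and B_mod: "B (x mod int q) = B x" for x
      unfolding A_eq_iff B_eq_iff mod_eq_dvd_iff[symmetric] by simp_all
    define gv ge gf where "gv x = A x v\<^sub>0" and "ge x m = (A x \<cdot> B m) e\<^sub>0" and "gf j = B j f\<^sub>0" for x m j
    have elems: "gv x \<in> V" "ge x m \<in> E" "gf j \<in> F" for x m j
      unfolding gv_def ge_def gf_def
      using Aut_elems[OF AB_Aut(1) base_elems(1)] Aut_elems[of "A x \<cdot> B m", OF _ base_elems(2)]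
        Aut_elems[OF AB_Aut(2) base_elems(3)] by simp_all
    have gv_eq: "gv x = gv y \<longleftrightarrow> x mod int p = y mod int p" for x y
      unfolding gv_def mod_eq_dvd_iff A_eq_iff[symmetric] using A_vertex_inj by metis
    have gf_eq: "gf x = gf y \<longleftrightarrow> x mod int q = y mod int q" for x y
      unfolding gf_def mod_eq_dvd_iff B_eq_iff[symmetric] using B_face_inj by metis
    have ve_le: "gv x \<sqsubseteq> ge x m" "gv (x + neighbour k m) \<sqsubseteq> ge x m" for x m
    proof -
      have "(A x \<cdot> B m) v\<^sub>0 \<sqsubseteq> ge x m" unfolding ge_def by (rule Aut_mono) (simp_all add: base_le)
      then show "gv x \<sqsubseteq> ge x m" by (simp add: gv_def Aut_mult_apply B_vertex)
      have "(A x \<cdot> B m) (A 1 v\<^sub>0) = (A x \<cdot> (B m \<cdot> A 1)) v\<^sub>0" by (simp add: Aut_mult_apply Aut_closed)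
      also have "\<dots> = gv (x + neighbour k m)"
        unfolding BA gv_def by (simp add: Aut_mult_apply Aut_closed B_vertex Aut.int_pow_mult)
      finally show "gv (x + neighbour k m) \<sqsubseteq> ge x m"
        using Aut_mono[OF _ base_le(2), of "A x \<cdot> B m"] by (simp add: ge_def)
    qed
    have ve: "gv x \<sqsubseteq> ge y m \<longleftrightarrow> x mod int p = y mod int p \<or> x mod int p = (y + neighbour k m) mod int p"
      if "even y" for x y m
    proof -
      have "gv y \<noteq> gv (y + neighbour k m)"
        using M.parity_mod[of y "y + neighbour k m"] M.odd_neighbour that by (auto simp: gv_eq)
      from edge_ends[OF elems(2) elems(1) elems(1) ve_le(1) ve_le(2) this elems(1)]
      show ?thesis by (simp only: gv_eq)
    qed
    have ef_le: "ge x m \<sqsubseteq> gf m" "ge x m \<sqsubseteq> gf (m - 1)" if ev: "even x" for x m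
    proof -
      obtain y where y: "A x \<cdot> B m = B m \<cdot> A y" using AevenB[OF ev] by blast
      have "(A x \<cdot> B m) f\<^sub>0 = gf m" by (simp add: y gf_def Aut_mult_apply A_face)
      then show "ge x m \<sqsubseteq> gf m" using Aut_mono[OF _ base_le(3), of "A x \<cdot> B m"] by (simp add: ge_def)
      obtain z where z: "A x \<cdot> B (m - 1) = B (m - 1) \<cdot> A z" using AevenB[OF ev] by blast
      have "(A x \<cdot> B m) (B (-1) f\<^sub>0) = (A x \<cdot> (B m \<cdot> B (-1))) f\<^sub>0" by (simp add: Aut_mult_apply Aut_closed)
      also have "B m \<cdot> B (-1) = B (m - 1)" by (simp add: Aut.int_pow_mult[symmetric])
      also have "(A x \<cdot> B (m - 1)) f\<^sub>0 = gf (m - 1)" by (simp add: z gf_def Aut_mult_apply A_face)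
      finally show "ge x m \<sqsubseteq> gf (m - 1)"
        using Aut_mono[OF _ base_le(4), of "A x \<cdot> B m"] by (simp add: ge_def)
    qed
    have ef: "ge x m \<sqsubseteq> gf j \<longleftrightarrow> j mod int q = m mod int q \<or> j mod int q = (m - 1) mod int q"
      if "even x" for x m j
    proof -
      have "gf m \<noteq> gf (m - 1)" using q4 by (auto simp: gf_eq mod_eq_dvd_iff)
      from edge_faces[OF elems(2) elems(3) elems(3) ef_le(1)[OF that] ef_le(2)[OF that] this elems(3)]
      show ?thesis by (simp only: gf_eq)
    qed
    have "isomorphic (model p q k) P"
    proof (rule M.model_isomorphic[where gv = gv and ge = ge and gf = gf])
      show "finite_polyhedron P" by unfold_locales
      show "gv (x mod int p) = gv x" for x by (simp add: gv_eq)
      show "ge (x mod int p) (m mod int q) = ge x m" for x m by (simp add: ge_def A_mod B_mod)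
      show "gf (j mod int q) = gf j" for j by (simp add: gf_eq)
      show "range gv = V"
      proof
        show "V \<subseteq> range gv" using vertex_form unfolding gv_def by blast
      qed (use elems in auto)
      show "range gf = F"
      proof
        show "F \<subseteq> range gf" using face_form unfolding gf_def by blast
      qed (use elems in auto)
      show "{ge x m | x m. even x} = E"
      proof
        show "E \<subseteq> {ge x m | x m. even x}"
        proof
          fix e assume "e \<in> E"
          then obtain i j where e: "e = (A i \<cdot> B j) e\<^sub>0" using edge_form by blast
          show "e \<in> {ge x m | x m. even x}"
          proof (cases "even i")
            case True then show ?thesis using e unfolding ge_def by blast
          next
            case False
            \<comment> \<open>\<open>a b\<close> fixes the base edge. Multiplying by it on the right
              changes the parity of the exponent of \<open>a\<close>, because
              \<open>neighbour k j\<close> is odd.\<close>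
            have "A i \<cdot> B j \<cdot> (A 1 \<cdot> B 1) = A i \<cdot> (B j \<cdot> A 1) \<cdot> B 1" by (simp add: Aut.m_assoc)
            also have "\<dots> = (A i \<cdot> A (neighbour k j)) \<cdot> (B (-j) \<cdot> B 1)" unfolding BA by (simp add: Aut.m_assoc)
            also have "\<dots> = A (i + neighbour k j) \<cdot> B (1 - j)"
              unfolding Aut.int_pow_mult[OF ab_Aut(1), symmetric] Aut.int_pow_mult[OF ab_Aut(2), symmetric] by simp
            finally have "(A i \<cdot> B j \<cdot> (A 1 \<cdot> B 1)) e\<^sub>0 = ge (i + neighbour k j) (1 - j)" by (simp only: ge_def)
            moreover have "(A i \<cdot> B j \<cdot> (A 1 \<cdot> B 1)) e\<^sub>0 = (A i \<cdot> B j) ((a \<cdot> b) e\<^sub>0)"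
              by (simp add: Aut_mult_apply Aut_closed)
            ultimately have "e = ge (i + neighbour k j) (1 - j)" by (simp add: e ab_edge)
            moreover have "even (i + neighbour k j)" using False M.odd_neighbour by simp
            ultimately show ?thesis by blast
          qed
        qed
      qed (use elems in auto)
      show "x mod int p = y mod int p" if "gv x = gv y" for x y using that gv_eq by simp
      show "x mod int q = y mod int q" if "gf x = gf y" for x y using that gf_eq by simp
      show "x mod int p = y mod int p \<and> m mod int q = m' mod int q"
        if xy: "even x" "even y" "ge x m = ge y m'" for x y m m'
      proof
        have "gv x \<sqsubseteq> ge y m'" using ve_le(1)[of x m] xy by simp
        then have "x mod int p = y mod int p \<or> x mod int p = (y + neighbour k m') mod int p" using ve xy by blast
        moreover have "x mod int p \<noteq> (y + neighbour k m') mod int p"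
          using M.parity_mod[of x "y + neighbour k m'"] M.odd_neighbour xy by auto
        ultimately show "x mod int p = y mod int p" by blast
        then have "A x = A y" by (simp add: A_eq_iff mod_eq_dvd_iff)
        then have "A x (B m e\<^sub>0) = A x (B m' e\<^sub>0)" using xy(3) by (simp add: ge_def Aut_mult_apply)
        then have "B m e\<^sub>0 = B m' e\<^sub>0" by (simp add: Aut_inj Aut_closed)
        then have "B m = B m'" by (rule B_edge_inj)
        then show "m mod int q = m' mod int q" by (simp add: B_eq_iff mod_eq_dvd_iff)
      qed
    qed (fact ve ef | simp add: gv_def gf_def vertex_le_face)+
    then show thesis using that(2) ep True q4 qp adm by blast
  qed
qed

theorem digonal:
  assumes q: "q = 2" shows "isomorphic P (sphere_map p)"
proof -
  define g where "g z = (if fst z = 0 then A (int (snd z)) v\<^sub>0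
    else if fst z = 1 then A (int (snd z)) e\<^sub>0 else B (int (snd z)) f\<^sub>0)" for z :: "nat \<times> nat"
  define r where "r = leq (sphere_map p)"
  let ?S = "{0} \<times> {..<p} \<union> {1} \<times> {..<p} \<union> {2} \<times> {..<2} :: (nat \<times> nat) set"
  have Fr: "Field r = ?S"
  proof
    show "Field r \<subseteq> ?S" using p_ge_2 by (auto simp: r_def sphere_map_def Field_def Let_def)
    show "?S \<subseteq> Field r"
    proof
      fix z assume "z \<in> ?S"
      then have "(z, z) \<in> r" by (auto simp: r_def sphere_map_def Let_def)
      then show "z \<in> Field r" by (rule FieldI1)
    qed
  qed
  have elems: "A i v\<^sub>0 \<in> V" "A i e\<^sub>0 \<in> E" "B i f\<^sub>0 \<in> F" for i
    using Aut_elems[OF AB_Aut(1) base_elems(1)] Aut_elems[OF AB_Aut(1) base_elems(2)]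
      Aut_elems[OF AB_Aut(2) base_elems(3)] by simp_all
  have A_mod: "A (x mod int p) = A x" and B_mod: "B (x mod 2) = B x" for x
    unfolding A_eq_iff B_eq_iff q by (simp_all add: mod_eq_dvd_iff[symmetric])
  have A_nat: "\<exists>i'<p. A i = A (int i')" for i
    using p_ge_2 A_mod[of i] by (intro exI[of _ "nat (i mod int p)"]) (auto simp: nat_less_iff)
  have B_nat: "\<exists>j'<2. B j = B (int j')" for j
    using B_mod[of j] by (intro exI[of _ "nat (j mod 2)"]) (auto simp: nat_less_iff)
  have vertices: "V = (\<lambda>i. A (int i) v\<^sub>0) ` {..<p}"
  proof
    show "V \<subseteq> (\<lambda>i. A (int i) v\<^sub>0) ` {..<p}"
    proof
      fix v assume "v \<in> V"
      then obtain i where "v = A i v\<^sub>0" using vertex_form by blast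
      then show "v \<in> (\<lambda>i. A (int i) v\<^sub>0) ` {..<p}" using A_nat[of i] by auto
    qed
  qed (use elems in auto)
  have faces: "F = (\<lambda>j. B (int j) f\<^sub>0) ` {..<2}"
  proof
    show "F \<subseteq> (\<lambda>j. B (int j) f\<^sub>0) ` {..<2}"
    proof
      fix f assume "f \<in> F"
      then obtain j where "f = B j f\<^sub>0" using face_form by blast
      then show "f \<in> (\<lambda>j. B (int j) f\<^sub>0) ` {..<2}" using B_nat[of j] by auto
    qed
  qed (use elems in auto)
  have edges: "E = (\<lambda>i. A (int i) e\<^sub>0) ` {..<p}"
  proof
    show "E \<subseteq> (\<lambda>i. A (int i) e\<^sub>0) ` {..<p}"
    proof
      fix e assume "e \<in> E"
      then obtain i j where e: "e = (A i \<cdot> B j) e\<^sub>0" using edge_form by blast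
      \<comment> \<open>Because \<open>b^2 = 1\<close> and \<open>a b\<close> fixes the base edge,
        the factor \<open>B j\<close> can be absorbed into the power of \<open>a\<close>.\<close>
      have "\<exists>l. e = A l e\<^sub>0"
      proof (cases "even j")
        case True
        then have "B j = B 0" unfolding B_eq_iff q by simp
        then have "e = A i e\<^sub>0" using e by simp
        then show ?thesis ..
      next
        case False
        then have "B j = B 1" unfolding B_eq_iff q by simp
        then have "A i \<cdot> B j = (A (i - 1) \<cdot> A 1) \<cdot> B 1"
          by (simp only: Aut.int_pow_mult[OF ab_Aut(1), symmetric] diff_add_cancel)
        also have "\<dots> = A (i - 1) \<cdot> (a \<cdot> b)" by (simp add: Aut.m_assoc)
        finally have "e = A (i - 1) e\<^sub>0" using e ab_edge by (simp add: Aut_mult_apply)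
        then show ?thesis ..
      qed
      then obtain l where "e = A l e\<^sub>0" ..
      then show "e \<in> (\<lambda>i. A (int i) e\<^sub>0) ` {..<p}" using A_nat[of l] by auto
    qed
  qed (use elems in auto)
  have A_nat_eq: "A (int i) = A (int j) \<longleftrightarrow> i = j" if "i < p" "j < p" for i j
    using that unfolding A_eq_iff mod_eq_dvd_iff[symmetric] by simp
  have B_nat_eq: "B (int i) = B (int j) \<longleftrightarrow> i = j" if "i < 2" "j < 2" for i j
    using that unfolding B_eq_iff mod_eq_dvd_iff[symmetric] q by auto
  have ve: "A (int i) v\<^sub>0 \<sqsubseteq> A (int j) e\<^sub>0 \<longleftrightarrow> i = j \<or> i = (j + 1) mod p" if ij: "i < p" "j < p" for i j
  proof -
    have le: "A (int j) v\<^sub>0 \<sqsubseteq> A (int j) e\<^sub>0" by (rule Aut_mono[OF AB_Aut(1) base_le(1)])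
    have s: "A (int j) (A 1 v\<^sub>0) = A (int ((j + 1) mod p)) v\<^sub>0"
    proof -
      have "A (int j) (A 1 v\<^sub>0) = (A (int j) \<cdot> A 1) v\<^sub>0" by (simp add: Aut_mult_apply)
      also have "A (int j) \<cdot> A 1 = A (int j + 1)" by (simp only: Aut.int_pow_mult[OF ab_Aut(1)])
      also have "\<dots> = A ((int j + 1) mod int p)" by (simp only: A_mod)
      also have "(int j + 1) mod int p = int ((j + 1) mod p)" by (simp add: zmod_int add.commute)
      finally show ?thesis .
    qed
    have le': "A (int ((j + 1) mod p)) v\<^sub>0 \<sqsubseteq> A (int j) e\<^sub>0"
      using Aut_mono[OF AB_Aut(1) base_le(2), of "int j"] by (simp only: s)
    have lt: "(j + 1) mod p < p" using p_ge_2 by simp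
    have "(j + 1) mod p \<noteq> j" using p_ge_2 ij by (cases "j + 1 = p") auto
    then have "A (int j) v\<^sub>0 \<noteq> A (int ((j + 1) mod p)) v\<^sub>0" using A_vertex_inj A_nat_eq[OF ij(2) lt] by metis
    from edge_ends[OF elems(2) elems(1) elems(1) le le' this elems(1)]
    have "A (int i) v\<^sub>0 \<sqsubseteq> A (int j) e\<^sub>0 \<longleftrightarrow> A (int i) v\<^sub>0 = A (int j) v\<^sub>0 \<or> A (int i) v\<^sub>0 = A (int ((j + 1) mod p)) v\<^sub>0" .
    then show ?thesis using A_vertex_inj A_nat_eq[OF ij] A_nat_eq[OF ij(1) lt] by metis
  qed
  \<comment> \<open>There are at most two faces and each edge lies on two, so it lies on all of
    them.\<close>
  have ef: "e \<sqsubseteq> f" if "e \<in> E" "f \<in> F" for e f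
  proof -
    have "card F \<le> 2" unfolding faces using card_image_le[of "{..<2::nat}" "\<lambda>j. B (int j) f\<^sub>0"] by simp
    moreover have "finite F" by (simp add: faces)
    ultimately have "{f \<in> F. e \<sqsubseteq> f} = F"
      using card_faces_edge[OF that(1)] by (intro card_seteq) auto
    then show ?thesis using that by blast
  qed
  have vf: "A i v\<^sub>0 \<sqsubseteq> B j f\<^sub>0" for i j by (rule vertex_le_face)
  have rank: "rank P (A i v\<^sub>0) = 0" "rank P (A i e\<^sub>0) = 1" "rank P (B i f\<^sub>0) = 2" for i
    using elems by (auto simp: elems_def)
  have nle: "(y, x) \<notin> leq P" if "rank P x < rank P y" for x y
    using rank_less[of y x] that by fastforce
  have refl: "A i v\<^sub>0 \<sqsubseteq> A i v\<^sub>0" "A i e\<^sub>0 \<sqsubseteq> A i e\<^sub>0" "B i f\<^sub>0 \<sqsubseteq> B i f\<^sub>0" for i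
    using elems le_refl by (auto simp: elems_def)
  have vv: "A (int i) v\<^sub>0 \<sqsubseteq> A (int j) v\<^sub>0 \<longleftrightarrow> i = j" if "i < p" "j < p" for i j
    using same_rank[of "A (int i) v\<^sub>0" "A (int j) v\<^sub>0"] rank(1) A_vertex_inj[of "int i" "int j"] A_nat_eq[OF that] refl(1) by auto
  have ee: "A (int i) e\<^sub>0 \<sqsubseteq> A (int j) e\<^sub>0 \<longleftrightarrow> i = j" if "i < p" "j < p" for i j
    using same_rank[of "A (int i) e\<^sub>0" "A (int j) e\<^sub>0"] rank(2) A_edge_inj[of "int i" "int j"] A_nat_eq[OF that] refl(2) by auto
  have ff: "B (int i) f\<^sub>0 \<sqsubseteq> B (int j) f\<^sub>0 \<longleftrightarrow> i = j" if "i < 2" "j < 2" for i j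
    using same_rank[of "B (int i) f\<^sub>0" "B (int j) f\<^sub>0"] rank(3) B_face_inj[of "int i" "int j"] B_nat_eq[OF that] refl(3) by auto
  have c: "(\<exists>i<p. z = (0, i)) \<or> (\<exists>i<p. z = (1, i)) \<or> (\<exists>j<2. z = (2, j))" if "z \<in> ?S" for z
    using that by auto
  have r_iff: "(z, z') \<in> r \<longleftrightarrow> z = z' \<or>
      fst z = 0 \<and> fst z' = 1 \<and> (snd z = snd z' \<or> snd z = (snd z' + 1) mod p) \<or> fst z \<noteq> 2 \<and> fst z' = 2"
    if z: "z \<in> ?S" "z' \<in> ?S" for z z'
    using c[OF z(1)] c[OF z(2)]
    by (elim disjE exE conjE; hypsubst) (simp_all add: r_def sphere_map_def Let_def Id_on_iff)
  have g: "g (0, i) = A (int i) v\<^sub>0" "g (1, i) = A (int i) e\<^sub>0" "g (2, i) = B (int i) f\<^sub>0" for i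
    by (simp_all add: g_def)
  have ef': "A i e\<^sub>0 \<sqsubseteq> B j f\<^sub>0" for i j by (rule ef[OF elems(2,3)])
  have nle': "\<not> A i e\<^sub>0 \<sqsubseteq> A j v\<^sub>0" "\<not> B i f\<^sub>0 \<sqsubseteq> A j v\<^sub>0" "\<not> B i f\<^sub>0 \<sqsubseteq> A j e\<^sub>0" for i j
    by (rule nle; simp only: rank; simp)+
  have le: "(z, z') \<in> r \<longleftrightarrow> g z \<sqsubseteq> g z'" if z: "z \<in> ?S" "z' \<in> ?S" for z z'
    unfolding r_iff[OF z] using c[OF z(1)] c[OF z(2)]
    by (elim disjE exE conjE; hypsubst; simp only: g vv ee ff ve ef' vf nle'; simp)
  have inj: "inj_on g ?S"
  proof (rule inj_onI)
    fix z z' assume z: "z \<in> ?S" "z' \<in> ?S" "g z = g z'"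
    have "g z \<sqsubseteq> g z" using le[OF z(1) z(1)] r_iff[OF z(1) z(1)] by simp
    then have "g z \<sqsubseteq> g z'" "g z' \<sqsubseteq> g z" using z(3) by simp_all
    then have "(z, z') \<in> r" "(z', z) \<in> r" by (simp_all only: le[OF z(1,2)] le[OF z(2,1)])
    then show "z = z'" unfolding r_iff[OF z(1,2)] r_iff[OF z(2,1)] by auto
  qed
  have g_img: "g ` ({n} \<times> X) = (\<lambda>i. g (n, i)) ` X" for n X
    by auto
  have "g ` ({0} \<times> {..<p}) = V" "g ` ({1} \<times> {..<p}) = E" "g ` ({2} \<times> {..<2}) = F"
    unfolding vertices edges faces g_img g by simp_all
  then have "g ` ?S = V \<union> E \<union> F" unfolding image_Un by simp
  also have "\<dots> = Field (leq P)" using Field_cases by (auto simp: elems_def)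
  finally have img: "g ` ?S = Field (leq P)" .
  have "order_iso r (leq P) g" unfolding order_iso_def Fr bij_betw_def
    by (intro conjI ballI inj img le)
  then have "isomorphic (sphere_map p) P" unfolding isomorphic_def r_def by blast
  then show ?thesis by (rule isomorphic_sym)
qed

end

section \<open>From the definitions to a rooted polyhedron\<close>

context finite_polyhedron begin

lemma incident_vertices: "e \<in> E \<Longrightarrow> {v\<in>V. incident P v e} = {v\<in>V. v \<sqsubseteq> e}"
  using incident_rank[of _ 0 e 1] by auto

lemma incident_edges_vertex: "v \<in> V \<Longrightarrow> {e\<in>E. incident P v e} = {e\<in>E. v \<sqsubseteq> e}"
  using incident_rank[of v 0 _ 1] by auto

lemma incident_edges_face: "f \<in> F \<Longrightarrow> {e\<in>E. incident P e f} = {e\<in>E. e \<sqsubseteq> f}"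
  using incident_rank[of _ 1 f 2] by auto

lemma has_type_iff: "has_type P p q \<longleftrightarrow>
    (\<forall>f\<in>F. card {e\<in>E. e \<sqsubseteq> f} = p) \<and> (\<forall>v\<in>V. card {e\<in>E. v \<sqsubseteq> e} = q)"
  unfolding has_type_def by (simp only: incident_edges_vertex incident_edges_face cong: ball_cong)

lemma multiple_edges_iff: "multiple_edges P \<longleftrightarrow>
    (\<exists>e\<in>E. \<exists>e'\<in>E. e \<noteq> e' \<and> {v\<in>V. v \<sqsubseteq> e} = {v\<in>V. v \<sqsubseteq> e'})"
proof -
  have "ends (vertex_edge_graph P) e = {v\<in>V. v \<sqsubseteq> e}" if "e \<in> E" for e
    using incident_vertices[OF that] by (simp add: vertex_edge_graph_def)
  then show ?thesis unfolding multiple_edges_def by (simp add: vertex_edge_graph_def)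
qed

lemma adjacent_flag_image:
  assumes g: "g \<in> Aut" and fl: "flag v e f" and adj: "adjacent_flag P i {v, e, f} (g ` {v, e, f})"
  shows "i = 0 \<Longrightarrow> g e = e \<and> g f = f \<and> g v \<noteq> v" "i = 1 \<Longrightarrow> g v = v \<and> g f = f \<and> g e \<noteq> e"
    "i = 2 \<Longrightarrow> g v = v \<and> g e = e \<and> g f \<noteq> f"
proof -
  have eq: "{x \<in> {g v, g e, g f}. rank P x \<noteq> i} = {x \<in> {v, e, f}. rank P x \<noteq> i}"
    and ne: "{g v, g e, g f} \<noteq> {v, e, f}" using adj by (auto simp: adjacent_flag_def)
  have r: "rank P v = 0" "rank P e = 1" "rank P f = 2" "rank P (g v) = 0" "rank P (g e) = 1" "rank P (g f) = 2"
    using fl Aut_flag[OF g fl] by (auto simp: flag_def elems_def)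
  have same: "g x = x" if "x \<in> {v, e, f}" "rank P x \<noteq> i" "rank P (g x) = rank P x" for x
  proof -
    have "g x \<in> {x \<in> {g v, g e, g f}. rank P x \<noteq> i}" using that by auto
    then have "g x \<in> {v, e, f}" unfolding eq by simp
    then show ?thesis using that r by auto
  qed
  have s: "i \<noteq> 0 \<Longrightarrow> g v = v" "i \<noteq> 1 \<Longrightarrow> g e = e" "i \<noteq> 2 \<Longrightarrow> g f = f"
    using same[of v] same[of e] same[of f] r by simp_all
  show "i = 0 \<Longrightarrow> g e = e \<and> g f = f \<and> g v \<noteq> v" using s ne by auto
  show "i = 1 \<Longrightarrow> g v = v \<and> g f = f \<and> g e \<noteq> e" using s ne by auto
  show "i = 2 \<Longrightarrow> g v = v \<and> g e = e \<and> g f \<noteq> f" using s ne by auto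
qed

end

lemma tight_simple_rooted_exists:
  assumes ts: "tight_simple P" and type: "has_type P p q"
  obtains v\<^sub>0 e\<^sub>0 f\<^sub>0 \<rho>\<^sub>0 \<rho>\<^sub>1 \<rho>\<^sub>2 where "tight_simple_rooted P v\<^sub>0 e\<^sub>0 f\<^sub>0 \<rho>\<^sub>0 \<rho>\<^sub>1 \<rho>\<^sub>2 p q"
proof -
  interpret finite_polyhedron P
    using ts by unfold_locales (auto simp: tight_simple_def tight_def)
  have or: "orientably_regular P" using ts by (simp add: tight_simple_def)
  then obtain \<Phi> \<rho> where \<Phi>: "\<Phi> \<in> flags P" and \<rho>: "\<forall>i\<in>{0, 1, 2::nat}. \<rho> i \<in> Aut \<and> adjacent_flag P i \<Phi> (\<rho> i ` \<Phi>)"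
    and ind: "card (rcosets\<^bsub>aut_group P\<^esub> (generate (aut_group P) {\<rho> 0 \<cdot> \<rho> 1, \<rho> 1 \<cdot> \<rho> 2})) = 2"
    unfolding orientably_regular_def by blast
  obtain v0 e0 f0 where fl: "flag v0 e0 f0" "\<Phi> = {v0, e0, f0}" using \<Phi> unfolding flags_eq by blast
  have R: "\<rho> 0 \<in> Aut" "\<rho> 1 \<in> Aut" "\<rho> 2 \<in> Aut" using \<rho> by auto
  have adj: "adjacent_flag P i {v0, e0, f0} (\<rho> i ` {v0, e0, f0})" if "i \<in> {0, 1, 2}" for i
    using \<rho> that fl(2) by blast
  interpret rooted_polyhedron P v0 e0 f0 "\<rho> 0" "\<rho> 1" "\<rho> 2"
    by unfold_locales (use R fl adjacent_flag_image(1)[OF R(1) fl(1) adj] adjacent_flag_image(2)[OF R(2) fl(1) adj]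
      adjacent_flag_image(3)[OF R(3) fl(1) adj] in simp_all)
  have ind': "\<rho> 1 \<notin> Plus" using ind index_Plus unfolding Plus_def a_def b_def by blast
  obtain p' q' where pq': "has_type P p' q'" "card (flags P) = 2 * p' * q'"
    using ts by (auto simp: tight_simple_def tight_def)
  have base: "v0 \<in> V" "f0 \<in> F" using fl(1) by (auto simp: flag_def)
  \<comment> \<open>A vertex and a face exist, so the type occurring in \<open>tight\<close> is the
    given one.\<close>
  have "p' = p" "q' = q" using pq'(1) type base unfolding has_type_iff by auto
  have "tight_simple_rooted P v0 e0 f0 (\<rho> 0) (\<rho> 1) (\<rho> 2) p q"
  proof (unfold_locales)
    show "\<rho> 1 \<notin> Plus" by (rule ind')
    show "card {e \<in> E. e \<sqsubseteq> f} = p" if "f \<in> F" for f using type that by (simp add: has_type_iff)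
    show "card {e \<in> E. v \<sqsubseteq> e} = q" if "v \<in> V" for v using type that by (simp add: has_type_iff)
    show "card (flags P) = 2 * p * q" using pq'(2) \<open>p' = p\<close> \<open>q' = q\<close> by simp
    show "e = e'" if "e \<in> E" "e' \<in> E" "{v \<in> V. v \<sqsubseteq> e} = {v \<in> V. v \<sqsubseteq> e'}" for e e'
      using ts that unfolding tight_simple_def multiple_edges_iff by blast
  qed
  then show thesis by (rule that)
qed

theorem tight_simple_cases:
  assumes "tight_simple P" "has_type P p q"
  obtains "q = 2" "2 \<le> p" "isomorphic P (sphere_map p)"
    | "odd q" "p = 2 * q"
    | k where "even q" "even p" "4 \<le> q" "q < p" "admissible_exponent p q k" "isomorphic P (model p q k)"
proof -
  obtain v0 e0 f0 r0 r1 r2 where "tight_simple_rooted P v0 e0 f0 r0 r1 r2 p q"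
    using tight_simple_rooted_exists[OF assms] .
  then interpret R: tight_simple_rooted P v0 e0 f0 r0 r1 r2 p q .
  show thesis
  proof (cases "q = 2")
    case True
    then show thesis using that(1) R.digonal R.p_ge_2 True by blast
  next
    case False
    then have "3 \<le> q" using R.q_ge_2 by simp
    then show thesis by (rule R.large_valency) (use that(2,3) isomorphic_sym in blast)+
  qed
qed

section \<open>Standard models are tight polyhedra\<close>

lemma connected_range:
  fixes u :: "int \<Rightarrow> 'a"
  assumes "\<And>i. (u i, u (i + 1)) \<in> r \<and> (u (i + 1), u i) \<in> r"
  shows "(u i, u j) \<in> r\<^sup>*"
proof -
  have up: "(u i, u (i + int n)) \<in> r\<^sup>* \<and> (u (i + int n), u i) \<in> r\<^sup>*" for i n
  proof (induction n)
    case (Suc n)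
    have "(u (i + int n), u (i + int (Suc n))) \<in> r" "(u (i + int (Suc n)), u (i + int n)) \<in> r"
      using assms[of "i + int n"] by (simp_all add: add_ac)
    then show ?case using Suc by (meson converse_rtrancl_into_rtrancl rtrancl.rtrancl_into_rtrancl)
  qed simp
  show ?thesis
  proof (cases "i \<le> j")
    case True then show ?thesis using up[of i "nat (j - i)"] by simp
  next
    case False then show ?thesis using up[of j "nat (i - j)"] by simp
  qed
qed

context model_params begin

abbreviation "M \<equiv> model p q k"
abbreviation "vx \<equiv> model_vertex p"
abbreviation "ed \<equiv> model_edge p q"
abbreviation "fc \<equiv> model_face q"

lemmas code_eq = model_vertex_eq[OF pos] model_edge_eq[OF pos] model_face_eq[OF pos]
lemmas code_neq = model_neq[OF pos]
lemmas code_rank = model_rank[OF pos]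

lemma elems_M: "elems M 0 = range vx" "elems M 1 = {ed x m | x m. even x}" "elems M 2 = range fc"
  unfolding elems_def Field_model[OF pos] by (auto simp: code_rank simp del: One_nat_def)

lemma in_Field: "vx x \<in> Field (leq M)" "even x \<Longrightarrow> ed x m \<in> Field (leq M)" "fc j \<in> Field (leq M)"
  unfolding Field_model[OF pos] by auto

lemma M_le_cases:
  assumes "(z, z') \<in> leq M"
  obtains "z = z'" | x y m where "z = vx x" "z' = ed y m" "even y"
    | x m j where "z = ed x m" "z' = fc j" "even x" | x j where "z = vx x" "z' = fc j"
  using assms unfolding model_def by auto

lemma M_refl: "z \<in> Field (leq M) \<Longrightarrow> (z, z) \<in> leq M"
  by (rule model_le_refl[OF pos])

lemma M_rank_less: "(z, z') \<in> leq M \<Longrightarrow> z \<noteq> z' \<Longrightarrow> rank M z < rank M z'"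
  by (erule M_le_cases) (simp_all add: code_rank)

lemma M_partial_order: "Partial_order (leq M)"
  unfolding partial_order_on_def preorder_on_def
proof (intro conjI)
  show "refl_on (Field (leq M)) (leq M)"
    using M_refl by (auto simp: refl_on_def intro: FieldI1 FieldI2)
  show "trans (leq M)"
  proof (rule transI)
    fix x y z assume h: "(x, y) \<in> leq M" "(y, z) \<in> leq M"
    show "(x, z) \<in> leq M"
    proof (cases "x = y \<or> y = z")
      case False
      then have "rank M x < rank M y" "rank M y < rank M z" using M_rank_less h by auto
      then obtain i j where "x = vx i" "z = fc j"
        using h by (elim M_le_cases) (auto simp: code_rank)
      then show ?thesis by (simp add: model_le_vertex_face[OF pos])
    qed (use h in auto)
  qed
  show "antisym (leq M)"
  proof (rule antisymI)
    fix x y assume "(x, y) \<in> leq M" "(y, x) \<in> leq M"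
    then show "x = y" using M_rank_less[of x y] M_rank_less[of y x] by fastforce
  qed
  show "leq M \<subseteq> Field (leq M) \<times> Field (leq M)" by (auto intro: FieldI1 FieldI2)
qed

lemma finite_Field_M: "finite (Field (leq M))"
proof -
  have "range vx = vx ` {0..<int p}"
  proof
    show "range vx \<subseteq> vx ` {0..<int p}"
    proof
      fix z assume "z \<in> range vx"
      then obtain x where "z = vx x" by blast
      then have "z = vx (x mod int p)" by (simp add: code_eq)
      then show "z \<in> vx ` {0..<int p}" using pos by auto
    qed
  qed auto
  then have "finite (range vx)" by simp
  moreover have "range fc = fc ` {0..<int q}"
  proof
    show "range fc \<subseteq> fc ` {0..<int q}"
    proof
      fix z assume "z \<in> range fc"
      then obtain x where "z = fc x" by blast
      then have "z = fc (x mod int q)" by (simp add: code_eq)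
      then show "z \<in> fc ` {0..<int q}" using pos by auto
    qed
  qed auto
  then have "finite (range fc)" by simp
  moreover have "finite {ed x m | x m. even x}"
  proof (rule finite_subset)
    show "{ed x m | x m. even x} \<subseteq> (\<lambda>(x, m). ed x m) ` ({0..<int p} \<times> {0..<int q})"
    proof
      fix z assume "z \<in> {ed x m | x m. even x}"
      then obtain x m where "z = ed x m" by blast
      then have "z = (\<lambda>(x, m). ed x m) (x mod int p, m mod int q)" by (simp add: code_eq)
      moreover have "(x mod int p, m mod int q) \<in> {0..<int p} \<times> {0..<int q}" using pos by simp
      ultimately show "z \<in> (\<lambda>(x, m). ed x m) ` ({0..<int p} \<times> {0..<int q})" by blast
    qed
  qed simp
  ultimately show ?thesis unfolding Field_model[OF pos] by simp
qed

lemma le_ve: "even y \<Longrightarrow> (vx y, ed y m) \<in> leq M" "even y \<Longrightarrow> (vx (y + neighbour k m), ed y m) \<in> leq M"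
  by (simp_all add: model_le_vertex_edge)

lemma le_ef: "even x \<Longrightarrow> (ed x m, fc m) \<in> leq M" "even x \<Longrightarrow> (ed x m, fc (m - 1)) \<in> leq M"
  by (simp_all add: model_le_edge_face[OF pos])

lemma le_vf: "(vx x, fc j) \<in> leq M"
  by (rule model_le_vertex_face[OF pos])

lemma edge_between: obtains y where "even y" "(vx x, ed y j) \<in> leq M" "(ed y j, fc j) \<in> leq M"
proof (cases "even x")
  case True then show thesis using that[of x] le_ve le_ef by blast
next
  case False
  then have "even (x - neighbour k j)" using odd_neighbour by simp
  then show thesis using that[of "x - neighbour k j"] le_ve(2)[of "x - neighbour k j" j] le_ef by simp
qed

lemma M_flags:
  assumes C: "C \<in> flags M"
  shows "\<exists>v\<in>elems M 0. \<exists>e\<in>elems M 1. \<exists>f\<in>elems M 2. C = {v, e, f}"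
proof -
  have ch: "\<And>x y. x \<in> C \<Longrightarrow> y \<in> C \<Longrightarrow> (x, y) \<in> leq M \<or> (y, x) \<in> leq M"
    and mx: "\<And>D. D \<in> Chains (leq M) \<Longrightarrow> C \<subseteq> D \<Longrightarrow> D = C"
    using C unfolding flags_def Chains_def by blast+
  have same: "x = y" if "x \<in> C" "y \<in> C" "rank M x = rank M y" for x y
    using ch[OF that(1,2)] M_rank_less[of x y] M_rank_less[of y x] that(3) by fastforce
  have form: "x \<in> range vx \<or> x \<in> {ed x m | x m. even x} \<or> x \<in> range fc" if "x \<in> C" for x
    using ch[OF that that] FieldI1[of x x "leq M"] unfolding Field_model[OF pos] by blast
  have chain: "{v, e, f} \<in> Chains (leq M)" if "(v, e) \<in> leq M" "(e, f) \<in> leq M" "(v, f) \<in> leq M" for v e f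
  proof -
    have F: "v \<in> Field (leq M)" "e \<in> Field (leq M)" "f \<in> Field (leq M)"
      using FieldI1[OF that(1)] FieldI1[OF that(2)] FieldI2[OF that(2)] .
    show ?thesis unfolding Chains_def using that M_refl[OF F(1)] M_refl[OF F(2)] M_refl[OF F(3)] by simp
  qed
  \<comment> \<open>The second clause matters when the chain contains no vertex: then
    \<open>x\<close> may be prescribed, and below it is chosen as an end of the edge in the chain.
    \<open>face\<close> is the analogue for faces.\<close>
  have vert: "\<exists>x. (\<forall>z\<in>C. rank M z = 0 \<longrightarrow> z = vx x) \<and> (vx x \<in> C \<or> x = x0)" for x0
  proof (cases "\<exists>x. vx x \<in> C")
    case True
    then obtain x where x: "vx x \<in> C" ..
    have "z = vx x" if "z \<in> C" "rank M z = 0" for z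
      using same[OF that(1) x] that(2) by (simp add: code_rank)
    then show ?thesis using x by (intro exI[of _ x]) simp
  next
    case False
    have "z = vx x0" if "z \<in> C" "rank M z = 0" for z
      using form[OF that(1)] that False by (elim disjE) (auto simp: code_rank)
    then show ?thesis by (intro exI[of _ x0]) simp
  qed
  have face: "\<exists>j. (\<forall>z\<in>C. rank M z = 2 \<longrightarrow> z = fc j) \<and> (fc j \<in> C \<or> j = j0)" for j0
  proof (cases "\<exists>j. fc j \<in> C")
    case True
    then obtain j where j: "fc j \<in> C" ..
    have "z = fc j" if "z \<in> C" "rank M z = 2" for z
      using same[OF that(1) j] that(2) by (simp add: code_rank)
    then show ?thesis using j by (intro exI[of _ j]) simp
  next
    case False
    have "z = fc j0" if "z \<in> C" "rank M z = 2" for z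
      using form[OF that(1)] that False by (elim disjE) (auto simp: code_rank)
    then show ?thesis by (intro exI[of _ j0]) simp
  qed
  have rk: "rank M z = 0 \<or> rank M z = 1 \<or> rank M z = 2" if "z \<in> C" for z
    using form[OF that] by (auto simp: code_rank)
  \<comment> \<open>A maximal chain contains an edge, since otherwise \<open>edge_between\<close>
    would fit one between its vertex and its face.\<close>
  have "\<exists>y m. even y \<and> ed y m \<in> C"
  proof (rule ccontr)
    assume none: "\<nexists>y m. even y \<and> ed y m \<in> C"
    obtain x where x: "\<forall>z\<in>C. rank M z = 0 \<longrightarrow> z = vx x" using vert by blast
    obtain j where j: "\<forall>z\<in>C. rank M z = 2 \<longrightarrow> z = fc j" using face by blast
    obtain y where y: "even y" "(vx x, ed y j) \<in> leq M" "(ed y j, fc j) \<in> leq M" using edge_between .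
    have "C \<subseteq> {vx x, ed y j, fc j}"
    proof
      fix z assume z: "z \<in> C"
      then have "z \<in> range vx \<or> z \<in> range fc" using form none by blast
      then have "rank M z = 0 \<or> rank M z = 2" by (auto simp: code_rank)
      then show "z \<in> {vx x, ed y j, fc j}" using x j z by blast
    qed
    from mx[OF chain[OF y(2,3) le_vf] this] none y(1) show False by blast
  qed
  then obtain y m where ym: "even y" "ed y m \<in> C" by blast
  obtain x where x: "\<forall>z\<in>C. rank M z = 0 \<longrightarrow> z = vx x" "vx x \<in> C \<or> x = y" using vert by blast
  obtain j where j: "\<forall>z\<in>C. rank M z = 2 \<longrightarrow> z = fc j" "fc j \<in> C \<or> j = m" using face by blast
  have "(vx x, ed y m) \<in> leq M"
    using x(2) ch[OF _ ym(2), of "vx x"] le_ve(1)[OF ym(1), of m] model_not_le[OF pos] by metis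
  moreover have "(ed y m, fc j) \<in> leq M"
    using j(2) ch[OF _ ym(2), of "fc j"] le_ef(1)[OF ym(1), of m] model_not_le[OF pos] by metis
  ultimately have "{vx x, ed y m, fc j} \<in> Chains (leq M)" using chain le_vf by blast
  moreover have "C \<subseteq> {vx x, ed y m, fc j}"
  proof
    fix z assume z: "z \<in> C"
    have "z = ed y m" if "rank M z = 1" using same[OF z ym(2)] that by (simp add: code_rank)
    then show "z \<in> {vx x, ed y m, fc j}" using rk[OF z] x(1) j(1) z by blast
  qed
  ultimately have "C = {vx x, ed y m, fc j}" using mx by metis
  then show ?thesis unfolding elems_M using ym(1) by blast
qed

lemma M_incident: "incident M (vx x) (ed y m) \<longleftrightarrow> (vx x, ed y m) \<in> leq M"
  "incident M (ed y m) (fc j) \<longleftrightarrow> (ed y m, fc j) \<in> leq M"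
  unfolding incident_def by (simp_all add: model_not_le[OF pos])

lemma vertices_of_edge: "even y \<Longrightarrow> {v \<in> elems M 0. (v, ed y m) \<in> leq M} = {vx y, vx (y + neighbour k m)}"
  unfolding elems_M by (auto simp: model_le_vertex_edge code_eq)

lemma faces_of_edge: "even y \<Longrightarrow> {f \<in> elems M 2. (ed y m, f) \<in> leq M} = {fc m, fc (m - 1)}"
  unfolding elems_M by (auto simp: model_le_edge_face[OF pos] code_eq)

lemma distinct_ends: "even y \<Longrightarrow> vx y \<noteq> vx (y + neighbour k m)"
  using parity_mod[of y "y + neighbour k m"] odd_neighbour by (auto simp: code_eq)

lemma mod_shift_neq: "0 < d \<Longrightarrow> d < int q \<Longrightarrow> (m + d) mod int q \<noteq> m mod int q"
  unfolding mod_eq_dvd_iff by (simp add: zdvd_not_zless)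

lemma fc_neq: "fc m \<noteq> fc (m - 1)" "fc (m + 1) \<noteq> fc m"
  using mod_shift_neq[of 1 "m - 1"] mod_shift_neq[of 1 m] q_bounds by (auto simp: code_eq)

lemma card_edge: "even y \<Longrightarrow> card {v \<in> elems M 0. (v, ed y m) \<in> leq M} = 2"
  "even y \<Longrightarrow> card {f \<in> elems M 2. (ed y m, f) \<in> leq M} = 2"
  using distinct_ends[of y m] fc_neq[of m] by (simp_all only: vertices_of_edge faces_of_edge) simp_all

text \<open>At an even vertex the edges carry its own label; an odd vertex \<open>x\<close> is the
  far end of the edges labelled \<open>x - neighbour k m\<close>. In both cases \<open>m\<close>
  runs once through the residues modulo \<open>q\<close>.\<close>

lemma edges_at_vertex:
  "{e \<in> elems M 1. (vx x, e) \<in> leq M} = range (\<lambda>m. ed (if even x then x else x - neighbour k m) m)"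
proof
  show "{e \<in> elems M 1. (vx x, e) \<in> leq M} \<subseteq> range (\<lambda>m. ed (if even x then x else x - neighbour k m) m)"
  proof
    fix e assume "e \<in> {e \<in> elems M 1. (vx x, e) \<in> leq M}"
    then obtain y m where e: "e = ed y m" "even y" "(vx x, ed y m) \<in> leq M" unfolding elems_M by blast
    then have h: "x mod int p = y mod int p \<or> x mod int p = (y + neighbour k m) mod int p"
      by (simp add: model_le_vertex_edge)
    have "e = ed (if even x then x else x - neighbour k m) m"
    proof (cases "even x")
      case True
      then have "x mod int p = y mod int p"
        using h parity_mod[of x "y + neighbour k m"] e(2) odd_neighbour by auto
      then show ?thesis using True e(1) by (simp add: code_eq)
    next
      case False
      then have "x mod int p = (y + neighbour k m) mod int p" using h parity_mod[of x y] e(2) by auto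
      then have "(x - neighbour k m) mod int p = y mod int p" by (simp add: mod_eq_dvd_iff algebra_simps)
      then show ?thesis using False e(1) by (simp add: code_eq)
    qed
    then show "e \<in> range (\<lambda>m. ed (if even x then x else x - neighbour k m) m)" by blast
  qed
  show "range (\<lambda>m. ed (if even x then x else x - neighbour k m) m) \<subseteq> {e \<in> elems M 1. (vx x, e) \<in> leq M}"
  proof
    fix e assume "e \<in> range (\<lambda>m. ed (if even x then x else x - neighbour k m) m)"
    then obtain m where e: "e = ed (if even x then x else x - neighbour k m) m" by blast
    define y where "y = (if even x then x else x - neighbour k m)"
    have y: "even y" "e = ed y m" using odd_neighbour e by (simp_all add: y_def)
    have "(vx x, e) \<in> leq M"
    proof (cases "even x")
      case True then show ?thesis using le_ve(1)[of x m] by (simp add: y y_def)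
    next
      case False then show ?thesis using le_ve(2)[OF y(1), of m] by (simp add: y y_def)
    qed
    moreover have "e \<in> elems M 1" unfolding elems_M using y by blast
    ultimately show "e \<in> {e \<in> elems M 1. (vx x, e) \<in> leq M}" by (intro CollectI conjI)
  qed
qed

lemma edge_at_vertex_cong:
  "m mod int q = m' mod int q \<Longrightarrow> ed (if even x then x else x - neighbour k m) m = ed (if even x then x else x - neighbour k m') m'"
  using mod_diff_cong[OF refl neighbour_cong[of m m'], of x] by (simp add: code_eq)

lemma range_cong_interval:
  assumes "\<And>m m' :: int. m mod int q = m' mod int q \<Longrightarrow> g m = g m'" shows "range g = g ` {0..<int q}"
proof
  show "range g \<subseteq> g ` {0..<int q}"
  proof
    fix z assume "z \<in> range g"
    then obtain m where "z = g m" by blast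
    then have "z = g (m mod int q)" using assms[of m "m mod int q"] by simp
    then show "z \<in> g ` {0..<int q}" using pos by auto
  qed
qed auto

lemma card_edges_at_vertex: "card {e \<in> elems M 1. (vx x, e) \<in> leq M} = q"
proof -
  let ?g = "\<lambda>m. ed (if even x then x else x - neighbour k m) m"
  have "{e \<in> elems M 1. (vx x, e) \<in> leq M} = ?g ` {0..<int q}"
    unfolding edges_at_vertex by (rule range_cong_interval, rule edge_at_vertex_cong)
  moreover have "inj_on ?g {0..<int q}"
    by (rule inj_onI) (simp add: code_eq)
  ultimately show ?thesis by (simp add: card_image)
qed

lemma edges_of_face: "{e \<in> elems M 1. (e, fc j) \<in> leq M} = {ed y m | y m. even y \<and> (m = j \<or> m = j + 1)}"
proof
  show "{e \<in> elems M 1. (e, fc j) \<in> leq M} \<subseteq> {ed y m | y m. even y \<and> (m = j \<or> m = j + 1)}"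
  proof
    fix e assume "e \<in> {e \<in> elems M 1. (e, fc j) \<in> leq M}"
    then obtain y m where e: "e = ed y m" "even y" "(ed y m, fc j) \<in> leq M" unfolding elems_M by blast
    then have "j mod int q = m mod int q \<or> j mod int q = (m - 1) mod int q"
      by (simp add: model_le_edge_face[OF pos])
    then have "m mod int q = j mod int q \<or> m mod int q = (j + 1) mod int q"
      by (auto simp: mod_eq_dvd_iff algebra_simps dvd_diff_commute)
    then have "e = ed y j \<or> e = ed y (j + 1)" using e by (simp add: code_eq)
    then show "e \<in> {ed y m | y m. even y \<and> (m = j \<or> m = j + 1)}" using e(2) by blast
  qed
  show "{ed y m | y m. even y \<and> (m = j \<or> m = j + 1)} \<subseteq> {e \<in> elems M 1. (e, fc j) \<in> leq M}"
    unfolding elems_M using le_ef(1)[of _ j] le_ef(2)[of _ "j + 1"] by auto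
qed

lemma card_edges_of_face: "card {e \<in> elems M 1. (e, fc j) \<in> leq M} = p"
proof -
  obtain n where n: "p = 2 * n" using even_p by (rule evenE)
  \<comment> \<open>There are \<open>p/2\<close> even labels for each of the two values of
    \<open>m\<close>.\<close>
  let ?g = "\<lambda>(i, t). ed (2 * i) (j + t)"
  have "{ed y m | y m. even y \<and> (m = j \<or> m = j + 1)} = ?g ` ({0..<int n} \<times> {0, 1})"
  proof
    show "{ed y m | y m. even y \<and> (m = j \<or> m = j + 1)} \<subseteq> ?g ` ({0..<int n} \<times> {0, 1})"
    proof
      fix e assume "e \<in> {ed y m | y m. even y \<and> (m = j \<or> m = j + 1)}"
      then obtain y m where e: "e = ed y m" "even y" "m = j \<or> m = j + 1" by blast
      obtain i where i: "y = 2 * i" using e(2) ..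
      have "2 * (i mod int n) = (2 * i) mod int p" by (simp only: n of_nat_mult mult_mod_right) simp
      then have "(2 * (i mod int n)) mod int p = y mod int p" by (simp add: i)
      then have "e = ?g (i mod int n, m - j)" using e(1) by (simp add: code_eq)
      moreover have "(i mod int n, m - j) \<in> {0..<int n} \<times> {0, 1}" using e(3) pos n by auto
      ultimately show "e \<in> ?g ` ({0..<int n} \<times> {0, 1})" by blast
    qed
    show "?g ` ({0..<int n} \<times> {0, 1}) \<subseteq> {ed y m | y m. even y \<and> (m = j \<or> m = j + 1)}"
    proof
      fix e assume "e \<in> ?g ` ({0..<int n} \<times> {0, 1})"
      then obtain i t where e: "e = ed (2 * i) (j + t)" "t \<in> {0, 1}" by auto
      have "even (2 * i)" "j + t = j \<or> j + t = j + 1" using e(2) by auto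
      then show "e \<in> {ed y m | y m. even y \<and> (m = j \<or> m = j + 1)}" using e(1) by blast
    qed
  qed
  moreover have "inj_on ?g ({0..<int n} \<times> {0, 1})"
  proof (rule inj_onI, clarify)
    fix i t i' t' :: int
    assume h: "i \<in> {0..<int n}" "i' \<in> {0..<int n}" "t \<in> {0, 1}" "t' \<in> {0, 1}" "ed (2 * i) (j + t) = ed (2 * i') (j + t')"
    then have "(2 * i) mod int p = (2 * i') mod int p" "(j + t) mod int q = (j + t') mod int q"
      by (simp_all add: code_eq)
    then have "2 * (i mod int n) = 2 * (i' mod int n)" by (simp only: n of_nat_mult mult_mod_right) simp
    then have "i mod int n = i' mod int n" by simp
    moreover have "t = t'" using h(3,4) \<open>(j + t) mod int q = (j + t') mod int q\<close> mod_shift_neq[of 1 j] q_bounds by auto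
    ultimately show "i = i' \<and> t = t'" using h(1,2) by simp
  qed
  ultimately show ?thesis unfolding edges_of_face using n by (simp add: card_image card_cartesian_product)
qed

end

section \<open>Vertex figures, faces and connectivity of the model\<close>

context model_params begin

text \<open>The edges at vertex \<open>x\<close> in cyclic order: \<open>star x j\<close> and
  \<open>star x (j + 1)\<close> are the two that lie on face \<open>j\<close>.\<close>

abbreviation star :: "int \<Rightarrow> int \<Rightarrow> nat" where
  "star x m \<equiv> ed (if even x then x else x - neighbour k m) m"

lemma star_base_even: "even (if even x then x else x - neighbour k m)"
  using odd_neighbour by simp

lemma star_le_face: "(star x m, fc j) \<in> leq M \<longleftrightarrow> star x m = star x j \<or> star x m = star x (j + 1)"
proof -
  have "(star x m, fc j) \<in> leq M \<longleftrightarrow> m mod int q = j mod int q \<or> m mod int q = (j + 1) mod int q"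
    unfolding model_le_edge_face[OF pos star_base_even] by (auto simp: mod_eq_dvd_iff algebra_simps dvd_diff_commute)
  moreover have "star x m = star x i \<longleftrightarrow> m mod int q = i mod int q" for i
    using edge_at_vertex_cong[of m i x] by (auto simp: model_edge_eq[OF pos])
  ultimately show ?thesis by simp
qed

lemma star_succ_neq: "star x j \<noteq> star x (j + 1)"
  using mod_shift_neq[of 1 j] q_bounds by (auto simp: model_edge_eq[OF pos])

lemma star_faces: "{f \<in> range fc. (star x m, f) \<in> leq M} = {fc m, fc (m - 1)}"
  using faces_of_edge[OF star_base_even] unfolding elems_M .

lemma vertex_figure_M: "polygonal (Restr (leq M) {G. (vx x, G) \<in> leq M \<and> G \<noteq> vx x})"
proof -
  define r where "r = Restr (leq M) {G. (vx x, G) \<in> leq M \<and> G \<noteq> vx x}"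
  define X where "X = range (star x)"
  define Y where "Y = range fc"
  have X_le: "(vx x, e) \<in> leq M" "e \<noteq> vx x" "(e, e) \<in> leq M" if "e \<in> X" for e
  proof -
    have e: "e \<in> {e \<in> elems M 1. (vx x, e) \<in> leq M}" using that unfolding X_def edges_at_vertex .
    then show "(vx x, e) \<in> leq M" by simp
    show "e \<noteq> vx x" using that by (auto simp: X_def code_neq)
    show "(e, e) \<in> leq M" using e M_refl by (simp add: elems_def)
  qed
  have Y_le: "(vx x, f) \<in> leq M" "f \<noteq> vx x" "(f, f) \<in> leq M" if "f \<in> Y" for f
    using that M_refl[OF in_Field(3)] le_vf by (auto simp: Y_def code_neq)
  have r_eq: "(z, z') \<in> r \<longleftrightarrow> (z, z') \<in> leq M" if "z \<in> X \<union> Y" "z' \<in> X \<union> Y" for z z'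
    using that X_le(1,2) Y_le(1,2) unfolding r_def by blast
  have mem: "z \<in> X \<union> Y" if "(vx x, z) \<in> leq M" "z \<noteq> vx x" for z
  proof (rule M_le_cases[OF that(1)])
    fix x' y m assume h: "vx x = vx x'" "z = ed y m" "even y"
    then have "z \<in> {e \<in> elems M 1. (vx x, e) \<in> leq M}" using that(1) unfolding elems_M by blast
    then show ?thesis unfolding edges_at_vertex X_def by blast
  qed (use that in \<open>auto simp: Y_def code_neq\<close>)
  have disj: "X \<inter> Y = {}" by (auto simp: X_def Y_def code_neq)
  have xf: "{e \<in> X. (e, fc j) \<in> r} = {star x j, star x (j + 1)}" for j
  proof -
    have "(star x m, fc j) \<in> r \<longleftrightarrow> star x m = star x j \<or> star x m = star x (j + 1)" for m
      using r_eq[of "star x m" "fc j"] star_le_face[of x m j] by (simp add: X_def Y_def)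
    then show ?thesis unfolding X_def by blast
  qed
  have "polygonal r"
  proof (rule polygonalI[where X = X and Y = Y])
    show "Field r = X \<union> Y"
    proof
      show "Field r \<subseteq> X \<union> Y" using mem unfolding r_def Field_def by blast
      show "X \<union> Y \<subseteq> Field r"
      proof
        fix z assume z: "z \<in> X \<union> Y"
        then have "(z, z) \<in> r" unfolding r_eq[OF z z] using X_le(3) Y_le(3) by blast
        then show "z \<in> Field r" by (rule FieldI1)
      qed
    qed
    show "X \<inter> Y = {}" by (rule disj)
    show "(z, z) \<in> r" if "z \<in> X \<union> Y" for z
      unfolding r_eq[OF that that] using that X_le(3) Y_le(3) by blast
    show "z \<in> X \<and> z' \<in> Y" if "(z, z') \<in> r" "z \<noteq> z'" for z z'
    proof -
      have "z \<in> X \<union> Y" "z' \<in> X \<union> Y" "(z, z') \<in> leq M" using that mem unfolding r_def by blast+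
      moreover from this have "rank M z < rank M z'" using M_rank_less that(2) by blast
      ultimately show ?thesis by (auto simp: X_def Y_def code_rank)
    qed
    show "card {x \<in> X. (x, y) \<in> r} = 2" if "y \<in> Y" for y
    proof -
      obtain j where "y = fc j" using \<open>y \<in> Y\<close> unfolding Y_def by blast
      then show ?thesis using xf star_succ_neq by simp
    qed
    show "card {y \<in> Y. (e, y) \<in> r} = 2" if "e \<in> X" for e
    proof -
      obtain m where m: "e = star x m" using \<open>e \<in> X\<close> unfolding X_def by blast
      have "{y \<in> Y. (e, y) \<in> r} = {f \<in> range fc. (star x m, f) \<in> leq M}"
        using r_eq \<open>e \<in> X\<close> unfolding m Y_def by blast
      then show ?thesis unfolding star_faces using fc_neq by simp
    qed
    show "(e, e') \<in> {(x, x'). x \<in> X \<and> x' \<in> X \<and> (\<exists>y\<in>Y. (x, y) \<in> r \<and> (x', y) \<in> r)}\<^sup>*"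
      if "e \<in> X" "e' \<in> X" for e e'
    proof -
      obtain m m' where m: "e = star x m" "e' = star x m'" using \<open>e \<in> X\<close> \<open>e' \<in> X\<close> unfolding X_def by blast
      show ?thesis unfolding m
      proof (rule connected_range)
        fix i
        have "star x i \<in> {e \<in> X. (e, fc i) \<in> r}" "star x (i + 1) \<in> {e \<in> X. (e, fc i) \<in> r}"
          unfolding xf by auto
        moreover have "fc i \<in> Y" by (simp add: Y_def)
        ultimately show "(star x i, star x (i + 1)) \<in> {(x, x'). x \<in> X \<and> x' \<in> X \<and> (\<exists>y\<in>Y. (x, y) \<in> r \<and> (x', y) \<in> r)} \<and>
          (star x (i + 1), star x i) \<in> {(x, x'). x \<in> X \<and> x' \<in> X \<and> (\<exists>y\<in>Y. (x, y) \<in> r \<and> (x', y) \<in> r)}"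
          by blast
      qed
    qed
  qed
  then show ?thesis by (simp add: r_def)
qed

text \<open>Two consecutive edges \<open>(y, j)\<close> and \<open>(y', j + 1)\<close> of face
  \<open>j\<close> lead from the even vertex \<open>y\<close> to the even vertex \<open>y'\<close>,
  shifted by \<open>neighbour k j - neighbour k (j + 1)\<close>. This shift is 2 or
  \<open>2k\<close>, and the multiples of either exhaust the even residues, as
  \<open>k^2 = 1\<close> modulo \<open>p/2\<close>.\<close>

lemma face_step_reaches:
  assumes "even y" shows "\<exists>s. (s * (neighbour k j - neighbour k (j + 1))) mod int p = y mod int p"
proof -
  obtain z where z: "y = 2 * z" using assms ..
  show ?thesis
  proof (cases "even j")
    case True
    then obtain t where t: "j = 2 * t" ..
    have "neighbour k j - neighbour k (j + 1) = 2"
      unfolding t neighbour_even neighbour_odd by simp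
    then show ?thesis by (intro exI[of _ z]) (simp add: z mult.commute)
  next
    case False
    then obtain t where t: "j = 2 * t + 1" by (rule oddE)
    have "j + 1 = 2 * (t + 1)" by (simp add: t)
    then have "neighbour k (j + 1) = 1 - (2 + 2 * k) * (t + 1)" by (simp only: neighbour_even)
    then have d: "neighbour k j - neighbour k (j + 1) = 2 * k"
      unfolding t neighbour_odd by (simp add: algebra_simps)
    \<comment> \<open>The witness is \<open>k * z\<close>, because multiplication by
      \<open>k * k\<close> acts as the identity on even residues.\<close>
    have "(k * z) * (2 * k) - y = (2 * (k * k) - 2) * z" by (simp add: z algebra_simps)
    then have "int p dvd (k * z) * (2 * k) - y" using exponent_square by (metis dvd_mult2)
    then show ?thesis unfolding d mod_eq_dvd_iff by blast
  qed
qed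

lemma face_M: "polygonal (Restr (leq M) {G. (G, fc j) \<in> leq M \<and> G \<noteq> fc j})"
proof -
  define r where "r = Restr (leq M) {G. (G, fc j) \<in> leq M \<and> G \<noteq> fc j}"
  define X where "X = range vx"
  define Y where "Y = {e \<in> elems M 1. (e, fc j) \<in> leq M}"
  have X_le: "(z, fc j) \<in> leq M" "z \<noteq> fc j" "(z, z) \<in> leq M" if "z \<in> X" for z
    using that M_refl[OF in_Field(1)] le_vf by (auto simp: X_def code_neq)
  have Y_le: "(e, fc j) \<in> leq M" "e \<noteq> fc j" "(e, e) \<in> leq M" if "e \<in> Y" for e
    using that M_refl unfolding Y_def elems_M by (auto simp: code_neq in_Field)
  have r_eq: "(z, z') \<in> r \<longleftrightarrow> (z, z') \<in> leq M" if "z \<in> X \<union> Y" "z' \<in> X \<union> Y" for z z'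
    using that X_le(1,2) Y_le(1,2) unfolding r_def by blast
  have mem: "z \<in> X \<union> Y" if "(z, fc j) \<in> leq M" "z \<noteq> fc j" for z
  proof (rule M_le_cases[OF that(1)])
    fix x m j' assume h: "z = ed x m" "fc j = fc j'" "even x"
    then show ?thesis using that(1) unfolding Y_def elems_M by blast
  qed (use that in \<open>auto simp: X_def code_neq\<close>)
  have disj: "X \<inter> Y = {}" unfolding X_def Y_def elems_M by (auto simp: code_neq)
  have Y_rank: "rank M e = 1" if "e \<in> Y" for e using that by (simp add: Y_def elems_def)
  have ve: "{v \<in> X. (v, e) \<in> r} = {v \<in> elems M 0. (v, e) \<in> leq M}" if "e \<in> Y" for e
    using r_eq that unfolding X_def elems_M by blast
  have star_Y: "{e \<in> Y. (vx x, e) \<in> r} = {star x j, star x (j + 1)}" for x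
  proof -
    have "{e \<in> Y. (vx x, e) \<in> r} = {e \<in> {e \<in> elems M 1. (vx x, e) \<in> leq M}. (e, fc j) \<in> leq M}"
      using r_eq[of "vx x"] unfolding Y_def X_def by blast
    also have "\<dots> = {star x j, star x (j + 1)}"
      unfolding edges_at_vertex using star_le_face[of x _ j] by blast
    finally show ?thesis .
  qed
  have "polygonal r"
  proof (rule polygonalI[where X = X and Y = Y])
    show "Field r = X \<union> Y"
    proof
      show "Field r \<subseteq> X \<union> Y" using mem unfolding r_def Field_def by blast
      show "X \<union> Y \<subseteq> Field r"
      proof
        fix z assume z: "z \<in> X \<union> Y"
        then have "(z, z) \<in> r" unfolding r_eq[OF z z] using X_le(3) Y_le(3) by blast
        then show "z \<in> Field r" by (rule FieldI1)
      qed
    qed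
    show "X \<inter> Y = {}" by (rule disj)
    show "(z, z) \<in> r" if "z \<in> X \<union> Y" for z
      unfolding r_eq[OF that that] using that X_le(3) Y_le(3) by blast
    show "z \<in> X \<and> z' \<in> Y" if "(z, z') \<in> r" "z \<noteq> z'" for z z'
    proof -
      have zz: "z \<in> X \<union> Y" "z' \<in> X \<union> Y" "(z, z') \<in> leq M" using that mem unfolding r_def by blast+
      then have "rank M z < rank M z'" using M_rank_less that(2) by blast
      moreover have "rank M w = 0" if "w \<in> X" for w using that by (auto simp: X_def code_rank)
      ultimately show ?thesis using zz(1,2) Y_rank by fastforce
    qed
    show "card {x \<in> X. (x, y) \<in> r} = 2" if "y \<in> Y" for y
    proof -
      obtain x m where "y = ed x m" "even x" using \<open>y \<in> Y\<close> unfolding Y_def elems_M by blast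
      then show ?thesis using ve[OF that] card_edge(1) by simp
    qed
    show "card {y \<in> Y. (z, y) \<in> r} = 2" if "z \<in> X" for z
    proof -
      obtain x where "z = vx x" using \<open>z \<in> X\<close> unfolding X_def by blast
      then show ?thesis using star_Y star_succ_neq by simp
    qed
    let ?R = "{(x, x'). x \<in> X \<and> x' \<in> X \<and> (\<exists>y\<in>Y. (x, y) \<in> r \<and> (x', y) \<in> r)}"
    show "(z, z') \<in> ?R\<^sup>*" if zz: "z \<in> X" "z' \<in> X" for z z'
    proof -
      define \<delta> where "\<delta> = neighbour k j - neighbour k (j + 1)"
      \<comment> \<open>The walk around face \<open>j\<close>: even positions hold even vertices,
        successive ones differing by \<open>\<delta>\<close>, and odd positions hold the odd
        vertices between them.\<close>
      define u where "u i = vx (if even i then (i div 2) * \<delta> else (i div 2) * \<delta> + neighbour k j)" for i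
      have u: "u (2 * s) = vx (s * \<delta>)" "u (2 * s + 1) = vx (s * \<delta> + neighbour k j)" for s
        by (simp_all add: u_def)
      have "even \<delta>" using odd_neighbour by (simp add: \<delta>_def)
      have share: "(vx y, vx (y + neighbour k m)) \<in> ?R \<and> (vx (y + neighbour k m), vx y) \<in> ?R"
        if ym: "even y" "m = j \<or> m = j + 1" for y m
      proof -
        have Ym: "ed y m \<in> Y" unfolding Y_def edges_of_face using ym by blast
        have "vx y \<in> {v \<in> X. (v, ed y m) \<in> r}" "vx (y + neighbour k m) \<in> {v \<in> X. (v, ed y m) \<in> r}"
          unfolding ve[OF Ym] vertices_of_edge[OF ym(1)] by auto
        then show ?thesis using Ym by blast
      qed
      have step: "(u i, u (i + 1)) \<in> ?R \<and> (u (i + 1), u i) \<in> ?R" for i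
      proof (cases "even i")
        case True
        then obtain s where s: "i = 2 * s" ..
        show ?thesis unfolding s u using share[of "s * \<delta>" j] \<open>even \<delta>\<close> by simp
      next
        case False
        then obtain s where s: "i = 2 * s + 1" by (rule oddE)
        have "u (i + 1) = vx ((s + 1) * \<delta>)" using u(1)[of "s + 1"] by (simp add: s algebra_simps)
        moreover have "u i = vx ((s + 1) * \<delta> + neighbour k (j + 1))"
          unfolding s u by (simp add: \<delta>_def algebra_simps)
        ultimately show ?thesis using share[of "(s + 1) * \<delta>" "j + 1"] \<open>even \<delta>\<close> by simp
      qed
      have reach: "\<exists>i. vx x = u i" for x
      proof (cases "even x")
        case True
        then obtain s where "(s * \<delta>) mod int p = x mod int p" using face_step_reaches unfolding \<delta>_def by blast
        then have "vx x = u (2 * s)" unfolding u by (simp add: code_eq)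
        then show ?thesis ..
      next
        case False
        then have "even (x - neighbour k j)" using odd_neighbour by simp
        then obtain s where "(s * \<delta>) mod int p = (x - neighbour k j) mod int p"
          using face_step_reaches unfolding \<delta>_def by blast
        then have "(s * \<delta> + neighbour k j) mod int p = x mod int p"
          by (simp add: mod_eq_dvd_iff algebra_simps)
        then have "vx x = u (2 * s + 1)" unfolding u by (simp add: code_eq)
        then show ?thesis ..
      qed
      obtain i i' where "z = u i" "z' = u i'" using zz reach unfolding X_def by blast
      then show ?thesis using connected_range[of u ?R, OF step] by blast
    qed
  qed
  then show ?thesis by (simp add: r_def)
qed

lemma connected_M: "connected_graph (vertex_edge_graph M)"
  unfolding connected_graph_def
proof (intro ballI)
  fix z z' assume zz: "z \<in> verts (vertex_edge_graph M)" "z' \<in> verts (vertex_edge_graph M)"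
  let ?R = "{(x, y). \<exists>e\<in>edges (vertex_edge_graph M). {x, y} \<subseteq> ends (vertex_edge_graph M) e}"
  have share: "(vx y, vx (y + neighbour k m)) \<in> ?R \<and> (vx (y + neighbour k m), vx y) \<in> ?R" if "even y" for y m
  proof -
    have e: "ed y m \<in> elems M 1" unfolding elems_M using \<open>even y\<close> by blast
    have "vx y \<in> elems M 0" "vx (y + neighbour k m) \<in> elems M 0" unfolding elems_M by auto
    moreover have "incident M (vx y) (ed y m)" "incident M (vx (y + neighbour k m)) (ed y m)"
      using le_ve[OF that] by (auto simp: incident_def)
    ultimately show ?thesis using e by (auto simp: vertex_edge_graph_def)
  qed
  \<comment> \<open>The edges with \<open>m = 0\<close> and \<open>m = 1\<close> already join each
    integer label to its successor.\<close>
  have n: "neighbour k 0 = 1" "neighbour k 1 = -1" by (simp_all add: neighbour_def)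
  have step: "(vx i, vx (i + 1)) \<in> ?R \<and> (vx (i + 1), vx i) \<in> ?R" for i
  proof (cases "even i")
    case True then show ?thesis using share[of i 0] by (simp only: n)
  next
    case False
    then have "even (i + 1)" by simp
    from share[OF this, of 1] show ?thesis unfolding n by (simp only: add.assoc add.right_inverse add_0_right simp_thms conj_commute)
  qed
  obtain i i' where "z = vx i" "z' = vx i'" using zz by (auto simp: vertex_edge_graph_def elems_M)
  then show "(z, z') \<in> ?R\<^sup>*" using connected_range[of vx ?R, OF step] by blast
qed

lemma polyhedron_M: "polyhedron M"
  unfolding polyhedron_def
proof (intro conjI)
  show "Partial_order (leq M)" by (rule M_partial_order)
  show "rank M ` Field (leq M) \<subseteq> {0, 1, 2}" unfolding Field_model[OF pos] by (auto simp: code_rank)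
  show "\<forall>x y. (x, y) \<in> leq M \<and> x \<noteq> y \<longrightarrow> rank M x < rank M y" using M_rank_less by blast
  show "\<forall>C\<in>flags M. \<exists>v\<in>elems M 0. \<exists>e\<in>elems M 1. \<exists>F\<in>elems M 2. C = {v, e, F}" using M_flags by blast
  show "connected_graph (vertex_edge_graph M)" by (rule connected_M)
  show "\<forall>v\<in>elems M 0. polygonal (Restr (leq M) {G. (v, G) \<in> leq M \<and> G \<noteq> v})"
    unfolding elems_M using vertex_figure_M by blast
  show "\<forall>F\<in>elems M 2. polygonal (Restr (leq M) {G. (G, F) \<in> leq M \<and> G \<noteq> F})"
    unfolding elems_M using face_M by blast
  show "\<forall>e\<in>elems M 1. card {v \<in> elems M 0. incident M v e} = 2 \<and> card {F \<in> elems M 2. incident M e F} = 2"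
  proof
    fix e assume "e \<in> elems M 1"
    then obtain y m where e: "e = ed y m" "even y" unfolding elems_M by blast
    have "{v \<in> elems M 0. incident M v e} = {v \<in> elems M 0. (v, ed y m) \<in> leq M}"
      unfolding elems_M e using M_incident(1)[of _ y m] by blast
    moreover have "{F \<in> elems M 2. incident M e F} = {f \<in> elems M 2. (ed y m, f) \<in> leq M}"
      unfolding elems_M e using M_incident(2)[of y m] by blast
    ultimately show "card {v \<in> elems M 0. incident M v e} = 2 \<and> card {F \<in> elems M 2. incident M e F} = 2"
      using card_edge[OF e(2)] by simp
  qed
qed

lemma finite_polyhedron_M: "finite_polyhedron M"
  by unfold_locales (rule polyhedron_M finite_Field_M)+

sublocale M: finite_polyhedron M by (rule finite_polyhedron_M)

lemma has_type_M: "has_type M p q"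
  unfolding M.has_type_iff
proof
  show "\<forall>f\<in>elems M 2. card {e \<in> elems M 1. (e, f) \<in> leq M} = p"
    using card_edges_of_face unfolding elems_M(3) by blast
  show "\<forall>v\<in>elems M 0. card {e \<in> elems M 1. (v, e) \<in> leq M} = q"
    using card_edges_at_vertex unfolding elems_M(1) by blast
qed

lemma no_multiple_edges_M: "\<not> multiple_edges M"
proof
  assume "multiple_edges M"
  then obtain e e' where h: "e \<in> elems M 1" "e' \<in> elems M 1" "e \<noteq> e'"
    "{v \<in> elems M 0. (v, e) \<in> leq M} = {v \<in> elems M 0. (v, e') \<in> leq M}"
    unfolding M.multiple_edges_iff by blast
  obtain x m y l where e: "e = ed x m" "even x" "e' = ed y l" "even y" using h(1,2) unfolding elems_M by blast
  have eq: "{vx x, vx (x + neighbour k m)} = {vx y, vx (y + neighbour k l)}"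
    using h(4) unfolding e vertices_of_edge[OF e(2)] vertices_of_edge[OF e(4)] .
  \<comment> \<open>Every edge has one even and one odd end, so equal pairs of ends match in this
    order and \<open>neighbour_inj\<close> applies.\<close>
  have ne: "vx x' \<noteq> vx (y' + neighbour k l')" if "even x'" "even y'" for x' y' l'
    using parity_mod[of x' "y' + neighbour k l'"] odd_neighbour that by (auto simp: code_eq)
  have "vx x = vx y" "vx (x + neighbour k m) = vx (y + neighbour k l)"
    using eq ne[OF e(2,4), of l] ne[OF e(4,2), of m] by (auto simp: doubleton_eq_iff)
  then have xy: "x mod int p = y mod int p" and xn: "(x + neighbour k m) mod int p = (y + neighbour k l) mod int p"
    by (simp_all add: code_eq)
  have "((x + neighbour k m) - x) mod int p = ((y + neighbour k l) - y) mod int p"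
    by (rule mod_diff_cong[OF xn xy])
  then have "m mod int q = l mod int q" by (intro neighbour_inj) simp
  then have "e = e'" using xy by (simp add: e code_eq)
  with h(3) show False by simp
qed

end

text \<open>Each edge lies in four flags: two choices of an end times two choices of a face.\<close>

lemma (in finite_polyhedron) card_flags_edges: "card (flags P) = 4 * card E"
proof -
  let ?S = "SIGMA e:E. {v\<in>V. v \<sqsubseteq> e} \<times> {f\<in>F. e \<sqsubseteq> f}"
  let ?g = "\<lambda>(e, v, f). {v, e, f}"
  have fin: "finite (elems P i)" for i
    by (rule finite_subset[OF _ finite_Field]) (auto simp: elems_def)
  have img: "?g ` ?S = flags P" unfolding flags_eq flag_def by (force simp: image_iff)
  have "inj_on ?g ?S"
  proof (rule inj_onI)
    fix z z' assume z: "z \<in> ?S" "z' \<in> ?S" "?g z = ?g z'"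
    then obtain e v f e' v' f' where e: "z = (e, v, f)" "z' = (e', v', f')" by (metis prod_cases3)
    have "flag v e f" "flag v' e' f'" using z(1,2) unfolding e by (simp_all add: flag_def)
    from flag_inj[OF this] show "z = z'" using z(3) by (simp add: e)
  qed
  from card_image[OF this] have "card (flags P) = card ?S" by (simp only: img)
  also have "\<dots> = (\<Sum>e\<in>E. card ({v\<in>V. v \<sqsubseteq> e} \<times> {f\<in>F. e \<sqsubseteq> f}))"
    by (rule card_SigmaI) (use fin in auto)
  also have "\<dots> = (\<Sum>e\<in>E. 4)"
    by (intro sum.cong refl) (simp add: card_cartesian_product card_vertices_edge card_faces_edge del: One_nat_def)
  finally show ?thesis by simp
qed

text \<open>An injective monotone map of a finite poset into itself permutes its elements and also
  the finite set of comparable pairs, so it reflects the order.\<close>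

lemma (in finite_polyhedron) AutI:
  assumes closed: "\<And>x. x \<in> Field (leq P) \<Longrightarrow> g x \<in> Field (leq P)"
    and inj: "inj_on g (Field (leq P))" and mono: "\<And>x y. x \<sqsubseteq> y \<Longrightarrow> g x \<sqsubseteq> g y"
  shows "restrict g (Field (leq P)) \<in> Aut"
proof -
  let ?S = "Field (leq P)"
  have "g ` ?S = ?S" using closed inj finite_Field by (intro endo_inj_surj) auto
  then have bij: "bij_betw g ?S ?S" using inj by (simp add: bij_betw_def)
  have fin: "finite (leq P)"
    by (rule finite_subset[of _ "?S \<times> ?S"]) (auto intro: FieldI1 FieldI2 simp: finite_Field)
  have "(\<lambda>(x, y). (g x, g y)) ` leq P = leq P"
  proof (rule endo_inj_surj[OF fin])
    show "(\<lambda>(x, y). (g x, g y)) ` leq P \<subseteq> leq P" using mono by auto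
    show "inj_on (\<lambda>(x, y). (g x, g y)) (leq P)"
      using inj by (auto simp: inj_on_def) (meson FieldI1 FieldI2)+
  qed
  then have reflects: "x \<sqsubseteq> y" if xy: "x \<in> ?S" "y \<in> ?S" "g x \<sqsubseteq> g y" for x y
  proof -
    have "(g x, g y) \<in> (\<lambda>(x, y). (g x, g y)) ` leq P"
      using xy(3) \<open>(\<lambda>(x, y). (g x, g y)) ` leq P = leq P\<close> by simp
    then obtain x' y' where h: "x' \<sqsubseteq> y'" "g x = g x'" "g y = g y'" by auto
    then have "x = x'" "y = y'" using inj xy FieldI1[OF h(1)] FieldI2[OF h(1)] by (meson inj_onD)+
    then show ?thesis using h(1) by simp
  qed
  have "restrict g ?S \<in> Bij ?S"
    unfolding Bij_def using bij by (simp add: bij_betw_restrict_eq)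
  moreover have "x \<sqsubseteq> y \<longleftrightarrow> restrict g ?S x \<sqsubseteq> restrict g ?S y" if "x \<in> ?S" "y \<in> ?S" for x y
    using that mono reflects by auto
  ultimately show ?thesis by (simp add: Aut_iff)
qed

section \<open>Automorphisms of the model\<close>

context model_params begin

lemma model_Aut:
  assumes \<alpha>: "\<And>x x'. x mod int p = x' mod int p \<longleftrightarrow> \<alpha> x mod int p = \<alpha> x' mod int p"
    and \<epsilon>: "\<And>x m x' m'. even x \<Longrightarrow> even x' \<Longrightarrow> x mod int p = x' mod int p \<and> m mod int q = m' mod int q \<longleftrightarrow>
        \<epsilon> x m mod int p = \<epsilon> x' m' mod int p \<and> \<mu> x m mod int q = \<mu> x' m' mod int q"
    and \<phi>: "\<And>j j'. j mod int q = j' mod int q \<longleftrightarrow> \<phi> j mod int q = \<phi> j' mod int q"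
    and ev: "\<And>x m. even x \<Longrightarrow> even (\<epsilon> x m)"
    and v1: "\<And>x m. even x \<Longrightarrow> (vx (\<alpha> x), ed (\<epsilon> x m) (\<mu> x m)) \<in> leq M"
    and v2: "\<And>x m. even x \<Longrightarrow> (vx (\<alpha> (x + neighbour k m)), ed (\<epsilon> x m) (\<mu> x m)) \<in> leq M"
    and f1: "\<And>x m. even x \<Longrightarrow> (ed (\<epsilon> x m) (\<mu> x m), fc (\<phi> m)) \<in> leq M"
    and f2: "\<And>x m. even x \<Longrightarrow> (ed (\<epsilon> x m) (\<mu> x m), fc (\<phi> (m - 1))) \<in> leq M"
  obtains g where "g \<in> M.Aut" "\<And>x. g (vx x) = vx (\<alpha> x)" "\<And>x m. even x \<Longrightarrow> g (ed x m) = ed (\<epsilon> x m) (\<mu> x m)"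
    "\<And>j. g (fc j) = fc (\<phi> j)"
proof -
  have pm: "even (x mod int p) \<longleftrightarrow> even x" for x using parity_mod[of "x mod int p" x] by simp
  \<comment> \<open>Only even labels name edges, and 0 is a placeholder for odd ones. Evenness is
    well defined modulo the even number \<open>p\<close>, so the function respects residues.\<close>
  define ge where "ge x m = (if even x then ed (\<epsilon> x m) (\<mu> x m) else 0)" for x m
  define h where "h = model_map (\<lambda>x. vx (\<alpha> x)) ge (\<lambda>j. fc (\<phi> j))"
  have hv: "h (vx x) = vx (\<alpha> x)" for x
    unfolding h_def
  proof (rule model_map_apply(1)[OF pos])
    show "vx (\<alpha> (x mod int p)) = vx (\<alpha> x)" for x using \<alpha>[of "x mod int p" x] by (simp add: code_eq)
  qed
  have he: "h (ed x m) = ed (\<epsilon> x m) (\<mu> x m)" if "even x" for x m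
  proof -
    have "h (ed x m) = ge x m" unfolding h_def
    proof (rule model_map_apply(2)[OF pos])
      show "ge (x mod int p) (m mod int q) = ge x m" for x m
        using \<epsilon>[of "x mod int p" x "m mod int q" m] by (simp add: ge_def pm code_eq)
    qed
    then show ?thesis using that by (simp add: ge_def)
  qed
  have hf: "h (fc j) = fc (\<phi> j)" for j
    unfolding h_def
  proof (rule model_map_apply(3)[OF pos])
    show "fc (\<phi> (j mod int q)) = fc (\<phi> j)" for j using \<phi>[of "j mod int q" j] by (simp add: code_eq)
  qed
  have cases: "(\<exists>x. z = vx x) \<or> (\<exists>x m. even x \<and> z = ed x m) \<or> (\<exists>j. z = fc j)" if "z \<in> Field (leq M)" for z
    using that unfolding Field_model[OF pos] by blast
  have closed: "h z \<in> Field (leq M)" if "z \<in> Field (leq M)" for z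
    using cases[OF that] hv he hf ev in_Field by (elim disjE exE conjE) simp_all
  have inj: "inj_on h (Field (leq M))"
  proof (rule inj_onI)
    fix z z' assume z: "z \<in> Field (leq M)" "z' \<in> Field (leq M)" "h z = h z'"
    from cases[OF z(1)] cases[OF z(2)] z(3) show "z = z'"
      by (elim disjE exE conjE; hypsubst)
        (simp_all add: hv he hf code_neq code_eq \<alpha>[symmetric] \<epsilon>[symmetric] \<phi>[symmetric])
  qed
  have mono: "(h z, h z') \<in> leq M" if zz: "(z, z') \<in> leq M" for z z'
  proof (rule M_le_cases[OF zz])
    assume "z = z'"
    then show ?thesis using closed FieldI1[OF zz] M_refl by simp
  next
    fix x y m assume e: "z = vx x" "z' = ed y m" "even y"
    then have "x mod int p = y mod int p \<or> x mod int p = (y + neighbour k m) mod int p"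
      using zz by (simp add: model_le_vertex_edge)
    then have "vx (\<alpha> x) = vx (\<alpha> y) \<or> vx (\<alpha> x) = vx (\<alpha> (y + neighbour k m))"
      using \<alpha> by (simp add: code_eq)
    then show ?thesis using v1[OF e(3)] v2[OF e(3)] unfolding e hv he[OF e(3)] by metis
  next
    fix x m j assume e: "z = ed x m" "z' = fc j" "even x"
    then have "j mod int q = m mod int q \<or> j mod int q = (m - 1) mod int q"
      using zz by (simp add: model_le_edge_face[OF pos])
    then have "fc (\<phi> j) = fc (\<phi> m) \<or> fc (\<phi> j) = fc (\<phi> (m - 1))"
      using \<phi> by (simp add: code_eq)
    then show ?thesis using f1[OF e(3)] f2[OF e(3)] unfolding e hf he[OF e(3)] by metis
  next
    fix x j assume "z = vx x" "z' = fc j"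
    then show ?thesis by (simp add: hv hf le_vf)
  qed
  show thesis
    by (rule that[OF M.AutI[OF closed inj mono]]) (simp_all add: in_Field hv he hf)
qed

text \<open>In the rotation group this is \<open>mirror\<close> combined with
  \<open>b a = a^-1 b^-1\<close>. It matches the ends of edges under automorphisms that turn
  \<open>m\<close> into \<open>1 - m\<close>.\<close>

lemma neighbour_flip: "neighbour k (1 - m) = - neighbour k m"
proof (cases "even m")
  case True
  then obtain t where t: "m = 2 * t" ..
  have "1 - m = 2 * (- t) + 1" by (simp add: t)
  then have "neighbour k (1 - m) = -1 - (2 + 2 * k) * (- t)" by (simp only: neighbour_odd)
  then show ?thesis unfolding t neighbour_even by simp
next
  case False
  then obtain t where t: "m = 2 * t + 1" by (rule oddE)
  have "1 - m = 2 * (- t)" by (simp add: t)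
  then have "neighbour k (1 - m) = 1 - (2 + 2 * k) * (- t)" by (simp only: neighbour_even)
  then show ?thesis unfolding t neighbour_odd by simp
qed

lemma mod_neg_eq_iff: "(- x) mod n = (- y) mod n \<longleftrightarrow> x mod n = y mod (n :: int)"
  by (simp add: mod_eq_dvd_iff dvd_diff_commute)

lemma mod_shift_eq_iff: "(x + c) mod n = (y + c) mod n \<longleftrightarrow> x mod n = y mod (n :: int)"
  by (simp add: mod_eq_dvd_iff)

lemma mod_flip_eq_iff: "(c - x) mod n = (c - y) mod n \<longleftrightarrow> x mod n = y mod (n :: int)"
  by (simp add: mod_eq_dvd_iff dvd_diff_commute)

text \<open>Left multiplication by \<open>a\<close>. The product \<open>a^(x+1) b^m\<close> has an
  odd exponent, so the edge is renamed by multiplying with \<open>a b\<close> on the right, which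
  gives the label \<open>(x + 1 + neighbour k m, 1 - m)\<close>.\<close>

lemma rotation_face_Aut:
  obtains g where "g \<in> M.Aut" "\<And>x. g (vx x) = vx (x + 1)"
    "\<And>x m. even x \<Longrightarrow> g (ed x m) = ed (x + 1 + neighbour k m) (1 - m)" "\<And>j. g (fc j) = fc (- j)"
proof (rule model_Aut[of "\<lambda>x. x + 1" "\<lambda>x m. x + 1 + neighbour k m" "\<lambda>x m. 1 - m" "\<lambda>j. - j"])
  show "x mod int p = x' mod int p \<longleftrightarrow> (x + 1) mod int p = (x' + 1) mod int p" for x x'
    by (simp only: mod_shift_eq_iff)
  show "j mod int q = j' mod int q \<longleftrightarrow> (- j) mod int q = (- j') mod int q" for j j'
    by (simp only: mod_neg_eq_iff)
  show "x mod int p = x' mod int p \<and> m mod int q = m' mod int q \<longleftrightarrow>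
      (x + 1 + neighbour k m) mod int p = (x' + 1 + neighbour k m') mod int p \<and> (1 - m) mod int q = (1 - m') mod int q"
    for x m x' m'
  proof (cases "m mod int q = m' mod int q")
    case True
    from neighbour_cong[OF True] obtain c where "neighbour k m - neighbour k m' = int p * c"
      by (metis mod_eq_dvd_iff dvd_def)
    then have d: "(x + 1 + neighbour k m) - (x' + 1 + neighbour k m') = (x - x') + int p * c" by simp
    have "(x + 1 + neighbour k m) mod int p = (x' + 1 + neighbour k m') mod int p \<longleftrightarrow> x mod int p = x' mod int p"
      unfolding mod_eq_dvd_iff d by (simp add: dvd_add_left_iff)
    then show ?thesis using True by (simp add: mod_flip_eq_iff)
  qed (simp add: mod_flip_eq_iff)
  show "even (x + 1 + neighbour k m)" if "even x" for x m using that odd_neighbour by simp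
  then have ev: "even (x + 1 + neighbour k m)" if "even x" for x m using that by blast
  show "(vx (x + 1), ed (x + 1 + neighbour k m) (1 - m)) \<in> leq M" if "even x" for x m
    using le_ve(2)[OF ev[OF that], of m "1 - m"] by (simp add: neighbour_flip)
  show "(vx (x + neighbour k m + 1), ed (x + 1 + neighbour k m) (1 - m)) \<in> leq M" if "even x" for x m
    using le_ve(1)[OF ev[OF that], of m "1 - m"] by (simp add: add_ac)
  show "(ed (x + 1 + neighbour k m) (1 - m), fc (- m)) \<in> leq M" if "even x" for x m
    using le_ef(2)[OF ev[OF that], of m "1 - m"] by simp
  show "(ed (x + 1 + neighbour k m) (1 - m), fc (- (m - 1))) \<in> leq M" if "even x" for x m
    using le_ef(1)[OF ev[OF that], of m "1 - m"] by simp
qed (rule that, assumption+)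

text \<open>The action of \<open>\<rho>\<^sub>1\<close>, which inverts \<open>a\<close> and
  \<open>b\<close> and takes the base edge to its image under \<open>b\<close>; hence
  \<open>1 - m\<close> rather than \<open>-m\<close>.\<close>

lemma reflection_Aut:
  obtains g where "g \<in> M.Aut" "\<And>x. g (vx x) = vx (- x)"
    "\<And>x m. even x \<Longrightarrow> g (ed x m) = ed (- x) (1 - m)" "\<And>j. g (fc j) = fc (- j)"
proof (rule model_Aut[of "\<lambda>x. - x" "\<lambda>x m. - x" "\<lambda>x m. 1 - m" "\<lambda>j. - j"])
  show "(vx (- x), ed (- x) (1 - m)) \<in> leq M" if "even x" for x m
    using le_ve(1)[of "- x" "1 - m"] that by simp
  show "(vx (- (x + neighbour k m)), ed (- x) (1 - m)) \<in> leq M" if "even x" for x m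
    using le_ve(2)[of "- x" "1 - m"] that by (simp add: neighbour_flip)
  show "(ed (- x) (1 - m), fc (- m)) \<in> leq M" if "even x" for x m
    using le_ef(2)[of "- x" "1 - m"] that by simp
  show "(ed (- x) (1 - m), fc (- (m - 1))) \<in> leq M" if "even x" for x m
    using le_ef(1)[of "- x" "1 - m"] that by simp
qed (simp_all add: mod_neg_eq_iff mod_flip_eq_iff)

lemma k_even_mod: "even x \<Longrightarrow> even y \<Longrightarrow> (k * x) mod int p = (k * y) mod int p \<longleftrightarrow> x mod int p = y mod int p"
proof
  assume h: "even x" "even y" "(k * x) mod int p = (k * y) mod int p"
  have "even (x - y)" using h(1,2) by simp
  then obtain z where z: "x - y = 2 * z" ..
  have "int p dvd k * x - k * y" using h(3) by (simp only: mod_eq_dvd_iff)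
  then have "int p dvd (k * x - k * y) * k - (2 * (k * k) - 2) * z"
    by (rule dvd_diff[OF dvd_mult2 dvd_mult2[OF exponent_square]])
  also have "(k * x - k * y) * k - (2 * (k * k) - 2) * z = k * k * (x - y) - k * k * (2 * z) + 2 * z"
    by (simp add: algebra_simps)
  also have "\<dots> = x - y" by (simp add: z)
  finally show "x mod int p = y mod int p" by (simp only: mod_eq_dvd_iff)
next
  assume "x mod int p = y mod int p"
  then show "(k * x) mod int p = (k * y) mod int p" by (rule mod_mult_cong[OF refl])
qed

lemma neighbour_rotate:
  "int p dvd k * (x + neighbour k m) - k - 1 - (k * x + neighbour k (m + 1))"
proof (cases "even m")
  case True
  then obtain t where t: "m = 2 * t" ..
  have "k * (x + neighbour k m) - k - 1 - (k * x + neighbour k (m + 1)) = (2 * (k * k) - 2) * (- t)"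
    unfolding t neighbour_even neighbour_odd by (simp add: algebra_simps)
  then show ?thesis using exponent_square by (metis dvd_mult2)
next
  case False
  then obtain t where t: "m = 2 * t + 1" by (rule oddE)
  have "m + 1 = 2 * (t + 1)" by (simp add: t)
  then have n: "neighbour k (m + 1) = 1 - (2 + 2 * k) * (t + 1)" by (simp only: neighbour_even)
  have "k * (x + neighbour k m) - k - 1 - (k * x + neighbour k (m + 1)) = (2 * (k * k) - 2) * (- t)"
    unfolding n unfolding t neighbour_odd by (simp add: algebra_simps)
  then show ?thesis using exponent_square by (metis dvd_mult2)
qed

text \<open>Left multiplication by \<open>b\<close>. For odd \<open>x\<close> the product
  \<open>b a^x = a^(k(x-1)) b a\<close> sends the base vertex to vertex \<open>k(x - 1) - 1\<close>,
  which is the second case of the formula on vertices.\<close>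

lemma rotation_vertex_Aut:
  obtains g where "g \<in> M.Aut" "\<And>x. g (vx x) = vx (if even x then k * x else k * x - k - 1)"
    "\<And>x m. even x \<Longrightarrow> g (ed x m) = ed (k * x) (m + 1)" "\<And>j. g (fc j) = fc (j + 1)"
proof (rule model_Aut[of "\<lambda>x. if even x then k * x else k * x - k - 1" "\<lambda>x m. k * x" "\<lambda>x m. m + 1" "\<lambda>j. j + 1"])
  let ?\<alpha> = "\<lambda>x. if even x then k * x else k * x - k - 1"
  show "x mod int p = y mod int p \<longleftrightarrow> ?\<alpha> x mod int p = ?\<alpha> y mod int p" for x y
  proof (cases "even x \<longleftrightarrow> even y")
    case same: True
    show ?thesis
    proof (cases "even x")
      case True
      then show ?thesis using k_even_mod[of x y] same by simp
    next
      case False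
      have "x mod int p = y mod int p \<longleftrightarrow> (x - 1) mod int p = (y - 1) mod int p" by (simp add: mod_eq_dvd_iff)
      also have "\<dots> \<longleftrightarrow> (k * (x - 1)) mod int p = (k * (y - 1)) mod int p"
        using k_even_mod[of "x - 1" "y - 1"] False same by simp
      also have "\<dots> \<longleftrightarrow> ?\<alpha> x mod int p = ?\<alpha> y mod int p"
        using False same by (simp add: mod_eq_dvd_iff algebra_simps)
      finally show ?thesis .
    qed
  next
    case diff: False
    have par: "even (?\<alpha> z) \<longleftrightarrow> even z" for z
    proof (cases "even z")
      case False
      have "k * z - k - 1 = k * (z - 1) - 1" by (simp add: algebra_simps)
      then show ?thesis using False by simp
    qed simp
    have "x mod int p \<noteq> y mod int p" using diff parity_mod by blast
    moreover have "?\<alpha> x mod int p \<noteq> ?\<alpha> y mod int p" using diff par parity_mod by blast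
    ultimately show ?thesis by blast
  qed
  show "x mod int p = x' mod int p \<and> m mod int q = m' mod int q \<longleftrightarrow>
      (k * x) mod int p = (k * x') mod int p \<and> (m + 1) mod int q = (m' + 1) mod int q"
    if "even x" "even x'" for x m x' m'
    using that by (simp only: k_even_mod mod_shift_eq_iff)
  show "j mod int q = j' mod int q \<longleftrightarrow> (j + 1) mod int q = (j' + 1) mod int q" for j j'
    by (simp only: mod_shift_eq_iff)
  show "even (k * x)" if "even x" for x using that by simp
  show "(vx (?\<alpha> x), ed (k * x) (m + 1)) \<in> leq M" if "even x" for x m
    using le_ve(1)[of "k * x" "m + 1"] that by simp
  show "(vx (?\<alpha> (x + neighbour k m)), ed (k * x) (m + 1)) \<in> leq M" if "even x" for x m
  proof -
    have "?\<alpha> (x + neighbour k m) = k * (x + neighbour k m) - k - 1" using that odd_neighbour by simp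
    then have "?\<alpha> (x + neighbour k m) mod int p = (k * x + neighbour k (m + 1)) mod int p"
      using neighbour_rotate[of x m] by (simp only: mod_eq_dvd_iff)
    then have "vx (?\<alpha> (x + neighbour k m)) = vx (k * x + neighbour k (m + 1))" by (simp only: code_eq)
    then show ?thesis using le_ve(2)[of "k * x" "m + 1"] that by simp
  qed
  show "(ed (k * x) (m + 1), fc (m + 1)) \<in> leq M" if "even x" for x m
    using le_ef(1)[of "k * x" "m + 1"] that by simp
  show "(ed (k * x) (m + 1), fc (m - 1 + 1)) \<in> leq M" if "even x" for x m
    using le_ef(2)[of "k * x" "m + 1"] that by simp
qed (rule that, assumption+)

end

section \<open>Regularity and orientability from the three generators\<close>

context rooted_polyhedron begin

lemma regular: "regular P"
  unfolding regular_def
proof (intro ballI)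
  fix C D assume "C \<in> flags P" "D \<in> flags P"
  then obtain v e f v' e' f' where fl: "flag v e f" "C = {v, e, f}" "flag v' e' f'" "D = {v', e', f'}"
    unfolding flags_eq by blast
  obtain h where h: "h \<in> Aut" "h v\<^sub>0 = v" "h e\<^sub>0 = e" "h f\<^sub>0 = f" using flag_image[OF fl(1)] by blast
  obtain h' where h': "h' \<in> Aut" "h' v\<^sub>0 = v'" "h' e\<^sub>0 = e'" "h' f\<^sub>0 = f'" using flag_image[OF fl(3)] by blast
  have i: "(inv\<^bsub>aut_group P\<^esub> h) (h x) = x" if "x \<in> Field (leq P)" for x
    using Aut_mult_apply[of "inv\<^bsub>aut_group P\<^esub> h" h x] Aut_one_apply[of x] h(1) that by simp
  have "(h' \<cdot> inv\<^bsub>aut_group P\<^esub> h) ` C = D"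
    using i[of v\<^sub>0] i[of e\<^sub>0] i[of f\<^sub>0] flag_Field[OF fl(1)] h h' by (simp add: fl Aut_mult_apply)
  then show "\<exists>g\<in>carrier (aut_group P). g ` C = D" using h(1) h'(1) by (intro bexI[of _ "h' \<cdot> inv\<^bsub>aut_group P\<^esub> h"]) simp_all
qed

lemma orientably_regularI:
  assumes "\<rho>\<^sub>1 \<notin> Plus" shows "orientably_regular P"
proof -
  define \<rho> where "\<rho> i = (if i = 0 then \<rho>\<^sub>0 else if i = 1 then \<rho>\<^sub>1 else \<rho>\<^sub>2)" for i :: nat
  let ?C = "{v\<^sub>0, e\<^sub>0, f\<^sub>0}"
  have C: "?C \<in> flags P" by (rule flag_elems[OF base_flag])
  have r: "rank P v\<^sub>0 = 0" "rank P e\<^sub>0 = 1" "rank P f\<^sub>0 = 2"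
    using base_flag by (auto simp: flag_def elems_def)
  have r': "rank P (\<rho>\<^sub>0 v\<^sub>0) = 0" "rank P (\<rho>\<^sub>1 e\<^sub>0) = 1" "rank P (\<rho>\<^sub>2 f\<^sub>0) = 2"
    using moved_flags by (auto simp: flag_def elems_def)
  have fl: "{\<rho>\<^sub>0 v\<^sub>0, e\<^sub>0, f\<^sub>0} \<in> flags P" "{v\<^sub>0, \<rho>\<^sub>1 e\<^sub>0, f\<^sub>0} \<in> flags P" "{v\<^sub>0, e\<^sub>0, \<rho>\<^sub>2 f\<^sub>0} \<in> flags P"
    using moved_flags flag_elems by auto
  have ne: "{\<rho>\<^sub>0 v\<^sub>0, e\<^sub>0, f\<^sub>0} \<noteq> ?C" "{v\<^sub>0, \<rho>\<^sub>1 e\<^sub>0, f\<^sub>0} \<noteq> ?C" "{v\<^sub>0, e\<^sub>0, \<rho>\<^sub>2 f\<^sub>0} \<noteq> ?C"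
    using flag_inj(1)[OF moved_flags(1) base_flag] flag_inj(2)[OF moved_flags(2) base_flag]
      flag_inj(3)[OF moved_flags(3) base_flag] \<rho>\<^sub>0(3) \<rho>\<^sub>1(3) \<rho>\<^sub>2(3) by blast+
  have adj: "adjacent_flag P i ?C (\<rho> i ` ?C)" if "i \<in> {0, 1, 2}" for i
  proof -
    have "i = 0 \<or> i = 1 \<or> i = 2" using that by auto
    moreover have "{x \<in> {\<rho>\<^sub>0 v\<^sub>0, e\<^sub>0, f\<^sub>0}. rank P x \<noteq> 0} = {x \<in> ?C. rank P x \<noteq> 0}"
      "{x \<in> {v\<^sub>0, \<rho>\<^sub>1 e\<^sub>0, f\<^sub>0}. rank P x \<noteq> 1} = {x \<in> ?C. rank P x \<noteq> 1}"
      "{x \<in> {v\<^sub>0, e\<^sub>0, \<rho>\<^sub>2 f\<^sub>0}. rank P x \<noteq> 2} = {x \<in> ?C. rank P x \<noteq> 2}"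
      using r r' by auto
    ultimately show ?thesis
      using C fl ne unfolding adjacent_flag_def by (elim disjE) (simp_all add: \<rho>_def \<rho>\<^sub>0 \<rho>\<^sub>1 \<rho>\<^sub>2)
  qed
  have "card (rcosets\<^bsub>aut_group P\<^esub> (generate (aut_group P) {\<rho> 0 \<cdot> \<rho> 1, \<rho> 1 \<cdot> \<rho> 2})) = 2"
    using index_Plus assms by (simp add: Plus_def a_def b_def \<rho>_def)
  moreover have "\<forall>i\<in>{0, 1, 2}. \<rho> i \<in> carrier (aut_group P) \<and> adjacent_flag P i ?C (\<rho> i ` ?C)"
    using adj by (auto simp: \<rho>_def)
  ultimately show ?thesis unfolding orientably_regular_def using regular C by blast
qed

end

section \<open>Orientability and tightness of the model\<close>

context model_params begin

lemma model_flag: "even y \<Longrightarrow> v = vx y \<or> v = vx (y + neighbour k m) \<Longrightarrow> f = fc m \<or> f = fc (m - 1) \<Longrightarrow>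
    M.flag v (ed y m) f"
  unfolding M.flag_def elems_M using le_ve[of y m] le_ef[of y m] by auto

lemma model_flagE:
  assumes "M.flag v e f"
  obtains x y m j where "v = vx x" "e = ed y m" "even y" "f = fc j" "fc j = fc m \<or> fc j = fc (m - 1)"
proof -
  obtain x y m j where h: "v = vx x" "e = ed y m" "even y" "f = fc j" "(ed y m, fc j) \<in> leq M"
    using assms unfolding M.flag_def elems_M by blast
  then have "fc j = fc m \<or> fc j = fc (m - 1)" by (simp add: model_le_edge_face[OF pos] code_eq)
  then show thesis using that h by blast
qed

lemma model_roots: 
  obtains \<rho>\<^sub>0 \<rho>\<^sub>1 \<rho>\<^sub>2 where "rooted_polyhedron M (vx 0) (ed 0 0) (fc 0) \<rho>\<^sub>0 \<rho>\<^sub>1 \<rho>\<^sub>2"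
    "\<rho>\<^sub>1 \<notin> rooted_polyhedron.Plus M \<rho>\<^sub>0 \<rho>\<^sub>1 \<rho>\<^sub>2"
proof -
  obtain ga where ga: "ga \<in> M.Aut" "\<And>x. ga (vx x) = vx (x + 1)"
    "\<And>x m. even x \<Longrightarrow> ga (ed x m) = ed (x + 1 + neighbour k m) (1 - m)" "\<And>j. ga (fc j) = fc (- j)"
    by (rule rotation_face_Aut, rule that, assumption+)
  obtain gr where gr: "gr \<in> M.Aut" "\<And>x. gr (vx x) = vx (- x)"
    "\<And>x m. even x \<Longrightarrow> gr (ed x m) = ed (- x) (1 - m)" "\<And>j. gr (fc j) = fc (- j)"
    by (rule reflection_Aut, rule that, assumption+)
  obtain gb where gb: "gb \<in> M.Aut" "\<And>x. gb (vx x) = vx (if even x then k * x else k * x - k - 1)"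
    "\<And>x m. even x \<Longrightarrow> gb (ed x m) = ed (k * x) (m + 1)" "\<And>j. gb (fc j) = fc (j + 1)"
    by (rule rotation_vertex_Aut, rule that, assumption+)
  let ?G = "aut_group M"
  note app = M.Aut_mult_apply[OF _ _ in_Field(1)] M.Aut_mult_apply[OF _ _ in_Field(2)] M.Aut_mult_apply[OF _ _ in_Field(3)]
  have n1: "neighbour k 1 = -1" by (simp add: neighbour_def)
  have big: "(1::int) mod int p = 1" "(1::int) mod int q = 1" "(-1) mod int q \<noteq> 0"
    using q_bounds by (simp_all add: mod_eq_0_iff_dvd)
  \<comment> \<open>As \<open>a = \<rho>\<^sub>0 \<cdot> \<rho>\<^sub>1\<close> and
    \<open>b = \<rho>\<^sub>1 \<cdot> \<rho>\<^sub>2\<close>, the two outer reflections are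
    recovered as \<open>a \<cdot> \<rho>\<^sub>1\<close> and
    \<open>\<rho>\<^sub>1 \<cdot> b\<close>.\<close>
  interpret R: rooted_polyhedron M "vx 0" "ed 0 0" "fc 0" "ga \<otimes>\<^bsub>?G\<^esub> gr" gr "gr \<otimes>\<^bsub>?G\<^esub> gb"
  proof
    show "M.flag (vx 0) (ed 0 0) (fc 0)" by (rule model_flag) auto
    show "ga \<otimes>\<^bsub>?G\<^esub> gr \<in> M.Aut" "gr \<in> M.Aut" "gr \<otimes>\<^bsub>?G\<^esub> gb \<in> M.Aut" using ga gr gb by simp_all
    show "(ga \<otimes>\<^bsub>?G\<^esub> gr) (ed 0 0) = ed 0 0" "(ga \<otimes>\<^bsub>?G\<^esub> gr) (fc 0) = fc 0"
      using ga gr n1 by (simp_all add: app)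
    show "(ga \<otimes>\<^bsub>?G\<^esub> gr) (vx 0) \<noteq> vx 0" using ga gr big by (simp add: app code_eq)
    show "gr (vx 0) = vx 0" "gr (fc 0) = fc 0" using gr by simp_all
    show "gr (ed 0 0) \<noteq> ed 0 0" using gr big by (simp add: code_eq)
    show "(gr \<otimes>\<^bsub>?G\<^esub> gb) (vx 0) = vx 0" "(gr \<otimes>\<^bsub>?G\<^esub> gb) (ed 0 0) = ed 0 0"
      using gr gb by (simp_all add: app)
    show "(gr \<otimes>\<^bsub>?G\<^esub> gb) (fc 0) \<noteq> fc 0" using gr gb big by (simp add: app code_eq)
  qed
  have ab: "R.a = ga" "R.b = gb"
  proof -
    show "R.a = ga" unfolding R.a_def using R.\<rho>_cancel(2)[OF ga(1)] .
    have "R.b = (gr \<otimes>\<^bsub>?G\<^esub> gr) \<otimes>\<^bsub>?G\<^esub> gb" unfolding R.b_def using gr gb by (simp add: M.Aut.m_assoc)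
    then show "R.b = gb" using gb by (simp add: R.\<rho>_square)
  qed
  \<comment> \<open>A two-colouring of the flags, comparing the parity of the vertex with the side
    of the edge on which the face lies, face \<open>m\<close> or face \<open>m - 1\<close>. Both
    rotations \<open>ga\<close> and \<open>gb\<close> keep the colours, whereas \<open>gr\<close>
    changes the colour of the base flag, so \<open>gr\<close> is no product of rotations.\<close>
  define col where "col v e f \<longleftrightarrow> ((\<exists>x. even x \<and> v = vx x) \<longleftrightarrow> (\<exists>x m. e = ed x m \<and> f = fc m))" for v e f
  have col: "col (vx x) (ed y m) (fc j) \<longleftrightarrow> (even x \<longleftrightarrow> fc j = fc m)" for x y m j
  proof -
    have "(\<exists>x'. even x' \<and> vx x = vx x') \<longleftrightarrow> even x" using parity_mod code_eq(1) by metis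
    moreover have "(\<exists>x' m'. ed y m = ed x' m' \<and> fc j = fc m') \<longleftrightarrow> fc j = fc m"
      unfolding code_eq by metis
    ultimately show ?thesis by (simp add: col_def)
  qed
  have flip: "fc (- j) = fc (1 - m) \<longleftrightarrow> fc j \<noteq> fc m" if "fc j = fc m \<or> fc j = fc (m - 1)" for j m
  proof -
    have "fc (- j) = fc (1 - m) \<longleftrightarrow> fc j = fc (m - 1)"
      using mod_neg_eq_iff[of j "int q" "m - 1"] by (simp add: code_eq)
    then show ?thesis using that fc_neq(1)[of m] by auto
  qed
  define K where "K = {g \<in> M.Aut. \<forall>v e f. M.flag v e f \<longrightarrow> (col (g v) (g e) (g f) \<longleftrightarrow> col v e f)}"
  have K_mem: "g \<in> K" if "g \<in> M.Aut"
    "\<And>x y m j. even y \<Longrightarrow> fc j = fc m \<or> fc j = fc (m - 1) \<Longrightarrow>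
      col (g (vx x)) (g (ed y m)) (g (fc j)) \<longleftrightarrow> col (vx x) (ed y m) (fc j)" for g
    unfolding K_def using that by (auto elim!: model_flagE)
  have "ga \<in> K"
    by (rule K_mem[OF ga(1)]) (simp add: ga col flip)
  have "gb \<in> K"
  proof (rule K_mem[OF gb(1)])
    fix x y m j :: int assume h: "even y" "fc j = fc m \<or> fc j = fc (m - 1)"
    have "even (if even x then k * x else k * x - k - 1) \<longleftrightarrow> even x"
    proof (cases "even x")
      case False
      have "k * x - k - 1 = k * (x - 1) - 1" by (simp add: algebra_simps)
      then show ?thesis using False by simp
    qed simp
    moreover have "fc (j + 1) = fc (m + 1) \<longleftrightarrow> fc j = fc m" by (simp only: code_eq mod_shift_eq_iff)
    ultimately show "col (gb (vx x)) (gb (ed y m)) (gb (fc j)) \<longleftrightarrow> col (vx x) (ed y m) (fc j)"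
      unfolding gb(2) gb(3)[OF h(1)] gb(4) col by blast
  qed
  have "subgroup K ?G"
  proof
    show "K \<subseteq> M.Aut" by (auto simp: K_def)
    show "\<one>\<^bsub>?G\<^esub> \<in> K"
      unfolding K_def using M.flag_Field by (auto simp: M.Aut_one_apply)
    show "g \<otimes>\<^bsub>?G\<^esub> h \<in> K" if "g \<in> K" "h \<in> K" for g h
    proof -
      have gh: "g \<in> M.Aut" "h \<in> M.Aut" using that by (auto simp: K_def)
      have "col ((g \<otimes>\<^bsub>?G\<^esub> h) v) ((g \<otimes>\<^bsub>?G\<^esub> h) e) ((g \<otimes>\<^bsub>?G\<^esub> h) f) \<longleftrightarrow> col v e f" if fl: "M.flag v e f" for v e f
      proof -
        have "col (g (h v)) (g (h e)) (g (h f)) \<longleftrightarrow> col (h v) (h e) (h f)"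
          using \<open>g \<in> K\<close> M.Aut_flag[OF gh(2) fl] by (simp add: K_def)
        also have "\<dots> \<longleftrightarrow> col v e f" using \<open>h \<in> K\<close> fl by (simp add: K_def)
        finally show ?thesis using M.flag_Field[OF fl] gh by (simp add: M.Aut_mult_apply)
      qed
      then show ?thesis using gh by (simp add: K_def)
    qed
    show "inv\<^bsub>?G\<^esub> g \<in> K" if "g \<in> K" for g
    proof -
      have g: "g \<in> M.Aut" using that by (simp add: K_def)
      have gi: "g ((inv\<^bsub>?G\<^esub> g) x) = x" if "x \<in> Field (leq M)" for x
        using M.Aut_mult_apply[OF g _ that, of "inv\<^bsub>?G\<^esub> g"] g that by (simp add: M.Aut_one_apply)
      have "col ((inv\<^bsub>?G\<^esub> g) v) ((inv\<^bsub>?G\<^esub> g) e) ((inv\<^bsub>?G\<^esub> g) f) \<longleftrightarrow> col v e f" if fl: "M.flag v e f" for v e f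
      proof -
        have inv_fl: "M.flag ((inv\<^bsub>?G\<^esub> g) v) ((inv\<^bsub>?G\<^esub> g) e) ((inv\<^bsub>?G\<^esub> g) f)"
          by (rule M.Aut_flag[OF _ fl]) (simp add: g)
        have "col (g v) (g e) (g f) \<longleftrightarrow> col v e f" if "M.flag v e f" for v e f
          using \<open>g \<in> K\<close> that by (simp add: K_def)
        from this[OF inv_fl] show ?thesis using M.flag_Field[OF fl] by (simp add: gi)
      qed
      then show ?thesis using g by (simp add: K_def)
    qed
  qed
  then have "R.Plus \<subseteq> K"
    unfolding R.Plus_def ab using \<open>ga \<in> K\<close> \<open>gb \<in> K\<close> by (intro M.Aut.generate_subgroup_incl) auto
  moreover have "gr \<notin> K"
  proof
    assume "gr \<in> K"
    then have "col (gr (vx 0)) (gr (ed 0 0)) (gr (fc 0)) \<longleftrightarrow> col (vx 0) (ed 0 0) (fc 0)"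
      using R.base_flag by (simp add: K_def)
    then show False using gr fc_neq(2)[of 0] by (auto simp: col)
  qed
  ultimately have "gr \<notin> R.Plus" by blast
  then show thesis using that R.rooted_polyhedron_axioms by blast
qed

lemma card_edges_M: "card (elems M 1) * 2 = p * q"
proof -
  obtain n where n: "p = 2 * n" using even_p by (rule evenE)
  let ?g = "\<lambda>(i, m). ed (2 * i) m"
  have mod2: "2 * (i mod int n) = (2 * i) mod int p" for i by (simp only: n of_nat_mult mult_mod_right) simp
  have "elems M 1 = ?g ` ({0..<int n} \<times> {0..<int q})"
  proof
    show "elems M 1 \<subseteq> ?g ` ({0..<int n} \<times> {0..<int q})"
    proof
      fix e assume "e \<in> elems M 1"
      then obtain y m where e: "e = ed y m" "even y" unfolding elems_M by blast
      obtain i where i: "y = 2 * i" using e(2) ..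
      have "e = ?g (i mod int n, m mod int q)" using e(1) i mod2[of i] by (simp add: code_eq)
      moreover have "(i mod int n, m mod int q) \<in> {0..<int n} \<times> {0..<int q}" using pos n by auto
      ultimately show "e \<in> ?g ` ({0..<int n} \<times> {0..<int q})" by blast
    qed
    show "?g ` ({0..<int n} \<times> {0..<int q}) \<subseteq> elems M 1"
    proof
      fix e assume "e \<in> ?g ` ({0..<int n} \<times> {0..<int q})"
      then obtain i m where "e = ed (2 * i) m" by auto
      moreover have "even (2 * i)" by simp
      ultimately show "e \<in> elems M 1" unfolding elems_M by blast
    qed
  qed
  moreover have "inj_on ?g ({0..<int n} \<times> {0..<int q})"
  proof (rule inj_onI, clarify)
    fix i t i' t' :: int
    assume h: "i \<in> {0..<int n}" "i' \<in> {0..<int n}" "t \<in> {0..<int q}" "t' \<in> {0..<int q}" "ed (2 * i) t = ed (2 * i') t'"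
    then have "(2 * i) mod int p = (2 * i') mod int p" "t mod int q = t' mod int q"
      by (simp_all add: code_eq)
    then have "2 * (i mod int n) = 2 * (i' mod int n)" by (simp only: mod2)
    then have "i mod int n = i' mod int n" by simp
    then show "i = i' \<and> t = t'" using h(1-4) \<open>t mod int q = t' mod int q\<close> by simp
  qed
  ultimately show ?thesis using n by (simp add: card_image card_cartesian_product)
qed

theorem tight_simple_M: "tight_simple M"
proof -
  obtain \<rho>\<^sub>0 \<rho>\<^sub>1 \<rho>\<^sub>2 where R: "rooted_polyhedron M (vx 0) (ed 0 0) (fc 0) \<rho>\<^sub>0 \<rho>\<^sub>1 \<rho>\<^sub>2"
    "\<rho>\<^sub>1 \<notin> rooted_polyhedron.Plus M \<rho>\<^sub>0 \<rho>\<^sub>1 \<rho>\<^sub>2" using model_roots .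
  then have "orientably_regular M" by (rule rooted_polyhedron.orientably_regularI)
  moreover have "card (flags M) = 2 * p * q" using M.card_flags_edges card_edges_M by simp
  then have "tight M" unfolding tight_def using has_type_M finite_Field_M by blast
  ultimately show ?thesis using polyhedron_M no_multiple_edges_M by (simp add: tight_simple_def)
qed

end

section \<open>Distinguishing the models\<close>

lemma order_iso_flag:
  assumes P: "finite_polyhedron P" and Q: "finite_polyhedron Q" and iso: "order_iso (leq P) (leq Q) g"
    and fl: "finite_polyhedron.flag P v e f"
  shows "finite_polyhedron.flag Q (g v) (g e) (g f)"
proof -
  interpret P: finite_polyhedron P by fact
  interpret Q: finite_polyhedron Q by fact
  note F = P.flag_Field[OF fl]
  have bij: "bij_betw g (Field (leq P)) (Field (leq Q))"
    and mono: "\<And>x y. x \<in> Field (leq P) \<Longrightarrow> y \<in> Field (leq P) \<Longrightarrow> (x, y) \<in> leq P \<longleftrightarrow> (g x, g y) \<in> leq Q"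
    using iso by (auto simp: order_iso_def)
  have le: "(v, e) \<in> leq P" "(e, f) \<in> leq P" "v \<noteq> e" "e \<noteq> f" using fl by (auto simp: P.flag_def elems_def)
  have gF: "g v \<in> Field (leq Q)" "g e \<in> Field (leq Q)" "g f \<in> Field (leq Q)"
    using bij F by (auto simp: bij_betw_def)
  have ne: "g v \<noteq> g e" "g e \<noteq> g f" using bij F le(3,4) by (auto simp: bij_betw_def inj_on_def)
  have le': "(g v, g e) \<in> leq Q" "(g e, g f) \<in> leq Q" using mono le F by blast+
  have "rank Q (g v) < rank Q (g e)" "rank Q (g e) < rank Q (g f)"
    using Q.rank_less le' ne by blast+
  moreover have "rank Q (g f) \<le> 2" using Q.Field_cases[OF gF(3)] by (auto simp: elems_def)
  ultimately have "rank Q (g v) = 0" "rank Q (g e) = 1" "rank Q (g f) = 2" by auto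
  then show ?thesis using gF le' by (simp add: Q.flag_def elems_def)
qed

text \<open>After composition with an automorphism the isomorphism fixes the base flag, and then it
  is determined along any path of adjacent flags. The walk round face 0 is the same for all
  exponents, so every vertex is fixed. Turning at the base vertex to edge \<open>(0, 2)\<close>
  leads to the far end \<open>-1 - 2k\<close> in one model and \<open>-1 - 2k'\<close> in the other,
  and these must coincide.\<close>

theorem models_isomorphic:
  assumes M1: "model_params p q k" and M2: "model_params p q k'"
    and iso: "isomorphic (model p q k) (model p q k')"
  shows "int p dvd 2 * (k - k')"
proof -
  interpret X: model_params p q k by (rule M1)
  interpret Y: model_params p q k' by (rule M2)
  obtain \<rho>\<^sub>0 \<rho>\<^sub>1 \<rho>\<^sub>2 where "rooted_polyhedron Y.M (X.vx 0) (X.ed 0 0) (X.fc 0) \<rho>\<^sub>0 \<rho>\<^sub>1 \<rho>\<^sub>2"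
    using Y.model_roots .
  then interpret R: rooted_polyhedron Y.M "X.vx 0" "X.ed 0 0" "X.fc 0" \<rho>\<^sub>0 \<rho>\<^sub>1 \<rho>\<^sub>2 .
  obtain g where g: "order_iso (leq X.M) (leq Y.M) g" using iso unfolding isomorphic_def by blast
  have base: "X.M.flag (X.vx 0) (X.ed 0 0) (X.fc 0)" by (rule X.model_flag) auto
  obtain h where h: "h \<in> Y.M.Aut" "h (X.vx 0) = g (X.vx 0)" "h (X.ed 0 0) = g (X.ed 0 0)" "h (X.fc 0) = g (X.fc 0)"
    using R.flag_image[OF order_iso_flag[OF X.finite_polyhedron_M Y.finite_polyhedron_M g base]] by blast
  define G where "G x = (inv\<^bsub>aut_group Y.M\<^esub> h) (g x)" for x
  have hi: "inv\<^bsub>aut_group Y.M\<^esub> h \<in> Y.M.Aut" using h by simp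
  have G_flag: "Y.M.flag (G v) (G e) (G f)" if "X.M.flag v e f" for v e f
    unfolding G_def by (rule Y.M.Aut_flag[OF hi order_iso_flag[OF X.finite_polyhedron_M Y.finite_polyhedron_M g that]])
  have bij: "bij_betw g (Field (leq X.M)) (Field (leq Y.M))" using g by (simp add: order_iso_def)
  have G_inj: "G x \<noteq> G y" if "x \<in> Field (leq X.M)" "y \<in> Field (leq X.M)" "x \<noteq> y" for x y
  proof -
    have "g x \<noteq> g y" using bij that by (auto simp: bij_betw_def inj_on_def)
    moreover have "g x \<in> Field (leq Y.M)" "g y \<in> Field (leq Y.M)" using bij that by (auto simp: bij_betw_def)
    ultimately show ?thesis unfolding G_def by (simp add: Y.M.Aut_inj[OF hi])
  qed
  have G_base: "G (X.vx 0) = X.vx 0" "G (X.ed 0 0) = X.ed 0 0" "G (X.fc 0) = X.fc 0"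
    unfolding G_def h(2,3,4)[symmetric] using Y.M.Aut_inv_apply[OF h(1)] Y.in_Field by simp_all
  have next_v: "G v' = w" if "X.M.flag v e f" "X.M.flag v' e f" "v' \<noteq> v" "Y.M.flag w (G e) (G f)" "w \<noteq> G v" for v e f v' w
    using Y.M.vertex_unique[OF G_flag[OF that(1)] G_flag[OF that(2)] that(4) _ that(5)]
      G_inj[of v' v] X.M.flag_Field[OF that(1)] X.M.flag_Field[OF that(2)] that(3) by blast
  have next_e: "G e' = w" if "X.M.flag v e f" "X.M.flag v e' f" "e' \<noteq> e" "Y.M.flag (G v) w (G f)" "w \<noteq> G e" for v e f e' w
    using Y.M.edge_unique[OF G_flag[OF that(1)] G_flag[OF that(2)] that(4) _ that(5)]
      G_inj[of e' e] X.M.flag_Field[OF that(1)] X.M.flag_Field[OF that(2)] that(3) by blast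
  have next_f: "G f' = w" if "X.M.flag v e f" "X.M.flag v e f'" "f' \<noteq> f" "Y.M.flag (G v) (G e) w" "w \<noteq> G f" for v e f f' w
    using Y.M.face_unique[OF G_flag[OF that(1)] G_flag[OF that(2)] that(4) _ that(5)]
      G_inj[of f' f] X.M.flag_Field[OF that(1)] X.M.flag_Field[OF that(2)] that(3) by blast
  have n: "neighbour l 0 = 1" "neighbour l 1 = -1" "neighbour l 2 = -1 - 2 * l" for l by (simp_all add: neighbour_def)
  have ed_ne: "X.ed x m \<noteq> X.ed y (m + 1)" for x y m
    using X.mod_shift_neq[of 1 m] X.q_bounds by (auto simp: X.code_eq)
  have vx_ne: "X.vx x \<noteq> X.vx y" if "even x" "odd y" for x y
    using X.parity_mod[of x y] that by (auto simp: X.code_eq)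
  \<comment> \<open>On face 0 only the edges with \<open>m = 0\<close> and \<open>m = 1\<close>
    occur, where \<open>neighbour\<close> is 1 and -1 whatever the exponent.\<close>
  have walk: "G (X.vx (2 * int t)) = X.vx (2 * int t) \<and> G (X.ed (2 * int t) 0) = X.ed (2 * int t) 0 \<and>
      G (X.vx (2 * int t + 1)) = X.vx (2 * int t + 1)" for t
  proof (induction t)
    case 0
    have "G (X.vx 1) = X.vx 1"
    proof (rule next_v[OF base])
      show "X.M.flag (X.vx 1) (X.ed 0 0) (X.fc 0)" by (rule X.model_flag) (auto simp: n)
      show "Y.M.flag (X.vx 1) (G (X.ed 0 0)) (G (X.fc 0))" unfolding G_base by (rule Y.model_flag) (auto simp: n)
    qed (use vx_ne[of 0 1] G_base in auto)
    then show ?case using G_base by simp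
  next
    case (Suc t)
    define z where "z = 2 * int t"
    have z: "2 * int (Suc t) = z + 2" "even z" by (simp_all add: z_def)
    have ih: "G (X.vx z) = X.vx z" "G (X.ed z 0) = X.ed z 0" "G (X.vx (z + 1)) = X.vx (z + 1)"
      using Suc by (simp_all add: z_def)
    have f1: "X.M.flag (X.vx (z + 1)) (X.ed z 0) (X.fc 0)" "X.M.flag (X.vx (z + 1)) (X.ed (z + 2) 1) (X.fc 0)"
      "X.M.flag (X.vx (z + 2)) (X.ed (z + 2) 1) (X.fc 0)" "X.M.flag (X.vx (z + 2)) (X.ed (z + 2) 0) (X.fc 0)"
      "X.M.flag (X.vx (z + 3)) (X.ed (z + 2) 0) (X.fc 0)"
      by (rule X.model_flag; simp add: n add_ac z(2))+
    have f2: "Y.M.flag (X.vx (z + 1)) (X.ed (z + 2) 1) (X.fc 0)"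
      "Y.M.flag (X.vx (z + 2)) (X.ed (z + 2) 1) (X.fc 0)" "Y.M.flag (X.vx (z + 2)) (X.ed (z + 2) 0) (X.fc 0)"
      "Y.M.flag (X.vx (z + 3)) (X.ed (z + 2) 0) (X.fc 0)"
      by (rule Y.model_flag; simp add: n add_ac z(2))+
    have e1: "X.ed (z + 2) 1 \<noteq> X.ed z 0" "X.ed (z + 2) 0 \<noteq> X.ed (z + 2) 1"
      using ed_ne[of z 0 "z + 2"] ed_ne[of "z + 2" 0 "z + 2"] by auto
    have v1: "X.vx (z + 2) \<noteq> X.vx (z + 1)" "X.vx (z + 3) \<noteq> X.vx (z + 2)"
      using vx_ne[of "z + 2" "z + 1"] vx_ne[of "z + 2" "z + 3"] z(2) by auto
    have s1: "G (X.ed (z + 2) 1) = X.ed (z + 2) 1"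
      by (rule next_e[OF f1(1,2) e1(1)]) (simp_all add: ih G_base f2 e1)
    have s2: "G (X.vx (z + 2)) = X.vx (z + 2)"
      by (rule next_v[OF f1(2,3) v1(1)]) (simp_all add: ih G_base f2 v1 s1)
    have s3: "G (X.ed (z + 2) 0) = X.ed (z + 2) 0"
      by (rule next_e[OF f1(3,4) e1(2)]) (simp_all add: s2 s1 G_base f2 e1)
    have s4: "G (X.vx (z + 3)) = X.vx (z + 3)"
      by (rule next_v[OF f1(4,5) v1(2)]) (simp_all add: s2 s3 G_base f2 v1)
    have t3: "z + 2 + 1 = z + 3" by simp
    show ?case unfolding z(1) t3 using s2 s3 s4 by (intro conjI)
  qed
  have fixed: "G (X.vx x) = X.vx x" for x
  proof -
    have x: "X.vx x = X.vx (x mod int p)" by (simp add: X.code_eq)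
    have "x mod int p \<ge> 0" using X.pos by simp
    then obtain y where y: "x mod int p = int y" using nonneg_int_cases by blast
    show ?thesis
    proof (cases "even y")
      case True
      then obtain t where "y = 2 * t" ..
      then show ?thesis using walk[of t] unfolding x y by simp
    next
      case False
      then obtain t where "y = 2 * t + 1" by (rule oddE)
      then show ?thesis using walk[of t] unfolding x y by (simp add: add.commute)
    qed
  qed
  have f1: "X.M.flag (X.vx 0) (X.ed 0 1) (X.fc 0)" "X.M.flag (X.vx 0) (X.ed 0 1) (X.fc 1)"
    "X.M.flag (X.vx 0) (X.ed 0 2) (X.fc 1)" "X.M.flag (X.vx (-1 - 2 * k)) (X.ed 0 2) (X.fc 1)"
    by (rule X.model_flag; simp add: n add_ac)+
  have f2: "Y.M.flag (X.vx 0) (X.ed 0 1) (X.fc 0)" "Y.M.flag (X.vx 0) (X.ed 0 1) (X.fc 1)"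
    "Y.M.flag (X.vx 0) (X.ed 0 2) (X.fc 1)" "Y.M.flag (X.vx (-1 - 2 * k')) (X.ed 0 2) (X.fc 1)"
    by (rule Y.model_flag; simp add: n add_ac)+
  have e: "X.ed 0 1 \<noteq> X.ed 0 0" "X.ed 0 2 \<noteq> X.ed 0 1" "X.fc 1 \<noteq> X.fc 0"
    using ed_ne[of 0 0 0] ed_ne[of 0 1 0] X.fc_neq(2)[of 0] by auto
  have v: "X.vx (-1 - 2 * l) \<noteq> X.vx 0" for l using vx_ne[of 0 "-1 - 2 * l"] by auto
  have s1: "G (X.ed 0 1) = X.ed 0 1"
    by (rule next_e[OF base f1(1) e(1)]) (simp_all add: G_base f2 e)
  have s2: "G (X.fc 1) = X.fc 1"
    by (rule next_f[OF f1(1,2) e(3)]) (simp_all add: G_base f2 e s1)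
  have s3: "G (X.ed 0 2) = X.ed 0 2"
    by (rule next_e[OF f1(2,3) e(2)]) (simp_all add: G_base f2 e s1 s2)
  have "G (X.vx (-1 - 2 * k)) = X.vx (-1 - 2 * k')"
    by (rule next_v[OF f1(3,4) v]) (simp_all add: G_base f2 v s2 s3)
  then have "X.vx (-1 - 2 * k) = X.vx (-1 - 2 * k')" by (simp add: fixed)
  then have "int p dvd (-1 - 2 * k') - (-1 - 2 * k)" by (simp only: X.code_eq mod_eq_dvd_iff dvd_diff_commute)
  then show ?thesis by (simp add: right_diff_distrib)
qed

section \<open>The classification\<close>

lemma tight_simple_model:
  assumes "tight_simple R" "has_type R p q" "even q" "q \<noteq> 2"
  obtains k where "admissible_exponent p q k" "isomorphic R (model p q k)"
  using tight_simple_cases[OF assms(1,2)] assms(3,4) that by metis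

theorem theorem4p10:
  shows "(\<forall>p q. classified_type p q \<and> \<not> (multiplicity 2 p = 2 \<and> 4 dvd q) \<longrightarrow>
            (if 4 \<le> multiplicity 2 p \<and> 2 ^ (multiplicity 2 p - 1) dvd q
             then \<exists>(P :: nat ranked_poset) (Q :: nat ranked_poset).
                    tight_simple P \<and> has_type P p q \<and>
                    tight_simple Q \<and> has_type Q p q \<and>
                    \<not> isomorphic P Q \<and>
                    (\<forall>R :: 'a ranked_poset. tight_simple R \<and> has_type R p q \<longrightarrow>
                       isomorphic R P \<or> isomorphic R Q)
             else \<exists>P :: nat ranked_poset.
                    tight_simple P \<and> has_type P p q \<and>
                    (\<forall>R :: 'a ranked_poset. tight_simple R \<and> has_type R p q \<longrightarrow>
                       isomorphic R P))) \<and>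
         (\<forall>R :: 'a ranked_poset. tight_simple R \<longrightarrow>
            (\<exists>p q. classified_type p q \<and> has_type R p q) \<or>
            (\<exists>q. odd q \<and> has_type R (2 * q) q) \<or>
            (\<exists>p\<ge>2. isomorphic R (sphere_map p)))"
proof (intro conjI allI impI)
  fix p q assume "classified_type p q \<and> \<not> (multiplicity 2 p = 2 \<and> 4 dvd q)"
  then have ct: "classified_type p q" and excl: "\<not> (multiplicity 2 p = 2 \<and> 4 dvd q)" by auto
  have par: "even p" "even q" "4 \<le> q" "q < p" using ct by (auto simp: classified_type_def)
  have params: "model_params p q k" if "admissible_exponent p q k" for k
    using par that by unfold_locales
  have model: "tight_simple (model p q k)" "has_type (model p q k) p q" if "admissible_exponent p q k" for k
    using model_params.tight_simple_M[OF params[OF that]] model_params.has_type_M[OF params[OF that]] .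
  have classify: "\<exists>k. admissible_exponent p q k \<and> isomorphic R (model p q k)"
    if R: "tight_simple R" "has_type R p q" for R :: "'a ranked_poset"
    using tight_simple_model[OF R] par by force
  let ?two = "4 \<le> multiplicity 2 p \<and> 2 ^ (multiplicity 2 p - 1) dvd q"
  note exps = admissible_exponents_classified[OF ct excl]
  show "if ?two
        then \<exists>(P :: nat ranked_poset) (Q :: nat ranked_poset).
               tight_simple P \<and> has_type P p q \<and> tight_simple Q \<and> has_type Q p q \<and> \<not> isomorphic P Q \<and>
               (\<forall>R :: 'a ranked_poset. tight_simple R \<and> has_type R p q \<longrightarrow> isomorphic R P \<or> isomorphic R Q)
        else \<exists>P :: nat ranked_poset. tight_simple P \<and> has_type P p q \<and>
               (\<forall>R :: 'a ranked_poset. tight_simple R \<and> has_type R p q \<longrightarrow> isomorphic R P)"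
  proof (cases ?two)
    case True
    then obtain k\<^sub>1 k\<^sub>2 where a: "admissible_exponent p q k\<^sub>1" "admissible_exponent p q k\<^sub>2"
      and ne: "\<not> int p dvd 2 * (k\<^sub>1 - k\<^sub>2)"
      and all: "\<And>k. admissible_exponent p q k \<Longrightarrow> int p dvd 2 * (k - k\<^sub>1) \<or> int p dvd 2 * (k - k\<^sub>2)"
      using exps by auto
    have "\<not> isomorphic (model p q k\<^sub>1) (model p q k\<^sub>2)"
      using models_isomorphic[OF params[OF a(1)] params[OF a(2)]] ne by blast
    moreover have "isomorphic R (model p q k\<^sub>1) \<or> isomorphic R (model p q k\<^sub>2)"
      if R: "tight_simple R \<and> has_type R p q" for R :: "'a ranked_poset"
    proof -
      obtain k where "admissible_exponent p q k" "isomorphic R (model p q k)" using classify R by blast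
      then show ?thesis using all[of k] model_cong[of p k k\<^sub>1 q] model_cong[of p k k\<^sub>2 q] by auto
    qed
    ultimately show ?thesis using True model[OF a(1)] model[OF a(2)] by auto
  next
    case False
    then obtain k\<^sub>1 where a: "admissible_exponent p q k\<^sub>1"
      and all: "\<And>k. admissible_exponent p q k \<Longrightarrow> int p dvd 2 * (k - k\<^sub>1)"
      using exps by auto
    have "isomorphic R (model p q k\<^sub>1)"
      if R: "tight_simple R \<and> has_type R p q" for R :: "'a ranked_poset"
    proof -
      obtain k where "admissible_exponent p q k" "isomorphic R (model p q k)" using classify R by blast
      then show ?thesis using all[of k] model_cong[of p k k\<^sub>1 q] by auto
    qed
    then show ?thesis using False model[OF a] by auto
  qed
next
  fix R :: "'a ranked_poset" assume R: "tight_simple R"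
  then obtain p q where type: "has_type R p q" by (auto simp: tight_simple_def tight_def)
  show "(\<exists>p q. classified_type p q \<and> has_type R p q) \<or> (\<exists>q. odd q \<and> has_type R (2 * q) q) \<or>
      (\<exists>p\<ge>2. isomorphic R (sphere_map p))"
    using R type
  proof (cases rule: tight_simple_cases)
    case (3 k)
    then have "classified_type p q" by (intro classified_typeI)
    then show ?thesis using type by blast
  qed (use type in blast)+
qed

end
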